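(* Let $M$ be a compact Riemannian three-manifold (possibly with boundary), let $\Sigma$ be a compact Riemann surface (possibly with boundary), and suppose that $u:\Sigma\to M$ is a boundaried branched conformal immersion. Then, for any variation $\Phi:I\times\Sigma\to M$ of $u$ (i.e. a smooth family, $I$ an open interval containing $0$, $\Phi(0)=u$) with $\Phi(I,\partial\Sigma)\subset\partial M$, we have, denoting $v:=\Phi'(0)\in\Gamma_{\partial M}(u^*TM)$, $$\frac{d^2}{dt^2}\Big|_{t=0}(\mathcal{E}-\mathcal{A})(\Phi(t)) = 4\int_\Sigma|\mu|^2\,d\Sigma,$$ where, splitting $v=s+\sigma$ into $s:=v^\perp$ and $\sigma:=v^\top$, $$\mu=\Big(\nabla^\top_{\partial_z}\sigma^{(0,1)}-2e^{-2\lambda}\langle s,A(u_z,u_z)\rangle u_{\bar z}\Big)\otimes dz .$$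
   Context: A map $u:\Sigma\to M$ is boundaried if $u(\partial\Sigma)\subset\partial M$. A branched conformal immersion is a conformal map whose differential vanishes only on a discrete set, each zero being a branch point (locally $u$ looks like $z\mapsto z^{k+1}$ in a tangent plane plus higher-order terms). $\mathcal{A}$ is the area functional (area of the pull-back metric) and $\mathcal{E}(w)=\frac12\int_\Sigma|dw|^2$ is the Dirichlet energy, so that $\mathcal A\le\mathcal E$ with equality exactly for conformal maps. $\Gamma_{\partial M}(u^*TM)$ is the space of smooth sections $v$ of $u^*TM$ with $v(p)\in T_{u(p)}\partial M$ for all $p\in\partial\Sigma$. In a local complex parameter $z=x+iy$ on $\Sigma$, $u^*g=e^{2\lambda}(dx^2+dy^2)$, $\partial_z=\frac12(\partial_x-i\partial_y)$, $u_z=\partial_zu$, $u_{\bar z}=\partial_{\bar z}u$; $d\Sigma$ is the area element of $u^*g$. The pull-back bundle splits as $u^*TM=\xi\oplus\nu\Sigma$, where $\xi$ is the ramified tangent bundle (the tangent planes, extended smoothly across branch points) and $\nu\Sigma$ is the normal bundle; $\top$ and $\perp$ are the orthogonal projections on $\xi$ and $\nu\Sigma$. $\nabla$ is the pull-back of the Levi-Civita connection of $M$ and $A=(\nabla_\cdot\cdot)^\perp$ is the second fundamental form of $u$. All of these, and the inner product $\langle\cdot,\cdot\rangle$, are extended complex-(bi)linearly to the complexification $u^*TM\otimes\mathbb{C}$; $\sigma=\sigma^{(1,0)}+\sigma^{(0,1)}$ is the type decomposition of $\sigma$ in $\xi\otimes\mathbb{C}=\xi^{1,0}\oplus\xi^{0,1}$,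 where $\xi^{0,1}$ is spanned by $u_{\bar z}$ away from branch points. The norm $|\mu|$ is the Hermitian one, with $|u_z|^2=|u_{\bar z}|^2=\frac12e^{2\lambda}$ and $|dz|^2=2e^{-2\lambda}$. *)

theory Defs
  imports "HOL-Analysis.Analysis"
begin

section \<open>Smooth functions and charts\<close>

primrec Ck_on :: "nat \<Rightarrow> ('a::euclidean_space \<Rightarrow> 'b::real_normed_vector) \<Rightarrow> 'a set \<Rightarrow> bool" where
  "Ck_on 0 = (\<lambda>f U. continuous_on U f)"
| "Ck_on (Suc k) = (\<lambda>f U. \<exists>f'. (\<forall>x\<in>U. (f has_derivative f' x) (at x)) \<and>
                           (\<forall>b\<in>Basis. Ck_on k (\<lambda>x. f' x b) U))"

definition smooth_on :: "('a::euclidean_space \<Rightarrow> 'b::real_normed_vector) \<Rightarrow> 'a set \<Rightarrow> bool" where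
  "smooth_on f S \<longleftrightarrow>
     (\<forall>x\<in>S. \<exists>U F. open U \<and> x \<in> U \<and> (\<forall>k. Ck_on k F U) \<and> (\<forall>y\<in>S \<inter> U. F y = f y))"

text \<open>The analogous notion for holomorphic functions on a not necessarily open set (here: a
  relatively open subset of the closed upper half-plane).\<close>

definition holomorphic_extensible_on :: "(complex \<Rightarrow> complex) \<Rightarrow> complex set \<Rightarrow> bool" where
  "holomorphic_extensible_on f S \<longleftrightarrow>
     (\<forall>x\<in>S. \<exists>U F. open U \<and> x \<in> U \<and> F holomorphic_on U \<and> (\<forall>y\<in>S \<inter> U. F y = f y))"

definition half_plane :: "complex set" where
  "half_plane = {z. 0 \<le> Im z}"

definition half_space :: "(real^3) set" where
  "half_space = {x. 0 \<le> x $ 3}"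

text \<open>A chart is a domain together with a coordinate map; the coordinate map is only relevant
  on the domain. The model space \<open>H\<close> is \<open>half_plane\<close> or \<open>half_space\<close>.
  A manifold with boundary is a type carrying an atlas whose domains cover the type.\<close>

type_synonym ('a, 'b) chart = "'a set \<times> ('a \<Rightarrow> 'b)"

definition chart_inv :: "('a, 'b) chart \<Rightarrow> 'b \<Rightarrow> 'a" where
  "chart_inv c = inv_into (fst c) (snd c)"

definition is_chart :: "'b::euclidean_space set \<Rightarrow> ('a::t2_space, 'b) chart \<Rightarrow> bool" where
  "is_chart H c \<longleftrightarrow> open (fst c) \<and> openin (top_of_set H) (snd c ` fst c) \<and>
     homeomorphism (fst c) (snd c ` fst c) (snd c) (chart_inv c)"

definition transition :: "('a, 'b) chart \<Rightarrow> ('a, 'b) chart \<Rightarrow> 'b \<Rightarrow> 'b" where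
  "transition c c' = snd c' \<circ> chart_inv c"

definition smooth_atlas :: "'b::euclidean_space set \<Rightarrow> ('a::t2_space, 'b) chart set \<Rightarrow> bool" where
  "smooth_atlas H A \<longleftrightarrow> (\<forall>c\<in>A. is_chart H c) \<and> (\<Union>c\<in>A. fst c) = UNIV \<and>
     (\<forall>c\<in>A. \<forall>c'\<in>A. smooth_on (transition c c') (snd c ` (fst c \<inter> fst c')))"

definition riemann_surface_atlas :: "('a::t2_space, complex) chart set \<Rightarrow> bool" where
  "riemann_surface_atlas A \<longleftrightarrow> (\<forall>c\<in>A. is_chart half_plane c) \<and> (\<Union>c\<in>A. fst c) = UNIV \<and>
     (\<forall>c\<in>A. \<forall>c'\<in>A. holomorphic_extensible_on (transition c c') (snd c ` (fst c \<inter> fst c')))"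

definition manifold_boundary :: "'b::euclidean_space set \<Rightarrow> ('a, 'b) chart set \<Rightarrow> 'a set" where
  "manifold_boundary H A = {p. \<exists>c\<in>A. p \<in> fst c \<and> snd c p \<in> frontier H}"

definition chart_at :: "('a, 'b) chart set \<Rightarrow> 'a \<Rightarrow> ('a, 'b) chart" where
  "chart_at A p = (SOME c. c \<in> A \<and> p \<in> fst c)"


section \<open>Riemannian metrics and maps from a surface\<close>

text \<open>A tensor field on the target is given by its components in every chart of the atlas.\<close>

type_synonym 'm metric_field = "('m, real^3) chart \<Rightarrow> real^3 \<Rightarrow> real^3^3"

definition ip :: "real^3^3 \<Rightarrow> real^3 \<Rightarrow> real^3 \<Rightarrow> real" where
  "ip G a b = a \<bullet> (G *v b)"

definition riemannian_metric :: "('m::t2_space, real^3) chart set \<Rightarrow> 'm metric_field \<Rightarrow> bool" where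
  "riemannian_metric AM g \<longleftrightarrow>
     (\<forall>c\<in>AM. smooth_on (g c) (snd c ` fst c) \<and>
        (\<forall>x\<in>snd c ` fst c. transpose (g c x) = g c x \<and> (\<forall>a. a \<noteq> 0 \<longrightarrow> 0 < ip (g c x) a a))) \<and>
     (\<forall>c\<in>AM. \<forall>c'\<in>AM. \<forall>p\<in>fst c \<inter> fst c'. \<forall>a b.
        let D = frechet_derivative (transition c c') (at (snd c p) within half_space)
        in ip (g c (snd c p)) a b = ip (g c' (snd c' p)) (D a) (D b))"

definition local_rep ::
  "('s, complex) chart \<Rightarrow> ('m, real^3) chart \<Rightarrow> ('s \<Rightarrow> 'm) \<Rightarrow> complex \<Rightarrow> real^3" where
  "local_rep cS cM f = snd cM \<circ> f \<circ> chart_inv cS"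

definition local_dom ::
  "('s, complex) chart \<Rightarrow> ('m, real^3) chart \<Rightarrow> ('s \<Rightarrow> 'm) \<Rightarrow> complex set" where
  "local_dom cS cM f = snd cS ` (fst cS \<inter> f -` fst cM)"

definition smooth_map ::
  "('s::t2_space, complex) chart set \<Rightarrow> ('m::t2_space, real^3) chart set \<Rightarrow> ('s \<Rightarrow> 'm) \<Rightarrow> bool" where
  "smooth_map AS AM f \<longleftrightarrow> continuous_on UNIV f \<and>
     (\<forall>cS\<in>AS. \<forall>cM\<in>AM. smooth_on (local_rep cS cM f) (local_dom cS cM f))"

text \<open>Joint smoothness of \<open>(t, p) \<mapsto> \<Phi> t p\<close> on \<open>I \<times> \<Sigma>\<close>.\<close>

definition smooth_family ::
  "('s::t2_space, complex) chart set \<Rightarrow> ('m::t2_space, real^3) chart set \<Rightarrow> real set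
     \<Rightarrow> (real \<Rightarrow> 's \<Rightarrow> 'm) \<Rightarrow> bool" where
  "smooth_family AS AM I \<Phi> \<longleftrightarrow> continuous_on (I \<times> UNIV) (\<lambda>(t, p). \<Phi> t p) \<and>
     (\<forall>cS\<in>AS. \<forall>cM\<in>AM. smooth_on (\<lambda>(t, z). local_rep cS cM (\<Phi> t) z)
        {(t, z). t \<in> I \<and> z \<in> local_dom cS cM (\<Phi> t)})"

text \<open>Real partial derivatives of a function on the half-plane, one-sided at its boundary.\<close>

definition d_x :: "(complex \<Rightarrow> 'b::real_normed_vector) \<Rightarrow> complex \<Rightarrow> 'b" where
  "d_x f z = frechet_derivative f (at z within half_plane) 1"

definition d_y :: "(complex \<Rightarrow> 'b::real_normed_vector) \<Rightarrow> complex \<Rightarrow> 'b" where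
  "d_y f z = frechet_derivative f (at z within half_plane) \<i>"

definition pullback_metric ::
  "('m, real^3) chart set \<Rightarrow> 'm metric_field \<Rightarrow> ('s, complex) chart \<Rightarrow> ('s \<Rightarrow> 'm)
     \<Rightarrow> complex \<Rightarrow> complex \<Rightarrow> complex \<Rightarrow> real" where
  "pullback_metric AM g cS f z h k =
     (let cM = chart_at AM (f (chart_inv cS z));
          w = local_rep cS cM f;
          D = frechet_derivative w (at z within half_plane)
      in ip (g cM (w z)) (D h) (D k))"


section \<open>Area and energy\<close>

text \<open>A (nonnegative) density on \<open>\<Sigma>\<close> assigns to each chart a function \<open>d\<close> on its image, to be
  read as \<open>d dx dy\<close>. It induces a unique Borel measure on \<open>\<Sigma>\<close> whenever the local expressions
  agree on overlaps, i.e. change by the Jacobian of the coordinate change.\<close>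

definition density_measure ::
  "('s::t2_space, complex) chart set \<Rightarrow> (('s, complex) chart \<Rightarrow> complex \<Rightarrow> real) \<Rightarrow> 's measure" where
  "density_measure AS d = (THE m. sets m = sets borel \<and>
     (\<forall>cS\<in>AS. \<forall>B\<in>sets borel. B \<subseteq> fst cS \<longrightarrow>
        emeasure m B = (\<integral>\<^sup>+z. ennreal (d cS z) * indicator (snd cS ` B) z \<partial>lborel)))"

definition area_measure ::
  "('s::t2_space, complex) chart set \<Rightarrow> ('m, real^3) chart set \<Rightarrow> 'm metric_field \<Rightarrow> ('s \<Rightarrow> 'm)
     \<Rightarrow> 's measure" where
  "area_measure AS AM g f = density_measure AS (\<lambda>cS z. let h = pullback_metric AM g cS f z in
     sqrt (h 1 1 * h \<i> \<i> - (h 1 \<i>)\<^sup>2))"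

definition area ::
  "('s::t2_space, complex) chart set \<Rightarrow> ('m, real^3) chart set \<Rightarrow> 'm metric_field \<Rightarrow> ('s \<Rightarrow> 'm) \<Rightarrow> real"
  where "area AS AM g f = measure (area_measure AS AM g f) UNIV"

text \<open>By conformal invariance in dimension two, \<open>|df|\<^sup>2\<close> times the area element of any metric
  compatible with the complex structure is \<open>(|f\<^sub>x|\<^sup>2 + |f\<^sub>y|\<^sup>2) dx dy\<close> in a complex chart.\<close>

definition energy ::
  "('s::t2_space, complex) chart set \<Rightarrow> ('m, real^3) chart set \<Rightarrow> 'm metric_field \<Rightarrow> ('s \<Rightarrow> 'm) \<Rightarrow> real"
  where "energy AS AM g f = 1 / 2 *
     measure (density_measure AS (\<lambda>cS z. let h = pullback_metric AM g cS f z in h 1 1 + h \<i> \<i>)) UNIV"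


section \<open>Branched conformal immersions\<close>

definition critical_set ::
  "('s::t2_space, complex) chart set \<Rightarrow> ('m::t2_space, real^3) chart set \<Rightarrow> ('s \<Rightarrow> 'm) \<Rightarrow> 's set" where
  "critical_set AS AM f = {p. \<exists>cS\<in>AS. \<exists>cM\<in>AM. p \<in> fst cS \<and> f p \<in> fst cM \<and>
     frechet_derivative (local_rep cS cM f) (at (snd cS p) within half_plane) = (\<lambda>_. 0)}"

text \<open>The map \<open>w\<close> has a branch point at \<open>z\<^sub>0\<close>: up to higher order terms, \<open>w - w z\<^sub>0\<close> is
  \<open>(z - z\<^sub>0)\<^sup>k\<^sup>+\<^sup>1\<close> in the plane spanned by \<open>a\<close> and \<open>b\<close>. For smooth \<open>w\<close>, Taylor's formula gives the
  corresponding expansions of the derivatives of \<open>w\<close>.\<close>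

definition branch_point_at :: "(complex \<Rightarrow> real^3) \<Rightarrow> complex set \<Rightarrow> complex \<Rightarrow> bool" where
  "branch_point_at w S z0 \<longleftrightarrow> (\<exists>k\<ge>1. \<exists>a b. a \<noteq> b \<and> independent {a, b} \<and>
     ((\<lambda>z. (w z - w z0 - Re ((z - z0) ^ (k + 1)) *\<^sub>R a - Im ((z - z0) ^ (k + 1)) *\<^sub>R b)
             /\<^sub>R norm (z - z0) ^ (k + 1)) \<longlongrightarrow> 0) (at z0 within S))"

definition branched_conformal_immersion ::
  "('s::t2_space, complex) chart set \<Rightarrow> ('m::t2_space, real^3) chart set \<Rightarrow> 'm metric_field
     \<Rightarrow> ('s \<Rightarrow> 'm) \<Rightarrow> bool" where
  "branched_conformal_immersion AS AM g f \<longleftrightarrow> smooth_map AS AM f \<and>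
     (\<forall>cS\<in>AS. \<forall>z\<in>snd cS ` fst cS. let h = pullback_metric AM g cS f z in
        h 1 1 = h \<i> \<i> \<and> h 1 \<i> = 0) \<and>
     discrete (critical_set AS AM f) \<and>
     (\<forall>p\<in>critical_set AS AM f. \<forall>cS\<in>AS. \<forall>cM\<in>AM. p \<in> fst cS \<and> f p \<in> fst cM \<longrightarrow>
        branch_point_at (local_rep cS cM f) (local_dom cS cM f) (snd cS p))"

text \<open>A section \<open>v\<close> of the pull-back of the tangent bundle is given by its components
  \<open>v cM p\<close> at the points \<open>p\<close> with \<open>f p\<close> in the domain of \<open>cM\<close>.\<close>

definition smooth_section ::
  "('s::t2_space, complex) chart set \<Rightarrow> ('m::t2_space, real^3) chart set \<Rightarrow> ('s \<Rightarrow> 'm)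
     \<Rightarrow> (('m, real^3) chart \<Rightarrow> 's \<Rightarrow> real^3) \<Rightarrow> bool" where
  "smooth_section AS AM f v \<longleftrightarrow>
     (\<forall>cS\<in>AS. \<forall>cM\<in>AM. smooth_on (\<lambda>z. v cM (chart_inv cS z)) (local_dom cS cM f)) \<and>
     (\<forall>c\<in>AM. \<forall>c'\<in>AM. \<forall>p. f p \<in> fst c \<inter> fst c' \<longrightarrow>
        v c' p = frechet_derivative (transition c c') (at (snd c (f p)) within half_space) (v c p))"

definition boundary_tangent_section ::
  "('s::t2_space, complex) chart set \<Rightarrow> ('m::t2_space, real^3) chart set \<Rightarrow> ('s \<Rightarrow> 'm)
     \<Rightarrow> (('m, real^3) chart \<Rightarrow> 's \<Rightarrow> real^3) \<Rightarrow> bool" where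
  "boundary_tangent_section AS AM f v \<longleftrightarrow> smooth_section AS AM f v \<and>
     (\<forall>p\<in>manifold_boundary half_plane AS. \<forall>c\<in>AM. f p \<in> fst c \<longrightarrow> v c p $ 3 = 0)"

definition initial_velocity ::
  "(real \<Rightarrow> 's \<Rightarrow> 'm) \<Rightarrow> ('m, real^3) chart \<Rightarrow> 's \<Rightarrow> real^3" where
  "initial_velocity \<Phi> cM p = vector_derivative (\<lambda>t. snd cM (\<Phi> t p)) (at 0)"


section \<open>Complexified local geometry of a map \<open>w\<close> into a coordinate patch\<close>

text \<open>Throughout, \<open>G\<close> is the matrix field of the metric in the coordinate patch and \<open>R\<close> is the set of
  coordinates of the points where the differential of \<open>w\<close> does not vanish.\<close>

definition cvec :: "real^3 \<Rightarrow> complex^3" where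
  "cvec a = (\<chi> i. complex_of_real (a $ i))"

definition cip :: "real^3^3 \<Rightarrow> complex^3 \<Rightarrow> complex^3 \<Rightarrow> complex" where
  "cip G a b = (\<Sum>i\<in>UNIV. \<Sum>j\<in>UNIV. complex_of_real (G $ i $ j) * a $ i * b $ j)"

definition herm_normsq :: "real^3^3 \<Rightarrow> complex^3 \<Rightarrow> real" where
  "herm_normsq G a = Re (cip G a (\<chi> i. cnj (a $ i)))"

definition d_z :: "(complex \<Rightarrow> complex^3) \<Rightarrow> complex \<Rightarrow> complex^3" where
  "d_z F z = (1 / 2) *s (d_x F z - \<i> *s d_y F z)"

definition d_zbar :: "(complex \<Rightarrow> complex^3) \<Rightarrow> complex \<Rightarrow> complex^3" where
  "d_zbar F z = (1 / 2) *s (d_x F z + \<i> *s d_y F z)"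

definition metric_deriv :: "(real^3 \<Rightarrow> real^3^3) \<Rightarrow> real^3 \<Rightarrow> 3 \<Rightarrow> real^3^3" where
  "metric_deriv G x i = frechet_derivative G (at x within half_space) (axis i 1)"

definition christoffel :: "(real^3 \<Rightarrow> real^3^3) \<Rightarrow> real^3 \<Rightarrow> 3 \<Rightarrow> 3 \<Rightarrow> 3 \<Rightarrow> real" where
  "christoffel G x k i j = 1 / 2 * (\<Sum>l\<in>UNIV. matrix_inv (G x) $ k $ l *
     (metric_deriv G x i $ j $ l + metric_deriv G x j $ i $ l - metric_deriv G x l $ i $ j))"

definition christoffel_form :: "(real^3 \<Rightarrow> real^3^3) \<Rightarrow> real^3 \<Rightarrow> complex^3 \<Rightarrow> complex^3 \<Rightarrow> complex^3" where
  "christoffel_form G x a b =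
     (\<chi> k. \<Sum>i\<in>UNIV. \<Sum>j\<in>UNIV. complex_of_real (christoffel G x k i j) * a $ i * b $ j)"

definition u_z :: "(complex \<Rightarrow> real^3) \<Rightarrow> complex \<Rightarrow> complex^3" where
  "u_z w = d_z (cvec \<circ> w)"

definition u_zbar :: "(complex \<Rightarrow> real^3) \<Rightarrow> complex \<Rightarrow> complex^3" where
  "u_zbar w = d_zbar (cvec \<circ> w)"

text \<open>The pull-back of the Levi-Civita connection in the direction \<open>\<partial>\<^sub>z\<close>, for a section \<open>F\<close> along \<open>w\<close>.\<close>

definition nabla_z ::
  "(real^3 \<Rightarrow> real^3^3) \<Rightarrow> (complex \<Rightarrow> real^3) \<Rightarrow> (complex \<Rightarrow> complex^3) \<Rightarrow> complex \<Rightarrow> complex^3" where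
  "nabla_z G w F z = d_z F z + christoffel_form G (w z) (u_z w z) (F z)"

text \<open>The fibres of the ramified tangent bundle are limits of the tangent spaces at nearby points
  of \<open>R\<close>. At a point of \<open>R\<close> they are, by continuity, the lines spanned by \<open>u\<^sub>z\<close> and \<open>u\<^sub>z\<^sub>b\<^sub>a\<^sub>r\<close>.\<close>

definition xi10 :: "(complex \<Rightarrow> real^3) \<Rightarrow> complex set \<Rightarrow> complex \<Rightarrow> (complex^3) set" where
  "xi10 w R z = {T. \<exists>a. ((\<lambda>y. a y *s u_z w y) \<longlongrightarrow> T) (at z within R)}"

definition xi01 :: "(complex \<Rightarrow> real^3) \<Rightarrow> complex set \<Rightarrow> complex \<Rightarrow> (complex^3) set" where
  "xi01 w R z = {T. \<exists>a. ((\<lambda>y. a y *s u_zbar w y) \<longlongrightarrow> T) (at z within R)}"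

definition xi :: "(complex \<Rightarrow> real^3) \<Rightarrow> complex set \<Rightarrow> complex \<Rightarrow> (complex^3) set" where
  "xi w R z = {S + T | S T. S \<in> xi10 w R z \<and> T \<in> xi01 w R z}"

definition tang_part ::
  "(real^3 \<Rightarrow> real^3^3) \<Rightarrow> (complex \<Rightarrow> real^3) \<Rightarrow> complex set \<Rightarrow> complex \<Rightarrow> complex^3 \<Rightarrow> complex^3" where
  "tang_part G w R z X = (THE T. T \<in> xi w R z \<and> (\<forall>Y\<in>xi w R z. cip (G (w z)) (X - T) Y = 0))"

definition normal_part ::
  "(real^3 \<Rightarrow> real^3^3) \<Rightarrow> (complex \<Rightarrow> real^3) \<Rightarrow> complex set \<Rightarrow> complex \<Rightarrow> complex^3 \<Rightarrow> complex^3" where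
  "normal_part G w R z X = X - tang_part G w R z X"

definition part01 :: "(complex \<Rightarrow> real^3) \<Rightarrow> complex set \<Rightarrow> complex \<Rightarrow> complex^3 \<Rightarrow> complex^3" where
  "part01 w R z X = (THE T. T \<in> xi01 w R z \<and> X - T \<in> xi10 w R z)"

text \<open>\<open>A(u\<^sub>z, u\<^sub>z)\<close>, the second fundamental form evaluated on \<open>\<partial>\<^sub>z\<close> twice.\<close>

definition sff_zz ::
  "(real^3 \<Rightarrow> real^3^3) \<Rightarrow> (complex \<Rightarrow> real^3) \<Rightarrow> complex set \<Rightarrow> complex \<Rightarrow> complex^3" where
  "sff_zz G w R z = normal_part G w R z (nabla_z G w (u_z w) z)"

text \<open>The conformal factor \<open>e\<^sup>2\<^sup>\<lambda>\<close> (zero at branch points).\<close>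

definition conf_factor :: "(real^3 \<Rightarrow> real^3^3) \<Rightarrow> (complex \<Rightarrow> real^3) \<Rightarrow> complex \<Rightarrow> real" where
  "conf_factor G w z = ip (G (w z)) (d_x w z) (d_x w z)"

text \<open>The coefficient of \<open>dz\<close> in \<open>\<mu>\<close> and the squared norm of \<open>\<mu>\<close>, using \<open>|dz|\<^sup>2 = 2 e\<^sup>-\<^sup>2\<^sup>\<lambda>\<close>. At branch
  points the values are irrelevant, since these form a null set.\<close>

definition mu_coeff ::
  "(real^3 \<Rightarrow> real^3^3) \<Rightarrow> (complex \<Rightarrow> real^3) \<Rightarrow> complex set \<Rightarrow> (complex \<Rightarrow> real^3) \<Rightarrow> complex
     \<Rightarrow> complex^3" where
  "mu_coeff G w R V z =
     (let sigma = (\<lambda>y. tang_part G w R y (cvec (V y)));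
          sigma01 = (\<lambda>y. part01 w R y (sigma y));
          s = (\<lambda>y. normal_part G w R y (cvec (V y)))
      in tang_part G w R z (nabla_z G w sigma01 z)
         - (complex_of_real (2 / conf_factor G w z) * cip (G (w z)) (s z) (sff_zz G w R z))
             *s u_zbar w z)"

definition mu_normsq_local ::
  "(real^3 \<Rightarrow> real^3^3) \<Rightarrow> (complex \<Rightarrow> real^3) \<Rightarrow> complex set \<Rightarrow> (complex \<Rightarrow> real^3) \<Rightarrow> complex
     \<Rightarrow> real" where
  "mu_normsq_local G w R V z =
     herm_normsq (G (w z)) (mu_coeff G w R V z) * (2 / conf_factor G w z)"

text \<open>\<open>|\<mu>|\<^sup>2\<close> as a function on \<open>\<Sigma>\<close>; away from branch points its value does not depend on the charts.\<close>

definition mu_normsq ::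
  "('s::t2_space, complex) chart set \<Rightarrow> ('m::t2_space, real^3) chart set \<Rightarrow> 'm metric_field
     \<Rightarrow> ('s \<Rightarrow> 'm) \<Rightarrow> (('m, real^3) chart \<Rightarrow> 's \<Rightarrow> real^3) \<Rightarrow> 's \<Rightarrow> real" where
  "mu_normsq AS AM g f v p =
     (let cS = chart_at AS p;
          cM = chart_at AM (f p);
          w = local_rep cS cM f;
          R = local_dom cS cM f - snd cS ` (fst cS \<inter> critical_set AS AM f)
      in mu_normsq_local (g cM) w R (\<lambda>z. v cM (chart_inv cS z)) (snd cS p))"


section \<open>Second derivatives\<close>

definition has_second_derivative :: "(real \<Rightarrow> real) \<Rightarrow> real \<Rightarrow> real \<Rightarrow> bool" where
  "has_second_derivative F D t0 \<longleftrightarrow>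
     (\<exists>F'. (\<forall>\<^sub>F t in nhds t0. (F has_real_derivative F' t) (at t)) \<and>
           (F' has_real_derivative D) (at t0))"

end

theory Submission
  imports Defs "HOL-Complex_Analysis.Cauchy_Integral_Formula"
begin

text \<open>In a complex chart let \<open>e\<close> be half the trace of the pull-back metric along the variation and
  \<open>a\<close>, \<open>b\<close> the components of its trace-free part, so that the energy density is \<open>e\<close> and the area
  density is \<open>sqrt (e\<^sup>2 - a\<^sup>2 - b\<^sup>2)\<close>. Since \<open>u\<close> is conformal, \<open>a = b = 0\<close> at \<open>t = 0\<close>; hence the second
  derivative of \<open>e - sqrt (e\<^sup>2 - a\<^sup>2 - b\<^sup>2)\<close> at \<open>0\<close> is \<open>(a'\<^sup>2 + b'\<^sup>2) / e\<close> wherever \<open>e > 0\<close>. By metric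
  compatibility and symmetry of the connection \<open>a' - \<i> b' = 4 \<langle>\<nabla>\<^sub>z v, u\<^sub>z\<rangle>\<close>, while differentiating the products
  of \<open>\<sigma>\<^bsup>(0,1)\<^esup>\<close> and \<open>s\<close> with \<open>u\<^sub>z\<close> shows that \<open>\<mu>\<close> is \<open>(2 / e) \<langle>\<nabla>\<^sub>z v, u\<^sub>z\<rangle>\<close> times the conjugate of
  \<open>u\<^sub>z\<close>. So the second derivative of the integrand is \<open>4 |\<mu>|\<^sup>2 d\<Sigma>\<close> pointwise, without integration by parts.

  Two points remain near the branch points. Differentiating twice under the integral needs bounds that are
  uniform where \<open>e\<close> vanishes at \<open>t = 0\<close>: a nonnegative function with bounded second derivative satisfies
  \<open>f'\<^sup>2 \<le> C f\<close>, and this is applied to \<open>e\<close>, \<open>e \<plusminus> a\<close>, \<open>e \<plusminus> b\<close> and to the determinant. Moreover the area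
  must be differentiable for small \<open>t \<noteq> 0\<close>, where the maps need not be immersions: because the branch points
  of \<open>u\<close> have finite order, some iterated directional derivative of the determinant does not vanish nearby,
  so the determinant vanishes only on a null set.\<close>

section \<open>Directional derivatives of smooth functions\<close>

text \<open>The square root of the determinant is merely Lipschitz in t where the determinant
  vanishes, and near such zeros its second derivative need not be bounded, so a dominating function
  cannot be found by differentiating twice at every t. Scaling replaces it: with r = sqrt (e 0), the
  values of e, a, b are O((r + |t|)^2) and their t-derivatives O(r + |t|), with constants
  independent of the point of the surface. For t \<noteq> 0 a Lipschitz bound together with
  differentiability almost everywhere gives the first derivative. The second one is taken at t = 0
  alone: for |t| \<le> c r the determinant stays comparable to r^4, for |t| > c r every term is
  already O(|t|), and both regimes bound the increment of the first derivative by C |t|. At the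
  boundary, maps and metrics are defined on half-planes and half-spaces only; they are
  differentiated through smooth extensions to open sets. The area and energy measures are specified
  by a definite description, so existence and uniqueness must come from a change of variables;
  integrals are then computed on a finite Borel partition into coordinate pieces.\<close>

definition pd :: "'a::euclidean_space \<Rightarrow> ('a \<Rightarrow> 'b::real_normed_vector) \<Rightarrow> 'a \<Rightarrow> 'b" where
  "pd h f x = frechet_derivative f (at x) h"

lemma pd_eq: "(f has_derivative f') (at x) \<Longrightarrow> pd h f x = f' h"
  unfolding pd_def using frechet_derivative_at by metis

lemma Ck_on_subset: "Ck_on k f U \<Longrightarrow> V \<subseteq> U \<Longrightarrow> Ck_on k f V"
proof (induction k arbitrary: f)
  case (Suc k)
  from Suc.prems(1) obtain f' where "\<forall>x\<in>U. (f has_derivative f' x) (at x)"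
    "\<forall>b\<in>Basis. Ck_on k (\<lambda>x. f' x b) U" by auto
  with Suc show ?case by (auto intro!: exI[of _ f'])
qed (auto intro: continuous_on_subset)

lemma Ck_on_imp_continuous: "Ck_on k f U \<Longrightarrow> continuous_on U f"
proof (cases k)
  case (Suc j)
  moreover assume "Ck_on k f U"
  ultimately obtain f' where "\<forall>x\<in>U. (f has_derivative f' x) (at x)" by auto
  then have "\<forall>x\<in>U. isCont f x" using has_derivative_continuous by blast
  then show ?thesis by (rule continuous_at_imp_continuous_on)
qed auto

lemma Ck_on_SucD: "Ck_on (Suc k) f U \<Longrightarrow> Ck_on k f U"
proof (induction k arbitrary: f)
  case 0
  then show ?case using Ck_on_imp_continuous by fastforce
next
  case (Suc k)
  then obtain f' where f': "\<forall>x\<in>U. (f has_derivative f' x) (at x)"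
    "\<forall>b\<in>Basis. Ck_on (Suc k) (\<lambda>x. f' x b) U"
    by (subst (asm) Ck_on.simps(2)) auto
  then show ?case using Suc.IH by auto
qed

lemma Ck_on_cong:
  assumes "open U" "\<And>x. x \<in> U \<Longrightarrow> f x = g x" "Ck_on k f U"
  shows "Ck_on k g U"
proof (cases k)
  case 0
  then show ?thesis using assms continuous_on_cong by (metis Ck_on.simps(1))
next
  case (Suc j)
  then obtain f' where f': "\<forall>x\<in>U. (f has_derivative f' x) (at x)"
    "\<forall>b\<in>Basis. Ck_on j (\<lambda>x. f' x b) U" using assms by auto
  have "\<forall>x\<in>U. (g has_derivative f' x) (at x)"
    using f'(1) assms by (meson has_derivative_transform_within_open)
  then show ?thesis using f' Suc by auto
qed

lemma Ck_on_const: "Ck_on k (\<lambda>x. c) U"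
proof (induction k arbitrary: c)
  case (Suc k)
  show ?case by (simp, intro exI[of _ "\<lambda>x h. 0"]) (use Suc in auto)
qed auto

lemma Ck_on_bounded_linear: "bounded_linear L \<Longrightarrow> Ck_on k L U"
proof (cases k)
  case 0
  assume "bounded_linear L"
  with 0 show ?thesis by (simp add: linear_continuous_on)
next
  case (Suc j)
  assume "bounded_linear L"
  then have "(L has_derivative L) (at x)" for x by (rule bounded_linear_imp_has_derivative)
  with Suc show ?thesis by (auto intro!: exI[of _ "\<lambda>x. L"] Ck_on_const)
qed

lemma Ck_on_add: "Ck_on k f U \<Longrightarrow> Ck_on k g U \<Longrightarrow> Ck_on k (\<lambda>x. f x + g x) U"
proof (induction k arbitrary: f g)
  case (Suc k)
  then obtain f' g' where "\<forall>x\<in>U. (f has_derivative f' x) (at x)"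
    "\<forall>b\<in>Basis. Ck_on k (\<lambda>x. f' x b) U" "\<forall>x\<in>U. (g has_derivative g' x) (at x)"
    "\<forall>b\<in>Basis. Ck_on k (\<lambda>x. g' x b) U" by auto
  then show ?case using Suc.IH
    by (simp, intro exI[of _ "\<lambda>x h. f' x h + g' x h"]) (auto intro!: has_derivative_add)
qed (auto intro: continuous_on_add)

lemma Ck_on_sum: "(\<And>i. i \<in> S \<Longrightarrow> Ck_on k (f i) U) \<Longrightarrow> Ck_on k (\<lambda>x. \<Sum>i\<in>S. f i x) U"
  by (induction S rule: infinite_finite_induct) (auto intro: Ck_on_const Ck_on_add)

text \<open>The product rule contains the undifferentiated factors, so the induction step needs them
  in the class \<open>Ck_on k\<close> as well; \<open>Ck_on_SucD\<close> supplies this.\<close>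

lemma Ck_on_bilinear:
  assumes B: "bounded_bilinear B"
  shows "Ck_on k f U \<Longrightarrow> Ck_on k g U \<Longrightarrow> Ck_on k (\<lambda>x. B (f x) (g x)) U"
proof (induction k arbitrary: f g)
  case 0
  then show ?case using bounded_bilinear.continuous_on[OF B] by auto
next
  case (Suc k)
  then obtain f' g' where *: "\<forall>x\<in>U. (f has_derivative f' x) (at x)"
    "\<forall>b\<in>Basis. Ck_on k (\<lambda>x. f' x b) U" "\<forall>x\<in>U. (g has_derivative g' x) (at x)"
    "\<forall>b\<in>Basis. Ck_on k (\<lambda>x. g' x b) U" by auto
  have "Ck_on k f U" "Ck_on k g U" using Suc.prems Ck_on_SucD by blast+
  with * show ?case using Suc.IH
    by (simp, intro exI[of _ "\<lambda>x h. B (f x) (g' x h) + B (f' x h) (g x)"])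
       (auto intro!: Ck_on_add bounded_bilinear.FDERIV[OF B])
qed

lemma Ck_on_linear_compose:
  assumes L: "bounded_linear L"
  shows "Ck_on k f U \<Longrightarrow> Ck_on k (\<lambda>x. L (f x)) U"
proof (induction k arbitrary: f)
  case 0
  then show ?case using bounded_linear.continuous_on[OF L] by auto
next
  case (Suc k)
  then obtain f' where *: "\<forall>x\<in>U. (f has_derivative f' x) (at x)"
    "\<forall>b\<in>Basis. Ck_on k (\<lambda>x. f' x b) U" by auto
  then show ?case using Suc.IH
    by (simp, intro exI[of _ "\<lambda>x h. L (f' x h)"])
       (auto intro!: bounded_linear.has_derivative[OF L])
qed

text \<open>\<open>Ck_on\<close> controls partial derivatives along \<open>Basis\<close>, so the
  chain rule is written as a sum over basis vectors \<open>j\<close>: a component of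
  \<open>g'\<close> times \<open>f' (g x) j\<close>. The second factor is again a composition with
  \<open>g\<close>, one order lower, to which the induction hypothesis applies.\<close>

lemma Ck_on_compose:
  fixes f :: "'b::euclidean_space \<Rightarrow> 'c::real_normed_vector" and g :: "'a::euclidean_space \<Rightarrow> 'b"
  shows "Ck_on k f U \<Longrightarrow> Ck_on k g V \<Longrightarrow> g ` V \<subseteq> U \<Longrightarrow> Ck_on k (\<lambda>x. f (g x)) V"
proof (induction k arbitrary: f g)
  case 0
  then show ?case using continuous_on_compose2 by auto
next
  case (Suc k)
  then obtain f' g' where *: "\<forall>x\<in>U. (f has_derivative f' x) (at x)"
    "\<forall>b\<in>Basis. Ck_on k (\<lambda>x. f' x b) U" "\<forall>x\<in>V. (g has_derivative g' x) (at x)"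
    "\<forall>b\<in>Basis. Ck_on k (\<lambda>x. g' x b) V" by auto
  have gk: "Ck_on k g V" using Suc.prems Ck_on_SucD by blast
  have der: "((\<lambda>x. f (g x)) has_derivative (\<lambda>h. \<Sum>j\<in>Basis. (g' x h \<bullet> j) *\<^sub>R f' (g x) j)) (at x)"
    if "x \<in> V" for x
  proof -
    have fd: "(f has_derivative f' (g x)) (at (g x))" using * that Suc.prems by blast
    have fg: "((\<lambda>x. f (g x)) has_derivative (\<lambda>h. f' (g x) (g' x h))) (at x)"
      using has_derivative_compose[of g "g' x" x UNIV f "f' (g x)"] fd * that by blast
    have rep: "\<And>y. f' (g x) y = (\<Sum>j\<in>Basis. (y \<bullet> j) *\<^sub>R f' (g x) j)"
    proof -
      fix y
      have "f' (g x) y = f' (g x) (\<Sum>j\<in>Basis. (y \<bullet> j) *\<^sub>R j)" by (simp add: euclidean_representation)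
      also have "\<dots> = (\<Sum>j\<in>Basis. (y \<bullet> j) *\<^sub>R f' (g x) j)"
        using has_derivative_linear[OF fd] by (simp add: linear_sum linear_scale)
      finally show "f' (g x) y = (\<Sum>j\<in>Basis. (y \<bullet> j) *\<^sub>R f' (g x) j)" .
    qed
    show ?thesis by (rule has_derivative_eq_rhs[OF fg]) (intro ext rep)
  qed
  have "Ck_on k (\<lambda>x. \<Sum>j\<in>Basis. (g' x b \<bullet> j) *\<^sub>R f' (g x) j) V" if "b \<in> Basis" for b
  proof (intro Ck_on_sum Ck_on_bilinear[OF bounded_bilinear_scaleR])
    fix j :: 'b assume j: "j \<in> Basis"
    show "Ck_on k (\<lambda>x. g' x b \<bullet> j) V"
      using Ck_on_linear_compose[OF bounded_linear_inner_left] * that by blast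
    show "Ck_on k (\<lambda>x. f' (g x) j) V"
      using Suc.IH[of "\<lambda>x. f' x j" g] * j gk Suc.prems by blast
  qed
  with der show ?case
    by (simp, intro exI[of _ "\<lambda>x h. \<Sum>j\<in>Basis. (g' x h \<bullet> j) *\<^sub>R f' (g x) j"]) auto
qed

text \<open>The derivative hidden in the existential of \<open>Ck_on\<close> is unique, hence equal
  to \<open>pd\<close>; expanding \<open>h\<close> in the basis carries the regularity over from
  basis directions to all directions.\<close>

lemma Ck_on_Suc_pd:
  assumes "Ck_on (Suc k) f U"
  shows "x \<in> U \<Longrightarrow> (f has_derivative (\<lambda>h. pd h f x)) (at x)" "open U \<Longrightarrow> Ck_on k (pd h f) U"
proof -
  obtain f' where *: "\<forall>x\<in>U. (f has_derivative f' x) (at x)"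
    "\<forall>b\<in>Basis. Ck_on k (\<lambda>x. f' x b) U" using assms by auto
  then have e: "x \<in> U \<Longrightarrow> pd h f x = f' x h" for x h using pd_eq by blast
  show "x \<in> U \<Longrightarrow> (f has_derivative (\<lambda>h. pd h f x)) (at x)" using * e by simp
  have "Ck_on k (\<lambda>x. \<Sum>j\<in>Basis. (h \<bullet> j) *\<^sub>R f' x j) U"
  proof (rule Ck_on_sum)
    fix j :: 'a assume "j \<in> Basis"
    then have "Ck_on k (\<lambda>x. f' x j) U" using * by simp
    then show "Ck_on k (\<lambda>x. (h \<bullet> j) *\<^sub>R f' x j) U"
      by (rule Ck_on_linear_compose[OF bounded_linear_scaleR_right])
  qed
  moreover have "(\<Sum>j\<in>Basis. (h \<bullet> j) *\<^sub>R f' x j) = pd h f x" if "x \<in> U" for x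
  proof -
    have l: "linear (f' x)" using * that has_derivative_linear by blast
    have "f' x h = f' x (\<Sum>j\<in>Basis. (h \<bullet> j) *\<^sub>R j)" by (simp add: euclidean_representation)
    also have "\<dots> = (\<Sum>j\<in>Basis. (h \<bullet> j) *\<^sub>R f' x j)"
      using l by (simp add: linear_sum linear_scale)
    finally show ?thesis using e that by simp
  qed
  ultimately show "open U \<Longrightarrow> Ck_on k (pd h f) U" by (metis (lifting) Ck_on_cong)
qed

section \<open>Smooth functions on open sets and symmetry of second derivatives\<close>

definition Cinf :: "'a::euclidean_space set \<Rightarrow> ('a \<Rightarrow> 'b::real_normed_vector) \<Rightarrow> bool" where
  "Cinf U f \<longleftrightarrow> open U \<and> (\<forall>k. Ck_on k f U)"

lemma Cinf_open: "Cinf U f \<Longrightarrow> open U" by (simp add: Cinf_def)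

lemma Cinf_subset: "Cinf U f \<Longrightarrow> open V \<Longrightarrow> V \<subseteq> U \<Longrightarrow> Cinf V f"
  unfolding Cinf_def using Ck_on_subset by blast

lemma Cinf_continuous_on: "Cinf U f \<Longrightarrow> continuous_on U f"
  unfolding Cinf_def using Ck_on_imp_continuous by blast

lemma Cinf_has_derivative: "Cinf U f \<Longrightarrow> x \<in> U \<Longrightarrow> (f has_derivative (\<lambda>h. pd h f x)) (at x)"
  unfolding Cinf_def using Ck_on_Suc_pd by blast

lemma Cinf_pd: "Cinf U f \<Longrightarrow> Cinf U (pd h f)"
  unfolding Cinf_def using Ck_on_Suc_pd by blast

lemma Cinf_add: "Cinf U f \<Longrightarrow> Cinf U g \<Longrightarrow> Cinf U (\<lambda>x. f x + g x)"
  unfolding Cinf_def using Ck_on_add by blast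

lemma Cinf_linear_compose: "bounded_linear L \<Longrightarrow> Cinf U f \<Longrightarrow> Cinf U (\<lambda>x. L (f x))"
  unfolding Cinf_def using Ck_on_linear_compose by blast

lemma Cinf_bilinear: "bounded_bilinear B \<Longrightarrow> Cinf U f \<Longrightarrow> Cinf U g \<Longrightarrow> Cinf U (\<lambda>x. B (f x) (g x))"
  unfolding Cinf_def using Ck_on_bilinear by blast

lemma Cinf_mult:
  fixes f g :: "'a::euclidean_space \<Rightarrow> real"
  shows "Cinf U f \<Longrightarrow> Cinf U g \<Longrightarrow> Cinf U (\<lambda>x. f x * g x)"
  by (rule Cinf_bilinear[OF bounded_bilinear_mult])

lemma Cinf_diff: "Cinf U f \<Longrightarrow> Cinf U g \<Longrightarrow> Cinf U (\<lambda>x. f x - g x)"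
  using Cinf_add[of U f "\<lambda>x. - g x"] Cinf_linear_compose[of uminus U g]
  by (simp add: bounded_linear_minus)

lemma Cinf_compose: "Cinf U f \<Longrightarrow> Cinf V g \<Longrightarrow> g ` V \<subseteq> U \<Longrightarrow> Cinf V (\<lambda>x. f (g x))"
  unfolding Cinf_def using Ck_on_compose by blast

lemma pd_linear: "Cinf U f \<Longrightarrow> x \<in> U \<Longrightarrow> linear (\<lambda>h. pd h f x)"
  using Cinf_has_derivative has_derivative_linear by blast

lemma pd_bounded_linear: "bounded_linear L \<Longrightarrow> Cinf U f \<Longrightarrow> x \<in> U \<Longrightarrow> pd h (\<lambda>x. L (f x)) x = L (pd h f x)"
  by (rule pd_eq, rule bounded_linear.has_derivative, assumption, rule Cinf_has_derivative)

text \<open>Both mixed derivatives are limits of the same second difference quotient.\<close>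

lemma pd_second_difference:
  fixes f :: "'a::euclidean_space \<Rightarrow> real"
  assumes f: "Cinf U f" and sub: "\<And>a b. 0 \<le> a \<Longrightarrow> a \<le> s \<Longrightarrow> 0 \<le> b \<Longrightarrow> b \<le> s \<Longrightarrow> x + a *\<^sub>R h + b *\<^sub>R k \<in> U"
    and s: "s > 0"
  obtains a b where "0 < a" "a < s" "0 < b" "b < s"
    "f (x + s *\<^sub>R h + s *\<^sub>R k) - f (x + s *\<^sub>R h) - f (x + s *\<^sub>R k) + f x
      = s\<^sup>2 * pd k (pd h f) (x + a *\<^sub>R h + b *\<^sub>R k)"
proof -
  have line: "((\<lambda>r. F (y + r *\<^sub>R e)) has_real_derivative pd e F (y + r *\<^sub>R e)) (at r)"
    if "Cinf U F" "y + r *\<^sub>R e \<in> U" for F :: "'a \<Rightarrow> real" and y e r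
  proof -
    have l: "((\<lambda>r. y + r *\<^sub>R e) has_derivative (\<lambda>q. q *\<^sub>R e)) (at r)"
      by (auto intro!: derivative_eq_intros)
    have "((\<lambda>r. F (y + r *\<^sub>R e)) has_derivative (\<lambda>q. pd (q *\<^sub>R e) F (y + r *\<^sub>R e))) (at r)"
      by (rule has_derivative_compose[OF l]) (rule Cinf_has_derivative[OF that])
    moreover have "(\<lambda>q. pd (q *\<^sub>R e) F (y + r *\<^sub>R e)) = (*) (pd e F (y + r *\<^sub>R e))"
      using linear_scale[OF pd_linear[OF that]] by (simp add: fun_eq_iff mult.commute)
    ultimately show ?thesis by (simp add: has_field_derivative_def)
  qed
  \<comment> \<open>The second difference is an increment of \<open>?g\<close>; the mean value
    theorem in direction \<open>h\<close>, followed by the one in direction \<open>k\<close>,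
    produces the mixed derivative.\<close>
  let ?g = "\<lambda>a. f (x + s *\<^sub>R k + a *\<^sub>R h) - f (x + a *\<^sub>R h)"
  have U1: "x + s *\<^sub>R k + a *\<^sub>R h \<in> U" "x + a *\<^sub>R h \<in> U" if "0 \<le> a" "a \<le> s" for a
    using sub[of a s] sub[of a 0] that s by (auto simp: algebra_simps)
  have "\<exists>a>0. a < s \<and> ?g s - ?g 0 = (s - 0) * (pd h f (x + s *\<^sub>R k + a *\<^sub>R h) - pd h f (x + a *\<^sub>R h))"
    using s U1 by (intro MVT2 DERIV_diff line f) auto
  then obtain a where a: "0 < a" "a < s"
    "?g s - ?g 0 = s * (pd h f (x + s *\<^sub>R k + a *\<^sub>R h) - pd h f (x + a *\<^sub>R h))" by auto
  let ?k = "\<lambda>b. pd h f (x + a *\<^sub>R h + b *\<^sub>R k)"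
  have "\<exists>b>0. b < s \<and> ?k s - ?k 0 = (s - 0) * pd k (pd h f) (x + a *\<^sub>R h + b *\<^sub>R k)"
    using s sub a by (intro MVT2 line Cinf_pd f) auto
  then obtain b where b: "0 < b" "b < s" "?k s - ?k 0 = s * pd k (pd h f) (x + a *\<^sub>R h + b *\<^sub>R k)" by auto
  have "?g s - ?g 0 = s * (?k s - ?k 0)" using a by (simp add: algebra_simps)
  then show ?thesis using a b that[of a b] by (simp add: power2_eq_square algebra_simps)
qed

lemma pd_commute_real:
  fixes f :: "'a::euclidean_space \<Rightarrow> real"
  assumes f: "Cinf U f" and x: "x \<in> U"
  shows "pd h (pd k f) x = pd k (pd h f) x"
proof (rule ccontr)
  assume ne: "pd h (pd k f) x \<noteq> pd k (pd h f) x"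
  define e where "e = \<bar>pd h (pd k f) x - pd k (pd h f) x\<bar> / 2"
  have e: "e > 0" using ne by (simp add: e_def)
  have cont: "isCont (pd h (pd k f)) x" "isCont (pd k (pd h f)) x"
    using Cinf_continuous_on[OF Cinf_pd[OF Cinf_pd[OF f]]] Cinf_open[OF f] x
    by (auto simp: continuous_on_eq_continuous_at)
  have "\<forall>\<^sub>F y in nhds x. y \<in> U \<and> dist (pd h (pd k f) y) (pd h (pd k f) x) < e \<and>
      dist (pd k (pd h f) y) (pd k (pd h f) x) < e"
    using cont[unfolded isCont_def tendsto_at_iff_tendsto_nhds] e Cinf_open[OF f] x
    by (intro eventually_conj eventually_nhds_in_open tendstoD)
  then obtain d where d: "d > 0" "\<And>y. dist y x < d \<Longrightarrow> y \<in> U \<and> dist (pd h (pd k f) y) (pd h (pd k f) x) < e \<and>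
      dist (pd k (pd h f) y) (pd k (pd h f) x) < e"
    unfolding eventually_nhds_metric by blast
  \<comment> \<open>With this side length all points of the parallelogram lie within
    \<open>d / 2\<close> of \<open>x\<close>; the summand 1 keeps the denominator positive when both
    directions are zero.\<close>
  define s where "s = d / (2 * (norm h + norm k + 1))"
  have nn: "norm h + norm k + 1 > 0" by (smt (verit) norm_ge_zero)
  have s: "s > 0" using d nn by (simp add: s_def)
  have near: "dist (x + a *\<^sub>R h + b *\<^sub>R k) x < d" if "0 \<le> a" "a \<le> s" "0 \<le> b" "b \<le> s" for a b
  proof -
    have "dist (x + a *\<^sub>R h + b *\<^sub>R k) x \<le> a * norm h + b * norm k"
      using norm_triangle_ineq[of "a *\<^sub>R h" "b *\<^sub>R k"] that by (simp add: dist_norm add.assoc)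
    also have "\<dots> \<le> s * norm h + s * norm k"
      using that by (intro add_mono mult_right_mono) auto
    also have "\<dots> \<le> s * (norm h + norm k + 1)" using s by (simp add: algebra_simps)
    also have "\<dots> = d / 2" using nn by (simp add: s_def field_simps)
    finally show ?thesis using d by simp
  qed
  obtain a b where 1: "0 < a" "a < s" "0 < b" "b < s"
    "f (x + s *\<^sub>R h + s *\<^sub>R k) - f (x + s *\<^sub>R h) - f (x + s *\<^sub>R k) + f x
      = s\<^sup>2 * pd k (pd h f) (x + a *\<^sub>R h + b *\<^sub>R k)"
    by (rule pd_second_difference[OF f _ s, of x h k]) (use d(2)[OF near] in blast)+
  have near': "x + a *\<^sub>R k + b *\<^sub>R h \<in> U" if "0 \<le> a" "a \<le> s" "0 \<le> b" "b \<le> s" for a b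
  proof -
    have eq: "x + a *\<^sub>R k + b *\<^sub>R h = x + b *\<^sub>R h + a *\<^sub>R k" by simp
    show ?thesis unfolding eq using d(2)[OF near[of b a]] that by blast
  qed
  obtain a' b' where 2: "0 < a'" "a' < s" "0 < b'" "b' < s"
    "f (x + s *\<^sub>R k + s *\<^sub>R h) - f (x + s *\<^sub>R k) - f (x + s *\<^sub>R h) + f x
      = s\<^sup>2 * pd h (pd k f) (x + a' *\<^sub>R k + b' *\<^sub>R h)"
    by (rule pd_second_difference[OF f near' s])
  have "s\<^sup>2 * pd k (pd h f) (x + a *\<^sub>R h + b *\<^sub>R k) = s\<^sup>2 * pd h (pd k f) (x + b' *\<^sub>R h + a' *\<^sub>R k)"
    using 1(5) 2(5) by (simp add: algebra_simps)
  then have eq: "pd k (pd h f) (x + a *\<^sub>R h + b *\<^sub>R k) = pd h (pd k f) (x + b' *\<^sub>R h + a' *\<^sub>R k)"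
    using s by simp
  have "dist (pd k (pd h f) (x + a *\<^sub>R h + b *\<^sub>R k)) (pd k (pd h f) x) < e"
    "dist (pd h (pd k f) (x + b' *\<^sub>R h + a' *\<^sub>R k)) (pd h (pd k f) x) < e"
    using d(2)[OF near] 1 2 by auto
  then show False using eq unfolding e_def dist_real_def by (smt (verit) field_sum_of_halves)
qed

lemma pd_commute:
  fixes f :: "'a::euclidean_space \<Rightarrow> 'b::euclidean_space"
  assumes f: "Cinf U f" and x: "x \<in> U"
  shows "pd h (pd k f) x = pd k (pd h f) x"
proof (rule euclidean_eqI)
  fix b :: 'b assume "b \<in> Basis"
  have bl: "bounded_linear (\<lambda>y. y \<bullet> b)" by (rule bounded_linear_inner_left)
  have *: "pd k (\<lambda>x. f x \<bullet> b) y = pd k f y \<bullet> b" if "y \<in> U" for k y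
    using pd_bounded_linear[OF bl f that] .
  have **: "pd h (pd k (\<lambda>x. f x \<bullet> b)) x = pd h (pd k f) x \<bullet> b" for h k
  proof -
    have "((\<lambda>y. pd k f y \<bullet> b) has_derivative (\<lambda>h. pd h (pd k f) x \<bullet> b)) (at x)"
      by (rule bounded_linear.has_derivative[OF bl Cinf_has_derivative[OF Cinf_pd[OF f] x]])
    then have "(pd k (\<lambda>x. f x \<bullet> b) has_derivative (\<lambda>h. pd h (pd k f) x \<bullet> b)) (at x)"
      by (rule has_derivative_transform_within_open[OF _ Cinf_open[OF f] x]) (simp add: *)
    then show ?thesis by (rule pd_eq)
  qed
  show "pd h (pd k f) x \<bullet> b = pd k (pd h f) x \<bullet> b"
    using pd_commute_real[OF Cinf_linear_compose[OF bl f] x, of h k] ** by simp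
qed

section \<open>Paths of semidefinite forms\<close>

lemma mvt_bound:
  fixes f :: "real \<Rightarrow> real"
  assumes "\<And>s. s \<in> closed_segment t u \<Longrightarrow> (f has_real_derivative f' s) (at s)"
    and "\<And>s. s \<in> closed_segment t u \<Longrightarrow> \<bar>f' s\<bar> \<le> M"
  shows "\<bar>f u - f t\<bar> \<le> M * \<bar>u - t\<bar>"
  using field_differentiable_bound[OF convex_closed_segment, of t u f f' M u t] assms
  by (auto intro: has_field_derivative_at_within)

lemma taylor_bound:
  fixes f :: "real \<Rightarrow> real"
  assumes f: "\<And>s. s \<in> closed_segment t u \<Longrightarrow> (f has_real_derivative f1 s) (at s)"
    and f1: "\<And>s. s \<in> closed_segment t u \<Longrightarrow> (f1 has_real_derivative f2 s) (at s)"
    and f2: "\<And>s. s \<in> closed_segment t u \<Longrightarrow> \<bar>f2 s\<bar> \<le> M"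
  shows "\<bar>f u - f t - f1 t * (u - t)\<bar> \<le> M * (u - t)\<^sup>2"
proof -
  have M: "M \<ge> 0" using f2[of t] by (smt (verit) ends_in_segment(1))
  have b: "\<bar>f1 s - f1 t\<bar> \<le> M * \<bar>u - t\<bar>" if "s \<in> closed_segment t u" for s
  proof -
    have sub: "closed_segment t s \<subseteq> closed_segment t u" using that by (simp add: subset_closed_segment)
    have "\<bar>f1 s - f1 t\<bar> \<le> M * \<bar>s - t\<bar>"
      using sub by (intro mvt_bound[of _ _ f1 f2] f1 f2) auto
    also have "\<dots> \<le> M * \<bar>u - t\<bar>"
      using that M by (intro mult_left_mono) (auto simp: closed_segment_eq_real_ivl split: if_splits)
    finally show ?thesis .
  qed
  have "\<bar>(f u - f1 t * u) - (f t - f1 t * t)\<bar> \<le> (M * \<bar>u - t\<bar>) * \<bar>u - t\<bar>"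
    by (rule mvt_bound[where f' = "\<lambda>s. f1 s - f1 t"]) (auto intro!: derivative_eq_intros f b)
  then show ?thesis by (simp add: algebra_simps power2_eq_square)
qed

text \<open>Taylor's formula at \<open>t + h\<close> and \<open>t - h\<close>, where
  \<open>f\<close> is nonnegative, bounds the slope in both directions. A step \<open>h\<close> of
  the order of \<open>sqrt (f t / M)\<close> would give a bound of the square of \<open>f1 t\<close>
  by a multiple of \<open>f t\<close>; \<open>h\<close> is left free because it must also fit into
  the time interval.\<close>

lemma nonneg_derivative_bound:
  fixes f :: "real \<Rightarrow> real"
  assumes f: "\<And>s. \<bar>s - t\<bar> \<le> h \<Longrightarrow> (f has_real_derivative f1 s) (at s)"
    and f1: "\<And>s. \<bar>s - t\<bar> \<le> h \<Longrightarrow> (f1 has_real_derivative f2 s) (at s)"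
    and f2: "\<And>s. \<bar>s - t\<bar> \<le> h \<Longrightarrow> \<bar>f2 s\<bar> \<le> M"
    and nn: "\<And>s. \<bar>s - t\<bar> \<le> h \<Longrightarrow> 0 \<le> f s" and h: "0 \<le> h"
  shows "\<bar>f1 t\<bar> * h \<le> f t + M * h\<^sup>2"
proof -
  have *: "\<bar>s - t\<bar> \<le> h" if "s \<in> closed_segment t (t + k)" "\<bar>k\<bar> \<le> h" for s k
    using that by (auto simp: closed_segment_eq_real_ivl split: if_splits)
  have **: "\<bar>f (t + k) - f t - f1 t * k\<bar> \<le> M * h\<^sup>2 \<and> 0 \<le> f (t + k)" if "\<bar>k\<bar> = h" for k
  proof -
    have "\<bar>f (t + k) - f t - f1 t * (t + k - t)\<bar> \<le> M * (t + k - t)\<^sup>2"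
      using * that by (intro taylor_bound[of _ _ f f1 f2] f f1 f2) auto
    moreover have "k\<^sup>2 = h\<^sup>2" using that by (metis power2_abs)
    ultimately show ?thesis using nn[of "t + k"] that by simp
  qed
  have "\<bar>h\<bar> = h" "\<bar>- h\<bar> = h" using h by auto
  from **[OF this(1)] **[OF this(2)] have "\<bar>f1 t * h\<bar> \<le> f t + M * h\<^sup>2"
    by (auto simp: abs_le_iff)
  then show ?thesis using h by (simp add: abs_mult)
qed

lemma nonneg_derivative_zero:
  fixes f :: "real \<Rightarrow> real"
  assumes "(f has_real_derivative d) (at t)" "r > 0" "\<And>s. \<bar>s - t\<bar> < r \<Longrightarrow> 0 \<le> f s" "f t = 0"
  shows "d = 0"
  using assms by (intro DERIV_local_min[of f d t r]) (auto simp: abs_minus_commute)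

text \<open>\<open>e\<close> is the energy density along a path of symmetric positive semidefinite forms on the plane;
  \<open>a\<close> and \<open>b\<close> are the components of the trace-free part, so that \<open>e\<^sup>2 - a\<^sup>2 - b\<^sup>2\<close> is the
  determinant. All constants below depend on \<open>\<epsilon>\<close> and \<open>M\<close> only.\<close>

locale semidefinite_path =
  fixes \<epsilon> M :: real and e e1 e2 a a1 a2 b b1 b2 :: "real \<Rightarrow> real"
  assumes eps: "\<epsilon> > 0" and M: "M > 0"
    and der: "\<And>t. \<bar>t\<bar> < \<epsilon> \<Longrightarrow> (e has_real_derivative e1 t) (at t)"
      "\<And>t. \<bar>t\<bar> < \<epsilon> \<Longrightarrow> (e1 has_real_derivative e2 t) (at t)"
      "\<And>t. \<bar>t\<bar> < \<epsilon> \<Longrightarrow> (a has_real_derivative a1 t) (at t)"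
      "\<And>t. \<bar>t\<bar> < \<epsilon> \<Longrightarrow> (a1 has_real_derivative a2 t) (at t)"
      "\<And>t. \<bar>t\<bar> < \<epsilon> \<Longrightarrow> (b has_real_derivative b1 t) (at t)"
      "\<And>t. \<bar>t\<bar> < \<epsilon> \<Longrightarrow> (b1 has_real_derivative b2 t) (at t)"
    and bd: "\<And>t. \<bar>t\<bar> < \<epsilon> \<Longrightarrow> \<bar>e2 t\<bar> \<le> M" "\<And>t. \<bar>t\<bar> < \<epsilon> \<Longrightarrow> \<bar>a2 t\<bar> \<le> M"
      "\<And>t. \<bar>t\<bar> < \<epsilon> \<Longrightarrow> \<bar>b2 t\<bar> \<le> M"
    and e0: "e 0 \<le> M" and a0: "a 0 = 0" and b0: "b 0 = 0"
    and enn: "\<And>t. \<bar>t\<bar> < \<epsilon> \<Longrightarrow> 0 \<le> e t"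
    and det: "\<And>t. \<bar>t\<bar> < \<epsilon> \<Longrightarrow> (a t)\<^sup>2 + (b t)\<^sup>2 \<le> (e t)\<^sup>2"
begin

definition D where "D t = (e t)\<^sup>2 - (a t)\<^sup>2 - (b t)\<^sup>2"
definition D1 where "D1 t = 2 * (e t * e1 t - a t * a1 t - b t * b1 t)"
definition D2 where "D2 t = 2 * ((e1 t)\<^sup>2 + e t * e2 t - (a1 t)\<^sup>2 - a t * a2 t - (b1 t)\<^sup>2 - b t * b2 t)"
text \<open>The length scale of the path: the form at time 0 has size \<open>r\<^sup>2\<close>. All
  later estimates are homogeneous in \<open>r + \<bar>t\<bar>\<close>, which is at most
  \<open>S\<close>.\<close>

definition r where "r = sqrt (e 0)"
definition S where "S = sqrt M + \<epsilon>"
text \<open>The step \<open>\<eta> * r\<close> stays below \<open>\<epsilon>\<close> because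
  \<open>r \<le> sqrt M\<close>. Inserting it into \<open>nonneg_derivative_bound\<close> with start
  value \<open>r\<^sup>2\<close> and second derivative at most \<open>2 * M\<close> yields the slope
  bound \<open>K * r\<close>. \<open>N\<close> collects the constants that arise when this is
  integrated twice in time.\<close>

definition \<eta> where "\<eta> = \<epsilon> / (2 * (sqrt M + 1))"
definition K where "K = 1 / \<eta> + 2 * M * \<eta>"
definition N where "N = 1 + 2 * K + M"
text \<open>For the determinant the step is
  \<open>\<theta> * sqrt (D t) / (r + \<bar>t\<bar>)\<close>. Since
  \<open>sqrt (D t) \<le> N * (r + \<bar>t\<bar>)\<^sup>2\<close>, this choice makes the step at
  most \<open>r + \<bar>t\<bar>\<close> and less than \<open>\<epsilon> / 2\<close>.
  \<open>C0\<close> is the constant that \<open>nonneg_derivative_bound\<close> then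
  returns.\<close>

definition \<theta> where "\<theta> = \<epsilon> / (4 * N * (S + 1))"
definition C0 where "C0 = 1 / \<theta> + 48 * N\<^sup>2 * \<theta>"

section \<open>Scaling bounds for the form, its velocity and its determinant\<close>

lemma D_nonneg: "\<bar>t\<bar> < \<epsilon> \<Longrightarrow> 0 \<le> D t" using det[of t] by (simp add: D_def)

lemma D_der: "\<bar>t\<bar> < \<epsilon> \<Longrightarrow> (D has_real_derivative D1 t) (at t)"
  unfolding D_def[abs_def] D1_def
  by (auto intro!: derivative_eq_intros der simp: algebra_simps)

lemma D1_der: "\<bar>t\<bar> < \<epsilon> \<Longrightarrow> (D1 has_real_derivative D2 t) (at t)"
  unfolding D1_def[abs_def] D2_def
  by (auto intro!: derivative_eq_intros der simp: algebra_simps power2_eq_square)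

lemma r_nonneg: "0 \<le> r" and r_sq: "r\<^sup>2 = e 0" and r_le: "r \<le> sqrt M"
  using enn[of 0] e0 eps by (auto simp: r_def)

lemma eta_pos: "\<eta> > 0" using eps M by (simp add: \<eta>_def add_pos_pos)

lemma K_pos: "K > 0" using eta_pos M by (simp add: K_def add_pos_pos)

lemma N_ge: "1 \<le> N" "M \<le> N" "2 * K \<le> N" using K_pos M by (auto simp: N_def)

lemma S_pos: "S > 0" using eps M by (simp add: S_def add_pos_pos)

text \<open>Used for \<open>e\<close> and for the sums of \<open>e\<close> with \<open>a\<close> and
  with \<open>b\<close>: these are nonnegative because \<open>a\<close> and \<open>b\<close> are
  dominated by \<open>e\<close>, and they start at \<open>e 0\<close> because \<open>a\<close> and
  \<open>b\<close> start at 0. For a sum the second derivatives add up, hence \<open>2 * M\<close>.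
  If \<open>r = 0\<close>, time 0 is a minimum and the slope vanishes.\<close>

lemma initial_bound:
  assumes f: "\<And>s. \<bar>s\<bar> < \<epsilon> \<Longrightarrow> (f has_real_derivative f1 s) (at s)"
    and f1: "\<And>s. \<bar>s\<bar> < \<epsilon> \<Longrightarrow> (f1 has_real_derivative f2 s) (at s)"
    and f2: "\<And>s. \<bar>s\<bar> < \<epsilon> \<Longrightarrow> \<bar>f2 s\<bar> \<le> 2 * M"
    and nn: "\<And>s. \<bar>s\<bar> < \<epsilon> \<Longrightarrow> 0 \<le> f s" and f0: "f 0 = e 0"
  shows "\<bar>f1 0\<bar> \<le> K * r"
proof (cases "r = 0")
  case True
  then have "f 0 = 0" using r_sq f0 by simp
  then have "f1 0 = 0" using nonneg_derivative_zero[of f "f1 0" 0 \<epsilon>] f nn eps by simp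
  then show ?thesis using True by simp
next
  case False
  then have r: "r > 0" using r_nonneg by simp
  have "\<eta> * r \<le> \<eta> * sqrt M" using r_le eta_pos by simp
  also have "\<dots> < \<epsilon>"
  proof -
    have "sqrt M < 2 * (sqrt M + 1)" using M by (simp add: add_pos_pos)
    then show ?thesis using eps M unfolding \<eta>_def
      by (simp add: divide_simps add_pos_pos)
  qed
  finally have h: "\<eta> * r < \<epsilon>" .
  have hp: "\<eta> * r > 0" using eta_pos r by simp
  have "\<bar>f1 0\<bar> * (\<eta> * r) \<le> f 0 + (2 * M) * (\<eta> * r)\<^sup>2"
    using h hp by (intro nonneg_derivative_bound[of 0 "\<eta> * r" f f1 f2]) (auto intro!: f f1 f2 nn)
  also have "\<dots> = K * r * (\<eta> * r)"
    using eta_pos by (simp add: f0 r_sq[symmetric] K_def field_simps power2_eq_square)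
  finally show ?thesis using hp by (metis mult_right_le_imp_le)
qed

lemma abs_le_of_sq: "x\<^sup>2 + z \<le> y\<^sup>2 \<Longrightarrow> 0 \<le> z \<Longrightarrow> 0 \<le> y \<Longrightarrow> \<bar>x\<bar> \<le> (y::real)"
  using abs_le_square_iff[of x y] by simp

lemma e1_0: "\<bar>e1 0\<bar> \<le> K * r"
  by (rule initial_bound[of e e1 e2]) (use der bd enn M in \<open>force+\<close>)

lemma ab_le: "\<bar>t\<bar> < \<epsilon> \<Longrightarrow> \<bar>a t\<bar> \<le> e t" "\<bar>t\<bar> < \<epsilon> \<Longrightarrow> \<bar>b t\<bar> \<le> e t"
  using det[of t] enn[of t] by (auto intro: abs_le_of_sq[of _ "(b t)\<^sup>2"] abs_le_of_sq[of _ "(a t)\<^sup>2"])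

lemma a1_0: "\<bar>a1 0\<bar> \<le> 2 * K * r"
proof -
  have "\<bar>e1 0 + a1 0\<bar> \<le> K * r"
    by (rule initial_bound[of "\<lambda>t. e t + a t" "\<lambda>t. e1 t + a1 t" "\<lambda>t. e2 t + a2 t"])
      (use der bd ab_le a0 in \<open>force intro: DERIV_add\<close>)+
  then show ?thesis using e1_0 by linarith
qed

lemma b1_0: "\<bar>b1 0\<bar> \<le> 2 * K * r"
proof -
  have "\<bar>e1 0 + b1 0\<bar> \<le> K * r"
    by (rule initial_bound[of "\<lambda>t. e t + b t" "\<lambda>t. e1 t + b1 t" "\<lambda>t. e2 t + b2 t"])
      (use der bd ab_le b0 in \<open>force intro: DERIV_add\<close>)+
  then show ?thesis using e1_0 by linarith
qed

text \<open>The bound on \<open>f2\<close> is integrated twice from time 0, starting from a slope of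
  order \<open>r\<close> and a value of order \<open>r\<^sup>2\<close>.\<close>

lemma growth:
  assumes f: "\<And>s. \<bar>s\<bar> < \<epsilon> \<Longrightarrow> (f has_real_derivative f1 s) (at s)"
    and f1: "\<And>s. \<bar>s\<bar> < \<epsilon> \<Longrightarrow> (f1 has_real_derivative f2 s) (at s)"
    and f2: "\<And>s. \<bar>s\<bar> < \<epsilon> \<Longrightarrow> \<bar>f2 s\<bar> \<le> M"
    and f0: "\<bar>f 0\<bar> \<le> e 0" "\<bar>f1 0\<bar> \<le> 2 * K * r" and t: "\<bar>t\<bar> < \<epsilon>"
  shows "\<bar>f1 t\<bar> \<le> N * (r + \<bar>t\<bar>)" "\<bar>f t\<bar> \<le> N * (r + \<bar>t\<bar>)\<^sup>2"
proof -
  have seg: "\<bar>s\<bar> \<le> \<bar>u\<bar>" if "s \<in> closed_segment 0 u" for s u :: real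
    using that by (auto simp: closed_segment_eq_real_ivl split: if_splits)
  have B: "\<bar>f1 s\<bar> \<le> (2 * K + M) * (r + \<bar>t\<bar>)" if s: "\<bar>s\<bar> \<le> \<bar>t\<bar>" for s
  proof -
    have "\<bar>f1 s - f1 0\<bar> \<le> M * \<bar>s - 0\<bar>"
      by (rule mvt_bound[of _ _ _ f2]) (use seg[of _ s] s t f1 f2 in fastforce)+
    moreover have "M * \<bar>s\<bar> \<le> M * \<bar>t\<bar>" using s M by simp
    ultimately have "\<bar>f1 s\<bar> \<le> 2 * K * r + M * \<bar>t\<bar>" using f0(2) by simp
    also have "\<dots> \<le> (2 * K + M) * (r + \<bar>t\<bar>)" using K_pos M r_nonneg by (simp add: algebra_simps)
    finally show ?thesis .
  qed
  have N1: "(2 * K + M) * (r + \<bar>t\<bar>) \<le> N * (r + \<bar>t\<bar>)"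
    using r_nonneg by (intro mult_right_mono) (auto simp: N_def)
  show "\<bar>f1 t\<bar> \<le> N * (r + \<bar>t\<bar>)" using B[of t] N1 by simp
  have "\<bar>f t - f 0\<bar> \<le> ((2 * K + M) * (r + \<bar>t\<bar>)) * \<bar>t - 0\<bar>"
    by (rule mvt_bound[of _ _ _ f1]) (use seg[of _ t] t f B in fastforce)+
  also have "\<dots> \<le> ((2 * K + M) * (r + \<bar>t\<bar>)) * (r + \<bar>t\<bar>)"
    using K_pos M r_nonneg by (intro mult_left_mono) auto
  finally have "\<bar>f t\<bar> \<le> r\<^sup>2 + (2 * K + M) * (r + \<bar>t\<bar>)\<^sup>2"
    using f0(1) unfolding r_sq[symmetric] power2_eq_square mult.assoc by linarith
  also have "\<dots> \<le> (r + \<bar>t\<bar>)\<^sup>2 + (2 * K + M) * (r + \<bar>t\<bar>)\<^sup>2"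
    using r_nonneg by (simp add: power_mono)
  finally show "\<bar>f t\<bar> \<le> N * (r + \<bar>t\<bar>)\<^sup>2" by (simp add: N_def algebra_simps)
qed

lemma growth_all:
  assumes "\<bar>t\<bar> < \<epsilon>"
  shows "\<bar>e1 t\<bar> \<le> N * (r + \<bar>t\<bar>)" "\<bar>e t\<bar> \<le> N * (r + \<bar>t\<bar>)\<^sup>2" "\<bar>a1 t\<bar> \<le> N * (r + \<bar>t\<bar>)"
    "\<bar>a t\<bar> \<le> N * (r + \<bar>t\<bar>)\<^sup>2" "\<bar>b1 t\<bar> \<le> N * (r + \<bar>t\<bar>)" "\<bar>b t\<bar> \<le> N * (r + \<bar>t\<bar>)\<^sup>2"
proof -
  have e0': "0 \<le> e 0" "\<bar>e1 0\<bar> \<le> 2 * K * r"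
    using enn[of 0] eps e1_0 mult_nonneg_nonneg[OF less_imp_le[OF K_pos] r_nonneg] by auto
  show "\<bar>e1 t\<bar> \<le> N * (r + \<bar>t\<bar>)" "\<bar>e t\<bar> \<le> N * (r + \<bar>t\<bar>)\<^sup>2"
    using growth[OF der(1,2) bd(1) _ _ assms] e0' by auto
  show "\<bar>a1 t\<bar> \<le> N * (r + \<bar>t\<bar>)" "\<bar>a t\<bar> \<le> N * (r + \<bar>t\<bar>)\<^sup>2"
    using growth[OF der(3,4) bd(2) _ a1_0 assms] e0' a0 by auto
  show "\<bar>b1 t\<bar> \<le> N * (r + \<bar>t\<bar>)" "\<bar>b t\<bar> \<le> N * (r + \<bar>t\<bar>)\<^sup>2"
    using growth[OF der(5,6) bd(3) _ b1_0 assms] e0' b0 by auto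
qed

lemma abs_combine:
  fixes x y z u v w B :: real
  assumes "\<bar>x\<bar> \<le> B" "\<bar>y\<bar> \<le> B" "\<bar>z\<bar> \<le> B"
  shows "\<bar>2 * (x - y - z)\<bar> \<le> 6 * B"
    "\<bar>u\<bar> \<le> B \<Longrightarrow> \<bar>v\<bar> \<le> B \<Longrightarrow> \<bar>w\<bar> \<le> B \<Longrightarrow> \<bar>2 * (x + y - z - u - v - w)\<bar> \<le> 12 * B"
  using assms by (auto simp: abs_le_iff)

text \<open>Homogeneity: \<open>e\<close>, \<open>a\<close>, \<open>b\<close> have weight 2 in
  \<open>r + \<bar>t\<bar>\<close> and each time derivative lowers the weight by 1. The determinant
  is quadratic and has weight 4, so \<open>D1\<close> has weight 3 and \<open>D2\<close> has weight
  2.\<close>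

lemma D1_bound: assumes "\<bar>t\<bar> < \<epsilon>" shows "\<bar>D1 t\<bar> \<le> 6 * N\<^sup>2 * (r + \<bar>t\<bar>) ^ 3"
proof -
  let ?s = "r + \<bar>t\<bar>"
  note g = growth_all[OF assms]
  have s: "?s \<ge> 0" using r_nonneg by simp
  have p: "\<bar>x * y\<bar> \<le> N\<^sup>2 * ?s ^ 3" if "\<bar>x\<bar> \<le> N * ?s\<^sup>2" "\<bar>y\<bar> \<le> N * ?s" for x y
  proof -
    have "\<bar>x * y\<bar> \<le> (N * ?s\<^sup>2) * (N * ?s)"
      unfolding abs_mult using that s N_ge(1) by (intro mult_mono) auto
    then show ?thesis by (simp add: power2_eq_square power3_eq_cube algebra_simps)
  qed
  show ?thesis using abs_combine(1)[OF p[OF g(2) g(1)] p[OF g(4) g(3)] p[OF g(6) g(5)]]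
    unfolding D1_def by (simp only: mult.assoc)
qed

lemma D2_bound: assumes "\<bar>t\<bar> < \<epsilon>" shows "\<bar>D2 t\<bar> \<le> 12 * N\<^sup>2 * (r + \<bar>t\<bar>)\<^sup>2"
proof -
  let ?s = "r + \<bar>t\<bar>"
  note g = growth_all[OF assms]
  have s: "?s \<ge> 0" using r_nonneg by simp
  have q: "\<bar>y\<^sup>2\<bar> \<le> N\<^sup>2 * ?s\<^sup>2" if "\<bar>y\<bar> \<le> N * ?s" for y
    using power_mono[OF that, of 2] by (simp add: power_mult_distrib)
  have p: "\<bar>x * y\<bar> \<le> N\<^sup>2 * ?s\<^sup>2" if "\<bar>x\<bar> \<le> N * ?s\<^sup>2" "\<bar>y\<bar> \<le> M" for x y
  proof -
    have "\<bar>x * y\<bar> \<le> (N * ?s\<^sup>2) * N"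
      unfolding abs_mult using that s N_ge by (intro mult_mono) auto
    then show ?thesis by (simp add: power2_eq_square algebra_simps)
  qed
  show ?thesis
    using abs_combine(2)[OF q[OF g(1)] p[OF g(2) bd(1)[OF assms]] q[OF g(3)]
        p[OF g(4) bd(2)[OF assms]] q[OF g(5)] p[OF g(6) bd(3)[OF assms]]]
    unfolding D2_def by (simp only: mult.assoc)
qed

lemma theta_pos: "\<theta> > 0" using eps N_ge S_pos by (simp add: \<theta>_def)

lemma C0_pos: "C0 > 0" using theta_pos N_ge by (simp add: C0_def add_pos_nonneg)

lemma s_le_S: "\<bar>t\<bar> < \<epsilon> \<Longrightarrow> r + \<bar>t\<bar> \<le> S" using r_le by (simp add: S_def)

lemma sqrt_D_le: assumes "\<bar>t\<bar> < \<epsilon>" shows "sqrt (D t) \<le> N * (r + \<bar>t\<bar>)\<^sup>2"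
proof -
  have "D t \<le> (e t)\<^sup>2" by (simp add: D_def)
  then have "sqrt (D t) \<le> \<bar>e t\<bar>" by (metis real_sqrt_abs real_sqrt_le_iff)
  then show ?thesis using growth_all(2)[OF assms] by linarith
qed

text \<open>\<open>nonneg_derivative_bound\<close> for the nonnegative function \<open>D\<close>,
  with a step proportional to \<open>sqrt (D t) / (r + \<bar>t\<bar>)\<close> so that both terms on
  the right balance. The factor \<open>r + \<bar>t\<bar>\<close> is kept because it makes the
  derivative of \<open>sqrt (D t)\<close> small near degenerate points. At a zero of
  \<open>D\<close> the derivative vanishes, since \<open>D\<close> has a minimum there.\<close>

lemma D1_sqrt_bound:
  assumes t: "\<bar>t\<bar> < \<epsilon> / 2" shows "\<bar>D1 t\<bar> \<le> C0 * (r + \<bar>t\<bar>) * sqrt (D t)"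
proof (cases "D t = 0")
  case True
  have "D1 t = 0"
  proof (rule nonneg_derivative_zero[of D "D1 t" t "\<epsilon> / 2"])
    fix s assume "\<bar>s - t\<bar> < \<epsilon> / 2"
    then have "\<bar>s\<bar> < \<epsilon>" using t by linarith
    then show "0 \<le> D s" by (rule D_nonneg)
  qed (use t eps True in \<open>auto intro!: D_der\<close>)
  then show ?thesis using True by simp
next
  case False
  have t': "\<bar>t\<bar> < \<epsilon>" using t eps by simp
  define s \<delta> h where "s = r + \<bar>t\<bar>" and "\<delta> = sqrt (D t)" and "h = \<theta> * \<delta> / s"
  have \<delta>: "\<delta> > 0" using False D_nonneg[OF t'] by (simp add: \<delta>_def)
  have \<delta>s: "\<delta> \<le> N * s\<^sup>2" using sqrt_D_le[OF t'] by (simp add: \<delta>_def s_def)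
  have s: "s > 0"
  proof (rule ccontr)
    assume "\<not> s > 0"
    then have "s = 0" using r_nonneg by (simp add: s_def)
    then show False using \<delta> \<delta>s by simp
  qed
  have hp: "h > 0" using theta_pos \<delta> s by (simp add: h_def)
  have "\<theta> * \<delta> \<le> \<theta> * (N * s\<^sup>2)" using \<delta>s theta_pos by simp
  then have hle: "h \<le> \<theta> * N * s" using s by (simp add: h_def field_simps power2_eq_square)
  have tN: "\<theta> * N = \<epsilon> / (4 * (S + 1))" using N_ge by (simp add: \<theta>_def)
  have "\<epsilon> \<le> S" using M by (simp add: S_def)
  then have "\<theta> * N \<le> 1" unfolding tN using S_pos by (simp add: divide_simps)
  then have hs: "h \<le> s" using hle s mult_right_mono[of "\<theta> * N" 1 s] by linarith
  have "\<theta> * N * s \<le> \<theta> * N * S"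
    using s_le_S[OF t'] theta_pos N_ge by (intro mult_left_mono) (auto simp: s_def)
  also have "\<dots> < \<epsilon> / 2" unfolding tN using S_pos eps by (simp add: divide_simps)
  finally have he: "h < \<epsilon> / 2" using hle by linarith
  \<comment> \<open>Since \<open>h \<le> s\<close>, the scale at most doubles on the window around
    \<open>t\<close>. This turns the constant 12 of \<open>D2_bound\<close> into 48.\<close>
  have near: "\<bar>u\<bar> < \<epsilon>" "r + \<bar>u\<bar> \<le> 2 * s" if "\<bar>u - t\<bar> \<le> h" for u
    using that he t hs by (auto simp: s_def)
  have "\<bar>D1 t\<bar> * h \<le> D t + (48 * N\<^sup>2 * s\<^sup>2) * h\<^sup>2"
  proof (rule nonneg_derivative_bound[of t h D D1 D2])
    fix u assume u: "\<bar>u - t\<bar> \<le> h"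
    show "(D has_real_derivative D1 u) (at u)" "(D1 has_real_derivative D2 u) (at u)" "0 \<le> D u"
      using near[OF u] D_der D1_der D_nonneg by auto
    have "(r + \<bar>u\<bar>)\<^sup>2 \<le> (2 * s)\<^sup>2" using near(2)[OF u] r_nonneg by (intro power_mono) auto
    then have "12 * N\<^sup>2 * (r + \<bar>u\<bar>)\<^sup>2 \<le> 12 * N\<^sup>2 * (2 * s)\<^sup>2" by (intro mult_left_mono) auto
    moreover have "12 * N\<^sup>2 * (2 * s)\<^sup>2 = 48 * N\<^sup>2 * s\<^sup>2" by (simp add: power_mult_distrib)
    ultimately show "\<bar>D2 u\<bar> \<le> 48 * N\<^sup>2 * s\<^sup>2"
      using D2_bound[OF near(1)[OF u]] by linarith
  qed (use hp in auto)
  also have "D t = \<delta>\<^sup>2" using D_nonneg[OF t'] by (simp add: \<delta>_def)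
  also have "\<delta>\<^sup>2 + (48 * N\<^sup>2 * s\<^sup>2) * h\<^sup>2 = (C0 * s * \<delta>) * h"
    using s theta_pos by (simp add: h_def C0_def field_simps power2_eq_square)
  finally show ?thesis using hp by (simp add: s_def \<delta>_def)
qed

text \<open>The quotient is the derivative of \<open>sqrt (D t)\<close> where
  \<open>D t > 0\<close>. At zeros of \<open>D\<close> it is 0 by the convention for division by
  zero, so the bound holds at every time.\<close>

lemma psi_bound: assumes t: "\<bar>t\<bar> < \<epsilon> / 2" shows "\<bar>D1 t / (2 * sqrt (D t))\<bar> \<le> C0 * (r + \<bar>t\<bar>)"
proof (cases "D t = 0")
  case True
  then show ?thesis using C0_pos r_nonneg by simp
next
  case False
  then have "sqrt (D t) > 0" using D_nonneg[of t] t eps by simp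
  moreover have "0 \<le> C0 * (r + \<bar>t\<bar>)" using C0_pos r_nonneg by simp
  moreover have "C0 * (r + \<bar>t\<bar>) * sqrt (D t) \<le> C0 * (r + \<bar>t\<bar>) * (2 * sqrt (D t))"
    using calculation by (intro mult_left_mono) auto
  ultimately show ?thesis using D1_sqrt_bound[OF t] by (simp add: abs_divide pos_divide_le_eq)
qed

lemma psi_bound': assumes t: "\<bar>t\<bar> < \<epsilon> / 2" shows "\<bar>D1 t / (2 * sqrt (D t))\<bar> \<le> C0 * S"
  using psi_bound[OF t] mult_left_mono[OF s_le_S[of t], of C0] C0_pos t eps by linarith

text \<open>The square root may fail to be differentiable at zeros of \<open>D\<close>. The mean
  value estimate is therefore applied to \<open>sqrt (D x + k)\<close> with \<open>k > 0\<close>,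
  whose slope obeys the same bound, and \<open>k\<close> tends to 0.\<close>

lemma sqrt_D_lipschitz:
  assumes t: "\<bar>t\<bar> < \<epsilon> / 2" and u: "\<bar>u\<bar> < \<epsilon> / 2"
  shows "\<bar>sqrt (D u) - sqrt (D t)\<bar> \<le> C0 * S * \<bar>u - t\<bar>"
proof -
  have *: "\<bar>sqrt (D u + k) - sqrt (D t + k)\<bar> \<le> C0 * S * \<bar>u - t\<bar>" if k: "k > 0" for k
  proof (rule mvt_bound[where f' = "\<lambda>x. D1 x / (2 * sqrt (D x + k))"])
    fix x assume "x \<in> closed_segment t u"
    then have x: "\<bar>x\<bar> < \<epsilon> / 2" using t u by (auto simp: closed_segment_eq_real_ivl split: if_splits)
    then have x': "\<bar>x\<bar> < \<epsilon>" using eps by simp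
    have Dk: "D x + k > 0" using D_nonneg[OF x'] k by simp
    show "((\<lambda>x. sqrt (D x + k)) has_real_derivative D1 x / (2 * sqrt (D x + k))) (at x)"
      using Dk by (auto intro!: derivative_eq_intros D_der[OF x'] simp: field_simps)
    have "\<bar>D1 x / (2 * sqrt (D x + k))\<bar> = \<bar>D1 x\<bar> / (2 * sqrt (D x + k))" using Dk by (simp add: abs_divide)
    also have "\<dots> \<le> C0 * S"
    proof -
      have "\<bar>D1 x\<bar> \<le> C0 * (r + \<bar>x\<bar>) * sqrt (D x)" by (rule D1_sqrt_bound[OF x])
      also have "\<dots> \<le> C0 * S * sqrt (D x)"
        using s_le_S[OF x'] C0_pos D_nonneg[OF x'] by (intro mult_right_mono mult_left_mono) auto
      also have "\<dots> \<le> C0 * S * (2 * sqrt (D x + k))"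
      proof -
        have "sqrt (D x) \<le> sqrt (D x + k)" using k by simp
        moreover have "0 \<le> sqrt (D x + k)" using Dk by simp
        ultimately have "sqrt (D x) \<le> 2 * sqrt (D x + k)" by linarith
        then show ?thesis using C0_pos S_pos by (intro mult_left_mono) auto
      qed
      finally show ?thesis using Dk by (simp add: pos_divide_le_eq)
    qed
    finally show "\<bar>D1 x / (2 * sqrt (D x + k))\<bar> \<le> C0 * S" .
  qed
  have "((\<lambda>k. \<bar>sqrt (D u + k) - sqrt (D t + k)\<bar>) \<longlongrightarrow> \<bar>sqrt (D u + 0) - sqrt (D t + 0)\<bar>) (at_right 0)"
    by (intro tendsto_intros)
  then show ?thesis
    using * by (intro tendsto_upperbound[of "\<lambda>k. \<bar>sqrt (D u + k) - sqrt (D t + k)\<bar>" _ "at_right 0"])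
      (auto simp: eventually_at_right_less intro!: eventually_mono[OF eventually_at_right_less[of 0]])
qed

lemma psi_der:
  assumes t: "\<bar>t\<bar> < \<epsilon>" and D: "D t > 0"
  shows "((\<lambda>t. D1 t / (2 * sqrt (D t))) has_real_derivative
           D2 t / (2 * sqrt (D t)) - (D1 t)\<^sup>2 / (4 * D t * sqrt (D t))) (at t)"
proof -
  have "((\<lambda>t. D1 t / (2 * sqrt (D t))) has_real_derivative
         (D2 t * (2 * sqrt (D t)) - D1 t * (D1 t / sqrt (D t))) / ((2 * sqrt (D t)) * (2 * sqrt (D t)))) (at t)"
    using D by (auto intro!: derivative_eq_intros D_der[OF t] D1_der[OF t] simp: field_simps)
  also have "(D2 t * (2 * sqrt (D t)) - D1 t * (D1 t / sqrt (D t))) / ((2 * sqrt (D t)) * (2 * sqrt (D t)))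
      = D2 t / (2 * sqrt (D t)) - (D1 t)\<^sup>2 / (4 * D t * sqrt (D t))"
    using D by (simp add: field_simps power2_eq_square)
  finally show ?thesis .
qed

lemma D_0: "D 0 = r ^ 4" "D1 0 = 2 * r\<^sup>2 * e1 0" "sqrt (D 0) = r\<^sup>2"
proof -
  show "D 0 = r ^ 4" using r_sq a0 b0 by (simp add: D_def power2_eq_square power4_eq_xxxx)
  then have "D 0 = (r\<^sup>2)\<^sup>2" by simp
  then show "sqrt (D 0) = r\<^sup>2" by (metis abs_power2 real_sqrt_abs)
  show "D1 0 = 2 * r\<^sup>2 * e1 0" using r_sq a0 b0 by (simp add: D1_def)
qed

text \<open>For \<open>\<bar>t\<bar> \<le> c * r\<close> the determinant moves by at most
  \<open>48 * N\<^sup>2 * r ^ 3 * (c * r)\<close>, which is half of its initial value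
  \<open>r ^ 4\<close>; this fixes \<open>c\<close>. The summands of \<open>C\<close> are the
  constants of the two regimes of \<open>psi_deviation\<close> and the Lipschitz constant.\<close>

definition c where "c = 1 / (96 * N\<^sup>2)"
definition C where "C = 48 * N\<^sup>2 + (48 * N\<^sup>2)\<^sup>2 + C0 * (1 / c + 1) + K / c + C0 * S"

lemma c_pos: "c > 0" "c \<le> 1"
proof -
  have "1 \<le> N\<^sup>2" using N_ge(1) by simp
  then show "c > 0" "c \<le> 1" by (auto simp: c_def divide_simps)
qed

lemma C_ge: "48 * N\<^sup>2 + (48 * N\<^sup>2)\<^sup>2 \<le> C" "C0 * (1 / c + 1) + K / c \<le> C" "C0 * S \<le> C"
proof -
  have "0 \<le> 48 * N\<^sup>2" "0 \<le> (48 * N\<^sup>2)\<^sup>2" "0 \<le> C0 * (1 / c + 1)" "0 \<le> K / c" "0 \<le> C0 * S"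
    using c_pos C0_pos K_pos S_pos by auto
  then show "48 * N\<^sup>2 + (48 * N\<^sup>2)\<^sup>2 \<le> C" "C0 * (1 / c + 1) + K / c \<le> C" "C0 * S \<le> C"
    unfolding C_def by linarith+
qed

text \<open>The increment bound at time 0, uniform up to degenerate points: \<open>e1 0\<close> is
  the slope of \<open>sqrt (D t)\<close> at 0 when \<open>r > 0\<close>. If
  \<open>\<bar>t\<bar> \<le> c * r\<close>, the determinant stays above \<open>r ^ 4 / 2\<close> and
  the slope has a derivative of weight 0, hence bounded. Otherwise \<open>r\<close> is at most
  \<open>\<bar>t\<bar> / c\<close>, and the slope and \<open>e1 0\<close> are separately of order
  \<open>\<bar>t\<bar>\<close>.\<close>

lemma psi_deviation:
  assumes t: "\<bar>t\<bar> < \<epsilon> / 2"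
  shows "\<bar>D1 t / (2 * sqrt (D t)) - e1 0\<bar> \<le> C * \<bar>t\<bar>"
proof (cases "\<bar>t\<bar> \<le> c * r \<and> r > 0")
  case True
  have near: "D x \<ge> r ^ 4 / 2 \<and> \<bar>D1 x\<bar> \<le> 48 * N\<^sup>2 * r ^ 3 \<and> \<bar>D2 x\<bar> \<le> 48 * N\<^sup>2 * r\<^sup>2"
    if x: "\<bar>x\<bar> \<le> \<bar>t\<bar>" for x
  proof -
    have s: "r + \<bar>y\<bar> \<le> 2 * r" if "\<bar>y\<bar> \<le> \<bar>t\<bar>" for y
      using that True c_pos mult_right_mono[OF c_pos(2), of r] by linarith
    have B1: "\<bar>D1 y\<bar> \<le> 48 * N\<^sup>2 * r ^ 3" if "\<bar>y\<bar> \<le> \<bar>t\<bar>" for y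
    proof -
      have "\<bar>D1 y\<bar> \<le> 6 * N\<^sup>2 * (r + \<bar>y\<bar>) ^ 3" using that t eps by (intro D1_bound) simp
      also have "\<dots> \<le> 6 * N\<^sup>2 * (2 * r) ^ 3" using s[OF that] r_nonneg by (intro mult_left_mono power_mono) auto
      finally show ?thesis by (simp add: power_mult_distrib)
    qed
    have "\<bar>D2 x\<bar> \<le> 12 * N\<^sup>2 * (r + \<bar>x\<bar>)\<^sup>2" using x t eps by (intro D2_bound) simp
    also have "\<dots> \<le> 12 * N\<^sup>2 * (2 * r)\<^sup>2" using s[OF x] r_nonneg by (intro mult_left_mono power_mono) auto
    finally have B2: "\<bar>D2 x\<bar> \<le> 48 * N\<^sup>2 * r\<^sup>2" by (simp add: power_mult_distrib)
    have "\<bar>D x - D 0\<bar> \<le> (48 * N\<^sup>2 * r ^ 3) * \<bar>x - 0\<bar>"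
    proof (rule mvt_bound[of _ _ _ D1])
      fix y assume "y \<in> closed_segment 0 x"
      then have y: "\<bar>y\<bar> \<le> \<bar>t\<bar>" using x by (auto simp: closed_segment_eq_real_ivl split: if_splits)
      then show "(D has_real_derivative D1 y) (at y)" "\<bar>D1 y\<bar> \<le> 48 * N\<^sup>2 * r ^ 3"
        using B1 t eps by (auto intro!: D_der)
    qed
    also have "\<dots> \<le> (48 * N\<^sup>2 * r ^ 3) * (c * r)" using x True by (intro mult_left_mono) auto
    also have "\<dots> = r ^ 4 / 2" using N_ge by (simp add: c_def field_simps power4_eq_xxxx power3_eq_cube)
    finally show ?thesis using B1[OF x] B2 unfolding D_0 by linarith
  qed
  have "\<bar>D1 t / (2 * sqrt (D t)) - D1 0 / (2 * sqrt (D 0))\<bar> \<le> (48 * N\<^sup>2 + (48 * N\<^sup>2)\<^sup>2) * \<bar>t - 0\<bar>"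
  proof (rule mvt_bound)
    fix x assume "x \<in> closed_segment 0 t"
    then have x: "\<bar>x\<bar> \<le> \<bar>t\<bar>" by (auto simp: closed_segment_eq_real_ivl split: if_splits)
    note n = near[OF x]
    have r4: "r ^ 4 > 0" using True by simp
    have Dx: "D x > 0" using n r4 by linarith
    show "((\<lambda>t. D1 t / (2 * sqrt (D t))) has_real_derivative
           D2 x / (2 * sqrt (D x)) - (D1 x)\<^sup>2 / (4 * D x * sqrt (D x))) (at x)"
      using psi_der[OF _ Dx] x t eps by simp
    have "sqrt (r ^ 4 / 4) \<le> sqrt (D x)" using n r4 by (intro real_sqrt_le_mono) linarith
    moreover have "sqrt (r ^ 4 / 4) = r\<^sup>2 / 2"
      by (rule real_sqrt_unique) (auto simp: power_divide)
    ultimately have sq: "r\<^sup>2 \<le> 2 * sqrt (D x)" by simp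
    have r2: "r\<^sup>2 > 0" using True by simp
    have "\<bar>D2 x / (2 * sqrt (D x))\<bar> = \<bar>D2 x\<bar> / (2 * sqrt (D x))" using Dx by (simp add: abs_divide)
    also have "\<dots> \<le> (48 * N\<^sup>2 * r\<^sup>2) / r\<^sup>2" using n sq r2 by (intro frac_le) auto
    finally have 1: "\<bar>D2 x / (2 * sqrt (D x))\<bar> \<le> 48 * N\<^sup>2" using True by simp
    have "\<bar>(D1 x)\<^sup>2 / (4 * D x * sqrt (D x))\<bar> = (D1 x)\<^sup>2 / ((2 * D x) * (2 * sqrt (D x)))"
      using Dx by (simp add: abs_divide)
    also have "\<dots> \<le> (48 * N\<^sup>2 * r ^ 3)\<^sup>2 / (r ^ 4 * r\<^sup>2)"
    proof (rule frac_le)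
      show "(D1 x)\<^sup>2 \<le> (48 * N\<^sup>2 * r ^ 3)\<^sup>2"
        using power_mono[of "\<bar>D1 x\<bar>" "48 * N\<^sup>2 * r ^ 3" 2] n by simp
      show "r ^ 4 * r\<^sup>2 \<le> 2 * D x * (2 * sqrt (D x))" using n sq Dx by (intro mult_mono) auto
    qed (use r4 r2 in auto)
    also have "\<dots> = (48 * N\<^sup>2)\<^sup>2"
    proof -
      have "(r ^ 3)\<^sup>2 = r ^ 4 * r\<^sup>2" by (simp flip: power_mult power_add)
      then show ?thesis using r4 r2 by (simp add: power_mult_distrib)
    qed
    finally have 2: "\<bar>(D1 x)\<^sup>2 / (4 * D x * sqrt (D x))\<bar> \<le> (48 * N\<^sup>2)\<^sup>2" .
    show "\<bar>D2 x / (2 * sqrt (D x)) - (D1 x)\<^sup>2 / (4 * D x * sqrt (D x))\<bar> \<le> 48 * N\<^sup>2 + (48 * N\<^sup>2)\<^sup>2"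
      using 1 2 by linarith
  qed
  moreover have "D1 0 / (2 * sqrt (D 0)) = e1 0" using True by (simp add: D_0(2,3))
  ultimately show ?thesis
    using mult_right_mono[OF C_ge(1), of "\<bar>t\<bar>"] by simp
next
  case False
  then have rt: "r \<le> \<bar>t\<bar> / c" using c_pos r_nonneg by (auto simp: field_simps)
  have "\<bar>D1 t / (2 * sqrt (D t)) - e1 0\<bar> \<le> C0 * (r + \<bar>t\<bar>) + K * r"
    using psi_bound[OF t] e1_0 by linarith
  also have "\<dots> \<le> C0 * (\<bar>t\<bar> / c + \<bar>t\<bar>) + K * (\<bar>t\<bar> / c)"
    using rt C0_pos K_pos by (intro add_mono mult_left_mono) auto
  also have "\<dots> = (C0 * (1 / c + 1) + K / c) * \<bar>t\<bar>" using c_pos by (simp add: field_simps)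
  also have "\<dots> \<le> C * \<bar>t\<bar>" using C_ge(2) by (intro mult_right_mono) auto
  finally show ?thesis .
qed

text \<open>At \<open>t = 0\<close> the square root of the determinant is \<open>e 0\<close> and its
  second derivative differs from \<open>e2 0\<close> by the trace-free velocities alone: the squares
  of \<open>e1 0\<close> from \<open>D2\<close> and from \<open>D1\<close> cancel.\<close>

lemma psi_limit:
  assumes "e 0 > 0"
  shows "((\<lambda>t. e1 t - D1 t / (2 * sqrt (D t))) has_real_derivative ((a1 0)\<^sup>2 + (b1 0)\<^sup>2) / e 0) (at 0)"
proof -
  have D0: "D 0 = (e 0)\<^sup>2" "sqrt (D 0) = e 0" using a0 b0 assms by (auto simp: D_def)
  have "((\<lambda>t. e1 t - D1 t / (2 * sqrt (D t))) has_real_derivative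
      e2 0 - (D2 0 / (2 * sqrt (D 0)) - (D1 0)\<^sup>2 / (4 * D 0 * sqrt (D 0)))) (at 0)"
    using eps D0 assms by (intro DERIV_diff der psi_der) auto
  also have "e2 0 - (D2 0 / (2 * sqrt (D 0)) - (D1 0)\<^sup>2 / (4 * D 0 * sqrt (D 0))) = ((a1 0)\<^sup>2 + (b1 0)\<^sup>2) / e 0"
    unfolding D0 D1_def D2_def using a0 b0 assms by (simp add: field_simps power2_eq_square)
  finally show ?thesis .
qed

end

section \<open>Differentiation under the integral\<close>

text \<open>Dominated convergence for the difference quotients along an arbitrary sequence tending
  to \<open>t\<close>. Differentiability of the integrand is asked for almost everywhere and at the
  single time \<open>t\<close>, which accommodates the zeros of the determinant; the dominating
  function is the constant \<open>K\<close>.\<close>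

lemma has_real_derivative_integral_dominated:
  fixes f :: "real \<Rightarrow> 'a \<Rightarrow> real"
  assumes r: "r > 0"
    and int: "\<And>s. \<bar>s - t\<bar> < r \<Longrightarrow> integrable M (f s)"
    and lim: "AE x in M. ((\<lambda>s. (f s x - f t x) / (s - t)) \<longlongrightarrow> g x) (at t)"
    and bound: "\<And>s. \<bar>s - t\<bar> < r \<Longrightarrow> AE x in M. \<bar>f s x - f t x\<bar> \<le> K * \<bar>s - t\<bar>"
    and K: "integrable M (\<lambda>x. K)"
    and g: "g \<in> borel_measurable M"
  shows "((\<lambda>s. \<integral>x. f s x \<partial>M) has_real_derivative (\<integral>x. g x \<partial>M)) (at t)" and "integrable M g"
proof -
  have main: "integrable M g \<and>
      (\<lambda>i. ((\<integral>x. f (X i) x \<partial>M) - (\<integral>x. f t x \<partial>M)) / (X i - t)) \<longlonglongrightarrow> (\<integral>x. g x \<partial>M)"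
    if X: "\<And>i. X i \<noteq> t" "X \<longlonglongrightarrow> t" for X
  proof -
    \<comment> \<open>The bounds hold only within distance \<open>r\<close> of \<open>t\<close>, so
      an initial segment of the sequence is dropped.\<close>
    obtain n where n: "\<And>i. \<bar>X (i + n) - t\<bar> < r"
      using LIMSEQ_D[OF X(2) r] by (metis le_add2 real_norm_def)
    let ?q = "\<lambda>i x. (f (X (i + n)) x - f t x) / (X (i + n) - t)"
    have I: "integrable M (f (X (i + n)))" "integrable M (f t)" for i using int n r by auto
    have Xn: "(\<lambda>i. X (i + n)) \<longlonglongrightarrow> t" using X(2) by (rule LIMSEQ_ignore_initial_segment)
    have "AE x in M. (\<lambda>i. ?q i x) \<longlonglongrightarrow> g x"
      using lim
    proof eventually_elim
      case (elim x)
      have "filterlim (\<lambda>i. X (i + n)) (at t) sequentially"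
        using Xn X(1) by (simp add: filterlim_at)
      then show ?case by (rule filterlim_compose[OF elim])
    qed
    moreover have "AE x in M. norm (?q i x) \<le> K" for i
      using bound[OF n[of i]]
    proof eventually_elim
      case (elim x)
      then show ?case using X(1)[of "i + n"] by (simp add: abs_divide field_simps)
    qed
    moreover have "?q i \<in> borel_measurable M" for i using I by measurable
    ultimately have "integrable M g" "(\<lambda>i. \<integral>x. ?q i x \<partial>M) \<longlonglongrightarrow> (\<integral>x. g x \<partial>M)"
      using integrable_dominated_convergence[of g M ?q "\<lambda>_. K"]
        integral_dominated_convergence[of g M ?q "\<lambda>_. K"] g K by auto
    moreover have "(\<integral>x. ?q i x \<partial>M) = ((\<integral>x. f (X (i + n)) x \<partial>M) - (\<integral>x. f t x \<partial>M)) / (X (i + n) - t)" for i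
      using I by simp
    ultimately have "integrable M g"
      "(\<lambda>i. ((\<integral>x. f (X (i + n)) x \<partial>M) - (\<integral>x. f t x \<partial>M)) / (X (i + n) - t)) \<longlonglongrightarrow> (\<integral>x. g x \<partial>M)"
      by (simp_all only:)
    then show ?thesis by (auto intro: LIMSEQ_offset[of _ n])
  qed
  show "((\<lambda>s. \<integral>x. f s x \<partial>M) has_real_derivative (\<integral>x. g x \<partial>M)) (at t)"
    unfolding has_field_derivative_iff tendsto_at_iff_sequentially
    using main by (auto simp: o_def)
  \<comment> \<open>One concrete sequence avoiding \<open>t\<close> suffices to extract the
    integrability of the limit.\<close>
  have "(\<lambda>i. t + 1 / real (Suc i)) \<longlonglongrightarrow> t"
    using tendsto_add[OF tendsto_const LIMSEQ_inverse_real_of_nat, of t] by (simp add: inverse_eq_divide)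
  then show "integrable M g" using main[of "\<lambda>i. t + 1 / real (Suc i)"] by simp
qed

text \<open>Two differentiations under the integral. At every \<open>t\<close> with
  \<open>\<bar>t\<bar> < \<epsilon> / 2\<close> the quotients are dominated by the Lipschitz bounds,
  and \<open>nz\<close> gives the pointwise limit. At 0 the quotients of the first derivative are
  dominated by means of \<open>psi_deviation\<close>, and \<open>psi_limit\<close> gives the
  pointwise limit.\<close>

lemma second_derivative_integral:
  fixes e e1 e2 a a1 a2 b b1 b2 :: "real \<Rightarrow> 'a \<Rightarrow> real"
  assumes fin: "finite_measure M"
    and path: "\<And>x. x \<in> space M \<Longrightarrow> semidefinite_path \<epsilon> B (\<lambda>t. e t x) (\<lambda>t. e1 t x) (\<lambda>t. e2 t x)
        (\<lambda>t. a t x) (\<lambda>t. a1 t x) (\<lambda>t. a2 t x) (\<lambda>t. b t x) (\<lambda>t. b1 t x) (\<lambda>t. b2 t x)"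
    and eps: "\<epsilon> > 0"
    and meas: "\<And>t. \<bar>t\<bar> < \<epsilon> \<Longrightarrow> e t \<in> borel_measurable M" "\<And>t. \<bar>t\<bar> < \<epsilon> \<Longrightarrow> e1 t \<in> borel_measurable M"
      "\<And>t. \<bar>t\<bar> < \<epsilon> \<Longrightarrow> a t \<in> borel_measurable M" "\<And>t. \<bar>t\<bar> < \<epsilon> \<Longrightarrow> a1 t \<in> borel_measurable M"
      "\<And>t. \<bar>t\<bar> < \<epsilon> \<Longrightarrow> b t \<in> borel_measurable M" "\<And>t. \<bar>t\<bar> < \<epsilon> \<Longrightarrow> b1 t \<in> borel_measurable M"
    and nz: "\<And>t. \<bar>t\<bar> < \<epsilon> \<Longrightarrow> AE x in M. (e t x)\<^sup>2 - (a t x)\<^sup>2 - (b t x)\<^sup>2 \<noteq> 0"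
  shows "\<And>t. \<bar>t\<bar> < \<epsilon> \<Longrightarrow> integrable M (e t)"
    "\<And>t. \<bar>t\<bar> < \<epsilon> \<Longrightarrow> integrable M (\<lambda>x. sqrt ((e t x)\<^sup>2 - (a t x)\<^sup>2 - (b t x)\<^sup>2))"
    "integrable M (\<lambda>x. ((a1 0 x)\<^sup>2 + (b1 0 x)\<^sup>2) / e 0 x)"
    "\<exists>F'. (\<forall>t. \<bar>t\<bar> < \<epsilon> / 2 \<longrightarrow>
        ((\<lambda>t. \<integral>x. e t x - sqrt ((e t x)\<^sup>2 - (a t x)\<^sup>2 - (b t x)\<^sup>2) \<partial>M) has_real_derivative F' t) (at t)) \<and>
      (F' has_real_derivative (\<integral>x. ((a1 0 x)\<^sup>2 + (b1 0 x)\<^sup>2) / e 0 x \<partial>M)) (at 0)"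
proof -
  interpret finite_measure M by fact
  define dd where "dd t x = (e t x)\<^sup>2 - (a t x)\<^sup>2 - (b t x)\<^sup>2" for t x
  define dd1 where "dd1 t x = 2 * (e t x * e1 t x - a t x * a1 t x - b t x * b1 t x)" for t x
  define psi where "psi t x = dd1 t x / (2 * sqrt (dd t x))" for t x
  define Cst where "Cst = semidefinite_path.C \<epsilon> B"
  have mD: "dd t \<in> borel_measurable M" "psi t \<in> borel_measurable M" if "\<bar>t\<bar> < \<epsilon>" for t
  proof -
    note [measurable] = meas[OF that]
    have "dd t = (\<lambda>x. (e t x)\<^sup>2 - (a t x)\<^sup>2 - (b t x)\<^sup>2)" by (simp add: dd_def fun_eq_iff)
    moreover have "dd1 t = (\<lambda>x. 2 * (e t x * e1 t x - a t x * a1 t x - b t x * b1 t x))"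
      by (simp add: dd1_def fun_eq_iff)
    ultimately have [measurable]: "dd t \<in> borel_measurable M" "dd1 t \<in> borel_measurable M" by simp_all
    show "dd t \<in> borel_measurable M" by measurable
    have "psi t = (\<lambda>x. dd1 t x / (2 * sqrt (dd t x)))" by (simp add: psi_def fun_eq_iff)
    then show "psi t \<in> borel_measurable M" by simp
  qed
  \<comment> \<open>Since \<open>r + \<bar>t\<bar> \<le> S\<close> and the constants depend on
    \<open>\<epsilon>\<close> and \<open>B\<close> alone, the pointwise growth bounds become uniform
    in \<open>x\<close>.\<close>
  define L where "L = semidefinite_path.N \<epsilon> B * (semidefinite_path.S \<epsilon> B)\<^sup>2"
  define L1 where "L1 = semidefinite_path.N \<epsilon> B * semidefinite_path.S \<epsilon> B"
  have facts: "\<bar>e t x\<bar> \<le> L \<and> \<bar>e1 t x\<bar> \<le> L1 \<and> sqrt (dd t x) \<le> L \<and> 0 \<le> dd t x \<and>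
      (dd t x \<noteq> 0 \<longrightarrow> ((\<lambda>t. sqrt (dd t x)) has_real_derivative psi t x) (at t)) \<and>
      ((\<lambda>t. e t x) has_real_derivative e1 t x) (at t)" if "x \<in> space M" "\<bar>t\<bar> < \<epsilon>" for x t
  proof -
    interpret semidefinite_path \<epsilon> B "\<lambda>t. e t x" "\<lambda>t. e1 t x" "\<lambda>t. e2 t x"
      "\<lambda>t. a t x" "\<lambda>t. a1 t x" "\<lambda>t. a2 t x" "\<lambda>t. b t x" "\<lambda>t. b1 t x" "\<lambda>t. b2 t x"
      using path that by blast
    have DD: "semidefinite_path.D (\<lambda>t. e t x) (\<lambda>t. a t x) (\<lambda>t. b t x) t = dd t x" for t
      by (simp add: D_def dd_def)
    have DD1: "semidefinite_path.D1 (\<lambda>t. e t x) (\<lambda>t. e1 t x) (\<lambda>t. a t x) (\<lambda>t. a1 t x) (\<lambda>t. b t x) (\<lambda>t. b1 t x) t = dd1 t x" for t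
      by (simp add: D1_def dd1_def)
    let ?s = "r + \<bar>t\<bar>"
    have s: "0 \<le> ?s" "?s \<le> S" using r_nonneg s_le_S[OF that(2)] by auto
    have 1: "N * ?s\<^sup>2 \<le> L" unfolding L_def using s N_ge(1) by (intro mult_left_mono power_mono) auto
    have 2: "N * ?s \<le> L1" unfolding L1_def using s N_ge(1) by (intro mult_left_mono) auto
    have nn: "0 \<le> dd t x" using D_nonneg[OF that(2)] DD by simp
    have "((\<lambda>t. sqrt (dd t x)) has_real_derivative psi t x) (at t)" if "dd t x \<noteq> 0"
    proof -
      have "((\<lambda>t. dd t x) has_real_derivative dd1 t x) (at t)"
        using D_der[OF \<open>\<bar>t\<bar> < \<epsilon>\<close>] DD1 by (simp add: DD[abs_def] ext[of D "\<lambda>t. dd t x", OF DD])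
      then show ?thesis unfolding psi_def
        using nn that by (auto intro!: derivative_eq_intros simp: field_simps)
    qed
    then show ?thesis
      using 1 2 nn growth_all(1,2)[OF that(2)] sqrt_D_le[OF that(2)] der(1)[OF that(2)] DD by auto
  qed
  have facts2: "\<bar>sqrt (dd s x) - sqrt (dd t x)\<bar> \<le> Cst * \<bar>s - t\<bar> \<and> \<bar>psi t x\<bar> \<le> Cst \<and> \<bar>psi t x - e1 0 x\<bar> \<le> Cst * \<bar>t\<bar>
    \<and> \<bar>e s x - e t x\<bar> \<le> L1 * \<bar>s - t\<bar> \<and> \<bar>e1 t x - e1 0 x\<bar> \<le> B * \<bar>t\<bar>"
    if x: "x \<in> space M" and t: "\<bar>t\<bar> < \<epsilon> / 2" and s: "\<bar>s\<bar> < \<epsilon> / 2" for x t s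
  proof -
    interpret semidefinite_path \<epsilon> B "\<lambda>t. e t x" "\<lambda>t. e1 t x" "\<lambda>t. e2 t x"
      "\<lambda>t. a t x" "\<lambda>t. a1 t x" "\<lambda>t. a2 t x" "\<lambda>t. b t x" "\<lambda>t. b1 t x" "\<lambda>t. b2 t x"
      using path x by blast
    have DD: "semidefinite_path.D (\<lambda>t. e t x) (\<lambda>t. a t x) (\<lambda>t. b t x) t = dd t x" for t
      by (simp add: D_def dd_def)
    have DD1: "semidefinite_path.D1 (\<lambda>t. e t x) (\<lambda>t. e1 t x) (\<lambda>t. a t x) (\<lambda>t. a1 t x) (\<lambda>t. b t x) (\<lambda>t. b1 t x) t = dd1 t x" for t
      by (simp add: D1_def dd1_def)
    have CC: "semidefinite_path.C \<epsilon> B = Cst" by (simp add: Cst_def)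
    have "\<bar>sqrt (dd s x) - sqrt (dd t x)\<bar> \<le> C0 * S * \<bar>s - t\<bar>"
      using sqrt_D_lipschitz[OF t s] DD by simp
    also have "\<dots> \<le> Cst * \<bar>s - t\<bar>" using C_ge(3) CC by (intro mult_right_mono) auto
    finally have 1: "\<bar>sqrt (dd s x) - sqrt (dd t x)\<bar> \<le> Cst * \<bar>s - t\<bar>" .
    have 2: "\<bar>psi t x\<bar> \<le> Cst" using psi_bound'[OF t] DD DD1 C_ge(3) CC unfolding psi_def by simp
    have 3: "\<bar>psi t x - e1 0 x\<bar> \<le> Cst * \<bar>t\<bar>" using psi_deviation[OF t] DD DD1 CC unfolding psi_def by simp
    have 4: "\<bar>e s x - e t x\<bar> \<le> L1 * \<bar>s - t\<bar>"
    proof (rule mvt_bound[of _ _ "\<lambda>t. e t x" "\<lambda>t. e1 t x"])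
      fix y assume "y \<in> closed_segment t s"
      then have "\<bar>y\<bar> < \<epsilon>" using t s by (auto simp: closed_segment_eq_real_ivl split: if_splits)
      then show "((\<lambda>t. e t x) has_real_derivative e1 y x) (at y)" "\<bar>e1 y x\<bar> \<le> L1" using facts x by auto
    qed
    have "\<bar>e1 t x - e1 0 x\<bar> \<le> B * \<bar>t - 0\<bar>"
    proof (rule mvt_bound[of _ _ "\<lambda>t. e1 t x" "\<lambda>t. e2 t x"])
      fix y assume "y \<in> closed_segment 0 t"
      then have "\<bar>y\<bar> < \<epsilon>" using t by (auto simp: closed_segment_eq_real_ivl split: if_splits)
      then show "((\<lambda>t. e1 t x) has_real_derivative e2 y x) (at y)" "\<bar>e2 y x\<bar> \<le> B" using der(2) bd(1) by auto
    qed
    then show ?thesis using 1 2 3 4 by simp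
  qed
  show ie: "integrable M (e t)" if "\<bar>t\<bar> < \<epsilon>" for t
    by (rule integrable_const_bound[of _ L]) (use facts that meas in \<open>auto intro!: AE_I2\<close>)
  have iD: "integrable M (\<lambda>x. sqrt (dd t x))" if "\<bar>t\<bar> < \<epsilon>" for t
    by (rule integrable_const_bound[of _ L]) (use facts that mD in \<open>auto intro!: AE_I2\<close>)
  then show "\<And>t. \<bar>t\<bar> < \<epsilon> \<Longrightarrow> integrable M (\<lambda>x. sqrt ((e t x)\<^sup>2 - (a t x)\<^sup>2 - (b t x)\<^sup>2))"
    by (simp add: dd_def)
  let ?F = "\<lambda>t. \<integral>x. e t x - sqrt (dd t x) \<partial>M"
  let ?F' = "\<lambda>t. \<integral>x. e1 t x - psi t x \<partial>M"
  have first: "(?F has_real_derivative ?F' t) (at t)" if t: "\<bar>t\<bar> < \<epsilon> / 2" for t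
  proof (rule has_real_derivative_integral_dominated(1)[where r = "\<epsilon> / 2 - \<bar>t\<bar>" and K = "L1 + Cst"])
    have t': "\<bar>t\<bar> < \<epsilon>" using t eps by simp
    show "0 < \<epsilon> / 2 - \<bar>t\<bar>" using t by simp
    show "integrable M (\<lambda>x. e s x - sqrt (dd s x))" if "\<bar>s - t\<bar> < \<epsilon> / 2 - \<bar>t\<bar>" for s
      using that eps by (intro Bochner_Integration.integrable_diff ie iD) linarith+
    show "AE x in M. ((\<lambda>s. (e s x - sqrt (dd s x) - (e t x - sqrt (dd t x))) / (s - t)) \<longlongrightarrow> e1 t x - psi t x) (at t)"
      using nz[OF t'] AE_space
    proof eventually_elim
      case (elim x)
      then have "((\<lambda>t. e t x - sqrt (dd t x)) has_real_derivative e1 t x - psi t x) (at t)"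
        using facts[OF _ t'] by (intro DERIV_diff) (auto simp: dd_def)
      then show ?case by (simp add: has_field_derivative_iff)
    qed
    show "AE x in M. \<bar>e s x - sqrt (dd s x) - (e t x - sqrt (dd t x))\<bar> \<le> (L1 + Cst) * \<bar>s - t\<bar>"
      if "\<bar>s - t\<bar> < \<epsilon> / 2 - \<bar>t\<bar>" for s
    proof (rule AE_I2)
      fix x assume x: "x \<in> space M"
      have "\<bar>s\<bar> < \<epsilon> / 2" using that by linarith
      from facts2[OF x t this] show "\<bar>e s x - sqrt (dd s x) - (e t x - sqrt (dd t x))\<bar> \<le> (L1 + Cst) * \<bar>s - t\<bar>"
        unfolding distrib_right by linarith
    qed
    show "(\<lambda>x. e1 t x - psi t x) \<in> borel_measurable M" using meas(2)[OF t'] mD[OF t'] by measurable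
  qed simp
  have zero: "\<bar>0 :: real\<bar> < \<epsilon>" using eps by simp
  \<comment> \<open>At time 0 the integrand of the first derivative vanishes almost everywhere, so
    its increment from 0 is its value, and the deviations of \<open>psi\<close> and of
    \<open>e1\<close> from \<open>e1 0\<close> control it.\<close>
  have ae0: "AE x in M. e 0 x > 0 \<and> e1 0 x - psi 0 x = 0 \<and> x \<in> space M"
    using nz[OF zero] AE_space
  proof eventually_elim
    case (elim x)
    then interpret semidefinite_path \<epsilon> B "\<lambda>t. e t x" "\<lambda>t. e1 t x" "\<lambda>t. e2 t x"
      "\<lambda>t. a t x" "\<lambda>t. a1 t x" "\<lambda>t. a2 t x" "\<lambda>t. b t x" "\<lambda>t. b1 t x" "\<lambda>t. b2 t x"
      using path by blast
    have "e 0 x \<noteq> 0" using elim a0 b0 by auto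
    then have "e 0 x > 0" using enn[of 0] eps by simp
    moreover have "psi 0 x = e1 0 x" using a0 b0 calculation by (simp add: psi_def dd1_def dd_def)
    ultimately show ?case using elim by simp
  qed
  have int2: "integrable M (\<lambda>x. e1 s x - psi s x)" if "\<bar>s - 0\<bar> < \<epsilon> / 2" for s
  proof (rule integrable_const_bound[of _ "L1 + Cst"])
    have s: "\<bar>s\<bar> < \<epsilon>" "\<bar>s\<bar> < \<epsilon> / 2" using that eps by auto
    show "(\<lambda>x. e1 s x - psi s x) \<in> borel_measurable M" using meas(2) mD s by measurable
    show "AE x in M. norm (e1 s x - psi s x) \<le> L1 + Cst"
    proof (rule AE_I2)
      fix x assume x: "x \<in> space M"
      have "\<bar>e1 s x\<bar> \<le> L1" "\<bar>psi s x\<bar> \<le> Cst" using facts[OF x s(1)] facts2[OF x s(2) s(2)] by auto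
      then show "norm (e1 s x - psi s x) \<le> L1 + Cst" by (simp add: abs_le_iff)
    qed
  qed
  have lim2: "AE x in M. ((\<lambda>s. (e1 s x - psi s x - (e1 0 x - psi 0 x)) / (s - 0)) \<longlongrightarrow>
      ((a1 0 x)\<^sup>2 + (b1 0 x)\<^sup>2) / e 0 x) (at 0)"
    using ae0
  proof eventually_elim
    case (elim x)
    then interpret semidefinite_path \<epsilon> B "\<lambda>t. e t x" "\<lambda>t. e1 t x" "\<lambda>t. e2 t x"
      "\<lambda>t. a t x" "\<lambda>t. a1 t x" "\<lambda>t. a2 t x" "\<lambda>t. b t x" "\<lambda>t. b1 t x" "\<lambda>t. b2 t x"
      using path by blast
    have "((\<lambda>t. e1 t x - psi t x) has_real_derivative ((a1 0 x)\<^sup>2 + (b1 0 x)\<^sup>2) / e 0 x) (at 0)"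
      using psi_limit elim unfolding psi_def D1_def D_def dd1_def dd_def by simp
    then show ?case by (simp add: has_field_derivative_iff)
  qed
  have bd2: "AE x in M. \<bar>e1 s x - psi s x - (e1 0 x - psi 0 x)\<bar> \<le> (B + Cst) * \<bar>s - 0\<bar>" if s: "\<bar>s - 0\<bar> < \<epsilon> / 2" for s
    using ae0
  proof eventually_elim
    case (elim x)
    have s': "\<bar>s\<bar> < \<epsilon> / 2" using s by simp
    have "\<bar>psi s x - e1 0 x\<bar> \<le> Cst * \<bar>s\<bar>" "\<bar>e1 s x - e1 0 x\<bar> \<le> B * \<bar>s\<bar>"
      using facts2[OF _ s' s', of x] elim by auto
    then have "\<bar>e1 s x - psi s x\<bar> \<le> B * \<bar>s\<bar> + Cst * \<bar>s\<bar>" by linarith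
    then show ?case using elim by (simp add: distrib_right)
  qed
  have ms2: "(\<lambda>x. ((a1 0 x)\<^sup>2 + (b1 0 x)\<^sup>2) / e 0 x) \<in> borel_measurable M"
    using meas(1)[OF zero] meas(4)[OF zero] meas(6)[OF zero] by measurable
  have second: "(?F' has_real_derivative (\<integral>x. ((a1 0 x)\<^sup>2 + (b1 0 x)\<^sup>2) / e 0 x \<partial>M)) (at 0)"
      "integrable M (\<lambda>x. ((a1 0 x)\<^sup>2 + (b1 0 x)\<^sup>2) / e 0 x)"
    using has_real_derivative_integral_dominated[where r = "\<epsilon> / 2" and K = "B + Cst" and t = 0
        and f = "\<lambda>t x. e1 t x - psi t x" and M = M, OF _ int2 lim2 bd2 _ ms2] eps by auto
  show "integrable M (\<lambda>x. ((a1 0 x)\<^sup>2 + (b1 0 x)\<^sup>2) / e 0 x)" using second by blast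
  show "\<exists>F'. (\<forall>t. \<bar>t\<bar> < \<epsilon> / 2 \<longrightarrow>
        ((\<lambda>t. \<integral>x. e t x - sqrt ((e t x)\<^sup>2 - (a t x)\<^sup>2 - (b t x)\<^sup>2) \<partial>M) has_real_derivative F' t) (at t)) \<and>
      (F' has_real_derivative (\<integral>x. ((a1 0 x)\<^sup>2 + (b1 0 x)\<^sup>2) / e 0 x \<partial>M)) (at 0)"
    using first second by (intro exI[of _ ?F']) (simp add: dd_def)
qed

section \<open>Null sets and change of variables in the plane\<close>

text \<open>By the Lindelof property countably many of the isolating neighbourhoods already cover
  \<open>Z\<close>, and each contains at most one of its points.\<close>

lemma countable_if_isolated:
  fixes Z :: "'a::second_countable_topology set"
  assumes "\<And>x. x \<in> Z \<Longrightarrow> \<exists>U. open U \<and> x \<in> U \<and> U \<inter> Z \<subseteq> {x}"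
  shows "countable Z"
proof -
  obtain U where U: "\<And>x. x \<in> Z \<Longrightarrow> open (U x) \<and> x \<in> U x \<and> U x \<inter> Z \<subseteq> {x}"
    using assms by metis
  obtain F where F: "F \<subseteq> U ` Z" "countable F" "\<Union>F = \<Union>(U ` Z)"
    using Lindelof[of "U ` Z"] U by (metis (no_types, lifting) imageE)
  have "Z \<subseteq> \<Union>F" unfolding F(3) using U by blast
  then have "Z = (\<Union>V\<in>F. V \<inter> Z)" by blast
  moreover have "countable (V \<inter> Z)" if "V \<in> F" for V
  proof -
    from F(1) that obtain x where "x \<in> Z" "V = U x" by blast
    then show ?thesis using U countable_subset[of "V \<inter> Z" "{x}"] by auto
  qed
  ultimately show ?thesis using F(2) by (metis countable_UN)
qed

text \<open>Induction on the order of the nonvanishing derivative: a zero of a function is either a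
  zero of its derivative, of which there are countably many, or a simple zero, which is
  isolated.\<close>

lemma countable_zeros:
  fixes \<phi> :: "nat \<Rightarrow> real \<Rightarrow> real"
  assumes "open J"
  shows "(\<And>j x. j < m \<Longrightarrow> x \<in> J \<Longrightarrow> (\<phi> j has_real_derivative \<phi> (Suc j) x) (at x)) \<Longrightarrow>
    (\<And>x. x \<in> J \<Longrightarrow> \<phi> m x \<noteq> 0) \<Longrightarrow> countable {x \<in> J. \<phi> 0 x = 0}"
proof (induction m arbitrary: \<phi>)
  case 0
  then have "{x \<in> J. \<phi> 0 x = 0} = {}" by auto
  then show ?case by (metis countable_empty)
next
  case (Suc m)
  have "countable {x \<in> J. \<phi> (Suc 0) x = 0}"
    using Suc.IH[of "\<lambda>j. \<phi> (Suc j)"] Suc.prems by auto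
  moreover have "countable {x \<in> J. \<phi> 0 x = 0 \<and> \<phi> (Suc 0) x \<noteq> 0}" (is "countable ?Z")
  proof (rule countable_if_isolated)
    fix x assume x: "x \<in> ?Z"
    then have "((\<lambda>y. (\<phi> 0 y - \<phi> 0 x) / (y - x)) \<longlongrightarrow> \<phi> (Suc 0) x) (at x)"
      using Suc.prems(1)[of 0 x] by (simp add: has_field_derivative_iff)
    then have "\<forall>\<^sub>F y in at x. (\<phi> 0 y - \<phi> 0 x) / (y - x) \<noteq> 0"
      using x by (intro tendsto_imp_eventually_ne) auto
    then obtain U where "open U" "x \<in> U" "\<And>y. y \<in> U \<Longrightarrow> y \<noteq> x \<Longrightarrow> (\<phi> 0 y - \<phi> 0 x) / (y - x) \<noteq> 0"
      unfolding eventually_at_topological by blast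
    then show "\<exists>U. open U \<and> x \<in> U \<and> U \<inter> ?Z \<subseteq> {x}"
      using x by (intro exI[of _ U]) force
  qed
  moreover have "{x \<in> J. \<phi> 0 x = 0} \<subseteq> {x \<in> J. \<phi> (Suc 0) x = 0} \<union> ?Z" by blast
  ultimately show ?case by (metis (no_types, lifting) countable_Un countable_subset)
qed

section \<open>Fubini and the Jacobian formula transported to the complex plane\<close>

lemma lborel_complex_eq: "lborel = distr (lborel \<Otimes>\<^sub>M lborel) borel (\<lambda>(x, y). Complex x y)"
proof (rule lborel_eqI)
  have m: "(\<lambda>(x, y). Complex x y) \<in> borel_measurable (lborel \<Otimes>\<^sub>M lborel)"
    by (simp add: lborel_prod Complex_eq, unfold case_prod_beta)
      (intro borel_measurable_continuous_onI continuous_intros)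
  fix l u :: complex
  assume lu: "\<And>b. b \<in> Basis \<Longrightarrow> l \<bullet> b \<le> u \<bullet> b"
  have le: "Re l \<le> Re u" "Im l \<le> Im u" using lu[of 1] lu[of \<i>] by (auto simp: Basis_complex_def)
  have "emeasure (distr (lborel \<Otimes>\<^sub>M lborel) borel (\<lambda>(x, y). Complex x y)) (box l u)
      = emeasure (lborel \<Otimes>\<^sub>M lborel) ({Re l<..<Re u} \<times> {Im l<..<Im u})"
    by (subst emeasure_distr[OF m]) (auto simp: in_box_complex_iff space_pair_measure intro!: arg_cong2[where f = emeasure])
  also have "\<dots> = (Re u - Re l) * (Im u - Im l)"
    using le by (subst lborel.emeasure_pair_measure_Times) (auto simp: ennreal_mult)
  finally show "emeasure (distr (lborel \<Otimes>\<^sub>M lborel) borel (\<lambda>(x, y). Complex x y)) (box l u)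
      = (\<Prod>b\<in>Basis. (u - l) \<bullet> b)" by (simp add: Basis_complex_def)
qed simp

lemma null_if_countable_slices:
  fixes Z :: "complex set"
  assumes Z: "Z \<in> sets borel" and slice: "\<And>y. countable {x. Complex x y \<in> Z}"
  shows "emeasure lborel Z = 0"
proof -
  have m: "(\<lambda>(x, y). Complex x y) \<in> borel_measurable (lborel \<Otimes>\<^sub>M lborel)"
    by (simp add: lborel_prod Complex_eq, unfold case_prod_beta)
      (intro borel_measurable_continuous_onI continuous_intros)
  have P: "(\<lambda>(x, y). Complex x y) -` Z \<inter> space (lborel \<Otimes>\<^sub>M lborel) \<in> sets (lborel \<Otimes>\<^sub>M lborel)"
    using measurable_sets[OF m Z] .
  have "emeasure lborel Z = emeasure (lborel \<Otimes>\<^sub>M lborel) ((\<lambda>(x, y). Complex x y) -` Z \<inter> space (lborel \<Otimes>\<^sub>M lborel))"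
    by (subst lborel_complex_eq, subst emeasure_distr[OF m Z]) simp
  also have "\<dots> = (\<integral>\<^sup>+y. emeasure lborel ((\<lambda>x. (x, y)) -` ((\<lambda>(x, y). Complex x y) -` Z \<inter> space (lborel \<Otimes>\<^sub>M lborel))) \<partial>lborel)"
    by (rule lborel_pair.emeasure_pair_measure_alt2[OF P])
  also have "\<dots> = (\<integral>\<^sup>+y. 0 \<partial>(lborel :: real measure))"
  proof (rule nn_integral_cong)
    fix y :: real
    have "(\<lambda>x. (x, y)) -` ((\<lambda>(x, y). Complex x y) -` Z \<inter> space (lborel \<Otimes>\<^sub>M lborel)) = {x. Complex x y \<in> Z}"
      by (auto simp: space_pair_measure)
    then show "emeasure lborel ((\<lambda>x. (x, y)) -` ((\<lambda>(x, y). Complex x y) -` Z \<inter> space (lborel \<Otimes>\<^sub>M lborel))) = 0"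
      using slice[of y] by (simp add: emeasure_lborel_countable)
  qed
  finally show ?thesis by simp
qed

text \<open>The Jacobian formula below is stated with determinants of matrices on Cartesian spaces,
  so the plane is identified with \<open>real^2\<close>; the two measures are compared on
  boxes.\<close>

lemma lborel_complex_vec: "lborel = distr (lborel :: (real^2) measure) borel (\<lambda>v. Complex (v $ 1) (v $ 2))"
proof (rule lborel_eqI)
  have m: "(\<lambda>v. Complex (v $ 1) (v $ 2)) \<in> borel_measurable (lborel :: (real^2) measure)"
    by (simp add: Complex_eq)
  fix l u :: complex
  assume lu: "\<And>b. b \<in> Basis \<Longrightarrow> l \<bullet> b \<le> u \<bullet> b"
  have le: "Re l \<le> Re u" "Im l \<le> Im u" using lu[of 1] lu[of \<i>] by (auto simp: Basis_complex_def)
  let ?l = "vector [Re l, Im l] :: real^2" and ?u = "vector [Re u, Im u] :: real^2"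
  have B: "(Basis :: (real^2) set) = {axis 1 1, axis 2 1}"
    by (auto simp: Basis_vec_def UNIV_2)
  have ne: "(axis 1 1 :: real^2) \<noteq> axis 2 1" by (simp add: axis_eq_axis)
  have "emeasure (distr (lborel :: (real^2) measure) borel (\<lambda>v. Complex (v $ 1) (v $ 2))) (box l u)
      = emeasure lborel (box ?l ?u)"
    by (subst emeasure_distr[OF m])
      (auto simp: in_box_complex_iff mem_box B inner_axis vector_2 intro!: arg_cong2[where f = emeasure])
  also have "\<dots> = (Re u - Re l) * (Im u - Im l)"
    using le ne by (subst emeasure_lborel_box) (auto simp: B inner_axis vector_2)
  finally show "emeasure (distr (lborel :: (real^2) measure) borel (\<lambda>v. Complex (v $ 1) (v $ 2))) (box l u)
      = (\<Prod>b\<in>Basis. (u - l) \<bullet> b)" by (simp add: Basis_complex_def)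
qed simp

text \<open>The underlying change of variables theorem is an equivalence for each real value
  \<open>r\<close>: the image has measure \<open>r\<close> exactly if the Jacobian integrates to
  \<open>r\<close>. Reading it in both directions also settles the infinite case.\<close>

lemma emeasure_differentiable_image:
  fixes f :: "real^'n::{finite,wellorder} \<Rightarrow> real^'n::_"
  assumes S: "S \<in> sets borel" and fS: "f ` S \<in> sets borel"
    and der: "\<And>x. x \<in> S \<Longrightarrow> (f has_derivative f' x) (at x within S)"
    and inj: "inj_on f S"
    and meas: "(\<lambda>x. indicator S x * \<bar>det (matrix (f' x))\<bar>) \<in> borel_measurable borel"
  shows "emeasure lborel (f ` S) = (\<integral>\<^sup>+x. ennreal (indicator S x * \<bar>det (matrix (f' x))\<bar>) \<partial>lborel)"
proof -
  let ?h = "\<lambda>x. indicator S x * \<bar>det (matrix (f' x))\<bar>"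
  have SL: "S \<in> sets lebesgue" using S by simp
  have hS: "(?h has_integral r) UNIV \<longleftrightarrow> ((\<lambda>x. \<bar>det (matrix (f' x))\<bar>) has_integral r) S" for r
  proof -
    have "?h = (\<lambda>x. if x \<in> S then \<bar>det (matrix (f' x))\<bar> else 0)" by (auto simp: indicator_def)
    then show ?thesis by (simp add: has_integral_restrict_UNIV)
  qed
  have key: "(f ` S \<in> lmeasurable \<and> measure lebesgue (f ` S) = r) \<longleftrightarrow>
      ((\<integral>\<^sup>+x. ennreal (?h x) \<partial>lborel) = ennreal r \<and> 0 \<le> r)" for r
  proof -
    have "(\<integral>\<^sup>+x. ennreal (?h x) \<partial>lebesgue) = (\<integral>\<^sup>+x. ennreal (?h x) \<partial>lborel)"
      by (rule nn_integral_completion)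
    moreover have "?h \<in> lebesgue \<rightarrow>\<^sub>M borel"
      using meas by (simp add: measurable_completion)
    ultimately have "(?h has_integral r) UNIV \<longleftrightarrow> (\<integral>\<^sup>+x. ennreal (?h x) \<partial>lborel) = ennreal r \<and> 0 \<le> r"
      by (subst has_integral_iff_nn_integral_lebesgue) auto
    then show ?thesis using has_measure_differentiable_image[OF SL der inj, of r] hS by simp
  qed
  have em: "emeasure lebesgue (f ` S) = emeasure lborel (f ` S)" using fS by simp
  show ?thesis
  proof (cases "emeasure lborel (f ` S) = \<infinity>")
    case True
    show ?thesis
    proof (rule ccontr)
      assume "emeasure lborel (f ` S) \<noteq> (\<integral>\<^sup>+x. ennreal (?h x) \<partial>lborel)"
      then obtain r where "(\<integral>\<^sup>+x. ennreal (?h x) \<partial>lborel) = ennreal r" "0 \<le> r"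
        using True by (cases "\<integral>\<^sup>+x. ennreal (?h x) \<partial>lborel" rule: ennreal_cases) auto
      then have "f ` S \<in> lmeasurable" using key by blast
      then show False using True em by (simp add: fmeasurable_def)
    qed
  next
    case False
    then have "f ` S \<in> lmeasurable" using fS em by (simp add: fmeasurable_def top.not_eq_extremum)
    then have "(\<integral>\<^sup>+x. ennreal (?h x) \<partial>lborel) = ennreal (measure lebesgue (f ` S))" using key by blast
    moreover have "emeasure lebesgue (f ` S) = ennreal (measure lebesgue (f ` S))"
      using False em by (intro emeasure_eq_ennreal_measure) simp
    ultimately show ?thesis using em by simp
  qed
qed

text \<open>As a real 2 by 2 matrix, multiplication by \<open>g' z\<close> has determinant
  \<open>(cmod (g' z))\<^sup>2\<close>.\<close>

lemma emeasure_complex_image: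
  fixes g :: "complex \<Rightarrow> complex"
  assumes S: "S \<in> sets borel" and gS: "g ` S \<in> sets borel"
    and der: "\<And>z. z \<in> S \<Longrightarrow> (g has_derivative (\<lambda>h. g' z * h)) (at z within S)"
    and inj: "inj_on g S"
    and meas: "(\<lambda>z. indicator S z * (cmod (g' z))\<^sup>2) \<in> borel_measurable borel"
  shows "emeasure lborel (g ` S) = (\<integral>\<^sup>+z. ennreal (indicator S z * (cmod (g' z))\<^sup>2) \<partial>lborel)"
proof -
  define T :: "real^2 \<Rightarrow> complex" where "T v = Complex (v $ 1) (v $ 2)" for v
  define T' :: "complex \<Rightarrow> real^2" where "T' z = vector [Re z, Im z]" for z
  have TT': "T (T' z) = z" "T' (T v) = v" for z v
    by (auto simp: T_def T'_def vector_2 vec_eq_iff forall_2)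
  have lT: "bounded_linear T"
  proof -
    have "linear T" by (auto simp: T_def linear_iff complex_eq_iff)
    then show ?thesis by (rule linear_conv_bounded_linear[THEN iffD1])
  qed
  have lT': "bounded_linear T'"
  proof -
    have "linear T'" by (auto simp: T'_def linear_iff vec_eq_iff forall_2 vector_2)
    then show ?thesis by (rule linear_conv_bounded_linear[THEN iffD1])
  qed
  have mT: "T \<in> borel_measurable borel" "T' \<in> borel_measurable borel"
    using lT lT' by (auto intro!: borel_measurable_continuous_onI linear_continuous_on)
  have lb: "lborel = distr lborel borel T" using lborel_complex_vec by (simp add: T_def[abs_def])
  have B: "T -` X \<in> sets borel" if "X \<in> sets borel" for X using measurable_sets[OF mT(1) that] by simp
  have em: "emeasure lborel X = emeasure lborel (T -` X)" if "X \<in> sets borel" for X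
    using that mT by (subst lb, subst emeasure_distr) auto
  let ?S = "T -` S" and ?f = "\<lambda>v. T' (g (T v))" and ?f' = "\<lambda>v h. T' (g' (T v) * T h)"
  have fS: "?f ` ?S = T -` (g ` S)"
  proof (intro equalityI subsetI)
    fix v assume "v \<in> ?f ` ?S"
    then show "v \<in> T -` (g ` S)" by (auto simp: TT')
  next
    fix v assume "v \<in> T -` (g ` S)"
    then obtain s where s: "s \<in> S" "T v = g s" by auto
    then have "v = ?f (T' s)" using TT'(2)[of v] by (simp add: TT'(1))
    then show "v \<in> ?f ` ?S" using s by (intro image_eqI[of _ _ "T' s"]) (simp_all add: TT'(1))
  qed
  have detm: "\<bar>det (matrix (?f' v))\<bar> = (cmod (g' (T v)))\<^sup>2" for v
  proof -
    have "det (matrix (?f' v)) = (Re (g' (T v)))\<^sup>2 + (Im (g' (T v)))\<^sup>2"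
      by (simp add: det_2 matrix_def T_def T'_def vector_2 axis_def power2_eq_square)
    then show ?thesis by (simp add: cmod_power2)
  qed
  have "emeasure lborel (g ` S) = emeasure lborel (?f ` ?S)" using em[OF gS] fS by simp
  also have "\<dots> = (\<integral>\<^sup>+v. ennreal (indicator ?S v * \<bar>det (matrix (?f' v))\<bar>) \<partial>lborel)"
  proof (rule emeasure_differentiable_image)
    show "?S \<in> sets borel" using B S by blast
    show "?f ` ?S \<in> sets borel" unfolding fS using B gS by blast
    show "inj_on ?f ?S"
    proof (rule inj_onI)
      fix v w assume vw: "v \<in> ?S" "w \<in> ?S" "?f v = ?f w"
      then have "g (T v) = g (T w)" using TT'(1) by metis
      then have "T v = T w" using inj_onD[OF inj] vw by auto
      then show "v = w" using TT'(2) by metis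
    qed
    have "(\<lambda>v. indicator ?S v * \<bar>det (matrix (?f' v))\<bar>) = (\<lambda>z. indicator S z * (cmod (g' z))\<^sup>2) \<circ> T"
      by (auto simp: detm indicator_def)
    then show "(\<lambda>v. indicator ?S v * \<bar>det (matrix (?f' v))\<bar>) \<in> borel_measurable borel"
      using measurable_comp[OF mT(1) meas] by simp
    show "(?f has_derivative ?f' v) (at v within ?S)" if "v \<in> ?S" for v
    proof -
      have "(g has_derivative (\<lambda>h. g' (T v) * h)) (at (T v) within T ` ?S)"
        using der that by (auto intro: has_derivative_subset)
      from has_derivative_in_compose[OF bounded_linear_imp_has_derivative[OF lT] this]
      show ?thesis by (rule bounded_linear.has_derivative[OF lT'])
    qed
  qed
  also have "\<dots> = (\<integral>\<^sup>+v. ennreal (indicator S (T v) * (cmod (g' (T v)))\<^sup>2) \<partial>lborel)"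
    by (simp add: detm indicator_def)
  also have "\<dots> = (\<integral>\<^sup>+z. ennreal (indicator S z * (cmod (g' z))\<^sup>2) \<partial>distr lborel borel T)"
    using mT meas by (subst nn_integral_distr) auto
  finally show ?thesis by (simp flip: lb)
qed

lemma nn_integral_complex_image:
  fixes g :: "complex \<Rightarrow> complex"
  assumes S: "S \<in> sets borel" and gX: "\<And>X. X \<in> sets borel \<Longrightarrow> X \<subseteq> S \<Longrightarrow> g ` X \<in> sets borel"
    and der: "\<And>z. z \<in> S \<Longrightarrow> (g has_derivative (\<lambda>h. g' z * h)) (at z within S)"
    and inj: "inj_on g S"
    and meas: "(\<lambda>z. indicator S z * (cmod (g' z))\<^sup>2) \<in> borel_measurable borel"
    and f: "f \<in> borel_measurable borel"
  shows "(\<integral>\<^sup>+z. f z * indicator (g ` S) z \<partial>lborel)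
    = (\<integral>\<^sup>+z. f (g z) * ennreal ((cmod (g' z))\<^sup>2) * indicator S z \<partial>lborel)"
proof -
  have cont: "continuous_on S g"
    using der has_derivative_continuous continuous_on_eq_continuous_within by blast
  define gg where "gg z = (if z \<in> S then g z else 0)" for z
  have mgg: "gg \<in> borel_measurable borel"
    unfolding gg_def[abs_def] using S cont
    by (subst measurable_restrict_space_iff[symmetric]) (auto intro: borel_measurable_continuous_on_restrict)
  define \<mu> where "\<mu> = density lborel (\<lambda>z. ennreal (indicator S z * (cmod (g' z))\<^sup>2))"
  have eq: "density lborel (indicator (g ` S)) = distr \<mu> borel gg"
  proof (rule measure_eqI)
    fix Y assume "Y \<in> sets (density lborel (indicator (g ` S)))"
    then have Y: "Y \<in> sets borel" by simp
    let ?X = "S \<inter> gg -` Y"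
    have X: "?X \<in> sets borel" using measurable_sets[OF mgg Y] S by auto
    have gSY: "g ` S \<inter> Y = g ` ?X" by (auto simp: gg_def)
    have "emeasure (density lborel (indicator (g ` S))) Y = emeasure lborel (g ` S \<inter> Y)"
      using Y gX[OF S] by (subst emeasure_density) (auto simp flip: indicator_inter_arith)
    also have "\<dots> = (\<integral>\<^sup>+z. ennreal (indicator ?X z * (cmod (g' z))\<^sup>2) \<partial>lborel)"
      unfolding gSY
    proof (rule emeasure_complex_image[OF X])
      show "g ` ?X \<in> sets borel" using gX X by blast
      show "(g has_derivative (*) (g' z)) (at z within ?X)" if "z \<in> ?X" for z
        using der[of z] that by (auto intro: has_derivative_subset)
      show "inj_on g ?X" using inj by (rule inj_on_subset) auto
      have "(\<lambda>z. indicator ?X z * (indicator S z * (cmod (g' z))\<^sup>2)) \<in> borel_measurable borel"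
        by (rule borel_measurable_times[OF borel_measurable_indicator[OF X] meas])
      moreover have "(\<lambda>z. indicator ?X z * (indicator S z * (cmod (g' z))\<^sup>2)) = (\<lambda>z. indicator ?X z * (cmod (g' z))\<^sup>2)"
        by (auto simp: indicator_def)
      ultimately show "(\<lambda>z. indicator ?X z * (cmod (g' z))\<^sup>2) \<in> borel_measurable borel" by simp
    qed
    also have "\<dots> = emeasure \<mu> (gg -` Y)"
      unfolding \<mu>_def using measurable_sets[OF mgg Y] meas
      by (subst emeasure_density) (auto intro!: nn_integral_cong simp: indicator_def)
    also have "\<dots> = emeasure (distr \<mu> borel gg) Y"
      using Y mgg by (subst emeasure_distr) (auto simp: \<mu>_def)
    finally show "emeasure (density lborel (indicator (g ` S))) Y = emeasure (distr \<mu> borel gg) Y" .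
  qed simp
  have "(\<integral>\<^sup>+z. f z * indicator (g ` S) z \<partial>lborel) = (\<integral>\<^sup>+z. f z \<partial>density lborel (indicator (g ` S)))"
    using f gX[OF S] by (subst nn_integral_density) (auto simp: mult.commute)
  also have "\<dots> = (\<integral>\<^sup>+z. f (gg z) \<partial>\<mu>)"
    unfolding eq using mgg f by (subst nn_integral_distr) (auto simp: \<mu>_def)
  also have "\<dots> = (\<integral>\<^sup>+z. ennreal (indicator S z * (cmod (g' z))\<^sup>2) * f (gg z) \<partial>lborel)"
    unfolding \<mu>_def using mgg f meas by (subst nn_integral_density) auto
  also have "\<dots> = (\<integral>\<^sup>+z. f (g z) * ennreal ((cmod (g' z))\<^sup>2) * indicator S z \<partial>lborel)"
    by (rule nn_integral_cong) (auto simp: indicator_def gg_def mult.commute)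
  finally show ?thesis .
qed

section \<open>Densities on a Riemann surface\<close>

text \<open>From every point of the closed half-plane, small positive steps along both 1 and \<i>
  stay inside it, so even one-sided derivatives at the boundary determine the differential.\<close>

lemma has_derivative_unique_half_plane:
  assumes "z \<in> half_plane" "(f has_derivative f') (at z within half_plane)"
    "(f has_derivative f'') (at z within half_plane)"
  shows "f' = f''"
proof (rule frechet_derivative_unique_within[OF assms(2,3)])
  fix i :: complex and e :: real assume "i \<in> Basis" "0 < e"
  then show "\<exists>d. 0 < \<bar>d\<bar> \<and> \<bar>d\<bar> < e \<and> z + d *\<^sub>R i \<in> half_plane"
    using assms(1) by (intro exI[of _ "e / 2"]) (auto simp: half_plane_def Basis_complex_def)
qed

lemma frechet_half_plane:
  "z \<in> half_plane \<Longrightarrow> (f has_derivative f') (at z within half_plane) \<Longrightarrow>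
    frechet_derivative f (at z within half_plane) = f'"
  by (metis differentiableI frechet_derivative_works has_derivative_unique_half_plane)

lemma frechet_half_space:
  assumes x: "x \<in> half_space" and f: "(f has_derivative f') (at x within half_space)"
  shows "frechet_derivative f (at x within half_space) = f'"
proof (rule frechet_derivative_unique_within[OF _ f])
  show "(f has_derivative frechet_derivative f (at x within half_space)) (at x within half_space)"
    using f differentiableI frechet_derivative_works by blast
  fix i :: "real^3" and e :: real assume "i \<in> Basis" "0 < e"
  then show "\<exists>d. 0 < \<bar>d\<bar> \<and> \<bar>d\<bar> < e \<and> x + d *\<^sub>R i \<in> half_space"
    using x by (intro exI[of _ "e / 2"]) (auto simp: half_space_def Basis_vec_def axis_def)
qed

lemma has_derivative_within_eq:
  assumes "(F has_derivative F') (at z within H)" "open U" "z \<in> U" "z \<in> H"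
    "\<And>y. y \<in> H \<inter> U \<Longrightarrow> F y = f y"
  shows "(f has_derivative F') (at z within H)"
proof (rule has_derivative_transform_eventually[OF assms(1)])
  show "\<forall>\<^sub>F x in at z within H. F x = f x"
    using assms unfolding eventually_at_topological by blast
qed (use assms in auto)

lemma chart_facts:
  assumes "is_chart H c"
  shows "open (fst c)" "openin (top_of_set H) (snd c ` fst c)"
    "p \<in> fst c \<Longrightarrow> chart_inv c (snd c p) = p"
    "z \<in> snd c ` fst c \<Longrightarrow> snd c (chart_inv c z) = z" "z \<in> snd c ` fst c \<Longrightarrow> chart_inv c z \<in> fst c"
    "continuous_on (fst c) (snd c)" "continuous_on (snd c ` fst c) (chart_inv c)"
    "inj_on (snd c) (fst c)" "snd c ` fst c \<subseteq> H"
proof -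
  show "open (fst c)" "openin (top_of_set H) (snd c ` fst c)"
    using assms unfolding is_chart_def by blast+
  have h: "homeomorphism (fst c) (snd c ` fst c) (snd c) (chart_inv c)"
    using assms unfolding is_chart_def by blast
  then show "p \<in> fst c \<Longrightarrow> chart_inv c (snd c p) = p"
    "z \<in> snd c ` fst c \<Longrightarrow> snd c (chart_inv c z) = z" "z \<in> snd c ` fst c \<Longrightarrow> chart_inv c z \<in> fst c"
    "continuous_on (fst c) (snd c)" "continuous_on (snd c ` fst c) (chart_inv c)"
    unfolding homeomorphism_def by blast+
  show "inj_on (snd c) (fst c)" using h unfolding homeomorphism_def by (metis inj_on_inverseI)
  show "snd c ` fst c \<subseteq> H" using assms unfolding is_chart_def by (meson openin_imp_subset)
qed

lemma closed_half_plane: "closed half_plane"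
  unfolding half_plane_def by (rule closed_halfspace_Im_ge)

lemma chart_image_borel: "is_chart half_plane c \<Longrightarrow> snd c ` fst c \<in> sets borel"
proof -
  assume "is_chart half_plane c"
  then obtain T where "open T" "snd c ` fst c = half_plane \<inter> T"
    using chart_facts(2) by (metis openin_open)
  then show ?thesis using closed_half_plane by auto
qed

lemma chart_image_openin:
  assumes c: "is_chart H c" and B: "open B" "B \<subseteq> fst c"
  shows "openin (top_of_set H) (snd c ` B)"
proof -
  have "snd c ` B = snd c ` fst c \<inter> chart_inv c -` B"
    using chart_facts(3-5)[OF c] B by force
  moreover have "openin (top_of_set (snd c ` fst c)) (snd c ` fst c \<inter> chart_inv c -` B)"
    using chart_facts(7)[OF c] B(1) by (simp add: continuous_openin_preimage_gen)
  ultimately show ?thesis using openin_trans chart_facts(2)[OF c] by metis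
qed

lemma chart_image_borel_subset:
  assumes c: "is_chart half_plane c" and B: "B \<in> sets borel" "B \<subseteq> fst c"
  shows "snd c ` B \<in> sets borel"
proof -
  have "chart_inv c \<in> borel_measurable (restrict_space borel (snd c ` fst c))"
    by (rule borel_measurable_continuous_on_restrict[OF chart_facts(7)[OF c]])
  then have "chart_inv c -` B \<inter> space (restrict_space borel (snd c ` fst c)) \<in> sets (restrict_space borel (snd c ` fst c))"
    using B(1) by (rule measurable_sets)
  moreover have "chart_inv c -` B \<inter> space (restrict_space borel (snd c ` fst c)) = snd c ` B"
    using chart_facts(3-5)[OF c] B(2) by (force simp: space_restrict_space)
  ultimately show ?thesis
    using chart_image_borel[OF c] by (auto simp: sets_restrict_space)
qed

text \<open>Compactness gives a finite subcover, and removing the earlier members makes it disjoint.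
  The family is indexed by all natural numbers for use with sequences; since the first
  \<open>n\<close> members cover, the later ones are empty.\<close>

lemma borel_partition:
  fixes U :: "'s::t2_space \<Rightarrow> 's set"
  assumes cpt: "compact (UNIV :: 's set)" and U: "\<And>p. open (U p)" "\<And>p. p \<in> U p"
  obtains n :: nat and q :: "nat \<Rightarrow> 's" and B :: "nat \<Rightarrow> 's set" where
    "\<And>i. B i \<in> sets borel" "\<And>i. B i \<subseteq> U (q i)" "disjoint_family B" "(\<Union>i\<in>{0..<n}. B i) = UNIV"
proof -
  obtain D where D: "finite D" "UNIV \<subseteq> (\<Union>p\<in>D. U p)"
    by (rule compactE_image[OF cpt, of UNIV U]) (use U in auto)
  obtain n and q :: "nat \<Rightarrow> 's" where q: "D = q ` {i. i < n}"
    using finite_imp_nat_seg_image_inj_on[OF D(1)] by metis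
  let ?B = "disjointed (\<lambda>i. U (q i))"
  have "(\<Union>i\<in>{0..<n}. ?B i) = UNIV"
    unfolding finite_UN_disjointed_eq using D(2) q by fastforce
  moreover have "?B i \<in> sets borel" for i
    unfolding disjointed_def using U(1) by auto
  moreover have "?B i \<subseteq> U (q i)" for i by (rule disjointed_subset)
  ultimately show ?thesis using that[of ?B q n] disjoint_family_disjointed by blast
qed

text \<open>The complex derivative of the coordinate change: for a holomorphic transition map the
  real differential is multiplication by its value on 1.\<close>

definition jac :: "('s, complex) chart \<Rightarrow> ('s, complex) chart \<Rightarrow> complex \<Rightarrow> complex" where
  "jac c c' z = frechet_derivative (transition c c') (at z within half_plane) 1"

section \<open>Coordinate changes and the measure glued from coordinate densities\<close>

locale compact_riemann_surface =
  fixes AS :: "('s::t2_space, complex) chart set"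
  assumes atlas: "riemann_surface_atlas AS" and cpt: "compact (UNIV :: 's set)"
begin

lemma chart: "c \<in> AS \<Longrightarrow> is_chart half_plane c"
  using atlas by (simp add: riemann_surface_atlas_def)

lemma chart_at: "chart_at AS p \<in> AS" "p \<in> fst (chart_at AS p)"
proof -
  have "\<exists>c. c \<in> AS \<and> p \<in> fst c" using atlas unfolding riemann_surface_atlas_def by blast
  then have "chart_at AS p \<in> AS \<and> p \<in> fst (chart_at AS p)" unfolding chart_at_def by (rule someI_ex)
  then show "chart_at AS p \<in> AS" "p \<in> fst (chart_at AS p)" by auto
qed

text \<open>The domain of the local holomorphic extension is shrunk so that all its points in the
  half-plane belong to the overlap of the charts. One-sided derivatives can then be computed from
  the extension.\<close>

lemma transition_holomorphic:
  assumes c: "c \<in> AS" "c' \<in> AS" and z: "z \<in> snd c ` (fst c \<inter> fst c')"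
  obtains U F where "open U" "z \<in> U" "F holomorphic_on U"
    "\<forall>y\<in>half_plane \<inter> U. y \<in> snd c ` (fst c \<inter> fst c') \<and> F y = transition c c' y"
proof -
  have "holomorphic_extensible_on (transition c c') (snd c ` (fst c \<inter> fst c'))"
    using atlas c unfolding riemann_surface_atlas_def by blast
  then obtain U F where U: "open U" "z \<in> U" "F holomorphic_on U"
    "\<forall>y\<in>snd c ` (fst c \<inter> fst c') \<inter> U. F y = transition c c' y"
    using z unfolding holomorphic_extensible_on_def by blast
  have "openin (top_of_set half_plane) (snd c ` (fst c \<inter> fst c'))"
    using chart_image_openin[OF chart[OF c(1)]] chart_facts(1)[OF chart[OF c(1)]] chart_facts(1)[OF chart[OF c(2)]]
    by (simp add: open_Int)
  then obtain T where T: "open T" "snd c ` (fst c \<inter> fst c') = half_plane \<inter> T" by (metis openin_open)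
  show ?thesis
    using that[of "U \<inter> T" F] U T z by (auto intro: holomorphic_on_subset)
qed

lemma jac_local:
  assumes c: "c \<in> AS" "c' \<in> AS" and F: "open U" "F holomorphic_on U"
    "\<forall>y\<in>half_plane \<inter> U. y \<in> snd c ` (fst c \<inter> fst c') \<and> F y = transition c c' y"
    and y: "y \<in> half_plane \<inter> U"
  shows "(transition c c' has_derivative (\<lambda>h. jac c c' y * h)) (at y within half_plane)" "jac c c' y = deriv F y"
proof -
  have "(F has_field_derivative deriv F y) (at y)" using F y holomorphic_derivI by blast
  then have "(F has_derivative (\<lambda>h. deriv F y * h)) (at y within half_plane)"
    by (simp add: has_field_derivative_def has_derivative_at_withinI)
  then have "(transition c c' has_derivative (\<lambda>h. deriv F y * h)) (at y within half_plane)"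
    by (rule has_derivative_within_eq[OF _ F(1)]) (use F(3) y in \<open>auto\<close>)
  moreover from this have "frechet_derivative (transition c c') (at y within half_plane) = (\<lambda>h. deriv F y * h)"
    using y by (intro frechet_half_plane) auto
  ultimately show "(transition c c' has_derivative (\<lambda>h. jac c c' y * h)) (at y within half_plane)" "jac c c' y = deriv F y"
    by (simp_all add: jac_def)
qed

lemma transition_derivative:
  assumes c: "c \<in> AS" "c' \<in> AS" and z: "z \<in> snd c ` (fst c \<inter> fst c')"
  shows "(transition c c' has_derivative (\<lambda>h. jac c c' z * h)) (at z within half_plane)"
proof -
  obtain U F where U: "open U" "z \<in> U" "F holomorphic_on U"
    "\<forall>y\<in>half_plane \<inter> U. y \<in> snd c ` (fst c \<inter> fst c') \<and> F y = transition c c' y"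
    using transition_holomorphic[OF assms] by blast
  have "z \<in> half_plane" using z chart_facts(9)[OF chart[OF c(1)]] by blast
  then show ?thesis using jac_local(1)[OF c U(1,3,4)] U(2) by blast
qed

lemma jac_continuous:
  assumes c: "c \<in> AS" "c' \<in> AS"
  shows "continuous_on (snd c ` (fst c \<inter> fst c')) (jac c c')"
  unfolding continuous_on_eq_continuous_within
proof
  fix z assume z: "z \<in> snd c ` (fst c \<inter> fst c')"
  have sub: "snd c ` (fst c \<inter> fst c') \<subseteq> half_plane" using chart_facts(9)[OF chart[OF c(1)]] by blast
  obtain U F where U: "open U" "z \<in> U" "F holomorphic_on U"
    "\<forall>y\<in>half_plane \<inter> U. y \<in> snd c ` (fst c \<inter> fst c') \<and> F y = transition c c' y"
    using transition_holomorphic[OF assms z] by blast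
  have "continuous_on U (deriv F)"
    using U holomorphic_deriv holomorphic_on_imp_continuous_on by blast
  then have "(deriv F \<longlongrightarrow> deriv F z) (at z within snd c ` (fst c \<inter> fst c'))"
    using U by (metis continuous_on_eq_continuous_at isCont_def tendsto_within_subset subset_UNIV)
  moreover have "\<forall>\<^sub>F y in at z within snd c ` (fst c \<inter> fst c'). deriv F y = jac c c' y"
    unfolding eventually_at_topological using U(1,2) jac_local(2)[OF c U(1,3,4)] sub by (metis IntI subsetD)
  moreover have "deriv F z = jac c c' z" using jac_local(2)[OF c U(1,3,4)] sub z U(2) by auto
  ultimately show "continuous (at z within snd c ` (fst c \<inter> fst c')) (jac c c')"
    unfolding continuous_within using tendsto_cong by force
qed

text \<open>A holomorphic change of coordinates multiplies area by the squared modulus of its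
  derivative, which is the transformation law here. Inside this context the name hides the density
  of measure theory, which therefore appears below under its qualified name.\<close>

definition density :: "(('s, complex) chart \<Rightarrow> complex \<Rightarrow> real) \<Rightarrow> bool" where
  "density d \<longleftrightarrow> (\<forall>c\<in>AS. continuous_on (snd c ` fst c) (d c) \<and> (\<forall>z\<in>snd c ` fst c. 0 \<le> d c z)) \<and>
    (\<forall>c\<in>AS. \<forall>c'\<in>AS. \<forall>p\<in>fst c \<inter> fst c'. d c (snd c p) = d c' (snd c' p) * (cmod (jac c c' (snd c p)))\<^sup>2)"

lemma density_measurable:
  assumes d: "density d" and c: "c \<in> AS" and B: "B \<in> sets borel" "B \<subseteq> fst c"
  shows "(\<lambda>z. indicator (snd c ` B) z * d c z) \<in> borel_measurable borel"
proof -
  have "continuous_on (snd c ` B) (d c)"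
    using d c B unfolding density_def by (meson continuous_on_subset image_mono)
  from borel_measurable_continuous_on_indicator[OF chart_image_borel_subset[OF chart[OF c] B] this]
  show ?thesis by simp
qed

lemma density_measurable':
  assumes d: "density d" and c: "c \<in> AS" and B: "B \<in> sets borel" "B \<subseteq> fst c"
  shows "(\<lambda>z. ennreal (d c z) * indicator (snd c ` B) z) \<in> borel_measurable borel"
proof -
  have "(\<lambda>z. ennreal (indicator (snd c ` B) z * d c z)) \<in> borel_measurable borel"
    using density_measurable[OF assms] by (rule measurable_compose[OF _ measurable_ennreal])
  moreover have "(\<lambda>z. ennreal (indicator (snd c ` B) z * d c z)) = (\<lambda>z. ennreal (d c z) * indicator (snd c ` B) z)"
    by (auto simp: indicator_def)
  ultimately show ?thesis by simp
qed

text \<open>The change of variables formula for the transition map, whose Jacobian is absorbed by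
  the transformation law of the density. Indicators turn the functions on chart images into Borel
  functions on the plane.\<close>

lemma density_change_chart:
  assumes d: "density d" and c: "c \<in> AS" "c' \<in> AS" and B: "B \<in> sets borel" "B \<subseteq> fst c \<inter> fst c'"
  shows "(\<integral>\<^sup>+z. ennreal (d c z) * indicator (snd c ` B) z \<partial>lborel)
    = (\<integral>\<^sup>+z. ennreal (d c' z) * indicator (snd c' ` B) z \<partial>lborel)"
proof -
  let ?S = "snd c ` B" and ?g = "transition c c'"
  note C = chart_facts[OF chart[OF c(1)]] and C' = chart_facts[OF chart[OF c(2)]]
  have g: "?g (snd c p) = snd c' p" if "p \<in> fst c" for p using that C(3) by (simp add: transition_def)
  have gi: "?g ` (snd c ` X) = snd c' ` X" if "X \<subseteq> fst c" for X
    unfolding image_image using that g by (intro image_cong) auto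
  \<comment> \<open>Borel subsets of the chart image come from Borel subsets of the surface, so the
    transition map carries them to Borel sets.\<close>
  have pre: "\<exists>Y. Y \<in> sets borel \<and> Y \<subseteq> B \<and> X = snd c ` Y" if X: "X \<in> sets borel" "X \<subseteq> ?S" for X
  proof -
    have "snd c \<in> borel_measurable (restrict_space borel (fst c))"
      by (rule borel_measurable_continuous_on_restrict[OF C(6)])
    then have "snd c -` X \<inter> space (restrict_space borel (fst c)) \<in> sets (restrict_space borel (fst c))"
      using X(1) by (rule measurable_sets)
    then have "snd c -` X \<inter> fst c \<in> sets borel"
      using C(1) by (auto simp: sets_restrict_space space_restrict_space)
    then have "snd c -` X \<inter> fst c \<inter> B \<in> sets borel" using B(1) by blast
    moreover have "X = snd c ` (snd c -` X \<inter> fst c \<inter> B)" using X(2) B(2) by blast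
    ultimately show ?thesis by blast
  qed
  have Bc: "B \<subseteq> fst c" "B \<subseteq> fst c'" using B(2) by auto
  have "(\<integral>\<^sup>+z. (ennreal (d c' z) * indicator (snd c' ` fst c') z) * indicator (?g ` ?S) z \<partial>lborel)
    = (\<integral>\<^sup>+z. (ennreal (d c' (?g z)) * indicator (snd c' ` fst c') (?g z)) * ennreal ((cmod (jac c c' z))\<^sup>2) * indicator ?S z \<partial>lborel)"
  proof (rule nn_integral_complex_image)
    show "?S \<in> sets borel" by (rule chart_image_borel_subset[OF chart[OF c(1)] B(1) Bc(1)])
    show "?g ` X \<in> sets borel" if "X \<in> sets borel" "X \<subseteq> ?S" for X
      using pre[OF that] gi Bc chart_image_borel_subset[OF chart[OF c(2)]] by (metis order_trans)
    show "(?g has_derivative (\<lambda>h. jac c c' z * h)) (at z within ?S)" if "z \<in> ?S" for z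
      by (rule has_derivative_subset[OF transition_derivative[OF c]]) (use that B C(9) in auto)
    show "inj_on ?g ?S"
    proof (rule inj_onI)
      fix a b assume ab: "a \<in> ?S" "b \<in> ?S" "?g a = ?g b"
      then obtain x y where xy: "x \<in> B" "a = snd c x" "y \<in> B" "b = snd c y" by blast
      then have "snd c' x = snd c' y" using ab g Bc by (metis subsetD)
      then have "x = y" using inj_onD[OF C'(8)] xy Bc by blast
      then show "a = b" using xy by simp
    qed
    have "continuous_on ?S (\<lambda>z. (cmod (jac c c' z))\<^sup>2)"
      using continuous_on_subset[OF jac_continuous[OF c], of ?S] B(2) by (auto intro!: continuous_intros)
    from borel_measurable_continuous_on_indicator[OF chart_image_borel_subset[OF chart[OF c(1)] B(1) Bc(1)] this]
    show "(\<lambda>z. indicator ?S z * (cmod (jac c c' z))\<^sup>2) \<in> borel_measurable borel" by simp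
    show "(\<lambda>z. ennreal (d c' z) * indicator (snd c' ` fst c') z) \<in> borel_measurable borel"
      using density_measurable'[OF d c(2), of "fst c'"] C'(1) by simp
  qed
  moreover have "(ennreal (d c' z) * indicator (snd c' ` fst c') z) * indicator (?g ` ?S) z
      = ennreal (d c' z) * indicator (snd c' ` B) z" for z
    using gi[OF Bc(1)] Bc by (auto simp: indicator_def)
  moreover have "(ennreal (d c' (?g z)) * indicator (snd c' ` fst c') (?g z)) * ennreal ((cmod (jac c c' z))\<^sup>2) * indicator ?S z
      = ennreal (d c z) * indicator ?S z" for z
  proof (cases "z \<in> ?S")
    case True
    then obtain p where p: "p \<in> B" "z = snd c p" by blast
    then have "d c z = d c' (snd c' p) * (cmod (jac c c' z))\<^sup>2"
      using d c B(2) unfolding density_def by blast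
    moreover have "0 \<le> d c' (snd c' p)" using d c p Bc unfolding density_def by blast
    ultimately show ?thesis using p Bc g[of p] True by (auto simp: ennreal_mult indicator_def)
  qed simp
  ultimately show ?thesis by simp
qed

text \<open>The measure is defined by splitting a set along a Borel partition subordinate to charts.
  For a set inside another chart the pieces are moved to that chart by
  \<open>density_change_chart\<close> and add up to the required integral.\<close>

lemma density_measure_exists:
  assumes d: "density d"
  shows "\<exists>m. sets m = sets borel \<and> (\<forall>c\<in>AS. \<forall>B\<in>sets borel. B \<subseteq> fst c \<longrightarrow>
        emeasure m B = (\<integral>\<^sup>+z. ennreal (d c z) * indicator (snd c ` B) z \<partial>lborel))"
proof -
  let ?I = "\<lambda>c B. \<integral>\<^sup>+z. ennreal (d c z) * indicator (snd c ` B) z \<partial>lborel"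
  obtain n q P where P: "\<And>i. P i \<in> sets borel" "\<And>i. P i \<subseteq> fst (chart_at AS (q i))"
      "disjoint_family P" "(\<Union>i\<in>{0..<n::nat}. P i) = UNIV"
    using borel_partition[OF cpt, of "\<lambda>p. fst (chart_at AS p)"] chart_at chart_facts(1)[OF chart] by metis
  define c where "c i = chart_at AS (q i)" for i
  have c: "c i \<in> AS" for i by (simp add: c_def chart_at)
  have Pc: "P i \<subseteq> fst (c i)" for i using P(2) by (simp add: c_def)
  have suminf: "(\<Sum>k. ?I c (X k)) = ?I c (\<Union>k. X k)"
    if "c \<in> AS" "\<And>k. X k \<in> sets borel" "\<And>k. X k \<subseteq> fst c" "disjoint_family X" for c and X :: "nat \<Rightarrow> 's set"
  proof -
    have dis: "disjoint_family (\<lambda>k. snd c ` X k)"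
      using that chart_facts(8)[OF chart[OF that(1)]] unfolding disjoint_family_on_def
      by (metis (no_types, lifting) image_empty inj_on_image_Int)
    have "(\<Sum>k. ?I c (X k)) = (\<integral>\<^sup>+z. (\<Sum>k. ennreal (d c z) * indicator (snd c ` X k) z) \<partial>lborel)"
      using density_measurable'[OF d that(1-3)] by (intro nn_integral_suminf[symmetric]) simp
    also have "\<dots> = ?I c (\<Union>k. X k)"
      using dis by (simp add: image_UN suminf_indicator)
    finally show ?thesis .
  qed
  define \<mu> where "\<mu> X = (\<Sum>i<n. ?I (c i) (X \<inter> P i))" for X
  define m where "m = measure_of UNIV (sets borel) \<mu>"
  have sm: "sets m = sets borel" unfolding m_def by (metis sets.sets_measure_of_eq space_borel)
  have em: "emeasure m X = \<mu> X" if X: "X \<in> sets borel" for X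
  proof (rule emeasure_measure_of[OF m_def])
    show "sets (borel :: 's measure) \<subseteq> Pow UNIV" by simp
    show "X \<in> sets m" using X sm by simp
    show "positive (sets m) \<mu>" by (simp add: positive_def \<mu>_def)
    show "countably_additive (sets m) \<mu>"
    proof (rule countably_additiveI)
      fix Y :: "nat \<Rightarrow> 's set" assume Y: "range Y \<subseteq> sets m" "disjoint_family Y"
      have "(\<Sum>k. \<mu> (Y k)) = (\<Sum>i<n. \<Sum>k. ?I (c i) (Y k \<inter> P i))"
        unfolding \<mu>_def by (rule suminf_sum) simp
      also have "\<dots> = (\<Sum>i<n. ?I (c i) (\<Union>k. Y k \<inter> P i))"
        using Y sm P(1) Pc c by (intro sum.cong suminf) (auto simp: disjoint_family_on_def intro: Pc[THEN subsetD])
      also have "\<dots> = \<mu> (\<Union>k. Y k)" by (simp add: \<mu>_def Int_UN_distrib2)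
      finally show "(\<Sum>k. \<mu> (Y k)) = \<mu> (\<Union>k. Y k)" .
    qed
  qed
  have "emeasure m B = ?I c' B" if c': "c' \<in> AS" and B: "B \<in> sets borel" "B \<subseteq> fst c'" for c' B
  proof -
    have "emeasure m B = (\<Sum>i<n. ?I c' (B \<inter> P i))"
      unfolding em[OF B(1)] \<mu>_def
      using c c' B P(1) Pc by (intro sum.cong density_change_chart[OF d]) (auto intro: Pc[THEN subsetD])
    also have "\<dots> = (\<integral>\<^sup>+z. (\<Sum>i<n. ennreal (d c' z) * indicator (snd c' ` (B \<inter> P i)) z) \<partial>lborel)"
      using B P(1) by (intro nn_integral_sum[symmetric]) (auto intro!: density_measurable'[OF d c'])
    also have "\<dots> = ?I c' B"
    proof (rule nn_integral_cong)
      fix z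
      have dis: "disjoint_family_on (\<lambda>i. snd c' ` (B \<inter> P i)) {..<n}"
        unfolding disjoint_family_on_def
      proof (intro ballI impI)
        fix i j :: nat assume "i \<noteq> j"
        then have "(B \<inter> P i) \<inter> (B \<inter> P j) = {}" using P(3) by (auto simp: disjoint_family_on_def)
        then show "snd c' ` (B \<inter> P i) \<inter> snd c' ` (B \<inter> P j) = {}"
          using inj_on_image_Int[OF chart_facts(8)[OF chart[OF c']], of "B \<inter> P i" "B \<inter> P j"] B(2) by auto
      qed
      have "(\<Union>i<n. B \<inter> P i) = B \<inter> (\<Union>i\<in>{0..<n}. P i)" by auto
      then have U: "(\<Union>i<n. snd c' ` (B \<inter> P i)) = snd c' ` B" by (simp add: P(4) flip: image_UN)
      have "(indicator (\<Union>i<n. snd c' ` (B \<inter> P i)) z :: ennreal) = (\<Sum>i<n. indicator (snd c' ` (B \<inter> P i)) z)"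
        by (rule indicator_UN_disjoint) (use dis in auto)
      then have "(\<Sum>i<n. indicator (snd c' ` (B \<inter> P i)) z) = (indicator (snd c' ` B) z :: ennreal)"
        by (simp add: U)
      then show "(\<Sum>i<n. ennreal (d c' z) * indicator (snd c' ` (B \<inter> P i)) z) = ennreal (d c' z) * indicator (snd c' ` B) z"
        by (simp flip: sum_distrib_left)
    qed
    finally show ?thesis .
  qed
  then show ?thesis using sm by blast
qed

text \<open>The prescribed values inside charts determine the measure of every Borel set, by
  additivity over a finite partition. With existence this makes the definite description
  meaningful.\<close>

lemma density_measure:
  assumes d: "density d"
  shows "sets (density_measure AS d) = sets borel"
    "c \<in> AS \<Longrightarrow> B \<in> sets borel \<Longrightarrow> B \<subseteq> fst c \<Longrightarrow>
      emeasure (density_measure AS d) B = (\<integral>\<^sup>+z. ennreal (d c z) * indicator (snd c ` B) z \<partial>lborel)"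
proof -
  let ?P = "\<lambda>m. sets m = sets borel \<and> (\<forall>c\<in>AS. \<forall>B\<in>sets borel. B \<subseteq> fst c \<longrightarrow>
        emeasure m B = (\<integral>\<^sup>+z. ennreal (d c z) * indicator (snd c ` B) z \<partial>lborel))"
  obtain n q P where P: "\<And>i. P i \<in> sets borel" "\<And>i. P i \<subseteq> fst (chart_at AS (q i))"
      "disjoint_family P" "(\<Union>i\<in>{0..<n::nat}. P i) = UNIV"
    using borel_partition[OF cpt, of "\<lambda>p. fst (chart_at AS p)"] chart_at chart_facts(1)[OF chart] by metis
  have sum: "emeasure m X = (\<Sum>i\<in>{0..<n}. \<integral>\<^sup>+z. ennreal (d (chart_at AS (q i)) z) * indicator (snd (chart_at AS (q i)) ` (X \<inter> P i)) z \<partial>lborel)"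
    if m: "?P m" and X: "X \<in> sets borel" for m X
  proof -
    have "emeasure m (\<Union>i\<in>{0..<n}. X \<inter> P i) = (\<Sum>i\<in>{0..<n}. emeasure m (X \<inter> P i))"
      using m X P(1,3) by (intro sum_emeasure[symmetric]) (auto simp: disjoint_family_on_def)
    moreover have "(\<Union>i\<in>{0..<n}. X \<inter> P i) = X" using P(4) by auto
    moreover have "emeasure m (X \<inter> P i) = (\<integral>\<^sup>+z. ennreal (d (chart_at AS (q i)) z) * indicator (snd (chart_at AS (q i)) ` (X \<inter> P i)) z \<partial>lborel)" for i
      using m X P(1,2) chart_at(1) by (meson Int_lower2 order_trans sets.Int)
    ultimately show ?thesis by simp
  qed
  have "\<exists>!m. ?P m"
  proof (rule ex_ex1I)
    show "\<exists>m. ?P m" by (rule density_measure_exists[OF d])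
    fix m m' assume "?P m" "?P m'"
    then show "m = m'" using sum by (intro measure_eqI) auto
  qed
  then have "?P (density_measure AS d)" unfolding density_measure_def by (rule theI')
  then show "sets (density_measure AS d) = sets borel"
    "c \<in> AS \<Longrightarrow> B \<in> sets borel \<Longrightarrow> B \<subseteq> fst c \<Longrightarrow>
      emeasure (density_measure AS d) B = (\<integral>\<^sup>+z. ennreal (d c z) * indicator (snd c ` B) z \<partial>lborel)"
    by blast+
qed

text \<open>Restricted to \<open>B\<close>, the surface measure is the push-forward of the
  coordinate density under the inverse chart. The map \<open>j\<close> makes this inverse total; its
  values off the coordinate image of \<open>B\<close> carry no mass.\<close>

lemma density_measure_piece:
  fixes f :: "'s \<Rightarrow> real"
  assumes d: "density d" and c: "c \<in> AS" and B: "B \<in> sets borel" "B \<subseteq> fst c" and f: "f \<in> borel_measurable borel"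
  shows "integrable (density_measure AS d) (\<lambda>p. indicator B p * f p) \<longleftrightarrow>
      integrable lborel (\<lambda>z. indicator (snd c ` B) z * (d c z * f (chart_inv c z)))" (is "?A \<longleftrightarrow> ?B")
    and "(\<integral>p. indicator B p * f p \<partial>density_measure AS d) =
      (\<integral>z. indicator (snd c ` B) z * (d c z * f (chart_inv c z)) \<partial>lborel)" (is "?C = ?D")
proof -
  let ?m = "density_measure AS d" and ?S = "snd c ` B"
  note C = chart_facts[OF chart[OF c]]
  note S = chart_image_borel_subset[OF chart[OF c] B]
  note sm = density_measure(1)[OF d]
  define j where "j z = (if z \<in> ?S then chart_inv c z else undefined)" for z
  have contj: "continuous_on ?S (chart_inv c)" using C(7) B(2) by (meson continuous_on_subset image_mono)
  have mj: "j \<in> borel_measurable borel"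
    unfolding j_def[abs_def] using S contj
    by (subst measurable_restrict_space_iff[symmetric]) (auto intro: borel_measurable_continuous_on_restrict)
  define \<mu> where "\<mu> = Nonnegative_Lebesgue_Integration.density lborel (\<lambda>z. ennreal (indicator ?S z * d c z))"
  have md: "(\<lambda>z. indicator ?S z * d c z) \<in> borel_measurable borel" by (rule density_measurable[OF d c B])
  have jS: "?S \<inter> j -` X = snd c ` (B \<inter> X)" for X using C(3) B(2) by (force simp: j_def)
  have eq: "Nonnegative_Lebesgue_Integration.density ?m (\<lambda>p. ennreal (indicator B p)) = distr \<mu> borel j"
  proof (rule measure_eqI)
    fix X assume "X \<in> sets (Nonnegative_Lebesgue_Integration.density ?m (\<lambda>p. ennreal (indicator B p)))"
    then have X: "X \<in> sets borel" using sm by simp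
    have "emeasure (Nonnegative_Lebesgue_Integration.density ?m (\<lambda>p. ennreal (indicator B p))) X = (\<integral>\<^sup>+p. ennreal (indicator B p) * indicator X p \<partial>?m)"
      using B(1) X sm by (intro emeasure_density) auto
    also have "\<dots> = (\<integral>\<^sup>+p. indicator (B \<inter> X) p \<partial>?m)"
      by (rule nn_integral_cong) (simp add: indicator_def)
    also have "\<dots> = emeasure ?m (B \<inter> X)" using B(1) X sm by simp
    also have "\<dots> = (\<integral>\<^sup>+z. ennreal (d c z) * indicator (snd c ` (B \<inter> X)) z \<partial>lborel)"
      using density_measure(2)[OF d c] B X by auto
    also have "\<dots> = emeasure \<mu> (j -` X)"
      unfolding \<mu>_def using md measurable_sets[OF mj X] unfolding jS[symmetric]
      by (subst emeasure_density) (auto intro!: nn_integral_cong simp: indicator_def)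
    also have "\<dots> = emeasure (distr \<mu> borel j) X"
      using X mj by (subst emeasure_distr) (auto simp: \<mu>_def)
    finally show "emeasure (Nonnegative_Lebesgue_Integration.density ?m (\<lambda>p. ennreal (indicator B p))) X = emeasure (distr \<mu> borel j) X" .
  qed (simp add: sm)
  have fm: "f \<in> borel_measurable ?m" using f sm measurable_cong_sets by blast
  have iB: "(\<lambda>p. indicator B p :: real) \<in> borel_measurable ?m" using B(1) sm by simp
  have nn: "0 \<le> indicator ?S z * d c z" for z
    using d c B(2) unfolding density_def by (auto simp: indicator_def)
  have fj: "(\<lambda>z. f (j z)) \<in> borel_measurable borel" using mj f by measurable
  have jf: "(indicator ?S z * d c z) * f (j z) = indicator ?S z * (d c z * f (chart_inv c z))" for z
    by (auto simp: indicator_def j_def)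
  have "?A \<longleftrightarrow> integrable (Nonnegative_Lebesgue_Integration.density ?m (\<lambda>p. ennreal (indicator B p))) f"
    using integrable_density[OF fm iB] by simp
  also have "\<dots> \<longleftrightarrow> integrable \<mu> (\<lambda>z. f (j z))"
    unfolding eq using mj f by (subst integrable_distr_eq) (auto simp: \<mu>_def)
  also have "\<dots> \<longleftrightarrow> integrable lborel (\<lambda>z. (indicator ?S z * d c z) * f (j z))"
    unfolding \<mu>_def using fj md nn by (subst integrable_density) auto
  finally show "?A \<longleftrightarrow> ?B" by (simp only: jf)
  have "?C = (\<integral>p. f p \<partial>Nonnegative_Lebesgue_Integration.density ?m (\<lambda>p. ennreal (indicator B p)))"
    using integral_density[OF fm iB] by simp
  also have "\<dots> = (\<integral>z. f (j z) \<partial>\<mu>)"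
    unfolding eq using mj f by (subst integral_distr) (auto simp: \<mu>_def)
  also have "\<dots> = (\<integral>z. (indicator ?S z * d c z) * f (j z) \<partial>lborel)"
    unfolding \<mu>_def using fj md nn by (subst integral_density) auto
  finally show "?C = ?D" by (simp only: jf)
qed

end

section \<open>The pull-back metric along a variation\<close>

lemma bounded_bilinear_matrix_vector: "bounded_bilinear ((*v) :: real^'n^'m \<Rightarrow> real^'n \<Rightarrow> real^'m)"
  by (rule bilinear_conv_bounded_bilinear[THEN iffD1])
    (simp add: bilinear_def linear_iff matrix_vector_mult_def vec_eq_iff algebra_simps sum.distrib sum_distrib_left)

lemma ip_linear:
  "ip G (x + y) b = ip G x b + ip G y b" "ip G a (x + y) = ip G a x + ip G a y"
  "ip G (r *\<^sub>R a) b = r * ip G a b" "ip G a (r *\<^sub>R b) = r * ip G a b"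
  by (simp_all add: ip_def inner_left_distrib inner_right_distrib matrix_vector_right_distrib
      matrix_vector_mult_scaleR)

lemma ip_commute: "transpose G = G \<Longrightarrow> ip G a b = ip G b a"
  unfolding ip_def by (metis dot_lmul_matrix inner_commute vector_transpose_matrix)

lemma Cinf_ip: "Cinf U G \<Longrightarrow> Cinf U a \<Longrightarrow> Cinf U b \<Longrightarrow> Cinf U (\<lambda>x. ip (G x) (a x) (b x))"
  unfolding ip_def
  by (rule Cinf_bilinear[OF bounded_bilinear_inner], assumption,
      rule Cinf_bilinear[OF bounded_bilinear_matrix_vector])

text \<open>The test vector \<open>(- B, A)\<close> shows that \<open>A\<close> times the
  discriminant gap is nonnegative. If \<open>A = 0\<close> and \<open>B\<close> were nonzero, the
  vector in the proof would give the form the value -1.\<close>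

lemma discriminant_le:
  fixes A B C :: real
  assumes "\<And>x y. 0 \<le> A * x\<^sup>2 + 2 * B * (x * y) + C * y\<^sup>2"
  shows "B\<^sup>2 \<le> A * C"
proof (cases "A = 0")
  case True
  have "B = 0"
  proof (rule ccontr)
    assume "B \<noteq> 0"
    then show False using assms[of "- (C + 1) / (2 * B)" 1] True by simp
  qed
  then show ?thesis using True by simp
next
  case False
  then have A: "A > 0" using assms[of 1 0] by simp
  have "0 \<le> A * (A * C - B\<^sup>2)"
    using assms[of "- B" A] by (simp add: algebra_simps power2_eq_square)
  then show ?thesis using A by (simp add: zero_le_mult_iff)
qed

text \<open>The outer derivative is one-sided on \<open>K\<close>, so the inner map must send points
  of \<open>H\<close> near \<open>z\<close> into \<open>K\<close>; \<open>U\<close> localises this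
  condition.\<close>

lemma has_derivative_chain_within:
  assumes w: "(w has_derivative D) (at z within H)" "z \<in> H" "open U" "z \<in> U"
    and \<tau>: "(\<tau> has_derivative T) (at (w z) within K)" and wK: "\<And>y. y \<in> H \<inter> U \<Longrightarrow> w y \<in> K"
  shows "((\<lambda>y. \<tau> (w y)) has_derivative (\<lambda>h. T (D h))) (at z within H)"
proof -
  have eq: "at z within H = at z within (H \<inter> U)" by (rule at_within_nhd[OF w(4,3)]) auto
  have "w ` (H \<inter> U) \<subseteq> K" using wK by blast
  then have "(\<tau> has_derivative T) (at (w z) within w ` (H \<inter> U))" by (rule has_derivative_subset[OF \<tau>])
  from has_derivative_in_compose[OF w(1)[unfolded eq] this] show ?thesis unfolding eq .
qed

section \<open>Local representations of a smooth family of maps\<close>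

locale variation = compact_riemann_surface AS for AS :: "('s::t2_space, complex) chart set" +
  fixes AM :: "('m::t2_space, real^3) chart set" and g :: "'m metric_field"
    and I :: "real set" and \<Phi> :: "real \<Rightarrow> 's \<Rightarrow> 'm"
  assumes atlasM: "smooth_atlas half_space AM" and metric: "riemannian_metric AM g"
    and I: "open I" "0 \<in> I" and fam: "smooth_family AS AM I \<Phi>"
begin

lemma chartM: "c \<in> AM \<Longrightarrow> is_chart half_space c"
  using atlasM by (simp add: smooth_atlas_def)

lemma chartM_at: "chart_at AM p \<in> AM" "p \<in> fst (chart_at AM p)"
proof -
  have "\<exists>c. c \<in> AM \<and> p \<in> fst c" using atlasM unfolding smooth_atlas_def by blast
  then have "chart_at AM p \<in> AM \<and> p \<in> fst (chart_at AM p)" unfolding chart_at_def by (rule someI_ex)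
  then show "chart_at AM p \<in> AM" "p \<in> fst (chart_at AM p)" by auto
qed

lemma local_dom_iff:
  assumes "cS \<in> AS"
  shows "z \<in> local_dom cS cM f \<longleftrightarrow> z \<in> snd cS ` fst cS \<and> f (chart_inv cS z) \<in> fst cM"
proof -
  note C = chart_facts(3-5)[OF chart[OF assms]]
  have "z \<in> snd cS ` (fst cS \<inter> f -` fst cM)" if "z \<in> snd cS ` fst cS" "f (chart_inv cS z) \<in> fst cM"
    using C(2,3)[OF that(1)] that(2) by (intro image_eqI[of _ _ "chart_inv cS z"]) auto
  then show ?thesis using C(1) by (auto simp: local_dom_def)
qed

lemma local_dom_half_plane: "cS \<in> AS \<Longrightarrow> z \<in> local_dom cS cM f \<Longrightarrow> z \<in> half_plane"
  using chart_facts(9)[OF chart] local_dom_iff by blast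

lemma local_rep_in: "cM \<in> AM \<Longrightarrow> cS \<in> AS \<Longrightarrow> z \<in> local_dom cS cM f \<Longrightarrow> local_rep cS cM f z \<in> snd cM ` fst cM"
  by (simp add: local_dom_iff local_rep_def)

lemma local_dom_open:
  assumes c: "cS \<in> AS" "cM \<in> AM" and t0: "t0 \<in> I" and z0: "z0 \<in> local_dom cS cM (\<Phi> t0)"
  obtains \<delta> where "\<delta> > 0" "ball t0 \<delta> \<subseteq> I"
    "\<forall>t\<in>ball t0 \<delta>. \<forall>z\<in>half_plane \<inter> ball z0 \<delta>. z \<in> local_dom cS cM (\<Phi> t)"
proof -
  let ?S = "snd cS ` fst cS" and ?f = "\<lambda>x. \<Phi> (fst x) (chart_inv cS (snd x))"
  have 1: "continuous_on (I \<times> ?S) (\<lambda>x. (fst x, chart_inv cS (snd x)))"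
    by (intro continuous_intros continuous_on_compose2[OF chart_facts(7)[OF chart[OF c(1)]]]) auto
  have 2: "continuous_on (I \<times> UNIV) (\<lambda>(t, p). \<Phi> t p)" using fam by (simp add: smooth_family_def)
  have "continuous_on (I \<times> ?S) (\<lambda>x. (\<lambda>(t, p). \<Phi> t p) (fst x, chart_inv cS (snd x)))"
    by (rule continuous_on_compose2[OF 2 1]) auto
  then have "continuous_on (I \<times> ?S) ?f" by simp
  then have "openin (top_of_set (I \<times> ?S)) ((I \<times> ?S) \<inter> ?f -` fst cM)"
    using chart_facts(1)[OF chartM[OF c(2)]] by (rule continuous_openin_preimage_gen)
  then obtain W where W: "open W" "(I \<times> ?S) \<inter> ?f -` fst cM = (I \<times> ?S) \<inter> W" unfolding openin_open by blast
  obtain T where T: "open T" "?S = half_plane \<inter> T"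
    using chart_facts(2)[OF chart[OF c(1)]] by (metis openin_open)
  have "(t0, z0) \<in> (I \<times> ?S) \<inter> ?f -` fst cM" using z0 t0 unfolding local_dom_iff[OF c(1)] by auto
  then have "(t0, z0) \<in> W \<inter> (I \<times> T)" using W(2) T by auto
  with open_Int[OF W(1) open_Times[OF I(1) T(1)]] obtain A B where AB: "open A" "open B" "(t0, z0) \<in> A \<times> B" "A \<times> B \<subseteq> W \<inter> (I \<times> T)"
    by (rule open_prod_elim)
  have "t0 \<in> A" "z0 \<in> B" using AB(3) by auto
  then obtain r1 r2 where r: "r1 > 0" "ball t0 r1 \<subseteq> A" "r2 > 0" "ball z0 r2 \<subseteq> B"
    using open_contains_ball[THEN iffD1, OF AB(1)] open_contains_ball[THEN iffD1, OF AB(2)] by blast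
  show ?thesis
  proof (rule that[of "min r1 r2"])
    have "A \<subseteq> I" using AB(3,4) by auto
    then show "ball t0 (min r1 r2) \<subseteq> I" using r(2) by auto
    show "\<forall>t\<in>ball t0 (min r1 r2). \<forall>z\<in>half_plane \<inter> ball z0 (min r1 r2). z \<in> local_dom cS cM (\<Phi> t)"
    proof (intro ballI)
      fix t z assume "t \<in> ball t0 (min r1 r2)" "z \<in> half_plane \<inter> ball z0 (min r1 r2)"
      then have tz: "(t, z) \<in> A \<times> B" "z \<in> half_plane" using r by auto
      then have "(t, z) \<in> (I \<times> ?S) \<inter> W" using AB(4) T(2) by blast
      then have "(t, z) \<in> (I \<times> ?S) \<inter> ?f -` fst cM" unfolding W(2) .
      then show "z \<in> local_dom cS cM (\<Phi> t)" unfolding local_dom_iff[OF c(1)] by auto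
    qed
  qed (use r in auto)
qed

text \<open>The bridge to calculus on open sets: near any time and point, the coordinate expression
  of the family extends smoothly across the boundary of the half-plane. The extended values may
  leave the half-space, so the metric components are extended to an open set \<open>V\<close>
  containing them.\<close>

lemma local_extension:
  assumes c: "cS \<in> AS" "cM \<in> AM" and t0: "t0 \<in> I" and z0: "z0 \<in> local_dom cS cM (\<Phi> t0)"
  obtains \<delta> F V G where "\<delta> > 0" "ball t0 \<delta> \<subseteq> I" "Cinf (ball t0 \<delta> \<times> ball z0 \<delta>) F"
    "\<forall>t\<in>ball t0 \<delta>. \<forall>z\<in>half_plane \<inter> ball z0 \<delta>. z \<in> local_dom cS cM (\<Phi> t) \<and> F (t, z) = local_rep cS cM (\<Phi> t) z"
    "Cinf V G" "F ` (ball t0 \<delta> \<times> ball z0 \<delta>) \<subseteq> V" "\<forall>x\<in>V \<inter> snd cM ` fst cM. G x = g cM x"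
proof -
  obtain \<delta>0 where d0: "\<delta>0 > 0" "ball t0 \<delta>0 \<subseteq> I"
    "\<forall>t\<in>ball t0 \<delta>0. \<forall>z\<in>half_plane \<inter> ball z0 \<delta>0. z \<in> local_dom cS cM (\<Phi> t)"
    using local_dom_open[OF assms] by blast
  let ?X = "{(t, z). t \<in> I \<and> z \<in> local_dom cS cM (\<Phi> t)}"
  have "smooth_on (\<lambda>(t, z). local_rep cS cM (\<Phi> t) z) ?X"
    using fam c unfolding smooth_family_def by blast
  moreover have X0: "(t0, z0) \<in> ?X" using t0 z0 by simp
  ultimately obtain U F where U: "open U" "(t0, z0) \<in> U" "\<forall>k. Ck_on k F U"
    "\<forall>y\<in>?X \<inter> U. F y = (\<lambda>(t, z). local_rep cS cM (\<Phi> t) z) y"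
    unfolding smooth_on_def by blast
  have CU: "Cinf U F" using U by (simp add: Cinf_def)
  let ?x0 = "local_rep cS cM (\<Phi> t0) z0"
  have F0: "F (t0, z0) = ?x0" using U(2,4) X0 by auto
  have "smooth_on (g cM) (snd cM ` fst cM)" using metric c unfolding riemannian_metric_def by blast
  then obtain V G where V: "open V" "?x0 \<in> V" "\<forall>k. Ck_on k G V" "\<forall>x\<in>snd cM ` fst cM \<inter> V. G x = g cM x"
    using local_rep_in[OF c(2,1) z0] unfolding smooth_on_def by blast
  have CV: "Cinf V G" using V by (simp add: Cinf_def)
  have oUV: "open (U \<inter> F -` V)"
    using continuous_open_preimage[OF Cinf_continuous_on[OF CU] U(1) V(1)] .
  have "(t0, z0) \<in> U \<inter> F -` V" using U(2) V(2) F0 by simp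
  with oUV obtain A B where AB: "open A" "open B" "(t0, z0) \<in> A \<times> B" "A \<times> B \<subseteq> U \<inter> F -` V"
    by (rule open_prod_elim)
  have "t0 \<in> A" "z0 \<in> B" using AB(3) by auto
  then obtain r1 r2 where r: "r1 > 0" "ball t0 r1 \<subseteq> A" "r2 > 0" "ball z0 r2 \<subseteq> B"
    using open_contains_ball[THEN iffD1, OF AB(1)] open_contains_ball[THEN iffD1, OF AB(2)] by blast
  define \<delta> where "\<delta> = min \<delta>0 (min r1 r2)"
  have sub: "ball t0 \<delta> \<times> ball z0 \<delta> \<subseteq> U \<inter> F -` V"
  proof -
    have "ball t0 \<delta> \<subseteq> A" "ball z0 \<delta> \<subseteq> B" using r by (auto simp: \<delta>_def)
    then show ?thesis using AB(4) by blast
  qed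
  have d: "\<delta> > 0" "\<delta> \<le> \<delta>0" using d0 r by (auto simp: \<delta>_def)
  have sb: "ball t0 \<delta> \<subseteq> ball t0 \<delta>0" "ball z0 \<delta> \<subseteq> ball z0 \<delta>0" using d(2) by auto
  show ?thesis
  proof (rule that[of \<delta> F V G])
    show "ball t0 \<delta> \<subseteq> I" using sb d0 by blast
    show "Cinf (ball t0 \<delta> \<times> ball z0 \<delta>) F"
      by (rule Cinf_subset[OF CU open_Times[OF open_ball open_ball]]) (use sub in blast)
    show "\<forall>t\<in>ball t0 \<delta>. \<forall>z\<in>half_plane \<inter> ball z0 \<delta>. z \<in> local_dom cS cM (\<Phi> t) \<and> F (t, z) = local_rep cS cM (\<Phi> t) z"
    proof (intro ballI)
      fix t z assume tz: "t \<in> ball t0 \<delta>" "z \<in> half_plane \<inter> ball z0 \<delta>"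
      then have l: "z \<in> local_dom cS cM (\<Phi> t)" "t \<in> I" using d0 sb by blast+
      moreover have "(t, z) \<in> U" using tz sub by blast
      ultimately show "z \<in> local_dom cS cM (\<Phi> t) \<and> F (t, z) = local_rep cS cM (\<Phi> t) z" using U(4) by auto
    qed
    show "F ` (ball t0 \<delta> \<times> ball z0 \<delta>) \<subseteq> V" using sub by blast
    show "\<forall>x\<in>V \<inter> snd cM ` fst cM. G x = g cM x" using V(4) by blast
  qed (use d CV in auto)
qed

lemma rep_derivative:
  assumes c: "cS \<in> AS" and F: "Cinf (ball t0 \<delta> \<times> ball z0 \<delta>) F"
    "\<forall>t\<in>ball t0 \<delta>. \<forall>z\<in>half_plane \<inter> ball z0 \<delta>. z \<in> local_dom cS cM (\<Phi> t) \<and> F (t, z) = local_rep cS cM (\<Phi> t) z"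
    and t: "t \<in> ball t0 \<delta>" and z: "z \<in> half_plane \<inter> ball z0 \<delta>"
  shows "(local_rep cS cM (\<Phi> t) has_derivative (\<lambda>h. pd (0, h) F (t, z))) (at z within half_plane)"
proof -
  have "(t, z) \<in> ball t0 \<delta> \<times> ball z0 \<delta>" using t z by auto
  then have F': "(F has_derivative (\<lambda>h. pd h F (t, z))) (at (t, z))" by (rule Cinf_has_derivative[OF F(1)])
  have "((\<lambda>z. (t, z)) has_derivative (\<lambda>h. (0, h))) (at z within half_plane)"
    by (auto intro!: derivative_eq_intros)
  from has_derivative_compose[OF this F']
  have "((\<lambda>z. F (t, z)) has_derivative (\<lambda>h. pd (0, h) F (t, z))) (at z within half_plane)" .
  then show ?thesis
    by (rule has_derivative_within_eq[of _ _ _ _ "ball z0 \<delta>"]) (use F(2) t z in auto)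
qed

abbreviation Drep where
  "Drep cS cM t z \<equiv> frechet_derivative (local_rep cS cM (\<Phi> t)) (at z within half_plane)"

lemma Drep_eq:
  assumes "cS \<in> AS" "Cinf (ball t0 \<delta> \<times> ball z0 \<delta>) F"
    "\<forall>t\<in>ball t0 \<delta>. \<forall>z\<in>half_plane \<inter> ball z0 \<delta>. z \<in> local_dom cS cM (\<Phi> t) \<and> F (t, z) = local_rep cS cM (\<Phi> t) z"
    "t \<in> ball t0 \<delta>" "z \<in> half_plane \<inter> ball z0 \<delta>"
  shows "Drep cS cM t z = (\<lambda>h. pd (0, h) F (t, z))"
  using rep_derivative[OF assms] assms(5) frechet_half_plane by blast

lemma Drep_has_derivative:
  assumes c: "cS \<in> AS" "cM \<in> AM" and t: "t \<in> I" and z: "z \<in> local_dom cS cM (\<Phi> t)"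
  shows "(local_rep cS cM (\<Phi> t) has_derivative Drep cS cM t z) (at z within half_plane)"
proof -
  obtain \<delta> F V G where "\<delta> > 0" "Cinf (ball t \<delta> \<times> ball z \<delta>) F"
    "\<forall>s\<in>ball t \<delta>. \<forall>y\<in>half_plane \<inter> ball z \<delta>. y \<in> local_dom cS cM (\<Phi> s) \<and> F (s, y) = local_rep cS cM (\<Phi> s) y"
    using local_extension[OF assms, of thesis] by blast
  from rep_derivative[OF c(1) this(2,3), of t z] this(1) local_dom_half_plane[OF c(1) z]
  have "(local_rep cS cM (\<Phi> t) has_derivative (\<lambda>h. pd (0, h) F (t, z))) (at z within half_plane)" by auto
  then show ?thesis using differentiableI frechet_derivative_works by blast
qed

lemma transitionM_derivative:
  assumes c: "c \<in> AM" "c' \<in> AM" and x: "x \<in> snd c ` (fst c \<inter> fst c')"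
  shows "(transition c c' has_derivative frechet_derivative (transition c c') (at x within half_space)) (at x within half_space)"
proof -
  have "smooth_on (transition c c') (snd c ` (fst c \<inter> fst c'))"
    using atlasM c unfolding smooth_atlas_def by blast
  then obtain U F where U: "open U" "x \<in> U" "\<forall>k. Ck_on k F U"
    "\<forall>y\<in>snd c ` (fst c \<inter> fst c') \<inter> U. F y = transition c c' y"
    using x unfolding smooth_on_def by blast
  have "openin (top_of_set half_space) (snd c ` (fst c \<inter> fst c'))"
    using chart_image_openin[OF chartM[OF c(1)]] chart_facts(1)[OF chartM[OF c(1)]] chart_facts(1)[OF chartM[OF c(2)]]
    by (simp add: open_Int)
  then obtain T where T: "open T" "snd c ` (fst c \<inter> fst c') = half_space \<inter> T" by (metis openin_open)
  have "(F has_derivative (\<lambda>h. pd h F x)) (at x within half_space)"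
    using Cinf_has_derivative[of U F x] U by (auto simp: Cinf_def intro: has_derivative_at_withinI)
  then have "(transition c c' has_derivative (\<lambda>h. pd h F x)) (at x within half_space)"
    by (rule has_derivative_within_eq[of _ _ _ _ "U \<inter> T"]) (use U T x in auto)
  then show ?thesis using differentiableI frechet_derivative_works by blast
qed

lemma rep_change_target:
  assumes c: "cS \<in> AS" "cM \<in> AM" "cM' \<in> AM" and t: "t \<in> I"
    and z: "z \<in> local_dom cS cM (\<Phi> t)" "z \<in> local_dom cS cM' (\<Phi> t)"
  shows "Drep cS cM' t z h = frechet_derivative (transition cM cM') (at (local_rep cS cM (\<Phi> t) z) within half_space) (Drep cS cM t z h)"
proof -
  let ?w = "local_rep cS cM (\<Phi> t)"
  obtain d1 where d1: "d1 > 0" "\<forall>s\<in>ball t d1. \<forall>y\<in>half_plane \<inter> ball z d1. y \<in> local_dom cS cM (\<Phi> s)"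
    using local_dom_open[OF c(1,2) t z(1), of thesis] by blast
  obtain d2 where d2: "d2 > 0" "\<forall>s\<in>ball t d2. \<forall>y\<in>half_plane \<inter> ball z d2. y \<in> local_dom cS cM' (\<Phi> s)"
    using local_dom_open[OF c(1,3) t z(2), of thesis] by blast
  define d where "d = min d1 d2"
  have d: "d > 0" "\<And>y. y \<in> half_plane \<inter> ball z d \<Longrightarrow> y \<in> local_dom cS cM (\<Phi> t) \<and> y \<in> local_dom cS cM' (\<Phi> t)"
    using d1 d2 by (auto simp: d_def)
  have zh: "z \<in> half_plane" using local_dom_half_plane[OF c(1) z(1)] .
  have wz: "?w y \<in> snd cM ` (fst cM \<inter> fst cM')" if "y \<in> half_plane \<inter> ball z d" for y
    using d(2)[OF that] unfolding local_dom_iff[OF c(1)] by (simp add: local_rep_def)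
  have "((\<lambda>y. transition cM cM' (?w y)) has_derivative (\<lambda>h. frechet_derivative (transition cM cM') (at (?w z) within half_space) (Drep cS cM t z h))) (at z within half_plane)"
  proof (rule has_derivative_chain_within[where w = ?w and \<tau> = "transition cM cM'" and U = "ball z d" and K = half_space
        and D = "Drep cS cM t z" and T = "frechet_derivative (transition cM cM') (at (?w z) within half_space)"])
    show "?w y \<in> half_space" if "y \<in> half_plane \<inter> ball z d" for y
      using wz[OF that] chart_facts(9)[OF chartM[OF c(2)]] by blast
    show "(transition cM cM' has_derivative frechet_derivative (transition cM cM') (at (?w z) within half_space)) (at (?w z) within half_space)"
      using wz[of z] zh d(1) by (intro transitionM_derivative c) auto
  qed (use zh d Drep_has_derivative[OF c(1,2) t z(1)] in auto)
  then have "(local_rep cS cM' (\<Phi> t) has_derivative (\<lambda>h. frechet_derivative (transition cM cM') (at (?w z) within half_space) (Drep cS cM t z h))) (at z within half_plane)"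
  proof (rule has_derivative_within_eq[of _ _ _ _ "ball z d"])
    fix y assume "y \<in> half_plane \<inter> ball z d"
    then have "\<Phi> t (chart_inv cS y) \<in> fst cM" using d(2) local_dom_iff[OF c(1)] by blast
    then show "transition cM cM' (?w y) = local_rep cS cM' (\<Phi> t) y"
      using chart_facts(3)[OF chartM[OF c(2)]] by (simp add: transition_def local_rep_def)
  qed (use zh d in auto)
  from frechet_half_plane[OF zh this] show ?thesis by simp
qed

text \<open>The definition of the pull-back metric chooses a target chart separately at each point
  and time. Differentiating requires one fixed chart, and the transformation law of the metric shows
  that the choice is immaterial.\<close>

lemma pullback_eq:
  assumes c: "cS \<in> AS" "cM \<in> AM" and t: "t \<in> I" and z: "z \<in> local_dom cS cM (\<Phi> t)"
  shows "pullback_metric AM g cS (\<Phi> t) z a b =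
    ip (g cM (local_rep cS cM (\<Phi> t) z)) (Drep cS cM t z a) (Drep cS cM t z b)"
proof -
  define p where "p = \<Phi> t (chart_inv cS z)"
  define c0 where "c0 = chart_at AM p"
  have c0: "c0 \<in> AM" "p \<in> fst c0" using chartM_at by (auto simp: c0_def)
  have z0: "z \<in> local_dom cS c0 (\<Phi> t)" using z c0 unfolding local_dom_iff[OF c(1)] p_def by blast
  have p: "p \<in> fst c0 \<inter> fst cM" using c0 z unfolding local_dom_iff[OF c(1)] p_def by blast
  have w: "local_rep cS c0 (\<Phi> t) z = snd c0 p" "local_rep cS cM (\<Phi> t) z = snd cM p"
    by (simp_all add: local_rep_def p_def)
  let ?T = "frechet_derivative (transition c0 cM) (at (snd c0 p) within half_space)"
  have "ip (g c0 (snd c0 p)) x y = ip (g cM (snd cM p)) (?T x) (?T y)" for x y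
    using metric c0 c p unfolding riemannian_metric_def Let_def by blast
  then show ?thesis
    unfolding rep_change_target[OF c(1) c0(1) c(2) t z0 z] w
    by (simp add: pullback_metric_def Let_def w flip: p_def c0_def)
qed

lemma rep_change_source:
  assumes c: "c \<in> AS" "c' \<in> AS" "cM \<in> AM" and t: "t \<in> I" and p: "p \<in> fst c" "p \<in> fst c'" "\<Phi> t p \<in> fst cM"
  shows "Drep c cM t (snd c p) h = Drep c' cM t (snd c' p) (jac c c' (snd c p) * h)"
proof -
  let ?z = "snd c p"
  note C = chart_facts[OF chart[OF c(1)]] and C' = chart_facts[OF chart[OF c(2)]]
  have tz: "transition c c' (snd c q) = snd c' q" if "q \<in> fst c" for q using C(3) that by (simp add: transition_def)
  have zS: "?z \<in> snd c ` (fst c \<inter> fst c')" using p by blast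
  have zh: "?z \<in> half_plane" using p C(9) by blast
  obtain U F where U: "open U" "?z \<in> U"
    "\<forall>y\<in>half_plane \<inter> U. y \<in> snd c ` (fst c \<inter> fst c') \<and> F y = transition c c' y"
    using transition_holomorphic[OF c(1,2) zS, of thesis] by blast
  have z': "snd c' p \<in> local_dom c' cM (\<Phi> t)" unfolding local_dom_iff[OF c(2)] using p C'(3) by simp
  have "((\<lambda>y. local_rep c' cM (\<Phi> t) (transition c c' y)) has_derivative (\<lambda>h. Drep c' cM t (snd c' p) (jac c c' ?z * h))) (at ?z within half_plane)"
  proof (rule has_derivative_chain_within[where w = "transition c c'" and \<tau> = "local_rep c' cM (\<Phi> t)" and U = U and K = half_plane
        and D = "\<lambda>h. jac c c' ?z * h" and T = "Drep c' cM t (snd c' p)"])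
    show "(local_rep c' cM (\<Phi> t) has_derivative Drep c' cM t (snd c' p)) (at (transition c c' ?z) within half_plane)"
      unfolding tz[OF p(1)] by (rule Drep_has_derivative[OF c(2,3) t z'])
    show "transition c c' y \<in> half_plane" if y: "y \<in> half_plane \<inter> U" for y
    proof -
      obtain q where "q \<in> fst c" "q \<in> fst c'" "y = snd c q" using U(3) y by blast
      then show ?thesis using tz C'(9) by auto
    qed
  qed (use zh U transition_derivative[OF c(1,2) zS] in auto)
  then have "(local_rep c cM (\<Phi> t) has_derivative (\<lambda>h. Drep c' cM t (snd c' p) (jac c c' ?z * h))) (at ?z within half_plane)"
  proof (rule has_derivative_within_eq[of _ _ _ _ U])
    fix y assume y: "y \<in> half_plane \<inter> U"
    then obtain q where q: "q \<in> fst c" "q \<in> fst c'" "y = snd c q" using U(3) by blast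
    then show "local_rep c' cM (\<Phi> t) (transition c c' y) = local_rep c cM (\<Phi> t) y"
      using C(3) C'(3) tz by (simp add: local_rep_def)
  qed (use zh U in auto)
  from frechet_half_plane[OF zh this] show ?thesis by simp
qed

section \<open>Components of the pull-back metric in a complex chart\<close>

definition hh where "hh c t z a b = pullback_metric AM g c (\<Phi> t) z a b"

lemma chart_dom:
  assumes "c \<in> AS" "z \<in> snd c ` fst c"
  obtains cM where "cM \<in> AM" "z \<in> local_dom c cM (\<Phi> t)"
  using assms chartM_at local_dom_iff by metis

lemma metric_sym: "cM \<in> AM \<Longrightarrow> x \<in> snd cM ` fst cM \<Longrightarrow> transpose (g cM x) = g cM x"
  using metric unfolding riemannian_metric_def by blast

lemma metric_pos: "cM \<in> AM \<Longrightarrow> x \<in> snd cM ` fst cM \<Longrightarrow> a \<noteq> 0 \<Longrightarrow> 0 < ip (g cM x) a a"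
  using metric unfolding riemannian_metric_def by blast

lemma hh_expand:
  assumes c: "c \<in> AS" "z \<in> snd c ` fst c" and t: "t \<in> I"
  shows "hh c t z (Complex a b) (Complex a' b') =
    a * a' * hh c t z 1 1 + (a * b' + b * a') * hh c t z 1 \<i> + b * b' * hh c t z \<i> \<i>"
    and "0 \<le> hh c t z v v"
proof -
  obtain cM where cM: "cM \<in> AM" "z \<in> local_dom c cM (\<Phi> t)" using chart_dom[OF c, of t thesis] by blast
  let ?G = "g cM (local_rep c cM (\<Phi> t) z)" and ?D = "Drep c cM t z"
  have e: "hh c t z v w = ip ?G (?D v) (?D w)" for v w
    unfolding hh_def by (rule pullback_eq[OF c(1) cM(1) t cM(2)])
  have x: "local_rep c cM (\<Phi> t) z \<in> snd cM ` fst cM" by (rule local_rep_in[OF cM(1) c(1) cM(2)])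
  have l: "linear ?D" using Drep_has_derivative[OF c(1) cM(1) t cM(2)] has_derivative_linear by blast
  have D: "?D (Complex a b) = a *\<^sub>R ?D 1 + b *\<^sub>R ?D \<i>" for a b
  proof -
    have "Complex a b = a *\<^sub>R 1 + b *\<^sub>R \<i>" by (simp add: complex_eq_iff)
    then show ?thesis using l by (simp add: linear_add linear_scale)
  qed
  have "ip ?G (?D \<i>) (?D 1) = ip ?G (?D 1) (?D \<i>)" by (rule ip_commute[OF metric_sym[OF cM(1) x]])
  then show "hh c t z (Complex a b) (Complex a' b') =
    a * a' * hh c t z 1 1 + (a * b' + b * a') * hh c t z 1 \<i> + b * b' * hh c t z \<i> \<i>"
    unfolding e D by (simp add: ip_linear algebra_simps)
  have "0 \<le> ip ?G y y" for y
    by (cases "y = 0") (use metric_pos[OF cM(1) x] in \<open>auto simp: ip_def intro: less_imp_le\<close>)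
  then show "0 \<le> hh c t z v v" by (simp add: e)
qed

lemma hh_cauchy_schwarz:
  assumes c: "c \<in> AS" "z \<in> snd c ` fst c" and t: "t \<in> I"
  shows "(hh c t z 1 \<i>)\<^sup>2 \<le> hh c t z 1 1 * hh c t z \<i> \<i>"
proof (rule discriminant_le)
  fix x y :: real
  have "0 \<le> hh c t z (Complex x y) (Complex x y)" by (rule hh_expand(2)[OF assms])
  then show "0 \<le> hh c t z 1 1 * x\<^sup>2 + 2 * hh c t z 1 \<i> * (x * y) + hh c t z \<i> \<i> * y\<^sup>2"
    unfolding hh_expand(1)[OF assms] by (simp add: algebra_simps power2_eq_square)
qed

lemma hh_change_chart:
  assumes c: "c \<in> AS" "c' \<in> AS" and p: "p \<in> fst c" "p \<in> fst c'" and t: "t \<in> I"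
  shows "hh c t (snd c p) a b = hh c' t (snd c' p) (jac c c' (snd c p) * a) (jac c c' (snd c p) * b)"
proof -
  define cM where "cM = chart_at AM (\<Phi> t p)"
  have cM: "cM \<in> AM" "\<Phi> t p \<in> fst cM" using chartM_at by (auto simp: cM_def)
  have z: "snd c p \<in> local_dom c cM (\<Phi> t)" "snd c' p \<in> local_dom c' cM (\<Phi> t)"
    using cM p chart_facts(3)[OF chart] c by (auto simp: local_dom_iff)
  have w: "local_rep c cM (\<Phi> t) (snd c p) = local_rep c' cM (\<Phi> t) (snd c' p)"
    using p c chart_facts(3)[OF chart] by (simp add: local_rep_def)
  show ?thesis
    unfolding hh_def pullback_eq[OF c(1) cM(1) t z(1)] pullback_eq[OF c(2) cM(1) t z(2)] w
      rep_change_source[OF c cM(1) t p cM(2)] ..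
qed

definition ee where "ee c t z = (hh c t z 1 1 + hh c t z \<i> \<i>) / 2"
definition al where "al c t z = (hh c t z 1 1 - hh c t z \<i> \<i>) / 2"
definition be where "be c t z = hh c t z 1 \<i>"

text \<open>The trace scales with the squared modulus of the Jacobian, while
  \<open>al - \<i> * be\<close> is multiplied by the square of the Jacobian itself: it is, up to a
  factor 2, the coefficient of the Hopf differential, a quadratic differential.\<close>

lemma change_chart:
  assumes c: "c \<in> AS" "c' \<in> AS" and p: "p \<in> fst c" "p \<in> fst c'" and t: "t \<in> I"
    and J: "jac c c' (snd c p) = Complex x y"
  shows "ee c t (snd c p) = (x\<^sup>2 + y\<^sup>2) * ee c' t (snd c' p)"
    "al c t (snd c p) = (x\<^sup>2 - y\<^sup>2) * al c' t (snd c' p) + 2 * x * y * be c' t (snd c' p)"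
    "be c t (snd c p) = (x\<^sup>2 - y\<^sup>2) * be c' t (snd c' p) - 2 * x * y * al c' t (snd c' p)"
proof -
  have z': "snd c' p \<in> snd c' ` fst c'" using p by blast
  have J1: "Complex x y * 1 = Complex x y" "Complex x y * \<i> = Complex (- y) x"
    by (auto simp: complex_eq_iff)
  note h = hh_change_chart[OF c p t, unfolded J] hh_expand(1)[OF c(2) z' t]
  show "ee c t (snd c p) = (x\<^sup>2 + y\<^sup>2) * ee c' t (snd c' p)"
    "al c t (snd c p) = (x\<^sup>2 - y\<^sup>2) * al c' t (snd c' p) + 2 * x * y * be c' t (snd c' p)"
    "be c t (snd c p) = (x\<^sup>2 - y\<^sup>2) * be c' t (snd c' p) - 2 * x * y * al c' t (snd c' p)"
    unfolding ee_def al_def be_def h(1) J1 h(2) by (simp_all add: field_simps power2_eq_square)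
qed

text \<open>The components of the pull-back metric are restrictions of functions smooth on a full
  product of balls, so they can be differentiated in time and along the surface also at boundary
  points.\<close>

lemma hh_local:
  assumes c: "c \<in> AS" and t0: "t0 \<in> I" and z0: "z0 \<in> snd c ` fst c"
  obtains \<delta> H where "\<delta> > 0" "ball t0 \<delta> \<subseteq> I" "half_plane \<inter> ball z0 \<delta> \<subseteq> snd c ` fst c"
    "\<And>a b. Cinf (ball t0 \<delta> \<times> ball z0 \<delta>) (H a b)"
    "\<And>t z a b. t \<in> ball t0 \<delta> \<Longrightarrow> z \<in> half_plane \<inter> ball z0 \<delta> \<Longrightarrow> hh c t z a b = H a b (t, z)"
proof -
  obtain cM where cM: "cM \<in> AM" "z0 \<in> local_dom c cM (\<Phi> t0)" using chart_dom[OF c z0, of t0 thesis] by blast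
  obtain \<delta> F V G where F: "\<delta> > 0" "ball t0 \<delta> \<subseteq> I" "Cinf (ball t0 \<delta> \<times> ball z0 \<delta>) F"
    "\<forall>t\<in>ball t0 \<delta>. \<forall>z\<in>half_plane \<inter> ball z0 \<delta>. z \<in> local_dom c cM (\<Phi> t) \<and> F (t, z) = local_rep c cM (\<Phi> t) z"
    "Cinf V G" "F ` (ball t0 \<delta> \<times> ball z0 \<delta>) \<subseteq> V" "\<forall>x\<in>V \<inter> snd cM ` fst cM. G x = g cM x"
    using local_extension[OF c cM(1) t0 cM(2), of thesis] by blast
  define H where "H a b x = ip (G (F x)) (pd (0, a) F x) (pd (0, b) F x)" for a b x
  show ?thesis
  proof (rule that[of \<delta> H])
    show "half_plane \<inter> ball z0 \<delta> \<subseteq> snd c ` fst c"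
    proof
      fix z assume "z \<in> half_plane \<inter> ball z0 \<delta>"
      then have "z \<in> local_dom c cM (\<Phi> t0)" using F(1,4) by force
      then show "z \<in> snd c ` fst c" using local_dom_iff[OF c] by blast
    qed
    show "Cinf (ball t0 \<delta> \<times> ball z0 \<delta>) (H a b)" for a b
      unfolding H_def[abs_def] by (intro Cinf_ip Cinf_pd F(3) Cinf_compose[OF F(5,3,6)])
    fix t z a b assume tz: "t \<in> ball t0 \<delta>" "z \<in> half_plane \<inter> ball z0 \<delta>"
    then have l: "z \<in> local_dom c cM (\<Phi> t)" "F (t, z) = local_rep c cM (\<Phi> t) z" "t \<in> I" using F(2,4) by auto
    have "(t, z) \<in> ball t0 \<delta> \<times> ball z0 \<delta>" using tz by auto
    then have "F (t, z) \<in> V" using F(6) by blast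
    then have "G (F (t, z)) = g cM (local_rep c cM (\<Phi> t) z)"
      using F(7) local_rep_in[OF cM(1) c l(1)] by (metis IntI l(2))
    then show "hh c t z a b = H a b (t, z)"
      unfolding hh_def pullback_eq[OF c cM(1) l(3) l(1)] H_def Drep_eq[OF c F(3,4) tz] by simp
  qed (use F in auto)
qed

end

lemma semidefinite_path_mono:
  assumes "semidefinite_path \<epsilon> M e e1 e2 a a1 a2 b b1 b2" "0 < \<epsilon>'" "\<epsilon>' \<le> \<epsilon>"
  shows "semidefinite_path \<epsilon>' M e e1 e2 a a1 a2 b b1 b2"
  using assms unfolding semidefinite_path_def by auto

lemma Cinf_line:
  fixes F :: "'a::euclidean_space \<Rightarrow> real"
  assumes F: "Cinf U F" and l: "(l has_derivative (\<lambda>s. s *\<^sub>R d)) (at t)" and U: "l t \<in> U"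
  shows "((\<lambda>s. F (l s)) has_real_derivative pd d F (l t)) (at t)"
proof -
  have "((\<lambda>s. F (l s)) has_derivative (\<lambda>s. pd (s *\<^sub>R d) F (l t))) (at t)"
    using has_derivative_compose[OF l Cinf_has_derivative[OF F U]] .
  moreover have "(\<lambda>s. pd (s *\<^sub>R d) F (l t)) = (*) (pd d F (l t))"
    using linear_scale[OF pd_linear[OF F U]] by (simp add: fun_eq_iff mult.commute)
  ultimately show ?thesis by (simp add: has_field_derivative_def)
qed

lemma Cinf_iterate_pd: "Cinf U f \<Longrightarrow> Cinf U ((pd h ^^ n) f)"
  by (induction n) (auto intro: Cinf_pd)

text \<open>Positivity at \<open>x0\<close> has a positive minimum \<open>c\<close> on the compact
  unit sphere. By continuity the form changes by at most \<open>c / 2\<close> times the squared norm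
  nearby, so half of the bound survives.\<close>

lemma ip_lower_bound:
  fixes \<gamma> :: "'a::metric_space \<Rightarrow> real^3^3"
  assumes cont: "isCont \<gamma> x0" and pos: "\<And>v. v \<noteq> 0 \<Longrightarrow> 0 < ip (\<gamma> x0) v v"
  obtains \<kappa> r where "\<kappa> > 0" "r > 0" "\<And>x v. dist x x0 < r \<Longrightarrow> \<kappa> * (norm v)\<^sup>2 \<le> ip (\<gamma> x) v v"
proof -
  have bl: "bounded_bilinear (\<lambda>v w. ip (\<gamma> x0) v w)"
    unfolding bilinear_conv_bounded_bilinear[symmetric] bilinear_def linear_iff by (simp add: ip_linear)
  have "continuous_on (sphere 0 1) (\<lambda>v. ip (\<gamma> x0) v v)"
    by (intro bounded_bilinear.continuous_on[OF bl] continuous_intros)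
  moreover have "sphere (0 :: real^3) 1 \<noteq> {}" by (auto intro!: exI[of _ "axis 1 1"])
  ultimately obtain v0 where v0: "v0 \<in> sphere 0 1" "\<And>v. v \<in> sphere 0 1 \<Longrightarrow> ip (\<gamma> x0) v0 v0 \<le> ip (\<gamma> x0) v v"
    using continuous_attains_inf[OF compact_sphere] by blast
  define c where "c = ip (\<gamma> x0) v0 v0"
  have c: "c > 0" unfolding c_def using v0(1) by (intro pos) auto
  have lower: "c * (norm v)\<^sup>2 \<le> ip (\<gamma> x0) v v" for v
  proof (cases "v = 0")
    case False
    have "c \<le> ip (\<gamma> x0) (v /\<^sub>R norm v) (v /\<^sub>R norm v)" unfolding c_def using False by (intro v0(2)) simp
    also have "\<dots> = ip (\<gamma> x0) v v / (norm v)\<^sup>2" by (simp add: ip_linear power2_eq_square divide_simps)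
    finally show ?thesis using False by (simp add: field_simps)
  qed (simp add: ip_def)
  obtain K where K: "K > 0" "\<And>(A :: real^3^3) (v :: real^3). norm (A *v v) \<le> norm A * norm v * K"
    using bounded_bilinear.pos_bounded[OF bounded_bilinear_matrix_vector] by metis
  have "c / (2 * K) > 0" using c K by simp
  then obtain r where r: "r > 0" "\<And>x. dist x x0 < r \<Longrightarrow> dist (\<gamma> x) (\<gamma> x0) < c / (2 * K)"
    using cont unfolding continuous_at_eps_delta by blast
  have "c / 2 * (norm v)\<^sup>2 \<le> ip (\<gamma> x) v v" if x: "dist x x0 < r" for x v
  proof -
    have "\<bar>ip (\<gamma> x) v v - ip (\<gamma> x0) v v\<bar> = \<bar>v \<bullet> ((\<gamma> x - \<gamma> x0) *v v)\<bar>"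
      by (simp add: ip_def matrix_vector_mult_diff_rdistrib inner_diff_right)
    also have "\<dots> \<le> norm v * norm ((\<gamma> x - \<gamma> x0) *v v)" by (rule Cauchy_Schwarz_ineq2)
    also have "\<dots> \<le> norm v * (norm (\<gamma> x - \<gamma> x0) * norm v * K)" by (intro mult_left_mono K) auto
    also have "\<dots> = norm (\<gamma> x - \<gamma> x0) * (K * (norm v)\<^sup>2)" by (simp add: power2_eq_square)
    also have "\<dots> \<le> c / (2 * K) * (K * (norm v)\<^sup>2)"
      using r(2)[OF x] K(1) by (intro mult_right_mono) (auto simp: dist_norm)
    also have "\<dots> = c / 2 * (norm v)\<^sup>2" using K(1) by simp
    finally show ?thesis using lower[of v] by linarith
  qed
  then show ?thesis using that[of "c / 2" r] c r(1) by auto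
qed

section \<open>Area and energy densities of the family\<close>

context variation
begin

lemma hh_continuous:
  assumes c: "c \<in> AS" and t: "t \<in> I"
  shows "continuous_on (snd c ` fst c) (\<lambda>z. hh c t z a b)"
  unfolding continuous_on_eq_continuous_within
proof
  fix z0 assume z0: "z0 \<in> snd c ` fst c"
  obtain \<delta> H where H: "\<delta> > 0" "ball t \<delta> \<subseteq> I" "half_plane \<inter> ball z0 \<delta> \<subseteq> snd c ` fst c"
    "\<And>a b. Cinf (ball t \<delta> \<times> ball z0 \<delta>) (H a b)"
    "\<And>s z a b. s \<in> ball t \<delta> \<Longrightarrow> z \<in> half_plane \<inter> ball z0 \<delta> \<Longrightarrow> hh c s z a b = H a b (s, z)"
    by (rule hh_local[OF c t z0]) (rule that)
  have sub: "snd c ` fst c \<subseteq> half_plane" using chart_facts(9)[OF chart[OF c]] .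
  have "isCont (H a b) (t, z0)"
    using Cinf_continuous_on[OF H(4)] Cinf_open[OF H(4)] H(1) by (simp add: continuous_on_eq_continuous_at)
  then have "((\<lambda>z. H a b (t, z)) \<longlongrightarrow> H a b (t, z0)) (at z0)"
    using isCont_o2[of z0 "\<lambda>z. (t, z)" "H a b"] unfolding isCont_def by (simp add: tendsto_Pair)
  moreover have "hh c t z0 a b = H a b (t, z0)" using H(5)[of t z0 a b] H(1) z0 sub by auto
  ultimately have "((\<lambda>z. H a b (t, z)) \<longlongrightarrow> hh c t z0 a b) (at z0 within snd c ` fst c)"
    by (metis tendsto_within_subset subset_UNIV)
  moreover have "\<forall>\<^sub>F z in at z0 within snd c ` fst c. H a b (t, z) = hh c t z a b"
    unfolding eventually_at_topological
    using H(1) H(5)[of t] sub by (intro exI[of _ "ball z0 \<delta>"]) auto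
  ultimately show "continuous (at z0 within snd c ` fst c) (\<lambda>z. hh c t z a b)"
    unfolding continuous_within by (rule Lim_transform_eventually)
qed

lemma det_eq: "(ee c t z)\<^sup>2 - (al c t z)\<^sup>2 - (be c t z)\<^sup>2 = hh c t z 1 1 * hh c t z \<i> \<i> - (hh c t z 1 \<i>)\<^sup>2"
  by (simp add: ee_def al_def be_def field_simps power2_eq_square)

lemma det_nonneg:
  "c \<in> AS \<Longrightarrow> z \<in> snd c ` fst c \<Longrightarrow> t \<in> I \<Longrightarrow> 0 \<le> (ee c t z)\<^sup>2 - (al c t z)\<^sup>2 - (be c t z)\<^sup>2"
  unfolding det_eq using hh_cauchy_schwarz by simp

lemma ee_nonneg: "c \<in> AS \<Longrightarrow> z \<in> snd c ` fst c \<Longrightarrow> t \<in> I \<Longrightarrow> 0 \<le> ee c t z"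
  unfolding ee_def using hh_expand(2)[of c z t] by simp

lemma continuous_components:
  assumes "c \<in> AS" "t \<in> I"
  shows "continuous_on (snd c ` fst c) (ee c t)" "continuous_on (snd c ` fst c) (al c t)"
    "continuous_on (snd c ` fst c) (be c t)"
  unfolding ee_def[abs_def] al_def[abs_def] be_def[abs_def]
  by (intro continuous_intros hh_continuous assms; simp)+

definition area_dens where "area_dens t c z = sqrt ((ee c t z)\<^sup>2 - (al c t z)\<^sup>2 - (be c t z)\<^sup>2)"
definition energy_dens where "energy_dens t c z = hh c t z 1 1 + hh c t z \<i> \<i>"

lemma energy_dens_eq: "energy_dens t c z = 2 * ee c t z"
  by (simp add: energy_dens_def ee_def)

lemma density_area: assumes t: "t \<in> I" shows "density (area_dens t)"
  unfolding density_def
proof (intro conjI ballI)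
  fix c assume c: "c \<in> AS"
  show "continuous_on (snd c ` fst c) (area_dens t c)"
    unfolding area_dens_def[abs_def] by (intro continuous_intros continuous_components c t)
  show "0 \<le> area_dens t c z" if "z \<in> snd c ` fst c" for z
    using det_nonneg[OF c that t] by (simp add: area_dens_def)
  fix c' p assume c': "c' \<in> AS" and p: "p \<in> fst c \<inter> fst c'"
  obtain x y where J: "jac c c' (snd c p) = Complex x y" by (cases "jac c c' (snd c p)")
  have p': "p \<in> fst c" "p \<in> fst c'" using p by auto
  note e = change_chart[OF c c' p' t J]
  let ?E = "ee c' t (snd c' p)" and ?A = "al c' t (snd c' p)" and ?B = "be c' t (snd c' p)"
  have "(ee c t (snd c p))\<^sup>2 - (al c t (snd c p))\<^sup>2 - (be c t (snd c p))\<^sup>2 = (?E\<^sup>2 - ?A\<^sup>2 - ?B\<^sup>2) * (x\<^sup>2 + y\<^sup>2)\<^sup>2"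
    unfolding e by (simp add: algebra_simps power2_eq_square)
  moreover have "sqrt ((x\<^sup>2 + y\<^sup>2)\<^sup>2) = x\<^sup>2 + y\<^sup>2" by simp
  ultimately show "area_dens t c (snd c p) = area_dens t c' (snd c' p) * (cmod (jac c c' (snd c p)))\<^sup>2"
    by (simp add: area_dens_def J real_sqrt_mult cmod_power2)
qed

lemma density_energy: assumes t: "t \<in> I" shows "density (energy_dens t)"
  unfolding density_def
proof (intro conjI ballI)
  fix c assume c: "c \<in> AS"
  show "continuous_on (snd c ` fst c) (energy_dens t c)"
    unfolding energy_dens_eq[abs_def] by (intro continuous_intros continuous_components c t)
  show "0 \<le> energy_dens t c z" if "z \<in> snd c ` fst c" for z
    using ee_nonneg[OF c that t] by (simp add: energy_dens_eq)
  fix c' p assume c': "c' \<in> AS" and p: "p \<in> fst c \<inter> fst c'"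
  obtain x y where J: "jac c c' (snd c p) = Complex x y" by (cases "jac c c' (snd c p)")
  show "energy_dens t c (snd c p) = energy_dens t c' (snd c' p) * (cmod (jac c c' (snd c p)))\<^sup>2"
    using change_chart(1)[OF c c' _ _ t J] p by (simp add: energy_dens_eq J cmod_power2)
qed

lemma area_measure_eq: "area_measure AS AM g (\<Phi> t) = density_measure AS (area_dens t)"
  unfolding area_measure_def area_dens_def[abs_def] Let_def det_eq hh_def ..

lemma energy_eq: "energy AS AM g (\<Phi> t) = 1 / 2 * measure (density_measure AS (energy_dens t)) UNIV"
  unfolding energy_def energy_dens_def[abs_def] Let_def hh_def ..

end

section \<open>Finite order of the determinant and uniform local paths\<close>

locale conformal_variation = variation AS AM g I \<Phi>
  for AS :: "('s::t2_space, complex) chart set" and AM :: "('m::t2_space, real^3) chart set"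
    and g I \<Phi> +
  assumes conformal: "branched_conformal_immersion AS AM g (\<Phi> 0)"
begin

lemma conformal_at:
  assumes "c \<in> AS" "z \<in> snd c ` fst c"
  shows "hh c 0 z \<i> \<i> = hh c 0 z 1 1" "hh c 0 z 1 \<i> = 0"
    "al c 0 z = 0" "be c 0 z = 0" "ee c 0 z = hh c 0 z 1 1"
proof -
  have "\<forall>cS\<in>AS. \<forall>z\<in>snd cS ` fst cS. let h = pullback_metric AM g cS (\<Phi> 0) z in
        h 1 1 = h \<i> \<i> \<and> h 1 \<i> = 0"
    using conformal unfolding branched_conformal_immersion_def by blast
  then have "hh c 0 z \<i> \<i> = hh c 0 z 1 1 \<and> hh c 0 z 1 \<i> = 0"
    using assms unfolding Let_def hh_def by metis
  then show "hh c 0 z \<i> \<i> = hh c 0 z 1 1" "hh c 0 z 1 \<i> = 0"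
    "al c 0 z = 0" "be c 0 z = 0" "ee c 0 z = hh c 0 z 1 1"
    by (simp_all add: al_def be_def ee_def)
qed

text \<open>If all derivatives of the determinant along the real axis vanish at a branch point, then \<open>u\<close> is
  constant along that axis up to an error of higher order than allowed by the branch point condition.\<close>

lemma finite_order:
  fixes D :: "real \<times> complex \<Rightarrow> real"
  assumes c: "c \<in> AS" and z0: "z0 \<in> snd c ` fst c" and d: "\<delta> > 0"
    and dom: "half_plane \<inter> ball z0 \<delta> \<subseteq> snd c ` fst c"
    and CD: "Cinf (ball 0 \<delta> \<times> ball z0 \<delta>) D"
    and D: "\<And>z. z \<in> half_plane \<inter> ball z0 \<delta> \<Longrightarrow> D (0, z) = (hh c 0 z 1 1)\<^sup>2"
  shows "\<exists>m. ((pd (0, 1)) ^^ m) D (0, z0) \<noteq> 0"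
proof (rule ccontr)
  assume "\<not> ?thesis"
  then have zero: "((pd (0, 1)) ^^ m) D (0, z0) = 0" for m by blast
  define \<psi> where "\<psi> m s = ((pd (0, 1)) ^^ m) D (0, z0 + of_real s)" for m and s :: real
  have z0h: "z0 \<in> half_plane" using z0 chart_facts(9)[OF chart[OF c]] by blast
  have line: "((\<lambda>s. (0 :: real, z0 + complex_of_real s)) has_derivative (\<lambda>s. s *\<^sub>R (0, 1))) (at s)" for s
    by (rule has_derivative_eq_rhs, (rule derivative_eq_intros refl)+) (simp add: scaleR_conv_of_real fun_eq_iff)
  \<comment> \<open>Horizontal segments stay in the half-plane even when \<open>z0\<close> is a
    boundary point, which is why the real direction is used throughout.\<close>
  have near: "z0 + of_real s \<in> half_plane" "\<bar>s\<bar> < e \<Longrightarrow> z0 + of_real s \<in> ball z0 e" for s e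
    using z0h by (auto simp: half_plane_def dist_norm)
  have \<psi>': "(\<psi> m has_real_derivative \<psi> (Suc m) s) (at s)" if "\<bar>s\<bar> < \<delta>" for m s
    unfolding \<psi>_def[abs_def] funpow.simps o_apply
    by (rule Cinf_line[OF Cinf_iterate_pd[OF CD] line]) (use near that d in auto)
  have h0: "hh c 0 z0 1 1 = 0" using zero[of 0] D[of z0] z0h d by simp
  obtain cM where cM: "cM \<in> AM" "z0 \<in> local_dom c cM (\<Phi> 0)" using chart_dom[OF c z0, of 0 thesis] by blast
  let ?w = "local_rep c cM (\<Phi> 0)"
  have xin: "?w z0 \<in> snd cM ` fst cM" by (rule local_rep_in[OF cM(1) c cM(2)])
  \<comment> \<open>The metric is definite, so vanishing of the pull-back form on a vector forces
    its image to vanish. Hence \<open>z0\<close> is critical and the branch point expansion is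
    available.\<close>
  have DD: "Drep c cM 0 z0 v = 0" if "hh c 0 z0 v v = 0" for v
  proof (rule ccontr)
    assume "Drep c cM 0 z0 v \<noteq> 0"
    then have "0 < ip (g cM (?w z0)) (Drep c cM 0 z0 v) (Drep c cM 0 z0 v)" by (rule metric_pos[OF cM(1) xin])
    then show False using that unfolding hh_def pullback_eq[OF c cM(1) I(2) cM(2)] by simp
  qed
  have "Drep c cM 0 z0 = (\<lambda>_. 0)"
  proof
    fix v :: complex
    have l: "linear (Drep c cM 0 z0)"
      using Drep_has_derivative[OF c cM(1) I(2) cM(2)] has_derivative_linear by blast
    have v: "Re v *\<^sub>R 1 + Im v *\<^sub>R \<i> = v" by (simp add: complex_eq_iff)
    have "Drep c cM 0 z0 (Re v *\<^sub>R 1 + Im v *\<^sub>R \<i>) = Re v *\<^sub>R Drep c cM 0 z0 1 + Im v *\<^sub>R Drep c cM 0 z0 \<i>"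
      by (simp only: linear_add[OF l] linear_scale[OF l])
    then show "Drep c cM 0 z0 v = 0" unfolding v using DD h0 conformal_at(1)[OF c z0] by simp
  qed
  moreover have p: "chart_inv c z0 \<in> fst c" "snd c (chart_inv c z0) = z0" "\<Phi> 0 (chart_inv c z0) \<in> fst cM"
    using chart_facts(4,5)[OF chart[OF c] z0] cM(2) unfolding local_dom_iff[OF c] by auto
  ultimately have "chart_inv c z0 \<in> critical_set AS AM (\<Phi> 0)"
    unfolding critical_set_def using c cM(1) by (intro CollectI bexI[of _ c] bexI[of _ cM]) simp_all
  then have "branch_point_at ?w (local_dom c cM (\<Phi> 0)) z0"
    using conformal c cM(1) p unfolding branched_conformal_immersion_def by metis
  then obtain k a b where k: "independent {a, b}" and
    lim: "((\<lambda>z. (?w z - ?w z0 - Re ((z - z0) ^ (k + 1)) *\<^sub>R a - Im ((z - z0) ^ (k + 1)) *\<^sub>R b)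
             /\<^sub>R norm (z - z0) ^ (k + 1)) \<longlongrightarrow> 0) (at z0 within local_dom c cM (\<Phi> 0))"
    unfolding branch_point_at_def by blast
  have a: "a \<noteq> 0" using k dependent_zero by blast
  obtain \<delta>1 F V G where F: "\<delta>1 > 0" "ball 0 \<delta>1 \<subseteq> I" "Cinf (ball 0 \<delta>1 \<times> ball z0 \<delta>1) F"
    "\<forall>t\<in>ball 0 \<delta>1. \<forall>z\<in>half_plane \<inter> ball z0 \<delta>1. z \<in> local_dom c cM (\<Phi> t) \<and> F (t, z) = local_rep c cM (\<Phi> t) z"
    "Cinf V G" "F ` (ball 0 \<delta>1 \<times> ball z0 \<delta>1) \<subseteq> V" "\<forall>x\<in>V \<inter> snd cM ` fst cM. G x = g cM x"
    using local_extension[OF c cM(1) I(2) cM(2), of thesis] by blast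
  have Gg: "G (F (0, z)) = g cM (?w z) \<and> z \<in> local_dom c cM (\<Phi> 0) \<and> F (0, z) = ?w z"
    if "z \<in> half_plane \<inter> ball z0 \<delta>1" for z
  proof -
    have l: "z \<in> local_dom c cM (\<Phi> 0)" "F (0, z) = ?w z" using F(1,4) that by auto
    have "(0, z) \<in> ball 0 \<delta>1 \<times> ball z0 \<delta>1" using F(1) that by auto
    then have "F (0, z) \<in> V" using F(6) by blast
    then show ?thesis using F(7) local_rep_in[OF cM(1) c l(1)] l by (metis IntI)
  qed
  have "isCont (\<lambda>x. G (F x)) (0, z0)"
    using Cinf_continuous_on[OF Cinf_compose[OF F(5,3,6)]] Cinf_open[OF F(3)] F(1)
    by (simp add: continuous_on_eq_continuous_at)
  then have "isCont (\<lambda>z. G (F (0, z))) z0" using isCont_o2[of z0 "\<lambda>z. (0, z)" "\<lambda>x. G (F x)"] by simp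
  moreover have "0 < ip (G (F (0, z0))) v v" if "v \<noteq> 0" for v
  proof -
    have "z0 \<in> half_plane \<inter> ball z0 \<delta>1" using z0h F(1) by simp
    from conjunct1[OF Gg[OF this]] have "G (F (0, z0)) = g cM (?w z0)" .
    then show ?thesis using metric_pos[OF cM(1) xin that] by (simp only:)
  qed
  ultimately obtain \<kappa> r1 where \<kappa>: "\<kappa> > 0" "r1 > 0" "\<And>z v. dist z z0 < r1 \<Longrightarrow> \<kappa> * (norm v)\<^sup>2 \<le> ip (G (F (0, z))) v v"
    using ip_lower_bound[of z0 "\<lambda>z. G (F (0, z))" thesis] by blast
  define r where "r = min \<delta> (min \<delta>1 r1) / 2"
  have r: "r > 0" "r < \<delta>" "r < \<delta>1" "r < r1" using d F(1) \<kappa>(2) by (auto simp: r_def min_def)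
  \<comment> \<open>Maclaurin bounds the square of \<open>hh c 0 z 1 1\<close> by a multiple of
    \<open>x ^ n\<close>. Two square roots turn this into a bound \<open>K * x ^ (k + 1)\<close> for
    the velocity of \<open>f\<close>, and integration gives an increment of order
    \<open>x ^ (k + 2)\<close>, one power more than the branch point expansion allows.\<close>
  define n where "n = 4 * k + 4"
  have "continuous_on {0..r} (\<psi> n)"
    using r by (intro continuous_at_imp_continuous_on ballI DERIV_isCont[OF \<psi>']) auto
  then have "bounded (\<psi> n ` {0..r})" by (intro compact_imp_bounded compact_continuous_image) auto
  then obtain C where C: "C > 0" "\<And>s. s \<in> {0..r} \<Longrightarrow> \<bar>\<psi> n s\<bar> \<le> C"
    unfolding bounded_pos by auto
  have hb: "(hh c 0 (z0 + of_real x) 1 1)\<^sup>2 \<le> C * x ^ n" if x: "0 < x" "x \<le> r" for x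
  proof -
    have "\<exists>s>0. s < x \<and> \<psi> 0 x = (\<Sum>m<n. \<psi> m 0 / fact m * x ^ m) + \<psi> n s / fact n * x ^ n"
      by (rule Maclaurin[of x n \<psi> "\<psi> 0"]) (use x r \<psi>' in \<open>auto simp: n_def\<close>)
    then obtain s where s: "s > 0" "s < x" "\<psi> 0 x = \<psi> n s / fact n * x ^ n"
      using zero by (auto simp: \<psi>_def)
    have "\<bar>\<psi> n s\<bar> / fact n \<le> C / 1"
      using C s x by (intro frac_le) (auto simp: fact_ge_1)
    then have "\<psi> n s / fact n \<le> C" by (simp add: abs_le_iff divide_le_eq)
    then have "\<psi> n s / fact n * x ^ n \<le> C * x ^ n" using x by (intro mult_right_mono) auto
    moreover have "\<psi> 0 x = (hh c 0 (z0 + of_real x) 1 1)\<^sup>2"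
      unfolding \<psi>_def using D[of "z0 + of_real x"] near[of x] x r by simp
    ultimately show ?thesis using s(3) by simp
  qed
  define K where "K = sqrt (sqrt C / \<kappa>)"
  have K: "K \<ge> 0" using C(1) \<kappa>(1) by (simp add: K_def)
  define f where "f s = F (0, z0 + of_real s)" for s
  have fd: "(f has_derivative (\<lambda>s. s *\<^sub>R pd (0, 1) F (0, z0 + of_real x))) (at x)" if "\<bar>x\<bar> < \<delta>1" for x
  proof -
    have m: "(0, z0 + of_real x) \<in> ball 0 \<delta>1 \<times> ball z0 \<delta>1" using near that F(1) by auto
    have "(f has_derivative (\<lambda>s. pd (s *\<^sub>R (0, 1)) F (0, z0 + of_real x))) (at x)"
      unfolding f_def[abs_def] by (rule has_derivative_compose[OF line Cinf_has_derivative[OF F(3) m]])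
    then show ?thesis unfolding linear_scale[OF pd_linear[OF F(3) m]] .
  qed
  have f'b: "norm (pd (0, 1) F (0, z0 + of_real x)) \<le> K * x ^ (k + 1)" if x: "0 < x" "x \<le> r" for x
  proof -
    let ?z = "z0 + of_real x" and ?v = "pd (0, 1) F (0, z0 + of_real x)"
    have zz: "?z \<in> half_plane \<inter> ball z0 \<delta>1" "dist ?z z0 < r1" using near[of x] x r by (auto simp: dist_norm)
    have zl: "?z \<in> local_dom c cM (\<Phi> 0)" using Gg[OF zz(1)] by blast
    have Dz: "Drep c cM 0 ?z 1 = ?v" using Drep_eq[OF c F(3,4) _ zz(1)] F(1) by simp
    have "\<kappa> * (norm ?v)\<^sup>2 \<le> ip (G (F (0, ?z))) ?v ?v" by (rule \<kappa>(3)[OF zz(2)])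
    also have "\<dots> = hh c 0 ?z 1 1"
      unfolding hh_def pullback_eq[OF c cM(1) I(2) zl] Dz conjunct1[OF Gg[OF zz(1)]] ..
    also have "\<dots> \<le> sqrt (C * x ^ n)"
      using hb[OF x] by (intro real_le_rsqrt)
    also have "\<dots> = sqrt C * (x ^ (k + 1))\<^sup>2"
    proof -
      have "x ^ n = ((x ^ (k + 1))\<^sup>2)\<^sup>2"
        unfolding power_mult[symmetric] n_def by (rule arg_cong[where f = "power x"]) simp
      then show ?thesis by (simp only: real_sqrt_mult real_sqrt_abs abs_power2)
    qed
    finally have "(norm ?v)\<^sup>2 \<le> sqrt C / \<kappa> * (x ^ (k + 1))\<^sup>2" using \<kappa>(1) by (simp add: field_simps)
    also have "\<dots> = (K * x ^ (k + 1))\<^sup>2" using C(1) \<kappa>(1) by (simp add: K_def power_mult_distrib)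
    finally have sq: "(norm ?v)\<^sup>2 \<le> (K * x ^ (k + 1))\<^sup>2" .
    have "0 \<le> K * x ^ (k + 1)" using K x by (intro mult_nonneg_nonneg zero_le_power) auto
    then show ?thesis by (rule power2_le_imp_le[OF sq])
  qed
  have fb: "norm (f x - f 0) \<le> K * x * x ^ (k + 1)" if x: "0 < x" "x \<le> r" for x
  proof -
    have "\<exists>s\<in>{0<..<x}. norm (f x - f 0) \<le> norm ((x - 0) *\<^sub>R pd (0, 1) F (0, z0 + of_real s))"
    proof (rule mvt_general)
      show "continuous_on {0..x} f"
        using fd x r by (intro continuous_at_imp_continuous_on ballI has_derivative_continuous[OF fd]) auto
      show "(f has_derivative (\<lambda>t. t *\<^sub>R pd (0, 1) F (0, z0 + complex_of_real s))) (at s)" if "0 < s" "s < x" for s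
        using that x r by (intro fd) auto
    qed (use x in simp)
    then obtain s where s: "0 < s" "s < x" "norm (f x - f 0) \<le> x * norm (pd (0, 1) F (0, z0 + of_real s))"
      using x by auto
    note s(3)
    also have "\<dots> \<le> x * (K * s ^ (k + 1))" using s x by (intro mult_left_mono f'b) auto
    also have "\<dots> \<le> x * (K * x ^ (k + 1))" using s x K by (intro mult_left_mono power_mono) auto
    finally show ?thesis by (simp add: mult_ac)
  qed
  \<comment> \<open>On the real ray the power of \<open>z - z0\<close> is real, so the term with
    \<open>b\<close> disappears and the expansion says that \<open>?q\<close> tends to 0. Since the
    increment of \<open>f\<close> divided by \<open>x ^ (k + 1)\<close> also tends to 0, this forces
    \<open>a = 0\<close>, contradicting independence.\<close>
  let ?q = "\<lambda>x. (f x - f 0 - x ^ (k + 1) *\<^sub>R a) /\<^sub>R x ^ (k + 1)"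
  have ev: "\<forall>\<^sub>F x in at_right 0. 0 < x \<and> x < r"
    using r(1) by (auto simp: eventually_at_right_field)
  have "filterlim (\<lambda>x. z0 + complex_of_real x) (at z0 within local_dom c cM (\<Phi> 0)) (at_right 0)"
    unfolding filterlim_at
  proof
    show "\<forall>\<^sub>F x in at_right 0. z0 + of_real x \<in> local_dom c cM (\<Phi> 0) \<and> z0 + of_real x \<noteq> z0"
      using ev
    proof eventually_elim
      case (elim x)
      then show ?case using Gg[of "z0 + of_real x"] near(1)[of x] near(2)[of x \<delta>1] r by auto
    qed
    have "((\<lambda>x. z0 + complex_of_real x) \<longlongrightarrow> z0 + complex_of_real 0) (at_right 0)" by (intro tendsto_intros)
    then show "((\<lambda>x. z0 + complex_of_real x) \<longlongrightarrow> z0) (at_right 0)" by simp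
  qed
  from filterlim_compose[OF lim this]
  have "(?q \<longlongrightarrow> 0) (at_right 0)"
  proof (rule Lim_transform_eventually)
    show "\<forall>\<^sub>F x in at_right 0. (?w (z0 + of_real x) - ?w z0 - Re ((z0 + of_real x - z0) ^ (k + 1)) *\<^sub>R a
        - Im ((z0 + of_real x - z0) ^ (k + 1)) *\<^sub>R b) /\<^sub>R norm (z0 + of_real x - z0) ^ (k + 1) = ?q x"
      using ev
    proof eventually_elim
      case (elim x)
      have "complex_of_real x ^ (k + 1) = of_real (x ^ (k + 1))" by simp
      then have "Re (complex_of_real x ^ (k + 1)) = x ^ (k + 1)" "Im (complex_of_real x ^ (k + 1)) = 0"
        by (simp_all only: Re_complex_of_real Im_complex_of_real)
      moreover have "f x = ?w (z0 + of_real x)" "f 0 = ?w z0"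
        using Gg[of "z0 + of_real x"] Gg[of z0] near(1)[of x] near(2)[of x \<delta>1] elim r z0h by (auto simp: f_def)
      ultimately show ?case using elim by simp
    qed
  qed
  then have "((\<lambda>x. norm (?q x) + K * x) \<longlongrightarrow> norm (0 :: real^3) + K * 0) (at_right 0)"
    by (intro tendsto_intros)
  moreover have "\<forall>\<^sub>F x in at_right 0. norm a \<le> norm (?q x) + K * x"
    using ev
  proof eventually_elim
    case (elim x)
    have x: "x ^ (k + 1) > 0" using elim by simp
    have "a = v /\<^sub>R y - (v - y *\<^sub>R a) /\<^sub>R y" if "y > 0" for y v using that by (simp add: scaleR_diff_right)
    from this[OF x, of "f x - f 0"] have "a = (f x - f 0) /\<^sub>R x ^ (k + 1) - ?q x" .
    then have "norm a \<le> norm ((f x - f 0) /\<^sub>R x ^ (k + 1)) + norm (?q x)" by (metis norm_triangle_ineq4)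
    also have "norm ((f x - f 0) /\<^sub>R x ^ (k + 1)) = norm (f x - f 0) / x ^ (k + 1)"
      using x by (simp only: norm_scaleR divide_inverse mult.commute abs_of_pos positive_imp_inverse_positive)
    also have "\<dots> \<le> K * x" using fb[of x] elim unfolding pos_divide_le_eq[OF x] by simp
    finally show ?case by simp
  qed
  ultimately have "norm a \<le> norm (0 :: real^3) + K * 0"
    by (intro tendsto_lowerbound[where F = "at_right (0 :: real)"]) auto
  then show False using a by simp
qed

end

text \<open>On every horizontal line in the ball the derivative of order \<open>m\<close> does not
  vanish, so the zeros on that line are countable; Fubini makes the whole zero set null.\<close>

lemma null_zero_set:
  fixes D :: "real \<times> complex \<Rightarrow> real"
  assumes CD: "Cinf U D" and sub: "{t} \<times> ball z0 r \<subseteq> U"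
    and m: "\<And>z. z \<in> ball z0 r \<Longrightarrow> ((pd (0, 1)) ^^ m) D (t, z) \<noteq> 0"
  shows "emeasure lborel {z \<in> ball z0 r. D (t, z) = 0} = 0" "{z \<in> ball z0 r. D (t, z) = 0} \<in> sets borel"
proof -
  let ?Z = "{z \<in> ball z0 r. D (t, z) = 0}"
  have "continuous_on (ball z0 r) (\<lambda>z. D (t, z))"
    by (rule continuous_on_compose2[OF Cinf_continuous_on[OF CD]]) (use sub in \<open>auto intro!: continuous_intros\<close>)
  then have "closedin (top_of_set (ball z0 r)) ?Z"
    by (rule continuous_closedin_preimage_constant)
  then obtain T where "closed T" "?Z = ball z0 r \<inter> T" unfolding closedin_closed by blast
  then show Z: "?Z \<in> sets borel" by simp
  show "emeasure lborel ?Z = 0"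
  proof (rule null_if_countable_slices[OF Z])
    fix y
    let ?J = "(\<lambda>x. Complex x y) -` ball z0 r"
    define \<phi> where "\<phi> j x = ((pd (0, 1)) ^^ j) D (t, Complex x y)" for j x
    have "continuous_on UNIV (\<lambda>x. Complex x y)"
      unfolding Complex_eq by (intro continuous_intros)
    then have J: "open ?J" by (intro open_vimage) auto
    have line: "((\<lambda>x. (t, Complex x y)) has_derivative (\<lambda>x. x *\<^sub>R (0, 1))) (at x)" for x
    proof -
      have "(\<lambda>x. (t, Complex x y)) = (\<lambda>x. (t, Complex 0 y) + x *\<^sub>R (0, 1))"
        by (auto simp: complex_eq_iff)
      then show ?thesis by (auto intro!: derivative_eq_intros)
    qed
    have "countable {x \<in> ?J. \<phi> 0 x = 0}"
    proof (rule countable_zeros[OF J])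
      show "(\<phi> j has_real_derivative \<phi> (Suc j) x) (at x)" if "x \<in> ?J" for j x
        unfolding \<phi>_def[abs_def] funpow.simps o_apply
        by (rule Cinf_line[OF Cinf_iterate_pd[OF CD] line]) (use that sub in auto)
      show "\<phi> m x \<noteq> 0" if "x \<in> ?J" for x using m[of "Complex x y"] that by (simp add: \<phi>_def)
    qed
    moreover have "{x. Complex x y \<in> ?Z} = {x \<in> ?J. \<phi> 0 x = 0}" by (auto simp: \<phi>_def)
    ultimately show "countable {x. Complex x y \<in> ?Z}" by simp
  qed
qed

lemma Cinf_bounded:
  fixes f :: "'a::euclidean_space \<Rightarrow> real"
  assumes "Cinf U f" "compact K" "K \<subseteq> U"
  obtains B where "B > 0" "\<And>x. x \<in> K \<Longrightarrow> \<bar>f x\<bar> \<le> B"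
proof -
  have "continuous_on K f" using continuous_on_subset[OF Cinf_continuous_on[OF assms(1)] assms(3)] .
  then have "bounded (f ` K)" using assms(2) by (intro compact_imp_bounded compact_continuous_image)
  then show ?thesis using that unfolding bounded_pos by auto
qed

context conformal_variation
begin

text \<open>All local input to the integral estimates, on one neighbourhood: bounds on the second
  time derivatives hold with a common \<open>M\<close> by compactness, and the nonzero derivative of
  the determinant at time 0 and point \<open>z0\<close> stays nonzero for all nearby times and
  points.\<close>

lemma local_path:
  assumes c: "c \<in> AS" and z0: "z0 \<in> snd c ` fst c"
  shows "\<exists>\<epsilon> r M e1 e2 a1 a2 b1 b2. \<epsilon> > 0 \<and> r > 0 \<and> ball 0 \<epsilon> \<subseteq> I \<and> half_plane \<inter> ball z0 r \<subseteq> snd c ` fst c \<and>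
    (\<forall>z\<in>half_plane \<inter> ball z0 r. semidefinite_path \<epsilon> M (\<lambda>t. ee c t z) (\<lambda>t. e1 t z) (\<lambda>t. e2 t z)
      (\<lambda>t. al c t z) (\<lambda>t. a1 t z) (\<lambda>t. a2 t z) (\<lambda>t. be c t z) (\<lambda>t. b1 t z) (\<lambda>t. b2 t z)) \<and>
    (\<forall>t. \<bar>t\<bar> < \<epsilon> \<longrightarrow> continuous_on (half_plane \<inter> ball z0 r) (e1 t) \<and>
      continuous_on (half_plane \<inter> ball z0 r) (a1 t) \<and> continuous_on (half_plane \<inter> ball z0 r) (b1 t) \<and>
      (AE z in lborel. z \<in> half_plane \<inter> ball z0 r \<longrightarrow> (ee c t z)\<^sup>2 - (al c t z)\<^sup>2 - (be c t z)\<^sup>2 \<noteq> 0))"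
proof -
  obtain \<delta> H where H: "\<delta> > 0" "ball 0 \<delta> \<subseteq> I" "half_plane \<inter> ball z0 \<delta> \<subseteq> snd c ` fst c"
    "\<And>a b. Cinf (ball 0 \<delta> \<times> ball z0 \<delta>) (H a b)"
    "\<And>s z a b. s \<in> ball 0 \<delta> \<Longrightarrow> z \<in> half_plane \<inter> ball z0 \<delta> \<Longrightarrow> hh c s z a b = H a b (s, z)"
    by (rule hh_local[OF c I(2) z0]) (rule that)
  let ?W = "ball 0 \<delta> \<times> ball z0 \<delta> :: (real \<times> complex) set"
  have half: "bounded_linear (\<lambda>y :: real. y / 2)" by (rule bounded_linear_divide)
  define E where "E x = (H 1 1 x + H \<i> \<i> x) / 2" for x
  define A where "A x = (H 1 1 x - H \<i> \<i> x) / 2" for x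
  define B where "B = H 1 \<i>"
  define D where "D x = H 1 1 x * H \<i> \<i> x - H 1 \<i> x * H 1 \<i> x" for x
  have CE: "Cinf ?W E" unfolding E_def[abs_def] by (rule Cinf_linear_compose[OF half Cinf_add[OF H(4) H(4)]])
  have CA: "Cinf ?W A" unfolding A_def[abs_def] by (rule Cinf_linear_compose[OF half Cinf_diff[OF H(4) H(4)]])
  have CB: "Cinf ?W B" unfolding B_def by (rule H(4))
  have CD: "Cinf ?W D" unfolding D_def[abs_def]
    by (rule Cinf_diff[OF Cinf_mult[OF H(4) H(4)] Cinf_mult[OF H(4) H(4)]])
  have eq: "ee c s z = E (s, z)" "al c s z = A (s, z)" "be c s z = B (s, z)"
      "(ee c s z)\<^sup>2 - (al c s z)\<^sup>2 - (be c s z)\<^sup>2 = D (s, z)"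
    if "s \<in> ball 0 \<delta>" "z \<in> half_plane \<inter> ball z0 \<delta>" for s z
    unfolding det_eq unfolding ee_def al_def be_def E_def A_def B_def D_def H(5)[OF that]
    by (simp_all add: power2_eq_square)
  \<comment> \<open>At time 0 conformality reduces the determinant to the square of
    \<open>hh c 0 z 1 1\<close>, the form required by \<open>finite_order\<close>.\<close>
  obtain m where m: "((pd (0, 1)) ^^ m) D (0, z0) \<noteq> 0"
  proof -
    have "D (0, z) = (hh c 0 z 1 1)\<^sup>2" if "z \<in> half_plane \<inter> ball z0 \<delta>" for z
    proof -
      have "z \<in> snd c ` fst c" using that H(3) by blast
      then show ?thesis
        using eq(4)[of 0 z] that H(1) conformal_at[OF c] by simp
    qed
    from finite_order[OF c z0 H(1,3) CD this] show ?thesis using that by blast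
  qed
  let ?Dm = "((pd (0, 1)) ^^ m) D"
  have "isCont ?Dm (0, z0)"
    using Cinf_continuous_on[OF Cinf_iterate_pd[OF CD]] Cinf_open[OF CD] H(1)
    by (simp add: continuous_on_eq_continuous_at)
  then obtain d1 where d1: "d1 > 0" "\<And>x. dist (0, z0) x < d1 \<Longrightarrow> ?Dm x \<noteq> 0"
    using continuous_at_avoid[of "(0, z0)" ?Dm 0] m by blast
  \<comment> \<open>Halving puts the closed product of balls inside the domain of smoothness and
    keeps the sum of the time and space distances below \<open>d1\<close>.\<close>
  define r where "r = min \<delta> d1 / 2"
  have r: "r > 0" "r < \<delta>" "2 * r \<le> d1" using H(1) d1(1) by (auto simp: r_def)
  have Dm: "?Dm (t, z) \<noteq> 0" if "\<bar>t\<bar> < r" "z \<in> ball z0 r" for t z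
  proof (rule d1(2))
    have "dist (0, z0) (t, z) \<le> \<bar>t\<bar> + dist z0 z"
      unfolding dist_Pair_Pair using sqrt_sum_squares_le_sum[of "dist 0 t" "dist z0 z"] by simp
    then show "dist (0, z0) (t, z) < d1" using that r by simp
  qed
  let ?K = "cball 0 r \<times> cball z0 r :: (real \<times> complex) set"
  have K: "compact ?K" "?K \<subseteq> ?W" using r by (auto intro: compact_Times)
  let ?t = "pd (1, 0) :: (real \<times> complex \<Rightarrow> real) \<Rightarrow> real \<times> complex \<Rightarrow> real"
  obtain M1 where M1: "M1 > 0" "\<And>x. x \<in> ?K \<Longrightarrow> \<bar>?t (?t E) x\<bar> \<le> M1"
    using Cinf_bounded[OF Cinf_pd[OF Cinf_pd[OF CE]] K, where thesis = thesis] by blast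
  obtain M2 where M2: "M2 > 0" "\<And>x. x \<in> ?K \<Longrightarrow> \<bar>?t (?t A) x\<bar> \<le> M2"
    using Cinf_bounded[OF Cinf_pd[OF Cinf_pd[OF CA]] K, where thesis = thesis] by blast
  obtain M3 where M3: "M3 > 0" "\<And>x. x \<in> ?K \<Longrightarrow> \<bar>?t (?t B) x\<bar> \<le> M3"
    using Cinf_bounded[OF Cinf_pd[OF Cinf_pd[OF CB]] K, where thesis = thesis] by blast
  obtain M4 where M4: "M4 > 0" "\<And>x. x \<in> ?K \<Longrightarrow> \<bar>E x\<bar> \<le> M4"
    using Cinf_bounded[OF CE K, where thesis = thesis] by blast
  define M where "M = M1 + M2 + M3 + M4"
  have M: "M1 \<le> M" "M2 \<le> M" "M3 \<le> M" "M4 \<le> M" "M > 0" using M1(1) M2(1) M3(1) M4(1) by (auto simp: M_def)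
  have line: "((\<lambda>s. (s, z)) has_derivative (\<lambda>s. s *\<^sub>R (1, 0))) (at s)" for s :: real and z :: complex
    by (rule has_derivative_eq_rhs, (rule derivative_eq_intros refl)+) (simp add: fun_eq_iff)
  have ball: "s \<in> ball 0 r \<longleftrightarrow> \<bar>s\<bar> < r" for s :: real by simp
  have der: "((\<lambda>s. f s z) has_real_derivative ?t F (s, z)) (at s)"
    if F: "Cinf ?W F" "\<And>s. \<bar>s\<bar> < r \<Longrightarrow> f s z = F (s, z)" and s: "\<bar>s\<bar> < r" and z: "z \<in> half_plane \<inter> ball z0 r"
    for F f s and z :: complex
  proof -
    have "((\<lambda>s. F (s, z)) has_real_derivative ?t F (s, z)) (at s)"
      by (rule Cinf_line[OF F(1) line]) (use s z r in auto)
    then show ?thesis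
      by (rule has_field_derivative_transform_within_open[of _ _ _ "ball 0 r"]) (use F(2) s in auto)
  qed
  have in_dom: "s \<in> ball 0 \<delta>" "z \<in> half_plane \<inter> ball z0 \<delta>" "(s, z) \<in> ?K"
    if "\<bar>s\<bar> < r" "z \<in> half_plane \<inter> ball z0 r" for s z
    using that r by auto
  have contF: "continuous_on (half_plane \<inter> ball z0 r) (\<lambda>z. F (t, z))" if "Cinf ?W F" "\<bar>t\<bar> < r" for F :: "real \<times> complex \<Rightarrow> real" and t
    by (rule continuous_on_compose2[OF Cinf_continuous_on[OF that(1)]]) (use that r in \<open>auto intro!: continuous_intros\<close>)
  show ?thesis
  proof (intro exI conjI ballI allI impI)
    show "0 < r" "0 < r" by (fact r)+
    show "ball 0 r \<subseteq> I" using H(2) r by (meson less_imp_le order_trans subset_ball)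
    show sub: "half_plane \<inter> ball z0 r \<subseteq> snd c ` fst c" using H(3) r by (auto intro: subsetD[OF subset_ball])
    show "semidefinite_path r M (\<lambda>t. ee c t z) (\<lambda>t. ?t E (t, z)) (\<lambda>t. ?t (?t E) (t, z))
      (\<lambda>t. al c t z) (\<lambda>t. ?t A (t, z)) (\<lambda>t. ?t (?t A) (t, z)) (\<lambda>t. be c t z) (\<lambda>t. ?t B (t, z)) (\<lambda>t. ?t (?t B) (t, z))"
      if z: "z \<in> half_plane \<inter> ball z0 r" for z
    proof
      show "0 < r" "0 < M" by (fact r M)+
      have zc: "z \<in> snd c ` fst c" using z sub by blast
      show "al c 0 z = 0" "be c 0 z = 0" using conformal_at[OF c zc] by auto
      show "ee c 0 z \<le> M"
      proof -
        have "\<bar>E (0, z)\<bar> \<le> M4" by (rule M4(2)[OF in_dom(3)]) (use r z in auto)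
        then show ?thesis using eq(1)[OF in_dom(1,2)[of 0 z]] r z M(4) by auto
      qed
      fix t assume t: "\<bar>t\<bar> < r"
      have tI: "t \<in> I" using in_dom(1)[OF t z] H(2) by blast
      show "0 \<le> ee c t z" by (rule ee_nonneg[OF c zc tI])
      show "(al c t z)\<^sup>2 + (be c t z)\<^sup>2 \<le> (ee c t z)\<^sup>2" using det_nonneg[OF c zc tI] by simp
      show "((\<lambda>t. ee c t z) has_real_derivative ?t E (t, z)) (at t)"
        by (rule der[OF CE _ t z]) (rule eq(1)[OF in_dom(1,2)[OF _ z]])
      show "((\<lambda>t. al c t z) has_real_derivative ?t A (t, z)) (at t)"
        by (rule der[OF CA _ t z]) (rule eq(2)[OF in_dom(1,2)[OF _ z]])
      show "((\<lambda>t. be c t z) has_real_derivative ?t B (t, z)) (at t)"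
        by (rule der[OF CB _ t z]) (rule eq(3)[OF in_dom(1,2)[OF _ z]])
      show "((\<lambda>t. ?t E (t, z)) has_real_derivative ?t (?t E) (t, z)) (at t)"
        by (rule der[where f = "\<lambda>t z. ?t E (t, z)", OF Cinf_pd[OF CE] refl t z])
      show "((\<lambda>t. ?t A (t, z)) has_real_derivative ?t (?t A) (t, z)) (at t)"
        by (rule der[where f = "\<lambda>t z. ?t A (t, z)", OF Cinf_pd[OF CA] refl t z])
      show "((\<lambda>t. ?t B (t, z)) has_real_derivative ?t (?t B) (t, z)) (at t)"
        by (rule der[where f = "\<lambda>t z. ?t B (t, z)", OF Cinf_pd[OF CB] refl t z])
      show "\<bar>?t (?t E) (t, z)\<bar> \<le> M" "\<bar>?t (?t A) (t, z)\<bar> \<le> M" "\<bar>?t (?t B) (t, z)\<bar> \<le> M"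
        using M1(2)[OF in_dom(3)[OF t z]] M2(2)[OF in_dom(3)[OF t z]] M3(2)[OF in_dom(3)[OF t z]] M by linarith+
    qed
    fix t assume t: "\<bar>t\<bar> < r"
    show "continuous_on (half_plane \<inter> ball z0 r) (\<lambda>z. ?t E (t, z))"
      "continuous_on (half_plane \<inter> ball z0 r) (\<lambda>z. ?t A (t, z))"
      "continuous_on (half_plane \<inter> ball z0 r) (\<lambda>z. ?t B (t, z))"
      by (rule contF[OF Cinf_pd[OF CE] t] contF[OF Cinf_pd[OF CA] t] contF[OF Cinf_pd[OF CB] t])+
    have sb: "{t} \<times> ball z0 r \<subseteq> ?W" using t r by auto
    note Z = null_zero_set[OF CD sb Dm[OF t]]
    have "{z \<in> ball z0 r. D (t, z) = 0} \<in> null_sets lborel" using Z by (simp add: null_sets_def)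
    then show "AE z in lborel. z \<in> half_plane \<inter> ball z0 r \<longrightarrow> (ee c t z)\<^sup>2 - (al c t z)\<^sup>2 - (be c t z)\<^sup>2 \<noteq> 0"
    proof (rule AE_I')
      show "{z \<in> space lborel. \<not> (z \<in> half_plane \<inter> ball z0 r \<longrightarrow> (ee c t z)\<^sup>2 - (al c t z)\<^sup>2 - (be c t z)\<^sup>2 \<noteq> 0)}
        \<subseteq> {z \<in> ball z0 r. D (t, z) = 0}"
        using eq(4)[OF in_dom(1,2)[OF t]] by auto
    qed
  qed
qed

end

section \<open>The Cauchy-Riemann part of the velocity\<close>

lemma cip_add: "cip G (a + b) c = cip G a c + cip G b c" "cip G a (b + c) = cip G a b + cip G a c"
  by (simp_all add: cip_def algebra_simps sum.distrib)

lemma cip_scale: "cip G (k *s a) b = k * cip G a b" "cip G a (k *s b) = k * cip G a b"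
  by (simp_all add: cip_def algebra_simps sum_distrib_left)

lemma cip_diff: "cip G (a - b) c = cip G a c - cip G b c" "cip G a (b - c) = cip G a b - cip G a c"
  by (simp_all add: cip_def algebra_simps sum_subtractf)

lemmas cip_simps = cip_add cip_scale cip_diff

lemma cip_commute: assumes "transpose G = G" shows "cip G a b = cip G b a"
proof -
  have "G $ i $ j = G $ j $ i" for i j using assms by (simp add: transpose_def vec_eq_iff)
  then show ?thesis
    unfolding cip_def by (subst sum.swap) (simp add: mult_ac)
qed

lemma cip_cvec: "cip G (cvec a) (cvec b) = of_real (ip G a b)"
  by (simp add: cip_def cvec_def ip_def inner_vec_def matrix_vector_mult_def sum_distrib_left mult_ac)

lemma linear_cvec: "linear cvec"
  by (simp add: linear_iff cvec_def vec_eq_iff scaleR_conv_of_real[symmetric])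

lemma bounded_linear_cvec: "bounded_linear cvec"
  using linear_cvec by (rule linear_conv_bounded_linear[THEN iffD1])

lemma bounded_bilinear_vscale: "bounded_bilinear ((*s) :: complex \<Rightarrow> complex^3 \<Rightarrow> complex^3)"
  by (rule bilinear_conv_bounded_bilinear[THEN iffD1])
    (simp add: bilinear_def linear_iff vec_eq_iff algebra_simps)

lemma has_derivative_cip:
  assumes G: "(\<Gamma> has_derivative M) (at z within S)" and X: "(X has_derivative X') (at z within S)"
    and Y: "(Y has_derivative Y') (at z within S)"
  shows "((\<lambda>y. cip (\<Gamma> y) (X y) (Y y)) has_derivative
    (\<lambda>h. cip (M h) (X z) (Y z) + cip (\<Gamma> z) (X' h) (Y z) + cip (\<Gamma> z) (X z) (Y' h))) (at z within S)"
proof -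
  have g: "((\<lambda>y. complex_of_real (\<Gamma> y $ i $ j)) has_derivative (\<lambda>h. complex_of_real (M h $ i $ j))) (at z within S)" for i j
    by (intro has_derivative_of_real bounded_linear.has_derivative[OF bounded_linear_vec_nth] G)
  have x: "((\<lambda>y. X y $ i) has_derivative (\<lambda>h. X' h $ i)) (at z within S)" for i
    by (intro bounded_linear.has_derivative[OF bounded_linear_vec_nth] X)
  have y: "((\<lambda>y. Y y $ i) has_derivative (\<lambda>h. Y' h $ i)) (at z within S)" for i
    by (intro bounded_linear.has_derivative[OF bounded_linear_vec_nth] Y)
  show ?thesis
    unfolding cip_def
    by (rule has_derivative_eq_rhs, (rule has_derivative_sum has_derivative_mult g x y)+)
      (simp add: fun_eq_iff algebra_simps sum.distrib)
qed

lemma d_z_eq: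
  "z \<in> half_plane \<Longrightarrow> (F has_derivative F') (at z within half_plane) \<Longrightarrow> d_z F z = (1 / 2) *s (F' 1 - \<i> *s F' \<i>)"
  by (simp add: d_z_def d_x_def d_y_def frechet_half_plane)

text \<open>Where \<open>U y\<close> is nonzero, dividing by a nonzero coordinate recovers the
  coefficient function, so the coefficients converge themselves and the limit is a multiple of
  \<open>U y\<close>. Constant coefficients give the converse.\<close>

lemma limits_of_lines:
  fixes U :: "complex \<Rightarrow> complex^3"
  assumes U: "(U \<longlongrightarrow> U y) (at y within R)" "U y \<noteq> 0" "at y within R \<noteq> bot"
  shows "{T. \<exists>a. ((\<lambda>x. a x *s U x) \<longlongrightarrow> T) (at y within R)} = {c *s U y | c. True}"
proof (intro equalityI subsetI)
  fix T assume "T \<in> {T. \<exists>a. ((\<lambda>x. a x *s U x) \<longlongrightarrow> T) (at y within R)}"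
  then obtain a where a: "((\<lambda>x. a x *s U x) \<longlongrightarrow> T) (at y within R)" by blast
  obtain i where i: "U y $ i \<noteq> 0" using U(2) by (metis vec_eq_iff zero_index)
  have Ui: "((\<lambda>x. U x $ i) \<longlongrightarrow> U y $ i) (at y within R)" by (rule tendsto_vec_nth[OF U(1)])
  have "((\<lambda>x. (a x *s U x) $ i / U x $ i) \<longlongrightarrow> T $ i / U y $ i) (at y within R)"
    by (intro tendsto_divide tendsto_vec_nth a Ui i)
  moreover have "\<forall>\<^sub>F x in at y within R. (a x *s U x) $ i / U x $ i = a x"
    using tendsto_imp_eventually_ne[OF Ui i] by eventually_elim simp
  ultimately have "(a \<longlongrightarrow> T $ i / U y $ i) (at y within R)" by (rule Lim_transform_eventually)
  then have "((\<lambda>x. a x *s U x) \<longlongrightarrow> (T $ i / U y $ i) *s U y) (at y within R)"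
    by (rule bounded_bilinear.tendsto[OF bounded_bilinear_vscale _ U(1)])
  then have "T = (T $ i / U y $ i) *s U y" by (rule tendsto_unique[OF U(3) a])
  then show "T \<in> {c *s U y | c. True}" by blast
next
  fix T assume "T \<in> {c *s U y | c. True}"
  then obtain c where c: "T = c *s U y" by blast
  have "((\<lambda>x. c *s U x) \<longlongrightarrow> T) (at y within R)"
    unfolding c by (rule bounded_bilinear.tendsto[OF bounded_bilinear_vscale tendsto_const U(1)])
  then show "T \<in> {T. \<exists>a. ((\<lambda>x. a x *s U x) \<longlongrightarrow> T) (at y within R)}"
    by (intro CollectI exI[of _ "\<lambda>_. c"])
qed

text \<open>The derivative of the metric in direction \<open>a\<close>, applied to \<open>b\<close>
  and \<open>c\<close>, extended complex-linearly in all three arguments.\<close>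

definition dG :: "(real^3 \<Rightarrow> real^3^3) \<Rightarrow> real^3 \<Rightarrow> complex^3 \<Rightarrow> complex^3 \<Rightarrow> complex^3 \<Rightarrow> complex" where
  "dG G x a b c = (\<Sum>i\<in>UNIV. a $ i * cip (metric_deriv G x i) b c)"

lemma sum_rotate:
  "(\<Sum>m\<in>A. \<Sum>i\<in>B. \<Sum>j\<in>C. f i j m) = (\<Sum>i\<in>B. \<Sum>j\<in>C. \<Sum>m\<in>A. f i j m)"
proof -
  have "(\<Sum>m\<in>A. \<Sum>i\<in>B. \<Sum>j\<in>C. f i j m) = (\<Sum>i\<in>B. \<Sum>m\<in>A. \<Sum>j\<in>C. f i j m)" by (rule sum.swap)
  also have "\<dots> = (\<Sum>i\<in>B. \<Sum>j\<in>C. \<Sum>m\<in>A. f i j m)" by (intro sum.cong refl sum.swap)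
  finally show ?thesis .
qed

text \<open>Lowering the index cancels the inverse matrix and leaves the Christoffel symbols of the
  first kind. The inverse is genuine because a positive definite matrix has trivial kernel.\<close>

lemma christoffel_form_lower:
  assumes sym: "transpose (G x) = G x" and pos: "\<And>v. v \<noteq> 0 \<Longrightarrow> 0 < ip (G x) v v"
  shows "cip (G x) (christoffel_form G x a b) c = (dG G x a b c + dG G x b a c - dG G x c a b) / 2"
proof -
  let ?g = "G x" and ?inv = "matrix_inv (G x)" and ?d = "metric_deriv G x"
  have "invertible ?g"
    unfolding invertible_left_inverse matrix_left_invertible_ker
  proof (intro allI impI)
    fix v assume "?g *v v = 0"
    then have "ip ?g v v = 0" by (simp add: ip_def)
    then show "v = 0" using pos[of v] by fastforce
  qed
  then have "?g ** ?inv = mat 1 \<and> ?inv ** ?g = mat 1"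
    unfolding invertible_def matrix_inv_def by (rule someI_ex)
  moreover have inv': "(\<Sum>k\<in>UNIV. ?g $ k $ m * ?inv $ k $ l) = (if l = m then 1 else 0)" if "?g ** ?inv = mat 1 \<and> ?inv ** ?g = mat 1" for m l
  proof -
    have gs: "?g $ k $ m = ?g $ m $ k" for k using sym by (simp add: transpose_def vec_eq_iff)
    have "(?g ** ?inv) $ m $ l = mat 1 $ m $ l" using that by simp
    then show ?thesis by (simp add: matrix_matrix_mult_def mat_def gs eq_commute)
  qed
  ultimately have inv: "(\<Sum>k\<in>UNIV. ?g $ k $ m * ?inv $ k $ l) = (if l = m then 1 else 0)" for m l by blast
  \<comment> \<open>Twice the contracted Christoffel symbol of the first kind, separated so that the
    inverse metric stands alone and meets the lowering metric.\<close>
  define S where "S l = (\<Sum>i\<in>UNIV. \<Sum>j\<in>UNIV. complex_of_real (?d i $ j $ l + ?d j $ i $ l - ?d l $ i $ j) * a $ i * b $ j)" for l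
  have chr: "christoffel_form G x a b $ k = (\<Sum>l\<in>UNIV. of_real (?inv $ k $ l) * S l) / 2" for k
  proof -
    have "christoffel_form G x a b $ k = (\<Sum>i\<in>UNIV. \<Sum>j\<in>UNIV. \<Sum>l\<in>UNIV.
        of_real (?inv $ k $ l) * (complex_of_real (?d i $ j $ l + ?d j $ i $ l - ?d l $ i $ j) * a $ i * b $ j)) / 2"
      by (simp add: christoffel_form_def christoffel_def sum_distrib_left sum_distrib_right sum_divide_distrib mult_ac)
    also have "\<dots> = (\<Sum>i\<in>UNIV. \<Sum>l\<in>UNIV. \<Sum>j\<in>UNIV.
        of_real (?inv $ k $ l) * (complex_of_real (?d i $ j $ l + ?d j $ i $ l - ?d l $ i $ j) * a $ i * b $ j)) / 2"
      by (simp only: sum.swap[where A = "UNIV :: 3 set" and B = "UNIV :: 3 set" and g = "\<lambda>j l. of_real (?inv $ k $ l) * (complex_of_real (?d _ $ j $ l + ?d j $ _ $ l - ?d l $ _ $ j) * a $ _ * b $ j)"])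
    also have "\<dots> = (\<Sum>l\<in>UNIV. of_real (?inv $ k $ l) * S l) / 2"
      by (subst sum.swap) (simp add: S_def sum_distrib_left)
    finally show ?thesis .
  qed
  have "cip ?g (christoffel_form G x a b) c
      = (\<Sum>m\<in>UNIV. \<Sum>l\<in>UNIV. of_real (\<Sum>k\<in>UNIV. ?g $ k $ m * ?inv $ k $ l) * S l * c $ m) / 2"
  proof -
    have "cip ?g (christoffel_form G x a b) c
      = (\<Sum>m\<in>UNIV. \<Sum>k\<in>UNIV. \<Sum>l\<in>UNIV. of_real (?g $ k $ m * ?inv $ k $ l) * S l * c $ m) / 2"
      unfolding cip_def chr
      by (subst sum.swap) (simp add: sum_distrib_left sum_distrib_right sum_divide_distrib mult_ac)
    also have "(\<Sum>m\<in>UNIV. \<Sum>k\<in>UNIV. \<Sum>l\<in>UNIV. of_real (?g $ k $ m * ?inv $ k $ l) * S l * c $ m)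
      = (\<Sum>m\<in>UNIV. \<Sum>l\<in>UNIV. \<Sum>k\<in>UNIV. of_real (?g $ k $ m * ?inv $ k $ l) * S l * c $ m)"
      by (intro sum.cong refl sum.swap)
    finally show ?thesis by (simp add: sum_distrib_right)
  qed
  also have "\<dots> = (\<Sum>m\<in>UNIV. S m * c $ m) / 2"
    unfolding inv by (simp add: if_distrib[of of_real] if_distrib[of "\<lambda>x. x * _"] cong: if_cong)
  also have "(\<Sum>m\<in>UNIV. S m * c $ m) = dG G x a b c + dG G x b a c - dG G x c a b"
  proof -
    have 1: "(\<Sum>m\<in>UNIV. \<Sum>i\<in>UNIV. \<Sum>j\<in>UNIV. complex_of_real (?d i $ j $ m) * a $ i * b $ j * c $ m) = dG G x a b c"
      unfolding dG_def cip_def sum_distrib_left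
      by (rule trans[OF sum_rotate]) (simp add: mult_ac)
    have 2: "(\<Sum>m\<in>UNIV. \<Sum>i\<in>UNIV. \<Sum>j\<in>UNIV. complex_of_real (?d j $ i $ m) * a $ i * b $ j * c $ m) = dG G x b a c"
    proof -
      have "(\<Sum>m\<in>UNIV. \<Sum>i\<in>UNIV. \<Sum>j\<in>UNIV. complex_of_real (?d j $ i $ m) * a $ i * b $ j * c $ m)
        = (\<Sum>m\<in>UNIV. \<Sum>j\<in>UNIV. \<Sum>i\<in>UNIV. complex_of_real (?d j $ i $ m) * a $ i * b $ j * c $ m)"
        by (intro sum.cong refl sum.swap)
      also have "\<dots> = dG G x b a c"
        unfolding dG_def cip_def sum_distrib_left
        by (rule trans[OF sum_rotate]) (simp add: mult_ac)
      finally show ?thesis .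
    qed
    have 3: "(\<Sum>m\<in>UNIV. \<Sum>i\<in>UNIV. \<Sum>j\<in>UNIV. complex_of_real (?d m $ i $ j) * a $ i * b $ j * c $ m) = dG G x c a b"
      unfolding dG_def cip_def sum_distrib_left by (simp add: mult_ac)
    have "(\<Sum>m\<in>UNIV. S m * c $ m) = (\<Sum>m\<in>UNIV. \<Sum>i\<in>UNIV. \<Sum>j\<in>UNIV. complex_of_real (?d i $ j $ m) * a $ i * b $ j * c $ m
        + complex_of_real (?d j $ i $ m) * a $ i * b $ j * c $ m - complex_of_real (?d m $ i $ j) * a $ i * b $ j * c $ m)"
      unfolding S_def sum_distrib_right by (intro sum.cong refl) (simp add: algebra_simps)
    also have "\<dots> = dG G x a b c + dG G x b a c - dG G x c a b"
      unfolding 1[symmetric] 2[symmetric] 3[symmetric] by (simp add: sum.distrib sum_subtractf)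
    finally show ?thesis .
  qed
  finally show ?thesis .
qed

text \<open>Geometry near a point where \<open>w\<close> is an immersion. \<open>W y\<close> is the
  differential of \<open>w\<close> at \<open>y\<close>; \<open>W1 z\<close> and \<open>Wi z\<close>
  are the differentials at \<open>z\<close> of its values on 1 and \<i>, and \<open>V'\<close> and
  \<open>G'\<close> those of \<open>V\<close> and of the metric. The frame is controlled on a
  neighbourhood because the projections in \<open>mu_coeff\<close> are differentiated, whereas
  second derivatives enter at \<open>z\<close> alone.\<close>

locale surface_patch =
  fixes G :: "real^3 \<Rightarrow> real^3^3" and w :: "complex \<Rightarrow> real^3" and R :: "complex set" and V :: "complex \<Rightarrow> real^3"
    and z :: complex and \<delta> :: real and W W1 Wi :: "complex \<Rightarrow> complex \<Rightarrow> real^3" and V' :: "complex \<Rightarrow> real^3"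
    and G' :: "real^3 \<Rightarrow> real^3^3"
  assumes z: "z \<in> half_plane" and \<delta>: "\<delta> > 0"
    and dw: "\<And>y. y \<in> half_plane \<inter> ball z \<delta> \<Longrightarrow> (w has_derivative W y) (at y within half_plane)"
    and wH: "\<And>y. y \<in> half_plane \<inter> ball z \<delta> \<Longrightarrow> w y \<in> half_space"
    and sym: "\<And>y. y \<in> half_plane \<inter> ball z \<delta> \<Longrightarrow> transpose (G (w y)) = G (w y)"
    and pos: "\<And>y v. y \<in> half_plane \<inter> ball z \<delta> \<Longrightarrow> v \<noteq> 0 \<Longrightarrow> 0 < ip (G (w y)) v v"
    and conf: "\<And>y. y \<in> half_plane \<inter> ball z \<delta> \<Longrightarrow> ip (G (w y)) (W y \<i>) (W y \<i>) = ip (G (w y)) (W y 1) (W y 1)"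
      "\<And>y. y \<in> half_plane \<inter> ball z \<delta> \<Longrightarrow> ip (G (w y)) (W y 1) (W y \<i>) = 0"
    and regular: "\<And>y. y \<in> half_plane \<inter> ball z \<delta> \<Longrightarrow> W y 1 \<noteq> 0"
    and R: "half_plane \<inter> ball z \<delta> \<subseteq> R" "R \<subseteq> half_plane"
    and dW: "((\<lambda>y. W y 1) has_derivative W1 z) (at z within half_plane)"
      "((\<lambda>y. W y \<i>) has_derivative Wi z) (at z within half_plane)"
    and contW: "continuous_on (half_plane \<inter> ball z \<delta>) (\<lambda>y. W y 1)"
      "continuous_on (half_plane \<inter> ball z \<delta>) (\<lambda>y. W y \<i>)"
    and dV: "(V has_derivative V') (at z within half_plane)"
    and dG: "(G has_derivative G') (at (w z) within half_space)"
    and G'_sym: "\<And>v. transpose (G' v) = G' v"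
begin

abbreviation N where "N \<equiv> half_plane \<inter> ball z \<delta>"

definition P where "P y = (1 / 2) *s (cvec (W y 1) - \<i> *s cvec (W y \<i>))"
definition Q where "Q y = (1 / 2) *s (cvec (W y 1) + \<i> *s cvec (W y \<i>))"
definition \<rho> where "\<rho> y = ip (G (w y)) (W y 1) (W y 1)"

lemma zN: "z \<in> N" using z \<delta> by simp

lemma frame:
  assumes y: "y \<in> N"
  shows "u_z w y = P y" "u_zbar w y = Q y" "conf_factor G w y = \<rho> y"
proof -
  have "((cvec \<circ> w) has_derivative (\<lambda>h. cvec (W y h))) (at y within half_plane)"
    unfolding o_def by (rule bounded_linear.has_derivative[OF bounded_linear_cvec dw[OF y]])
  then have d: "frechet_derivative (cvec \<circ> w) (at y within half_plane) = (\<lambda>h. cvec (W y h))"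
    using y by (intro frechet_half_plane) auto
  show "u_z w y = P y" "u_zbar w y = Q y"
    by (simp_all add: u_z_def u_zbar_def d_z_def d_zbar_def d_x_def d_y_def d P_def Q_def)
  have "frechet_derivative w (at y within half_plane) = W y"
    using dw[OF y] y by (intro frechet_half_plane) auto
  then show "conf_factor G w y = \<rho> y" by (simp add: conf_factor_def d_x_def \<rho>_def)
qed

lemma \<rho>_pos: "y \<in> N \<Longrightarrow> \<rho> y > 0" unfolding \<rho>_def by (rule pos[OF _ regular])

text \<open>Conformality in complex form: both frame vectors are isotropic. They are thus dual to
  each other up to a factor, and the coefficient of one is read off by pairing with the other; the
  formulas for the projections rest on this.\<close>

lemma products:
  assumes y: "y \<in> N"
  shows "cip (G (w y)) (P y) (P y) = 0" "cip (G (w y)) (Q y) (Q y) = 0"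
    "cip (G (w y)) (P y) (Q y) = of_real (\<rho> y) / 2" "cip (G (w y)) (Q y) (P y) = of_real (\<rho> y) / 2"
proof -
  have c: "ip (G (w y)) (W y \<i>) (W y 1) = 0" using conf(2)[OF y] ip_commute[OF sym[OF y]] by metis
  show "cip (G (w y)) (P y) (P y) = 0" "cip (G (w y)) (Q y) (Q y) = 0"
    "cip (G (w y)) (P y) (Q y) = of_real (\<rho> y) / 2" "cip (G (w y)) (Q y) (P y) = of_real (\<rho> y) / 2"
    unfolding P_def Q_def cip_simps cip_cvec conf(1)[OF y] conf(2)[OF y] c
    by (simp_all add: \<rho>_def field_simps)
qed

text \<open>The fibres are defined by limits along regular points. Here the frame is continuous and
  nonzero, and the point is an accumulation point of the half-plane, so the limits form exactly the
  spanned lines.\<close>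

lemma xi_eq:
  assumes y: "y \<in> N"
  shows "xi10 w R y = {c *s P y | c. True}" "xi01 w R y = {c *s Q y | c. True}"
    "xi w R y = {a *s P y + b *s Q y | a b. True}"
proof -
  have at: "at y within R = at y within N"
    by (rule at_within_nhd[of y "ball z \<delta>"]) (use y R in auto)
  have nt: "at y within R \<noteq> bot"
  proof -
    have "y islimpt half_plane"
      unfolding islimpt_approachable
    proof (intro allI impI)
      fix e :: real assume e: "e > 0"
      then show "\<exists>x'\<in>half_plane. x' \<noteq> y \<and> dist x' y < e"
        using y by (intro bexI[of _ "y + of_real (e / 2)"]) (auto simp: half_plane_def dist_norm)
    qed
    moreover have "at y within half_plane = at y within N"
      by (rule at_within_nhd[of y "ball z \<delta>"]) (use y in auto)
    ultimately show ?thesis unfolding at using trivial_limit_within[of y half_plane] by metis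
  qed
  have cc: "continuous_on N (\<lambda>y. cvec (W y 1))" "continuous_on N (\<lambda>y. cvec (W y \<i>))"
    by (intro bounded_linear.continuous_on[OF bounded_linear_cvec] contW)+
  have sc: "continuous_on N (\<lambda>y. c *s f y)" if "continuous_on N f" for c and f :: "complex \<Rightarrow> complex^3"
    by (rule bounded_bilinear.continuous_on[OF bounded_bilinear_vscale continuous_on_const that])
  have "continuous_on N P" "continuous_on N Q"
    unfolding P_def[abs_def] Q_def[abs_def] by (intro sc continuous_on_diff continuous_on_add cc)+
  then have lim: "(P \<longlongrightarrow> P y) (at y within R)" "(Q \<longlongrightarrow> Q y) (at y within R)"
    using y unfolding at continuous_on_def by blast+
  have ev: "\<forall>\<^sub>F x in at y within R. u_z w x = P x \<and> u_zbar w x = Q x"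
    unfolding at eventually_at_filter using frame by (auto intro!: always_eventually)
  have ne: "P y \<noteq> 0" "Q y \<noteq> 0" using products(3)[OF y] \<rho>_pos[OF y] by (auto simp: cip_def)
  have e1: "((\<lambda>x. a x *s u_z w x) \<longlongrightarrow> T) (at y within R) \<longleftrightarrow> ((\<lambda>x. a x *s P x) \<longlongrightarrow> T) (at y within R)" for a T
    by (rule tendsto_cong) (use ev in \<open>auto elim: eventually_mono\<close>)
  have e2: "((\<lambda>x. a x *s u_zbar w x) \<longlongrightarrow> T) (at y within R) \<longleftrightarrow> ((\<lambda>x. a x *s Q x) \<longlongrightarrow> T) (at y within R)" for a T
    by (rule tendsto_cong) (use ev in \<open>auto elim: eventually_mono\<close>)
  show 1: "xi10 w R y = {c *s P y | c. True}"
    unfolding xi10_def e1 by (rule limits_of_lines[OF lim(1) ne(1) nt])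
  show 2: "xi01 w R y = {c *s Q y | c. True}"
    unfolding xi01_def e2 by (rule limits_of_lines[OF lim(2) ne(2) nt])
  show "xi w R y = {a *s P y + b *s Q y | a b. True}"
    unfolding xi_def 1 2 by blast
qed

lemma coefficients:
  assumes y: "y \<in> N" and e: "a *s P y + b *s Q y = a' *s P y + b' *s Q y"
  shows "a = a'" "b = b'"
proof -
  have r: "complex_of_real (\<rho> y) \<noteq> 0" using \<rho>_pos[OF y] by simp
  have "cip (G (w y)) (a *s P y + b *s Q y) (Q y) = cip (G (w y)) (a' *s P y + b' *s Q y) (Q y)"
    "cip (G (w y)) (a *s P y + b *s Q y) (P y) = cip (G (w y)) (a' *s P y + b' *s Q y) (P y)"
    by (simp_all only: e)
  then show "a = a'" "b = b'" unfolding cip_simps products[OF y] using r by simp_all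
qed

lemma tang_part_eq:
  assumes y: "y \<in> N"
  shows "tang_part G w R y X = (2 / of_real (\<rho> y) * cip (G (w y)) X (Q y)) *s P y + (2 / of_real (\<rho> y) * cip (G (w y)) X (P y)) *s Q y"
    (is "_ = ?T")
  unfolding tang_part_def
proof (rule the_equality)
  have r: "complex_of_real (\<rho> y) \<noteq> 0" using \<rho>_pos[OF y] by simp
  show "?T \<in> xi w R y \<and> (\<forall>Y\<in>xi w R y. cip (G (w y)) (X - ?T) Y = 0)"
    unfolding xi_eq(3)[OF y]
  proof (intro conjI ballI)
    show "?T \<in> {a *s P y + b *s Q y | a b. True}" by blast
    fix Y assume "Y \<in> {a *s P y + b *s Q y | a b. True}"
    then obtain a b where Y: "Y = a *s P y + b *s Q y" by blast
    show "cip (G (w y)) (X - ?T) Y = 0"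
      unfolding Y cip_simps products[OF y] using r by (simp add: field_simps)
  qed
  fix T assume T: "T \<in> xi w R y \<and> (\<forall>Y\<in>xi w R y. cip (G (w y)) (X - T) Y = 0)"
  then obtain a b where ab: "T = a *s P y + b *s Q y" unfolding xi_eq(3)[OF y] by blast
  have "1 *s P y + 0 *s Q y \<in> xi w R y" "0 *s P y + 1 *s Q y \<in> xi w R y" unfolding xi_eq(3)[OF y] by blast+
  then have "cip (G (w y)) (X - T) (1 *s P y + 0 *s Q y) = 0" "cip (G (w y)) (X - T) (0 *s P y + 1 *s Q y) = 0"
    using T by blast+
  then have "a = 2 / of_real (\<rho> y) * cip (G (w y)) X (Q y)" "b = 2 / of_real (\<rho> y) * cip (G (w y)) X (P y)"
    unfolding ab cip_simps products[OF y] using r by (auto simp: field_simps)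
  then show "T = ?T" using ab by simp
qed

lemma part01_eq:
  assumes y: "y \<in> N"
  shows "part01 w R y (a *s P y + b *s Q y) = b *s Q y"
  unfolding part01_def
proof (rule the_equality)
  show "b *s Q y \<in> xi01 w R y \<and> a *s P y + b *s Q y - b *s Q y \<in> xi10 w R y"
    unfolding xi_eq(1,2)[OF y] by auto
  fix T assume "T \<in> xi01 w R y \<and> a *s P y + b *s Q y - T \<in> xi10 w R y"
  then obtain c d where cd: "T = d *s Q y" "a *s P y + b *s Q y - T = c *s P y"
    unfolding xi_eq(1,2)[OF y] by blast
  then have "a *s P y + b *s Q y = c *s P y + d *s Q y" by (simp add: diff_eq_eq)
  from coefficients(2)[OF y this] show "T = b *s Q y" using cd by simp
qed

section \<open>Covariant derivatives at the centre of the patch\<close>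

definition P' where "P' h = (1 / 2) *s (cvec (W1 z h) - \<i> *s cvec (Wi z h))"
definition Q' where "Q' h = (1 / 2) *s (cvec (W1 z h) + \<i> *s cvec (Wi z h))"

lemma has_derivative_frame:
  "(P has_derivative P') (at z within half_plane)" "(Q has_derivative Q') (at z within half_plane)"
proof -
  have sc: "((\<lambda>y. c *s f y) has_derivative (\<lambda>h. c *s f' h)) (at z within half_plane)"
    if "(f has_derivative f') (at z within half_plane)" for c f and f' :: "complex \<Rightarrow> complex^3"
    by (rule bounded_linear.has_derivative[OF bounded_bilinear.bounded_linear_right[OF bounded_bilinear_vscale] that])
  note c = bounded_linear.has_derivative[OF bounded_linear_cvec dW(1)] bounded_linear.has_derivative[OF bounded_linear_cvec dW(2)]
  show "(P has_derivative P') (at z within half_plane)" "(Q has_derivative Q') (at z within half_plane)"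
    unfolding P_def[abs_def] Q_def[abs_def] P'_def[abs_def] Q'_def[abs_def]
    by (intro sc has_derivative_diff has_derivative_add c)+
qed

definition dz :: "(complex \<Rightarrow> complex^3) \<Rightarrow> complex^3" where "dz F' = (1 / 2) *s (F' 1 - \<i> *s F' \<i>)"

text \<open>The covariant derivative depends on a section only through its value and differential at
  the point. Taking these two as arguments allows sections that agree nearby to be
  exchanged.\<close>

definition nab :: "complex^3 \<Rightarrow> (complex \<Rightarrow> complex^3) \<Rightarrow> complex^3" where
  "nab X X' = dz X' + christoffel_form G (w z) (P z) X"

lemma nabla_z_eq:
  assumes X: "(X has_derivative X') (at z within half_plane)" and e: "\<And>y. y \<in> N \<Longrightarrow> X y = F y"
  shows "nabla_z G w F z = nab (X z) X'"
proof -
  have "(F has_derivative X') (at z within half_plane)"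
    by (rule has_derivative_within_eq[OF X open_ball[of z \<delta>]]) (use \<delta> z e in auto)
  then show ?thesis
    using e[OF zN] frame(1)[OF zN] d_z_eq[OF z] by (simp add: nabla_z_def nab_def dz_def)
qed

lemma metric_deriv_eq: "metric_deriv G (w z) i = G' (axis i 1)"
  unfolding metric_deriv_def using frechet_half_space[OF wH[OF zN] dG] by simp

lemma cip_G': "cip (G' v) a b = dG G (w z) (cvec v) a b"
proof -
  have lin: "linear G'" using dG has_derivative_linear by blast
  have "v = (\<Sum>i\<in>UNIV. v $ i *\<^sub>R axis i 1)" by (metis basis_expansion scalar_mult_eq_scaleR)
  then have "G' v = G' (\<Sum>i\<in>UNIV. v $ i *\<^sub>R axis i 1)" by simp
  also have "\<dots> = (\<Sum>i\<in>UNIV. v $ i *\<^sub>R G' (axis i 1))" by (simp add: linear_sum[OF lin] linear_scale[OF lin])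
  finally have G'v: "G' v = (\<Sum>i\<in>UNIV. v $ i *\<^sub>R G' (axis i 1))" .
  have "cip (\<Sum>i\<in>UNIV. v $ i *\<^sub>R G' (axis i 1)) a b = (\<Sum>i\<in>UNIV. of_real (v $ i) * cip (G' (axis i 1)) a b)"
    unfolding cip_def by (simp add: sum_3 algebra_simps)
  then show ?thesis unfolding G'v[symmetric] by (simp add: dG_def metric_deriv_eq cvec_def)
qed

lemma dG_linear:
  "dG G x (a + b) c d = dG G x a c d + dG G x b c d" "dG G x (k *s a) c d = k * dG G x a c d"
  "dG G x (a - b) c d = dG G x a c d - dG G x b c d"
  by (simp_all add: dG_def algebra_simps sum.distrib sum_distrib_left sum_subtractf)

lemma dG_sym: "dG G (w z) a b c = dG G (w z) a c b"
  unfolding dG_def metric_deriv_eq using cip_commute[OF G'_sym] by metis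

lemma cip_sym: "cip (G (w z)) a b = cip (G (w z)) b a"
  by (rule cip_commute[OF sym[OF zN]])

lemma christoffel_lower:
  "cip (G (w z)) (christoffel_form G (w z) a b) c = (dG G (w z) a b c + dG G (w z) b a c - dG G (w z) c a b) / 2"
  by (rule christoffel_form_lower[of G "w z", OF sym[OF zN] pos[OF zN]])

text \<open>Metric compatibility: the derivative of the metric is the sum of two lowered Christoffel
  terms, because in that sum the remaining derivatives cancel by symmetry.\<close>

lemma has_derivative_product:
  assumes X: "(X has_derivative X') (at z within half_plane)" and Y: "(Y has_derivative Y') (at z within half_plane)"
  obtains f' where "((\<lambda>y. cip (G (w y)) (X y) (Y y)) has_derivative f') (at z within half_plane)"
    "(f' 1 - \<i> * f' \<i>) / 2 = cip (G (w z)) (nab (X z) X') (Y z) + cip (G (w z)) (X z) (nab (Y z) Y')"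
proof -
  have Gw: "((\<lambda>y. G (w y)) has_derivative (\<lambda>h. G' (W z h))) (at z within half_plane)"
    by (rule has_derivative_chain_within[OF dw[OF zN] z open_ball _ dG wH]) (use \<delta> in auto)
  let ?f = "\<lambda>h. cip (G' (W z h)) (X z) (Y z) + cip (G (w z)) (X' h) (Y z) + cip (G (w z)) (X z) (Y' h)"
  have 1: "((\<lambda>y. cip (G (w y)) (X y) (Y y)) has_derivative ?f) (at z within half_plane)"
    by (rule has_derivative_cip[OF Gw X Y])
  have d: "dG G (w z) (P z) (X z) (Y z) = cip (G (w z)) (christoffel_form G (w z) (P z) (X z)) (Y z)
      + cip (G (w z)) (X z) (christoffel_form G (w z) (P z) (Y z))"
    unfolding cip_sym[of "X z"] christoffel_lower
    using dG_sym[of "P z" "X z" "Y z"] dG_sym[of "X z" "P z" "Y z"] dG_sym[of "Y z" "P z" "X z"] by (simp add: field_simps)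
  have "(?f 1 - \<i> * ?f \<i>) / 2 = dG G (w z) (P z) (X z) (Y z) + cip (G (w z)) (dz X') (Y z) + cip (G (w z)) (X z) (dz Y')"
    unfolding cip_G' P_def dG_linear dz_def cip_simps by (simp add: field_simps)
  then have 2: "(?f 1 - \<i> * ?f \<i>) / 2 = cip (G (w z)) (nab (X z) X') (Y z) + cip (G (w z)) (X z) (nab (Y z) Y')"
    unfolding d nab_def cip_simps by simp
  show ?thesis by (rule that[OF 1 2])
qed

text \<open>Two products that agree near \<open>z\<close> have the same derivative, by uniqueness of
  one-sided differentials. This compares covariant derivatives without computing them.\<close>

lemma product_rule:
  assumes X: "(X has_derivative X') (at z within half_plane)" and Y: "(Y has_derivative Y') (at z within half_plane)"
    and X2: "(X2 has_derivative X2') (at z within half_plane)" and Y2: "(Y2 has_derivative Y2') (at z within half_plane)"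
    and e: "\<And>y. y \<in> N \<Longrightarrow> cip (G (w y)) (X y) (Y y) = cip (G (w y)) (X2 y) (Y2 y)"
  shows "cip (G (w z)) (nab (X z) X') (Y z) + cip (G (w z)) (X z) (nab (Y z) Y')
    = cip (G (w z)) (nab (X2 z) X2') (Y2 z) + cip (G (w z)) (X2 z) (nab (Y2 z) Y2')"
proof -
  obtain f where f: "((\<lambda>y. cip (G (w y)) (X y) (Y y)) has_derivative f) (at z within half_plane)"
    "(f 1 - \<i> * f \<i>) / 2 = cip (G (w z)) (nab (X z) X') (Y z) + cip (G (w z)) (X z) (nab (Y z) Y')"
    by (rule has_derivative_product[OF X Y])
  obtain f2 where f2: "((\<lambda>y. cip (G (w y)) (X2 y) (Y2 y)) has_derivative f2) (at z within half_plane)"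
    "(f2 1 - \<i> * f2 \<i>) / 2 = cip (G (w z)) (nab (X2 z) X2') (Y2 z) + cip (G (w z)) (X2 z) (nab (Y2 z) Y2')"
    by (rule has_derivative_product[OF X2 Y2])
  have "((\<lambda>y. cip (G (w y)) (X2 y) (Y2 y)) has_derivative f) (at z within half_plane)"
    by (rule has_derivative_within_eq[OF f(1) open_ball[of z \<delta>]]) (use \<delta> z e in auto)
  then have "f = f2" by (rule has_derivative_unique_half_plane[OF z _ f2(1)])
  then show ?thesis using f(2) f2(2) by simp
qed

lemma null_product:
  assumes X: "(X has_derivative X') (at z within half_plane)" and Y: "(Y has_derivative Y') (at z within half_plane)"
    and e: "\<And>y. y \<in> N \<Longrightarrow> cip (G (w y)) (X y) (Y y) = 0"
  shows "cip (G (w z)) (nab (X z) X') (Y z) + cip (G (w z)) (X z) (nab (Y z) Y') = 0"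
proof -
  have 0: "((\<lambda>_. 0 :: complex^3) has_derivative (\<lambda>_. 0)) (at z within half_plane)" by simp
  have "cip (G (w z)) (nab (X z) X') (Y z) + cip (G (w z)) (X z) (nab (Y z) Y')
    = cip (G (w z)) (nab 0 (\<lambda>_. 0)) 0 + cip (G (w z)) 0 (nab 0 (\<lambda>_. 0))"
    by (rule product_rule[OF X Y 0 0]) (simp only: e, simp add: cip_def)
  then show ?thesis by (simp add: cip_def)
qed

definition VC where "VC y = cvec (V y)"
definition VC' where "VC' h = cvec (V' h)"

lemma dVC: "(VC has_derivative VC') (at z within half_plane)"
  unfolding VC_def[abs_def] VC'_def[abs_def] by (rule bounded_linear.has_derivative[OF bounded_linear_cvec dV])

text \<open>Write \<open>S\<close> for the (0,1)-part of the velocity. Differentiating the isotropy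
  of \<open>P\<close> and \<open>Q\<close> shows that each is orthogonal to its own covariant
  derivative; since \<open>S\<close> is a multiple of \<open>Q\<close>, the derivative of
  \<open>S\<close> is orthogonal to \<open>Q\<close>, and its tangential part is a multiple of
  \<open>Q\<close>. The factor comes from differentiating the identity between the products of
  \<open>S\<close> and of \<open>VC\<close> with \<open>P\<close>: besides the derivative of
  \<open>VC\<close> it contains the product of \<open>s\<close> with the derivative of
  \<open>P\<close>, which is the second fundamental form term that is subtracted in
  \<open>mu_coeff\<close>.\<close>

lemma mu_coeff_eq:
  "mu_coeff G w R V z = (2 / of_real (\<rho> z) * cip (G (w z)) (nab (VC z) VC') (P z)) *s Q z"
proof -
  let ?B = "cip (G (w z))" and ?r = "complex_of_real (\<rho> z)"
  have r: "?r \<noteq> 0" using \<rho>_pos[OF zN] by simp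
  \<comment> \<open>Dividing by the product of \<open>P\<close> and \<open>Q\<close>, which equals
    half of \<open>\<rho>\<close>, makes \<open>\<phi>\<close> a quotient of two functions known to
    be differentiable at \<open>z\<close>.\<close>
  define \<phi> where "\<phi> y = cip (G (w y)) (VC y) (P y) / cip (G (w y)) (P y) (Q y)" for y
  have \<phi>: "\<phi> y = 2 / of_real (\<rho> y) * cip (G (w y)) (VC y) (P y)" if "y \<in> N" for y
    unfolding \<phi>_def products[OF that] by simp
  obtain f1 where f1: "((\<lambda>y. cip (G (w y)) (VC y) (P y)) has_derivative f1) (at z within half_plane)"
    by (rule has_derivative_product[OF dVC has_derivative_frame(1)])
  obtain f2 where f2: "((\<lambda>y. cip (G (w y)) (P y) (Q y)) has_derivative f2) (at z within half_plane)"
    by (rule has_derivative_product[OF has_derivative_frame])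
  have "?B (P z) (Q z) \<noteq> 0" unfolding products[OF zN] using r by simp
  from has_derivative_divide[OF f1 f2 this]
  obtain \<phi>' where \<phi>': "(\<phi> has_derivative \<phi>') (at z within half_plane)"
    unfolding \<phi>_def[abs_def] by blast
  define S where "S y = \<phi> y *s Q y" for y
  obtain S' where S': "(S has_derivative S') (at z within half_plane)"
    unfolding S_def[abs_def] using bounded_bilinear.FDERIV[OF bounded_bilinear_vscale \<phi>' has_derivative_frame(2)] by blast
  have sig: "part01 w R y (tang_part G w R y (cvec (V y))) = S y" if "y \<in> N" for y
    unfolding tang_part_eq[OF that] part01_eq[OF that] S_def \<phi>[OF that] VC_def ..
  have sig0: "S y = part01 w R y (tang_part G w R y (cvec (V y)))" if "y \<in> N" for y using sig[OF that] by simp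
  have NS: "nabla_z G w (\<lambda>y. part01 w R y (tang_part G w R y (cvec (V y)))) z = nab (S z) S'"
    by (rule nabla_z_eq[OF S' sig0])
  have NP: "nabla_z G w (u_z w) z = nab (P z) P'"
    by (rule nabla_z_eq[OF has_derivative_frame(1)]) (simp add: frame)
  have QQ: "?B (Q z) (nab (Q z) Q') = 0"
    using null_product[OF has_derivative_frame(2) has_derivative_frame(2) products(2)] cip_sym[of "nab (Q z) Q'"] by simp
  have PP: "?B (P z) (nab (P z) P') = 0"
    using null_product[OF has_derivative_frame(1) has_derivative_frame(1) products(1)] cip_sym[of "nab (P z) P'"] by simp
  have "?B (nab (S z) S') (Q z) + ?B (S z) (nab (Q z) Q') = 0"
    by (rule null_product[OF S' has_derivative_frame(2)]) (simp add: S_def cip_simps products)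
  then have SQ: "?B (nab (S z) S') (Q z) = 0" unfolding S_def cip_simps QQ by simp
  have "?B (nab (S z) S') (P z) + ?B (S z) (nab (P z) P') = ?B (nab (VC z) VC') (P z) + ?B (VC z) (nab (P z) P')"
  proof (rule product_rule[OF S' has_derivative_frame(1) dVC has_derivative_frame(1)])
    fix y assume y: "y \<in> N"
    then have "complex_of_real (\<rho> y) \<noteq> 0" using \<rho>_pos[OF y] by simp
    then show "cip (G (w y)) (S y) (P y) = cip (G (w y)) (VC y) (P y)"
      unfolding S_def cip_simps \<phi>[OF y] products[OF y] by simp
  qed
  moreover define s where "s = normal_part G w R z (cvec (V z))"
  have s: "VC z = (2 / ?r * ?B (VC z) (Q z)) *s P z + S z + s"
    unfolding s_def normal_part_def tang_part_eq[OF zN] S_def \<phi>[OF zN] VC_def by simp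
  have "?B (VC z) (nab (P z) P') = ?B ((2 / ?r * ?B (VC z) (Q z)) *s P z + S z + s) (nab (P z) P')"
    using s by simp
  then have "?B (VC z) (nab (P z) P') = ?B (S z) (nab (P z) P') + ?B s (nab (P z) P')"
    unfolding cip_simps PP by simp
  ultimately have SP: "?B (nab (S z) S') (P z) = ?B (nab (VC z) VC') (P z) + ?B s (nab (P z) P')" by simp
  have sPQ: "?B s (P z) = 0" "?B s (Q z) = 0"
    unfolding s_def normal_part_def tang_part_eq[OF zN] cip_simps products[OF zN] using r by simp_all
  have A: "?B s (sff_zz G w R z) = ?B s (nab (P z) P')"
    unfolding sff_zz_def normal_part_def NP tang_part_eq[OF zN] cip_simps sPQ by simp
  show ?thesis
    unfolding mu_coeff_def Let_def NS tang_part_eq[OF zN, of "nab (S z) S'"] SQ SP frame[OF zN] s_def[symmetric] A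
    by (simp add: vec_eq_iff algebra_simps)
qed

text \<open>\<open>k11\<close>, \<open>kii\<close>, \<open>k1i\<close> are the first variations of the components of the pull-back metric.\<close>

lemma mu_normsq_local_eq:
  defines "k11 \<equiv> ip (G' (V z)) (W z 1) (W z 1) + 2 * ip (G (w z)) (V' 1) (W z 1)"
    and "kii \<equiv> ip (G' (V z)) (W z \<i>) (W z \<i>) + 2 * ip (G (w z)) (V' \<i>) (W z \<i>)"
    and "k1i \<equiv> ip (G' (V z)) (W z 1) (W z \<i>) + ip (G (w z)) (V' 1) (W z \<i>) + ip (G (w z)) (W z 1) (V' \<i>)"
  shows "mu_normsq_local G w R V z = (((k11 - kii) / 2)\<^sup>2 + k1i\<^sup>2) / (4 * (\<rho> z)\<^sup>2)"
proof -
  let ?B = "cip (G (w z))"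
  have r: "\<rho> z > 0" by (rule \<rho>_pos[OF zN])
  define m where "m = ?B (nab (VC z) VC') (P z)"
  have c1: "ip (G' (V z)) (W z \<i>) (W z 1) = ip (G' (V z)) (W z 1) (W z \<i>)" by (rule ip_commute[OF G'_sym])
  have c2: "ip (G (w z)) (V' \<i>) (W z 1) = ip (G (w z)) (W z 1) (V' \<i>)" by (rule ip_commute[OF sym[OF zN]])
  \<comment> \<open>Of the three Christoffel terms, those differentiating the metric along
    \<open>P\<close> cancel by symmetry; the one along the velocity remains.\<close>
  have "m = ?B (dz VC') (P z) + dG G (w z) (VC z) (P z) (P z) / 2"
    unfolding m_def nab_def cip_simps christoffel_lower using dG_sym[of "P z" "VC z" "P z"] by simp
  also have "dG G (w z) (VC z) (P z) (P z) = cip (G' (V z)) (P z) (P z)" by (simp add: cip_G' VC_def)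
  also have "?B (dz VC') (P z) + cip (G' (V z)) (P z) (P z) / 2 = (of_real ((k11 - kii) / 2) - \<i> * of_real k1i) / 4"
    unfolding P_def dz_def VC'_def cip_simps cip_cvec c1 c2 k11_def kii_def k1i_def by (simp add: field_simps)
  finally have m: "m = (of_real ((k11 - kii) / 2) - \<i> * of_real k1i) / 4" .
  have "m = Complex ((k11 - kii) / 8) (- k1i / 4)" unfolding m by (simp add: complex_eq_iff)
  then have mn: "(cmod m)\<^sup>2 = (((k11 - kii) / 2)\<^sup>2 + k1i\<^sup>2) / 16"
    by (simp add: cmod_power2 power_divide)
  let ?k = "2 / of_real (\<rho> z) * m"
  \<comment> \<open>Since \<open>w\<close> is real, complex conjugation exchanges \<open>P\<close>
    and \<open>Q\<close>.\<close>
  have conj: "(\<chi> i. cnj ((?k *s Q z) $ i)) = cnj ?k *s P z"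
    by (simp add: vec_eq_iff P_def Q_def cvec_def)
  have "herm_normsq (G (w z)) (?k *s Q z) = Re (?k * cnj ?k * (of_real (\<rho> z) / 2))"
    unfolding herm_normsq_def conj cip_simps products[OF zN] by (simp only: mult_ac)
  also have "?k * cnj ?k * (of_real (\<rho> z) / 2) = of_real ((cmod ?k)\<^sup>2 * (\<rho> z / 2))"
    unfolding complex_norm_square[symmetric] by simp
  also have "Re (of_real ((cmod ?k)\<^sup>2 * (\<rho> z / 2))) = (cmod ?k)\<^sup>2 * (\<rho> z / 2)" by (rule Re_complex_of_real)
  finally have "herm_normsq (G (w z)) (?k *s Q z) = (cmod ?k)\<^sup>2 * (\<rho> z / 2)" .
  then have "mu_normsq_local G w R V z = (cmod ?k)\<^sup>2"
    unfolding mu_normsq_local_def mu_coeff_eq frame(3)[OF zN] m_def[symmetric] using r by simp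
  also have "\<dots> = 4 / (\<rho> z)\<^sup>2 * (cmod m)\<^sup>2" using r by (simp add: norm_mult norm_divide power_mult_distrib power_divide)
  finally show ?thesis unfolding mn using r by (simp add: field_simps)
qed

end

section \<open>Behaviour at the boundary and under change of charts\<close>

lemma half_space_frontier: "x \<in> frontier half_space \<Longrightarrow> x $ 3 = 0"
proof -
  have "half_space = {x. axis 3 (1 :: real) \<bullet> x \<ge> 0}" by (simp add: half_space_def inner_axis')
  moreover have "(axis 3 1 :: real^3) \<noteq> 0" by (simp add: axis_eq_0_iff)
  ultimately have "frontier half_space = {x. axis 3 (1 :: real) \<bullet> x = 0}" using frontier_halfspace_ge by metis
  then show "x \<in> frontier half_space \<Longrightarrow> x $ 3 = 0" by (simp add: inner_axis')
qed

lemma half_space_interior: "0 < x $ 3 \<Longrightarrow> x \<in> interior half_space"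
proof (rule interiorI[of "{x. 0 < x $ 3}"])
  show "open {x :: real^3. 0 < x $ 3}" by (rule open_halfspace_component_gt_cart)
qed (auto simp: half_space_def)

context variation
begin

text \<open>At an interior point the third coordinate of a transition map cannot have a minimum, because its
  differential has a right inverse.\<close>

lemma boundary_coordinate:
  assumes q: "q \<in> manifold_boundary half_space AM" and c: "c \<in> AM" "q \<in> fst c"
  shows "snd c q $ 3 = 0"
proof (rule ccontr)
  assume "snd c q $ 3 \<noteq> 0"
  obtain c0 where c0: "c0 \<in> AM" "q \<in> fst c0" "snd c0 q \<in> frontier half_space"
    using q unfolding manifold_boundary_def by blast
  note C = chart_facts[OF chartM[OF c(1)]] and C0 = chart_facts[OF chartM[OF c0(1)]]
  let ?x = "snd c q" and ?y = "snd c0 q"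
  have "?x \<in> half_space" using C(9) c(2) by blast
  then have x: "?x \<in> interior half_space"
    using \<open>snd c q $ 3 \<noteq> 0\<close> by (intro half_space_interior) (simp add: half_space_def)
  have y3: "?y $ 3 = 0" by (rule half_space_frontier[OF c0(3)])
  let ?T = "frechet_derivative (transition c c0) (at ?x within half_space)"
  let ?T' = "frechet_derivative (transition c0 c) (at ?y within half_space)"
  have T: "(transition c c0 has_derivative ?T) (at ?x within half_space)"
    using c c0 by (intro transitionM_derivative) auto
  have T': "(transition c0 c has_derivative ?T') (at ?y within half_space)"
    using c c0 by (intro transitionM_derivative) auto
  have op: "openin (top_of_set half_space) (snd c ` (fst c \<inter> fst c0))" "openin (top_of_set half_space) (snd c0 ` (fst c \<inter> fst c0))"
    using C(1) C0(1) by (auto intro!: chart_image_openin chartM c c0)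
  obtain O1 where O1: "open O1" "snd c ` (fst c \<inter> fst c0) = half_space \<inter> O1"
    using op(1) unfolding openin_open by blast
  obtain O2 where O2: "open O2" "snd c0 ` (fst c \<inter> fst c0) = half_space \<inter> O2"
    using op(2) unfolding openin_open by blast
  have xO: "?x \<in> O1" "?y \<in> O2" using O1(2) O2(2) c(2) c0(2) by blast+
  have T3: "?T h $ 3 = 0" for h
  proof -
    have "(transition c c0 has_derivative ?T) (at ?x)" using T at_within_interior[OF x] by simp
    then have d: "((\<lambda>y. transition c c0 y $ 3) has_derivative (\<lambda>h. ?T h $ 3)) (at ?x)"
      by (rule bounded_linear.has_derivative[OF bounded_linear_vec_nth])
    have "transition c c0 ?x $ 3 = 0" using y3 C(3) c(2) by (simp add: transition_def)
    moreover have "0 \<le> transition c c0 y $ 3" if y: "y \<in> O1 \<inter> interior half_space" for y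
    proof -
      have "y \<in> half_space \<inter> O1" using y interior_subset by blast
      then obtain r where "r \<in> fst c" "r \<in> fst c0" "y = snd c r" using O1(2) by blast
      then have "transition c c0 y \<in> half_space" using C(3) C0(9) by (auto simp: transition_def)
      then show ?thesis by (simp add: half_space_def)
    qed
    ultimately have "\<forall>\<^sub>F y in at ?x. transition c c0 ?x $ 3 \<le> transition c c0 y $ 3"
      unfolding eventually_at_topological using O1(1) xO x
      by (intro exI[of _ "O1 \<inter> interior half_space"]) auto
    from has_derivative_local_min[OF d this] show ?thesis by (rule fun_cong)
  qed
  have yh: "?y \<in> half_space" using C0(9) c0(2) by blast
  have tx: "transition c0 c ?y = ?x" using C0(3) c0(2) by (simp add: transition_def)
  have inO2: "\<exists>r. r \<in> fst c \<and> r \<in> fst c0 \<and> y = snd c0 r" if "y \<in> half_space \<inter> O2" for y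
    using that O2(2) by blast
  have "((\<lambda>y. transition c c0 (transition c0 c y)) has_derivative (\<lambda>h. ?T (?T' h))) (at ?y within half_space)"
  proof (rule has_derivative_chain_within[where w = "transition c0 c" and \<tau> = "transition c c0" and U = O2
        and K = half_space and D = ?T' and T = ?T])
    show "transition c0 c y \<in> half_space" if "y \<in> half_space \<inter> O2" for y
      using inO2[OF that] C0(3) C(9) by (auto simp: transition_def)
  qed (use T' T tx yh xO O2(1) in auto)
  then have "((\<lambda>y. y) has_derivative (\<lambda>h. ?T (?T' h))) (at ?y within half_space)"
  proof (rule has_derivative_within_eq[OF _ O2(1) xO(2) yh])
    fix y assume "y \<in> half_space \<inter> O2"
    then obtain r where "r \<in> fst c" "r \<in> fst c0" "y = snd c0 r" using inO2 by blast
    then show "transition c c0 (transition c0 c y) = y" using C(3) C0(3) by (simp add: transition_def)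
  qed
  from frechet_half_space[OF yh this] frechet_half_space[OF yh has_derivative_ident]
  have "?T (?T' h) = h" for h by (metis)
  then have "(axis 3 1 :: real^3) $ 3 = 0" using T3 by metis
  then show False by simp
qed

text \<open>The velocity of each point is the time derivative of any smooth local extension of the
  family. The third part allows an arbitrary such extension, so the velocity can be differentiated
  along the surface in the coordinates at hand.\<close>

lemma curve_derivative:
  assumes c: "cM \<in> AM" "\<Phi> 0 p \<in> fst cM"
  shows "((\<lambda>t. snd cM (\<Phi> t p)) has_derivative (\<lambda>t. t *\<^sub>R initial_velocity \<Phi> cM p)) (at 0)"
    and "\<exists>e>0. \<forall>t. \<bar>t\<bar> < e \<longrightarrow> t \<in> I \<and> \<Phi> t p \<in> fst cM"
    and "cS \<in> AS \<Longrightarrow> p \<in> fst cS \<Longrightarrow> Cinf (ball 0 \<delta> \<times> ball z0 \<delta>) F \<Longrightarrow>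
      (\<forall>t\<in>ball 0 \<delta>. \<forall>z\<in>half_plane \<inter> ball z0 \<delta>. z \<in> local_dom cS cM (\<Phi> t) \<and> F (t, z) = local_rep cS cM (\<Phi> t) z) \<Longrightarrow>
      snd cS p \<in> ball z0 \<delta> \<Longrightarrow> initial_velocity \<Phi> cM p = pd (1, 0) F (0, snd cS p)"
proof -
  have main: "((\<lambda>t. snd cM (\<Phi> t p)) has_derivative (\<lambda>t. t *\<^sub>R pd (1, 0) F (0, snd cS p))) (at 0) \<and>
      initial_velocity \<Phi> cM p = pd (1, 0) F (0, snd cS p) \<and> \<delta> > 0 \<and> (\<forall>t\<in>ball 0 \<delta>. \<Phi> t p \<in> fst cM)"
    if cS: "cS \<in> AS" "p \<in> fst cS" and F: "Cinf (ball 0 \<delta> \<times> ball z0 \<delta>) F"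
      "\<forall>t\<in>ball 0 \<delta>. \<forall>z\<in>half_plane \<inter> ball z0 \<delta>. z \<in> local_dom cS cM (\<Phi> t) \<and> F (t, z) = local_rep cS cM (\<Phi> t) z"
      and z: "snd cS p \<in> ball z0 \<delta>" for cS z0 \<delta> F
  proof -
    have \<delta>: "\<delta> > 0" using z by (metis ball_eq_empty empty_iff not_le)
    have zh: "snd cS p \<in> half_plane \<inter> ball z0 \<delta>" using z cS chart_facts(9)[OF chart[OF cS(1)]] by blast
    have inv: "chart_inv cS (snd cS p) = p" using chart_facts(3)[OF chart[OF cS(1)]] cS(2) by simp
    have m: "(0, snd cS p) \<in> ball 0 \<delta> \<times> ball z0 \<delta>" using z \<delta> by auto
    have l: "((\<lambda>t. (t, snd cS p)) has_derivative (\<lambda>t. t *\<^sub>R (1, 0))) (at (0::real))"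
      by (rule has_derivative_eq_rhs, (rule derivative_eq_intros refl)+) (simp add: fun_eq_iff)
    have "((\<lambda>t. F (t, snd cS p)) has_derivative (\<lambda>t. pd (t *\<^sub>R (1, 0)) F (0, snd cS p))) (at 0)"
      by (rule has_derivative_compose[OF l Cinf_has_derivative[OF F(1) m]])
    then have "((\<lambda>t. F (t, snd cS p)) has_derivative (\<lambda>t. t *\<^sub>R pd (1, 0) F (0, snd cS p))) (at 0)"
      unfolding linear_scale[OF pd_linear[OF F(1) m]] .
    then have 1: "((\<lambda>t. snd cM (\<Phi> t p)) has_derivative (\<lambda>t. t *\<^sub>R pd (1, 0) F (0, snd cS p))) (at 0)"
    proof (rule has_derivative_transform_within_open[of _ _ _ _ "ball 0 \<delta>"])
      fix t :: real assume "t \<in> ball 0 \<delta>"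
      then show "F (t, snd cS p) = snd cM (\<Phi> t p)" using F(2) zh by (simp add: local_rep_def inv)
    qed (use \<delta> in auto)
    then have "initial_velocity \<Phi> cM p = pd (1, 0) F (0, snd cS p)"
      unfolding initial_velocity_def by (intro vector_derivative_at) (simp add: has_vector_derivative_def)
    moreover have "\<Phi> t p \<in> fst cM" if "t \<in> ball 0 \<delta>" for t
    proof -
      have "snd cS p \<in> local_dom cS cM (\<Phi> t)" using F(2) that zh by blast
      then show ?thesis unfolding local_dom_iff[OF cS(1)] inv by blast
    qed
    ultimately show ?thesis using 1 \<delta> by blast
  qed
  define cS where "cS = chart_at AS p"
  have cS: "cS \<in> AS" "p \<in> fst cS" using chart_at by (auto simp: cS_def)
  have z: "snd cS p \<in> local_dom cS cM (\<Phi> 0)"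
    unfolding local_dom_iff[OF cS(1)] using cS c chart_facts(3)[OF chart[OF cS(1)] cS(2)] by simp
  obtain \<delta> F V G where F: "\<delta> > 0" "ball 0 \<delta> \<subseteq> I" "Cinf (ball 0 \<delta> \<times> ball (snd cS p) \<delta>) F"
    "\<forall>t\<in>ball 0 \<delta>. \<forall>z\<in>half_plane \<inter> ball (snd cS p) \<delta>. z \<in> local_dom cS cM (\<Phi> t) \<and> F (t, z) = local_rep cS cM (\<Phi> t) z"
    "Cinf V G" "F ` (ball 0 \<delta> \<times> ball (snd cS p) \<delta>) \<subseteq> V" "\<forall>x\<in>V \<inter> snd cM ` fst cM. G x = g cM x"
    using local_extension[OF cS(1) c(1) I(2) z, of thesis] by blast
  have zb: "snd cS p \<in> ball (snd cS p) \<delta>" using F(1) by simp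
  note m = main[OF cS F(3,4) zb]
  show "((\<lambda>t. snd cM (\<Phi> t p)) has_derivative (\<lambda>t. t *\<^sub>R initial_velocity \<Phi> cM p)) (at 0)" using m by simp
  show "\<exists>e>0. \<forall>t. \<bar>t\<bar> < e \<longrightarrow> t \<in> I \<and> \<Phi> t p \<in> fst cM"
    using m F(2) by (intro exI[of _ \<delta>]) auto
  show "cS \<in> AS \<Longrightarrow> p \<in> fst cS \<Longrightarrow> Cinf (ball 0 \<delta> \<times> ball z0 \<delta>) F \<Longrightarrow>
      (\<forall>t\<in>ball 0 \<delta>. \<forall>z\<in>half_plane \<inter> ball z0 \<delta>. z \<in> local_dom cS cM (\<Phi> t) \<and> F (t, z) = local_rep cS cM (\<Phi> t) z) \<Longrightarrow>
      snd cS p \<in> ball z0 \<delta> \<Longrightarrow> initial_velocity \<Phi> cM p = pd (1, 0) F (0, snd cS p)" for cS \<delta> z0 F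
    using main by blast
qed

text \<open>Smoothness comes from the local extension and the transformation law from the chain
  rule. For tangency, a boundary point moves inside the boundary, so its third coordinate is
  constantly 0 in every chart.\<close>

lemma boundary_tangent:
  assumes bd: "\<forall>t\<in>I. \<Phi> t ` manifold_boundary half_plane AS \<subseteq> manifold_boundary half_space AM"
  shows "boundary_tangent_section AS AM (\<Phi> 0) (initial_velocity \<Phi>)"
  unfolding boundary_tangent_section_def smooth_section_def
proof (intro conjI ballI allI impI)
  fix cS cM assume c: "cS \<in> AS" "cM \<in> AM"
  show "smooth_on (\<lambda>z. initial_velocity \<Phi> cM (chart_inv cS z)) (local_dom cS cM (\<Phi> 0))"
    unfolding smooth_on_def
  proof
    fix z0 assume z0: "z0 \<in> local_dom cS cM (\<Phi> 0)"
    obtain \<delta> F V G where F: "\<delta> > 0" "ball 0 \<delta> \<subseteq> I" "Cinf (ball 0 \<delta> \<times> ball z0 \<delta>) F"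
      "\<forall>t\<in>ball 0 \<delta>. \<forall>z\<in>half_plane \<inter> ball z0 \<delta>. z \<in> local_dom cS cM (\<Phi> t) \<and> F (t, z) = local_rep cS cM (\<Phi> t) z"
      "Cinf V G" "F ` (ball 0 \<delta> \<times> ball z0 \<delta>) \<subseteq> V" "\<forall>x\<in>V \<inter> snd cM ` fst cM. G x = g cM x"
      using local_extension[OF c I(2) z0, of thesis] by blast
    have "bounded_linear (\<lambda>z. (0 :: real, z :: complex))"
      by (intro bounded_linear_Pair bounded_linear_zero bounded_linear_ident)
    then have "Cinf (ball z0 \<delta>) (\<lambda>z. (0 :: real, z))"
      unfolding Cinf_def using Ck_on_bounded_linear by blast
    then have "Cinf (ball z0 \<delta>) (\<lambda>z. pd (1, 0) F (0, z))"
      by (rule Cinf_compose[OF Cinf_pd[OF F(3)]]) (use F(1) in auto)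
    moreover have "pd (1, 0) F (0, z) = initial_velocity \<Phi> cM (chart_inv cS z)"
      if z: "z \<in> local_dom cS cM (\<Phi> 0) \<inter> ball z0 \<delta>" for z
    proof -
      have zz: "z \<in> snd cS ` fst cS" "\<Phi> 0 (chart_inv cS z) \<in> fst cM"
        using z unfolding Int_iff local_dom_iff[OF c(1)] by blast+
      note C = chart_facts(4,5)[OF chart[OF c(1)] zz(1)]
      have "initial_velocity \<Phi> cM (chart_inv cS z) = pd (1, 0) F (0, snd cS (chart_inv cS z))"
        by (rule curve_derivative(3)[OF c(2) zz(2) c(1) C(2) F(3,4)]) (use C(1) z in simp)
      then show ?thesis using C(1) by simp
    qed
    ultimately show "\<exists>U F. open U \<and> z0 \<in> U \<and> (\<forall>k. Ck_on k F U) \<and>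
        (\<forall>y\<in>local_dom cS cM (\<Phi> 0) \<inter> U. F y = initial_velocity \<Phi> cM (chart_inv cS y))"
      using F(1) unfolding Cinf_def
      by (intro exI[of _ "ball z0 \<delta>"] exI[of _ "\<lambda>z. pd (1, 0) F (0, z)"]) auto
  qed
next
  fix c c' p assume c: "c \<in> AM" "c' \<in> AM" and p: "\<Phi> 0 p \<in> fst c \<inter> fst c'"
  let ?T = "frechet_derivative (transition c c') (at (snd c (\<Phi> 0 p)) within half_space)"
  have pc: "\<Phi> 0 p \<in> fst c" "\<Phi> 0 p \<in> fst c'" using p by auto
  note C = chart_facts[OF chartM[OF c(1)]]
  obtain e where e: "e > 0" "\<And>t. \<bar>t\<bar> < e \<Longrightarrow> \<Phi> t p \<in> fst c" using curve_derivative(2)[OF c(1) pc(1)] by blast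
  have T: "(transition c c' has_derivative ?T) (at (snd c (\<Phi> 0 p)) within half_space)"
    using p by (intro transitionM_derivative[OF c]) auto
  have "((\<lambda>t. transition c c' (snd c (\<Phi> t p))) has_derivative (\<lambda>t. ?T (t *\<^sub>R initial_velocity \<Phi> c p))) (at 0)"
  proof (rule has_derivative_chain_within[where w = "\<lambda>t. snd c (\<Phi> t p)" and \<tau> = "transition c c'" and U = "ball 0 e"
        and K = half_space and H = UNIV, OF curve_derivative(1)[OF c(1) pc(1)] UNIV_I open_ball _ T])
    show "snd c (\<Phi> t p) \<in> half_space" if "t \<in> UNIV \<inter> ball 0 e" for t
      using e(2)[of t] that C(9) by auto
  qed (use e in auto)
  then have "((\<lambda>t. snd c' (\<Phi> t p)) has_derivative (\<lambda>t. ?T (t *\<^sub>R initial_velocity \<Phi> c p))) (at 0)"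
    by (rule has_derivative_transform_within_open[of _ _ _ _ "ball 0 e"])
      (use e C(3) in \<open>auto simp: transition_def\<close>)
  then have "(\<lambda>t. ?T (t *\<^sub>R initial_velocity \<Phi> c p)) = (\<lambda>t. t *\<^sub>R initial_velocity \<Phi> c' p)"
    using curve_derivative(1)[OF c(2) pc(2)] by (rule has_derivative_unique)
  from fun_cong[OF this, of 1] show "initial_velocity \<Phi> c' p = ?T (initial_velocity \<Phi> c p)" by simp
next
  fix p c assume p: "p \<in> manifold_boundary half_plane AS" and c: "c \<in> AM" "\<Phi> 0 p \<in> fst c"
  obtain e where e: "e > 0" "\<And>t. \<bar>t\<bar> < e \<Longrightarrow> t \<in> I \<and> \<Phi> t p \<in> fst c" using curve_derivative(2)[OF c] by blast
  have "((\<lambda>t. snd c (\<Phi> t p) $ 3) has_derivative (\<lambda>t. (t *\<^sub>R initial_velocity \<Phi> c p) $ 3)) (at 0)"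
    by (rule bounded_linear.has_derivative[OF bounded_linear_vec_nth curve_derivative(1)[OF c]])
  then have "((\<lambda>t. 0) has_derivative (\<lambda>t. (t *\<^sub>R initial_velocity \<Phi> c p) $ 3)) (at 0)"
  proof (rule has_derivative_transform_within_open[of _ _ _ _ "ball 0 e"])
    fix t :: real assume "t \<in> ball 0 e"
    then have t: "t \<in> I" "\<Phi> t p \<in> fst c" using e(2)[of t] by auto
    then have "\<Phi> t p \<in> manifold_boundary half_space AM" using bd p by blast
    then show "snd c (\<Phi> t p) $ 3 = 0" using boundary_coordinate c(1) t(2) by blast
  qed (use e in auto)
  then have "(\<lambda>t :: real. (t *\<^sub>R initial_velocity \<Phi> c p) $ 3) = (\<lambda>t. 0)"
    using has_derivative_const by (rule has_derivative_unique)
  from fun_cong[OF this, of 1] show "initial_velocity \<Phi> c p $ 3 = 0" by simp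
qed

section \<open>Chart independence of the squared norm of mu\<close>

lemma jac_nonzero:
  assumes c: "c \<in> AS" "c' \<in> AS" and p: "p \<in> fst c" "p \<in> fst c'"
  shows "jac c c' (snd c p) \<noteq> 0"
proof
  assume 0: "jac c c' (snd c p) = 0"
  note C = chart_facts[OF chart[OF c(1)]] and C' = chart_facts[OF chart[OF c(2)]]
  have zS: "snd c p \<in> snd c ` (fst c \<inter> fst c')" and zS': "snd c' p \<in> snd c' ` (fst c' \<inter> fst c)" using p by blast+
  have zh: "snd c p \<in> half_plane" using p C(9) by blast
  obtain U F where U: "open U" "snd c p \<in> U"
    "\<forall>y\<in>half_plane \<inter> U. y \<in> snd c ` (fst c \<inter> fst c') \<and> F y = transition c c' y"
    using transition_holomorphic[OF c zS, of thesis] by blast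
  have tz: "transition c c' (snd c p) = snd c' p" using C(3) p by (simp add: transition_def)
  have inU: "\<exists>q. q \<in> fst c \<and> q \<in> fst c' \<and> y = snd c q" if "y \<in> half_plane \<inter> U" for y using U(3) that by blast
  have "((\<lambda>y. transition c' c (transition c c' y)) has_derivative (\<lambda>h. jac c' c (snd c' p) * (jac c c' (snd c p) * h))) (at (snd c p) within half_plane)"
  proof (rule has_derivative_chain_within[where w = "transition c c'" and \<tau> = "transition c' c" and U = U and K = half_plane
        and D = "\<lambda>h. jac c c' (snd c p) * h" and T = "\<lambda>h. jac c' c (snd c' p) * h"])
    show "(transition c' c has_derivative (\<lambda>h. jac c' c (snd c' p) * h)) (at (transition c c' (snd c p)) within half_plane)"
      unfolding tz by (rule transition_derivative[OF c(2,1) zS'])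
    show "transition c c' y \<in> half_plane" if "y \<in> half_plane \<inter> U" for y
      using inU[OF that] C(3) C'(9) by (auto simp: transition_def)
  qed (use zh U transition_derivative[OF c zS] in auto)
  then have "((\<lambda>y. y) has_derivative (\<lambda>h. jac c' c (snd c' p) * (jac c c' (snd c p) * h))) (at (snd c p) within half_plane)"
  proof (rule has_derivative_within_eq[OF _ U(1,2) zh])
    fix y assume "y \<in> half_plane \<inter> U"
    then obtain q where "q \<in> fst c" "q \<in> fst c'" "y = snd c q" using inU by blast
    then show "transition c' c (transition c c' y) = y" using C(3) C'(3) by (simp add: transition_def)
  qed
  from has_derivative_unique_half_plane[OF zh this has_derivative_ident]
  have "jac c' c (snd c' p) * (jac c c' (snd c p) * 1) = 1" by (rule fun_cong)
  then show False using 0 by simp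
qed

lemma components_differentiable:
  assumes c: "c \<in> AS" and z: "z \<in> snd c ` fst c"
  shows "((\<lambda>t. al c t z) has_real_derivative deriv (\<lambda>t. al c t z) 0) (at 0)"
    "((\<lambda>t. be c t z) has_real_derivative deriv (\<lambda>t. be c t z) 0) (at 0)"
proof -
  obtain \<delta> H where H: "\<delta> > 0" "ball 0 \<delta> \<subseteq> I" "half_plane \<inter> ball z \<delta> \<subseteq> snd c ` fst c"
    "\<And>a b. Cinf (ball 0 \<delta> \<times> ball z \<delta>) (H a b)"
    "\<And>s y a b. s \<in> ball 0 \<delta> \<Longrightarrow> y \<in> half_plane \<inter> ball z \<delta> \<Longrightarrow> hh c s y a b = H a b (s, y)"
    by (rule hh_local[OF c I(2) z]) (rule that)
  have zz: "z \<in> half_plane \<inter> ball z \<delta>" using z chart_facts(9)[OF chart[OF c]] H(1) by auto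
  have l: "((\<lambda>t. (t, z)) has_derivative (\<lambda>t. t *\<^sub>R (1, 0))) (at (0::real))"
    by (rule has_derivative_eq_rhs, (rule derivative_eq_intros refl)+) (simp add: fun_eq_iff)
  have h: "((\<lambda>t. hh c t z a b) has_real_derivative pd (1, 0) (H a b) (0, z)) (at 0)" for a b
  proof -
    have "((\<lambda>t. H a b (t, z)) has_real_derivative pd (1, 0) (H a b) (0, z)) (at 0)"
      by (rule Cinf_line[OF H(4) l]) (use H(1) in auto)
    then show ?thesis
      by (rule has_field_derivative_transform_within_open[of _ _ _ "ball 0 \<delta>"]) (use H(1,5) zz in auto)
  qed
  have "((\<lambda>t. al c t z) has_real_derivative (pd (1, 0) (H 1 1) (0, z) - pd (1, 0) (H \<i> \<i>) (0, z)) / 2) (at 0)"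
    unfolding al_def by (intro DERIV_cdivide DERIV_diff h)
  moreover have "((\<lambda>t. be c t z) has_real_derivative pd (1, 0) (H 1 \<i>) (0, z)) (at 0)"
    unfolding be_def by (rule h)
  ultimately show "((\<lambda>t. al c t z) has_real_derivative deriv (\<lambda>t. al c t z) 0) (at 0)"
    "((\<lambda>t. be c t z) has_real_derivative deriv (\<lambda>t. be c t z) 0) (at 0)"
    using DERIV_imp_deriv by metis+
qed

text \<open>The squared norm of mu in coordinates, expressed by the velocity of the trace-free part
  of the pull-back metric. At branch points, where \<open>ee c 0 z\<close> vanishes, the value is 0
  by division by zero.\<close>

definition mu_dens where
  "mu_dens c z = ((deriv (\<lambda>t. al c t z) 0)\<^sup>2 + (deriv (\<lambda>t. be c t z) 0)\<^sup>2) / (4 * (ee c 0 z)\<^sup>2)"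

text \<open>The trace-free velocity is multiplied by the square of the Jacobian. Its squared length
  and the square of \<open>ee\<close> therefore both scale with the fourth power of the modulus,
  which cancels.\<close>

lemma mu_dens_change_chart:
  assumes c: "c \<in> AS" "c' \<in> AS" and p: "p \<in> fst c" "p \<in> fst c'"
  shows "mu_dens c (snd c p) = mu_dens c' (snd c' p)"
proof -
  let ?z = "snd c p" and ?z' = "snd c' p"
  obtain x y where J: "jac c c' ?z = Complex x y" by (cases "jac c c' ?z")
  have "Complex x y \<noteq> 0" using jac_nonzero[OF c p] J by simp
  then have N: "x\<^sup>2 + y\<^sup>2 \<noteq> 0" by (auto simp: complex_eq_iff sum_power2_eq_zero_iff)
  note e = change_chart[OF c p _ J]
  let ?a = "deriv (\<lambda>t. al c' t ?z') 0" and ?b = "deriv (\<lambda>t. be c' t ?z') 0"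
  have z': "?z' \<in> snd c' ` fst c'" using p by blast
  note d = components_differentiable[OF c(2) z']
  have "((\<lambda>t. (x\<^sup>2 - y\<^sup>2) * al c' t ?z' + 2 * x * y * be c' t ?z') has_real_derivative (x\<^sup>2 - y\<^sup>2) * ?a + 2 * x * y * ?b) (at 0)"
    by (intro DERIV_add DERIV_cmult d)
  then have "((\<lambda>t. al c t ?z) has_real_derivative (x\<^sup>2 - y\<^sup>2) * ?a + 2 * x * y * ?b) (at 0)"
    by (rule has_field_derivative_transform_within_open[OF _ I]) (simp add: e)
  then have A: "deriv (\<lambda>t. al c t ?z) 0 = (x\<^sup>2 - y\<^sup>2) * ?a + 2 * x * y * ?b" by (rule DERIV_imp_deriv)
  have "((\<lambda>t. (x\<^sup>2 - y\<^sup>2) * be c' t ?z' - 2 * x * y * al c' t ?z') has_real_derivative (x\<^sup>2 - y\<^sup>2) * ?b - 2 * x * y * ?a) (at 0)"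
    by (intro DERIV_diff DERIV_cmult d)
  then have "((\<lambda>t. be c t ?z) has_real_derivative (x\<^sup>2 - y\<^sup>2) * ?b - 2 * x * y * ?a) (at 0)"
    by (rule has_field_derivative_transform_within_open[OF _ I]) (simp add: e)
  then have B: "deriv (\<lambda>t. be c t ?z) 0 = (x\<^sup>2 - y\<^sup>2) * ?b - 2 * x * y * ?a" by (rule DERIV_imp_deriv)
  have num: "((x\<^sup>2 - y\<^sup>2) * ?a + 2 * x * y * ?b)\<^sup>2 + ((x\<^sup>2 - y\<^sup>2) * ?b - 2 * x * y * ?a)\<^sup>2 = (x\<^sup>2 + y\<^sup>2)\<^sup>2 * (?a\<^sup>2 + ?b\<^sup>2)"
    by (simp add: algebra_simps power2_eq_square)
  show ?thesis
    unfolding mu_dens_def A B num e(1)[OF I(2)] using N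
    by (auto simp: power_mult_distrib mult.left_commute[of 4])
qed

end

context conformal_variation
begin

text \<open>Joins the invariant definition of mu with the first variation of the pull-back metric.
  At an immersed point the local extension provides a \<open>surface_patch\<close>; at a branch
  point both sides are 0.\<close>

lemma mu_normsq_chart_at:
  defines "u \<equiv> \<Phi> 0" and "v \<equiv> initial_velocity \<Phi>"
  shows "mu_normsq AS AM g u v p = mu_dens (chart_at AS p) (snd (chart_at AS p) p)"
proof -
  define c where "c = chart_at AS p"
  define cM where "cM = chart_at AM (u p)"
  define z where "z = snd c p"
  define w where "w = local_rep c cM u"
  define R where "R = local_dom c cM u - snd c ` (fst c \<inter> critical_set AS AM u)"
  define V where "V y = v cM (chart_inv c y)" for y
  have c: "c \<in> AS" "p \<in> fst c" using chart_at by (auto simp: c_def)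
  have cM: "cM \<in> AM" "u p \<in> fst cM" using chartM_at by (auto simp: cM_def)
  have zc: "z \<in> snd c ` fst c" using c by (simp add: z_def)
  have zl: "z \<in> local_dom c cM (\<Phi> 0)"
    unfolding local_dom_iff[OF c(1)] using c cM chart_facts(3)[OF chart[OF c(1)] c(2)] by (simp add: z_def u_def)
  have mu: "mu_normsq AS AM g u v p = mu_normsq_local (g cM) w R V z"
    by (simp add: mu_normsq_def Let_def w_def R_def V_def[abs_def] z_def c_def cM_def)
  have zh: "z \<in> half_plane" by (rule local_dom_half_plane[OF c(1) zl])
  obtain \<delta>1 F X G where F: "\<delta>1 > 0" "ball 0 \<delta>1 \<subseteq> I" "Cinf (ball 0 \<delta>1 \<times> ball z \<delta>1) F"
    "\<forall>t\<in>ball 0 \<delta>1. \<forall>y\<in>half_plane \<inter> ball z \<delta>1. y \<in> local_dom c cM (\<Phi> t) \<and> F (t, y) = local_rep c cM (\<Phi> t) y"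
    "Cinf X G" "F ` (ball 0 \<delta>1 \<times> ball z \<delta>1) \<subseteq> X" "\<forall>x\<in>X \<inter> snd cM ` fst cM. G x = g cM x"
    using local_extension[OF c(1) cM(1) I(2) zl, of thesis] by blast
  have z0: "0 \<in> ball (0 :: real) \<delta>1" using F(1) by simp
  have dom: "y \<in> local_dom c cM (\<Phi> 0)" "F (0, y) = w y" if "y \<in> half_plane \<inter> ball z \<delta>1" for y
    using F(4) z0 that by (auto simp: w_def u_def)
  have hw: "hh c 0 y a b = ip (g cM (w y)) (Drep c cM 0 y a) (Drep c cM 0 y b)" if "y \<in> half_plane \<inter> ball z \<delta>1" for y a b
    unfolding hh_def w_def u_def by (rule pullback_eq[OF c(1) cM(1) I(2) dom(1)[OF that]])
  have zN1: "z \<in> half_plane \<inter> ball z \<delta>1" using zh F(1) by simp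
  show ?thesis
  proof (cases "ee c 0 z = 0")
    \<comment> \<open>The conformal factor vanishes, so both expressions are divisions by
      zero.\<close>
    case True
    have "conf_factor (g cM) w z = hh c 0 z 1 1"
      unfolding hw[OF zN1] conf_factor_def d_x_def by (simp add: w_def u_def)
    also have "\<dots> = 0" using True conformal_at(5)[OF c(1) zc] by simp
    finally have "mu_normsq_local (g cM) w R V z = 0" by (simp add: mu_normsq_local_def)
    then show ?thesis using True mu by (simp add: mu_dens_def c_def z_def)
  next
    case False
    \<comment> \<open>By continuity the metric stays nondegenerate near \<open>z\<close>, which
      yields a patch consisting of immersed points.\<close>
    have "continuous_on (snd c ` fst c) (\<lambda>y. hh c 0 y 1 1)" by (rule hh_continuous[OF c(1) I(2)])
    moreover have h0: "hh c 0 z 1 1 \<noteq> 0" using False conformal_at(5)[OF c(1) zc] by simp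
    ultimately obtain e where e: "e > 0" "\<And>y. y \<in> snd c ` fst c \<Longrightarrow> dist z y < e \<Longrightarrow> hh c 0 y 1 1 \<noteq> 0"
      using continuous_on_avoid[of "snd c ` fst c" "\<lambda>y. hh c 0 y 1 1" z 0] zc by blast
    define \<delta> where "\<delta> = min \<delta>1 e"
    have \<delta>: "\<delta> > 0" "\<delta> \<le> \<delta>1" "\<delta> \<le> e" using F(1) e(1) by (auto simp: \<delta>_def)
    have N1: "y \<in> half_plane \<inter> ball z \<delta>1" if "y \<in> half_plane \<inter> ball z \<delta>" for y using that \<delta> by auto
    define W where "W y h = pd (0, h) F (0, y)" for y h :: complex
    define W1 where "W1 y h = pd (0, h) (pd (0, 1) F) (0, y)" for y h :: complex
    define Wi where "Wi y h = pd (0, h) (pd (0, \<i>) F) (0, y)" for y h :: complex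
    define V' where "V' h = pd (0, h) (pd (1, 0) F) (0, z)" for h :: complex
    define G' where "G' x = pd x G (F (0, z))" for x
    have DW: "Drep c cM 0 y = W y" if "y \<in> half_plane \<inter> ball z \<delta>1" for y
      unfolding W_def[abs_def] using Drep_eq[OF c(1) F(3,4) z0 that] by (simp add: fun_eq_iff)
    have hN: "y \<in> snd c ` fst c" "hh c 0 y 1 1 \<noteq> 0" if "y \<in> half_plane \<inter> ball z \<delta>" for y
    proof -
      show "y \<in> snd c ` fst c" using dom(1)[OF N1[OF that]] unfolding local_dom_iff[OF c(1)] by blast
      then show "hh c 0 y 1 1 \<noteq> 0" using e(2) that \<delta>(3) by auto
    qed
    have wy: "w y \<in> snd cM ` fst cM" if "y \<in> half_plane \<inter> ball z \<delta>" for y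
      unfolding w_def u_def by (rule local_rep_in[OF cM(1) c(1) dom(1)[OF N1[OF that]]])
    have m0: "(0, y) \<in> ball 0 \<delta>1 \<times> ball z \<delta>1" if "y \<in> ball z \<delta>1" for y :: complex using that F(1) by auto
    have lin0: "((\<lambda>y. (0 :: real, y)) has_derivative (\<lambda>h. (0, h))) (at z within half_plane)"
      by (auto intro!: derivative_eq_intros)
    have slice: "((\<lambda>y. f (0, y)) has_derivative (\<lambda>h. pd (0, h) f (0, z))) (at z within half_plane)"
      if "Cinf (ball 0 \<delta>1 \<times> ball z \<delta>1) f" for f :: "real \<times> complex \<Rightarrow> real^3"
      by (rule has_derivative_compose[OF lin0 Cinf_has_derivative[OF that m0]]) (use F(1) in simp)
    have contN: "continuous_on (half_plane \<inter> ball z \<delta>) (\<lambda>y. f (0, y))"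
      if "Cinf (ball 0 \<delta>1 \<times> ball z \<delta>1) f" for f :: "real \<times> complex \<Rightarrow> real^3"
      by (rule continuous_on_compose2[OF Cinf_continuous_on[OF that]]) (use \<delta> F(1) in \<open>auto intro!: continuous_intros\<close>)
    have FzX: "F (0, z) \<in> X" using F(6) m0[of z] F(1) by auto
    have Fw: "F (0, z) = w z" by (rule dom(2)[OF zN1])
    have Gz: "G (w z) = g cM (w z)" using F(7) FzX wy[of z] zh \<delta>(1) unfolding Fw by simp
    have GD: "(G has_derivative G') (at (w z))"
      unfolding G'_def[abs_def] Fw using Cinf_has_derivative[OF F(5) FzX] unfolding Fw .
    obtain O1 where O1: "open O1" "snd cM ` fst cM = half_space \<inter> O1"
      using chart_facts(2)[OF chartM[OF cM(1)]] unfolding openin_open by blast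
    have wO: "w z \<in> O1" "w z \<in> half_space" "w z \<in> X" using wy[of z] zh \<delta>(1) O1(2) FzX Fw by auto
    have gD: "(g cM has_derivative G') (at (w z) within half_space)"
    proof (rule has_derivative_within_eq[OF has_derivative_at_withinI[OF GD], of "X \<inter> O1"])
      show "open (X \<inter> O1)" using Cinf_open[OF F(5)] O1(1) by (rule open_Int)
      show "G y = g cM y" if "y \<in> half_space \<inter> (X \<inter> O1)" for y using F(7) that O1(2) by blast
    qed (use wO in auto)
    \<comment> \<open>The symmetry of \<open>G'\<close> follows by differentiating the symmetry of
      the metric, since one-sided derivatives are unique.\<close>
    have lt: "bounded_linear (transpose :: real^3^3 \<Rightarrow> real^3^3)"
      by (rule linear_conv_bounded_linear[THEN iffD1]) (simp add: linear_iff transpose_def vec_eq_iff)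
    have "((\<lambda>x. transpose (g cM x)) has_derivative (\<lambda>v. transpose (G' v))) (at (w z) within half_space)"
      by (rule bounded_linear.has_derivative[OF lt gD])
    then have "(g cM has_derivative (\<lambda>v. transpose (G' v))) (at (w z) within half_space)"
      by (rule has_derivative_within_eq[OF _ O1(1) wO(1,2)]) (use metric_sym[OF cM(1)] O1(2) in blast)
    from frechet_half_space[OF wO(2) this] frechet_half_space[OF wO(2) gD]
    have G's: "transpose (G' v) = G' v" for v by metis
    have Vy: "V y = pd (1, 0) F (0, y)" if y: "y \<in> half_plane \<inter> ball z \<delta>1" for y
    proof -
      have yy: "y \<in> snd c ` fst c" "\<Phi> 0 (chart_inv c y) \<in> fst cM"
        using dom(1)[OF y] unfolding local_dom_iff[OF c(1)] by blast+
      note C = chart_facts(4,5)[OF chart[OF c(1)] yy(1)]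
      have "initial_velocity \<Phi> cM (chart_inv c y) = pd (1, 0) F (0, snd c (chart_inv c y))"
        by (rule curve_derivative(3)[OF cM(1) yy(2) c(1) C(2) F(3,4)]) (use C(1) y in simp)
      then show ?thesis using C(1) by (simp add: V_def v_def)
    qed
    interpret sp: surface_patch "g cM" w R V z \<delta> W W1 Wi V' G'
    proof
      show "z \<in> half_plane" "0 < \<delta>" by (fact zh \<delta>)+
      show "(w has_derivative W y) (at y within half_plane)" if "y \<in> half_plane \<inter> ball z \<delta>" for y
        using Drep_has_derivative[OF c(1) cM(1) I(2) dom(1)[OF N1[OF that]]] DW[OF N1[OF that]]
        by (simp add: w_def u_def)
      show "w y \<in> half_space" if "y \<in> half_plane \<inter> ball z \<delta>" for y
        using wy[OF that] chart_facts(9)[OF chartM[OF cM(1)]] by blast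
      show "transpose (g cM (w y)) = g cM (w y)" if "y \<in> half_plane \<inter> ball z \<delta>" for y
        by (rule metric_sym[OF cM(1) wy[OF that]])
      show "0 < ip (g cM (w y)) x x" if "y \<in> half_plane \<inter> ball z \<delta>" "x \<noteq> 0" for y x
        by (rule metric_pos[OF cM(1) wy[OF that(1)] that(2)])
      show "ip (g cM (w y)) (W y \<i>) (W y \<i>) = ip (g cM (w y)) (W y 1) (W y 1)"
        "ip (g cM (w y)) (W y 1) (W y \<i>) = 0" "W y 1 \<noteq> 0" if y: "y \<in> half_plane \<inter> ball z \<delta>" for y
        using conformal_at(1,2)[OF c(1) hN(1)[OF y]] hN(2)[OF y] unfolding hw[OF N1[OF y]] DW[OF N1[OF y]]
        by (auto simp: ip_def)
      show "half_plane \<inter> ball z \<delta> \<subseteq> R"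
      proof
        fix y assume y: "y \<in> half_plane \<inter> ball z \<delta>"
        \<comment> \<open>A critical point may be witnessed in a different chart; the change of
          charts still makes the pull-back metric vanish there, which is excluded on the
          patch.\<close>
        have "y \<notin> snd c ` (fst c \<inter> critical_set AS AM u)"
        proof
          assume "y \<in> snd c ` (fst c \<inter> critical_set AS AM u)"
          then obtain q where q: "q \<in> fst c" "y = snd c q" "q \<in> critical_set AS AM u" by blast
          then obtain cS cN where cS: "cS \<in> AS" "cN \<in> AM" "q \<in> fst cS" "u q \<in> fst cN"
            "frechet_derivative (local_rep cS cN u) (at (snd cS q) within half_plane) = (\<lambda>_. 0)"
            unfolding critical_set_def by blast
          have ql: "snd cS q \<in> local_dom cS cN (\<Phi> 0)"
            unfolding local_dom_iff[OF cS(1)] using cS chart_facts(3)[OF chart[OF cS(1)] cS(3)] by (simp add: u_def)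
          have "hh c 0 y 1 1 = 0"
            unfolding q(2) hh_change_chart[OF c(1) cS(1) q(1) cS(3) I(2)]
            unfolding hh_def pullback_eq[OF cS(1,2) I(2) ql] using cS(5) by (simp add: u_def ip_def)
          then show False using hN(2)[OF y] by simp
        qed
        then show "y \<in> R" using dom(1)[OF N1[OF y]] by (simp add: R_def u_def)
      qed
      show "R \<subseteq> half_plane" unfolding R_def using local_dom_half_plane[OF c(1), of _ cM u] by blast
      show "((\<lambda>y. W y 1) has_derivative W1 z) (at z within half_plane)"
        "((\<lambda>y. W y \<i>) has_derivative Wi z) (at z within half_plane)"
        unfolding W_def W1_def[abs_def] Wi_def[abs_def] by (rule slice[OF Cinf_pd[OF F(3)]])+
      show "continuous_on (half_plane \<inter> ball z \<delta>) (\<lambda>y. W y 1)"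
        "continuous_on (half_plane \<inter> ball z \<delta>) (\<lambda>y. W y \<i>)"
        unfolding W_def by (rule contN[OF Cinf_pd[OF F(3)]])+
      show "(V has_derivative V') (at z within half_plane)"
        by (rule has_derivative_within_eq[of "\<lambda>y. pd (1, 0) F (0, y)" _ _ _ "ball z \<delta>1"])
          (use slice[OF Cinf_pd[OF F(3)]] Vy zh F(1) in \<open>auto simp: V'_def[abs_def]\<close>)
      show "(g cM has_derivative G') (at (w z) within half_space)" by (rule gD)
      show "transpose (G' x) = G' x" for x by (rule G's)
    qed
    have line: "((\<lambda>t. (t, z)) has_derivative (\<lambda>t. t *\<^sub>R (1, 0))) (at (0::real))"
      by (rule has_derivative_eq_rhs, (rule derivative_eq_intros refl)+) (simp add: fun_eq_iff)
    have tline: "((\<lambda>t. f (t, z)) has_derivative (\<lambda>t. t *\<^sub>R pd (1, 0) f (0, z))) (at 0)"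
      if "Cinf (ball 0 \<delta>1 \<times> ball z \<delta>1) f" for f :: "real \<times> complex \<Rightarrow> real^3"
    proof -
      have m: "(0, z) \<in> ball 0 \<delta>1 \<times> ball z \<delta>1" using F(1) by auto
      have "((\<lambda>t. f (t, z)) has_derivative (\<lambda>t. pd (t *\<^sub>R (1, 0)) f (0, z))) (at 0)"
        by (rule has_derivative_compose[OF line Cinf_has_derivative[OF that m]])
      then show ?thesis unfolding linear_scale[OF pd_linear[OF that m]] .
    qed
    have k: "((\<lambda>t. hh c t z a b) has_real_derivative
        ip (G' (V z)) (W z a) (W z b) + ip (g cM (w z)) (V' a) (W z b) + ip (g cM (w z)) (W z a) (V' b)) (at 0)" for a b
    proof -
      \<comment> \<open>Time and surface derivatives commute: the velocity of a coordinate vector is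
        the derivative of the velocity field.\<close>
      have comm: "pd (1, 0) (pd (0, a) F) (0, z) = V' a" for a
        unfolding V'_def by (rule pd_commute[OF F(3)]) (use F(1) in auto)
      have d1: "((\<lambda>t. pd (0, a) F (t, z)) has_derivative (\<lambda>t. t *\<^sub>R V' a)) (at 0)" for a
        using tline[OF Cinf_pd[OF F(3)], of "(0, a)"] unfolding comm .
      have d2: "((\<lambda>t. F (t, z)) has_derivative (\<lambda>t. t *\<^sub>R V z)) (at 0)"
        using tline[OF F(3)] unfolding Vy[OF zN1] .
      have GD': "(G has_derivative G') (at (F (0, z)))" unfolding Fw by (rule GD)
      have d3: "((\<lambda>t. G (F (t, z))) has_derivative (\<lambda>t. G' (t *\<^sub>R V z))) (at 0)"
        by (rule has_derivative_compose[OF d2 GD'])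
      have lG: "linear G'" using GD has_derivative_linear by blast
      have "((\<lambda>t. ip (G (F (t, z))) (pd (0, a) F (t, z)) (pd (0, b) F (t, z))) has_derivative
        (\<lambda>t. W z a \<bullet> (g cM (w z) *v (t *\<^sub>R V' b) + G' (t *\<^sub>R V z) *v W z b) + (t *\<^sub>R V' a) \<bullet> (g cM (w z) *v W z b))) (at 0)"
        unfolding ip_def using bounded_bilinear.FDERIV[OF bounded_bilinear_inner d1
            bounded_bilinear.FDERIV[OF bounded_bilinear_matrix_vector d3 d1], of a b] unfolding Fw Gz W_def .
      moreover have "(\<lambda>t. W z a \<bullet> (g cM (w z) *v (t *\<^sub>R V' b) + G' (t *\<^sub>R V z) *v W z b) + (t *\<^sub>R V' a) \<bullet> (g cM (w z) *v W z b))
        = (*) (ip (G' (V z)) (W z a) (W z b) + ip (g cM (w z)) (V' a) (W z b) + ip (g cM (w z)) (W z a) (V' b))"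
        unfolding linear_scale[OF lG]
        by (simp add: fun_eq_iff ip_def inner_right_distrib matrix_vector_mult_scaleR
            bounded_bilinear.scaleR_left[OF bounded_bilinear_matrix_vector] algebra_simps)
      ultimately have "((\<lambda>t. ip (G (F (t, z))) (pd (0, a) F (t, z)) (pd (0, b) F (t, z))) has_real_derivative
        ip (G' (V z)) (W z a) (W z b) + ip (g cM (w z)) (V' a) (W z b) + ip (g cM (w z)) (W z a) (V' b)) (at 0)"
        by (simp add: has_field_derivative_def)
      then show ?thesis
      proof (rule has_field_derivative_transform_within_open[of _ _ _ "ball 0 \<delta>1"])
        fix t :: real assume t: "t \<in> ball 0 \<delta>1"
        have tl: "z \<in> local_dom c cM (\<Phi> t)" "F (t, z) = local_rep c cM (\<Phi> t) z" "t \<in> I"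
          using F(2,4) t zN1 by blast+
        have "(t, z) \<in> ball 0 \<delta>1 \<times> ball z \<delta>1" using t F(1) by auto
        then have "F (t, z) \<in> X" using F(6) by blast
        then have Gt: "G (local_rep c cM (\<Phi> t) z) = g cM (local_rep c cM (\<Phi> t) z)"
          using F(7) local_rep_in[OF cM(1) c(1) tl(1)] unfolding tl(2) by blast
        show "ip (G (F (t, z))) (pd (0, a) F (t, z)) (pd (0, b) F (t, z)) = hh c t z a b"
          unfolding hh_def pullback_eq[OF c(1) cM(1) tl(3,1)] Drep_eq[OF c(1) F(3,4) t zN1] tl(2) Gt ..
      qed (use F(1) in auto)
    qed
    let ?k = "\<lambda>a b. ip (G' (V z)) (W z a) (W z b) + ip (g cM (w z)) (V' a) (W z b) + ip (g cM (w z)) (W z a) (V' b)"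
    have s: "?k a a = ip (G' (V z)) (W z a) (W z a) + 2 * ip (g cM (w z)) (V' a) (W z a)" for a
      using ip_commute[OF metric_sym[OF cM(1) wy[of z]], of "W z a" "V' a"] zh \<delta>(1) by simp
    have "((\<lambda>t. al c t z) has_real_derivative (?k 1 1 - ?k \<i> \<i>) / 2) (at 0)"
      unfolding al_def by (intro DERIV_cdivide DERIV_diff k)
    then have A: "deriv (\<lambda>t. al c t z) 0 = (?k 1 1 - ?k \<i> \<i>) / 2" by (rule DERIV_imp_deriv)
    have "((\<lambda>t. be c t z) has_real_derivative ?k 1 \<i>) (at 0)" unfolding be_def by (rule k)
    then have B: "deriv (\<lambda>t. be c t z) 0 = ?k 1 \<i>" by (rule DERIV_imp_deriv)
    have "sp.\<rho> z = ee c 0 z"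
      unfolding sp.\<rho>_def conformal_at(5)[OF c(1) zc] hw[OF zN1] DW[OF zN1] ..
    then have "mu_normsq_local (g cM) w R V z = mu_dens c z"
      unfolding mu_dens_def A B sp.mu_normsq_local_eq s by simp
    then show ?thesis using mu by (simp add: c_def z_def)
  qed
qed

lemma mu_normsq_eq:
  assumes "c \<in> AS" "p \<in> fst c"
  shows "mu_normsq AS AM g (\<Phi> 0) (initial_velocity \<Phi>) p = mu_dens c (snd c p)"
  unfolding mu_normsq_chart_at using mu_dens_change_chart chart_at assms by blast

end

section \<open>Integration over the surface\<close>

context compact_riemann_surface
begin

lemma density_measure_total:
  fixes f :: "'s \<Rightarrow> real"
  assumes d: "density d" and c: "\<And>i. c i \<in> AS" and B: "\<And>i. B i \<in> sets borel" "\<And>i. B i \<subseteq> fst (c i)"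
    and part: "disjoint_family B" "(\<Union>i\<in>{0..<n::nat}. B i) = UNIV" and f: "f \<in> borel_measurable borel"
    and int: "\<And>i. i < n \<Longrightarrow> integrable lborel (\<lambda>z. indicator (snd (c i) ` B i) z * (d (c i) z * f (chart_inv (c i) z)))"
  shows "integrable (density_measure AS d) f"
    "(\<integral>p. f p \<partial>density_measure AS d) =
      (\<Sum>i<n. \<integral>z. indicator (snd (c i) ` B i) z * (d (c i) z * f (chart_inv (c i) z)) \<partial>lborel)"
proof -
  have f_eq: "f p = (\<Sum>i<n. indicator (B i) p * f p)" for p
  proof -
    have "(indicator (\<Union>i<n. B i) p :: real) = (\<Sum>i<n. indicator (B i) p)"
      by (rule indicator_UN_disjoint) (use part(1) in \<open>auto simp: disjoint_family_on_def\<close>)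
    moreover have "(\<Union>i<n. B i) = UNIV" using part(2) by (simp add: atLeast0LessThan)
    ultimately have "(\<Sum>i<n. indicator (B i) p) = (1 :: real)" by simp
    then show ?thesis by (simp flip: sum_distrib_right)
  qed
  note piece = density_measure_piece[OF d c B f]
  have i: "integrable (density_measure AS d) (\<lambda>p. indicator (B i) p * f p)" if "i < n" for i
    unfolding piece(1) by (rule int[OF that])
  have "integrable (density_measure AS d) (\<lambda>p. \<Sum>i<n. indicator (B i) p * f p)"
    using i by (intro Bochner_Integration.integrable_sum) auto
  then show "integrable (density_measure AS d) f" by (simp flip: f_eq)
  have "(\<integral>p. f p \<partial>density_measure AS d) = (\<integral>p. (\<Sum>i<n. indicator (B i) p * f p) \<partial>density_measure AS d)"
    by (simp flip: f_eq)
  also have "\<dots> = (\<Sum>i<n. \<integral>p. indicator (B i) p * f p \<partial>density_measure AS d)"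
    using i by (intro Bochner_Integration.integral_sum) auto
  finally show "(\<integral>p. f p \<partial>density_measure AS d) =
      (\<Sum>i<n. \<integral>z. indicator (snd (c i) ` B i) z * (d (c i) z * f (chart_inv (c i) z)) \<partial>lborel)"
    by (simp only: piece(2))
qed

lemma density_measure_UNIV:
  assumes d: "density d" and c: "\<And>i. c i \<in> AS" and B: "\<And>i. B i \<in> sets borel" "\<And>i. B i \<subseteq> fst (c i)"
    and part: "disjoint_family B" "(\<Union>i\<in>{0..<n::nat}. B i) = UNIV"
    and int: "\<And>i. i < n \<Longrightarrow> integrable lborel (\<lambda>z. indicator (snd (c i) ` B i) z * d (c i) z)"
  shows "measure (density_measure AS d) UNIV = (\<Sum>i<n. \<integral>z. indicator (snd (c i) ` B i) z * d (c i) z \<partial>lborel)"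
proof -
  have "space (density_measure AS d) = UNIV" using sets_eq_imp_space_eq[OF density_measure(1)[OF d]] by simp
  then have "measure (density_measure AS d) UNIV = (\<integral>p. 1 \<partial>density_measure AS d)" by simp
  also have "\<dots> = (\<Sum>i<n. \<integral>z. indicator (snd (c i) ` B i) z * (d (c i) z * 1) \<partial>lborel)"
    by (rule density_measure_total(2)[OF d c B part]) (use int in auto)
  finally show ?thesis by simp
qed

text \<open>A function defined through a chart chosen pointwise has no evident measurability. It
  suffices that on each piece of a finite Borel partition it agrees with a Borel function of one
  chart.\<close>

lemma borel_measurable_pieces:
  fixes f :: "'s \<Rightarrow> real"
  assumes c: "\<And>i. c i \<in> AS" and B: "\<And>i. B i \<in> sets borel" "\<And>i. B i \<subseteq> fst (c i)"
    and part: "disjoint_family B" "(\<Union>i\<in>{0..<n::nat}. B i) = UNIV"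
    and g: "\<And>i. i < n \<Longrightarrow> (\<lambda>z. indicator (snd (c i) ` B i) z * g i z) \<in> borel_measurable borel"
    and f: "\<And>i p. i < n \<Longrightarrow> p \<in> B i \<Longrightarrow> f p = g i (snd (c i) p)"
  shows "f \<in> borel_measurable borel"
proof -
  have f_eq: "f p = (\<Sum>i<n. indicator (B i) p * f p)" for p
  proof -
    have "(indicator (\<Union>i<n. B i) p :: real) = (\<Sum>i<n. indicator (B i) p)"
      by (rule indicator_UN_disjoint) (use part(1) in \<open>auto simp: disjoint_family_on_def\<close>)
    moreover have "(\<Union>i<n. B i) = UNIV" using part(2) by (simp add: atLeast0LessThan)
    ultimately have "(\<Sum>i<n. indicator (B i) p) = (1 :: real)" by simp
    then show ?thesis by (simp flip: sum_distrib_right)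
  qed
  have "(\<lambda>p. indicator (B i) p * f p) \<in> borel_measurable borel" if i: "i < n" for i
  proof -
    have "continuous_on (B i) (snd (c i))"
      using chart_facts(6)[OF chart[OF c]] B(2) by (rule continuous_on_subset)
    then have "snd (c i) \<in> borel_measurable (restrict_space borel (B i))"
      by (rule borel_measurable_continuous_on_restrict)
    from measurable_compose[OF this g[OF i]]
    have "(\<lambda>p. indicator (snd (c i) ` B i) (snd (c i) p) * g i (snd (c i) p)) \<in> borel_measurable (restrict_space borel (B i))" .
    then have "(\<lambda>p. indicator (B i) p *\<^sub>R (indicator (snd (c i) ` B i) (snd (c i) p) * g i (snd (c i) p))) \<in> borel_measurable borel"
      using B(1) by (subst (asm) borel_measurable_restrict_space_iff) auto
    moreover have "(\<lambda>p. indicator (B i) p *\<^sub>R (indicator (snd (c i) ` B i) (snd (c i) p) * g i (snd (c i) p)))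
        = (\<lambda>p. indicator (B i) p * f p)"
      using f[OF i] by (auto simp: fun_eq_iff indicator_def)
    ultimately show ?thesis by simp
  qed
  then have "(\<lambda>p. \<Sum>i<n. indicator (B i) p * f p) \<in> borel_measurable borel"
    by (intro borel_measurable_sum) auto
  then show ?thesis by (simp flip: f_eq)
qed

end

section \<open>Assembling the second variation from coordinate pieces\<close>

context conformal_variation
begin

text \<open>The coordinate piece is bounded, so Lebesgue measure on it is finite and
  \<open>second_derivative_integral\<close> applies. The results are restated as integrals over the
  plane, the form in which the pieces are summed.\<close>

lemma piece_estimate:
  assumes c: "c \<in> AS" and P: "P \<in> sets borel" "P \<subseteq> half_plane \<inter> ball z0 r" and dom: "half_plane \<inter> ball z0 r \<subseteq> snd c ` fst c"
    and \<epsilon>: "0 < \<epsilon>" "ball 0 \<epsilon> \<subseteq> I"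
    and path: "\<forall>z\<in>half_plane \<inter> ball z0 r. semidefinite_path \<epsilon> M (\<lambda>t. ee c t z) (\<lambda>t. e1 t z) (\<lambda>t. e2 t z)
      (\<lambda>t. al c t z) (\<lambda>t. a1 t z) (\<lambda>t. a2 t z) (\<lambda>t. be c t z) (\<lambda>t. b1 t z) (\<lambda>t. b2 t z)"
    and cont: "\<forall>t. \<bar>t\<bar> < \<epsilon> \<longrightarrow> continuous_on (half_plane \<inter> ball z0 r) (e1 t) \<and>
      continuous_on (half_plane \<inter> ball z0 r) (a1 t) \<and> continuous_on (half_plane \<inter> ball z0 r) (b1 t) \<and>
      (AE z in lborel. z \<in> half_plane \<inter> ball z0 r \<longrightarrow> (ee c t z)\<^sup>2 - (al c t z)\<^sup>2 - (be c t z)\<^sup>2 \<noteq> 0)"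
  shows "\<And>t. \<bar>t\<bar> < \<epsilon> \<Longrightarrow> integrable lborel (\<lambda>z. indicator P z * ee c t z)"
    "\<And>t. \<bar>t\<bar> < \<epsilon> \<Longrightarrow> integrable lborel (\<lambda>z. indicator P z * area_dens t c z)"
    "integrable lborel (\<lambda>z. indicator P z * (area_dens 0 c z * mu_dens c z))"
    "(\<lambda>z. indicator P z * mu_dens c z) \<in> borel_measurable borel"
    "\<exists>F'. (\<forall>t. \<bar>t\<bar> < \<epsilon> / 2 \<longrightarrow>
        ((\<lambda>t. \<integral>z. indicator P z * (ee c t z - area_dens t c z) \<partial>lborel) has_real_derivative F' t) (at t)) \<and>
      (F' has_real_derivative 4 * (\<integral>z. indicator P z * (area_dens 0 c z * mu_dens c z) \<partial>lborel)) (at 0)"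
proof -
  let ?M = "restrict_space lborel P"
  have PM: "P \<inter> space lborel \<in> sets lborel" using P by simp
  have sp: "space ?M = P" by (simp add: space_restrict_space)
  have "bounded P" using P(2) bounded_subset[OF bounded_ball, of P z0 r] by blast
  then have "emeasure lborel P < \<infinity>" by (rule emeasure_bounded_finite)
  then have fin: "finite_measure ?M"
    using P(1) by (intro finite_measureI) (simp add: space_restrict_space emeasure_restrict_space less_top)
  have cm: "f \<in> borel_measurable ?M" if "continuous_on (half_plane \<inter> ball z0 r) f" for f :: "complex \<Rightarrow> real"
  proof -
    have "f \<in> borel_measurable (restrict_space borel P)"
      using continuous_on_subset[OF that P(2)] by (rule borel_measurable_continuous_on_restrict)
    then show ?thesis by (simp add: measurable_def sets_restrict_space space_restrict_space)
  qed
  have tI: "t \<in> I" if "\<bar>t\<bar> < \<epsilon>" for t using that \<epsilon>(2) by auto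
  note cc = continuous_components[OF c tI]
  have ae: "AE z in ?M. (ee c t z)\<^sup>2 - (al c t z)\<^sup>2 - (be c t z)\<^sup>2 \<noteq> 0" if "\<bar>t\<bar> < \<epsilon>" for t
  proof -
    have "AE z in lborel. z \<in> half_plane \<inter> ball z0 r \<longrightarrow> (ee c t z)\<^sup>2 - (al c t z)\<^sup>2 - (be c t z)\<^sup>2 \<noteq> 0"
      using cont that by blast
    then have "AE z in lborel. z \<in> P \<longrightarrow> (ee c t z)\<^sup>2 - (al c t z)\<^sup>2 - (be c t z)\<^sup>2 \<noteq> 0"
      by (rule AE_mp) (use P(2) in \<open>auto intro!: AE_I2\<close>)
    then show ?thesis using AE_restrict_space_iff[OF PM] by blast
  qed
  have pathP: "semidefinite_path \<epsilon> M (\<lambda>t. ee c t z) (\<lambda>t. e1 t z) (\<lambda>t. e2 t z)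
      (\<lambda>t. al c t z) (\<lambda>t. a1 t z) (\<lambda>t. a2 t z) (\<lambda>t. be c t z) (\<lambda>t. b1 t z) (\<lambda>t. b2 t z)" if "z \<in> space ?M" for z
    using path that P(2) unfolding sp by blast
  have ms: "ee c t \<in> borel_measurable ?M" "e1 t \<in> borel_measurable ?M" "al c t \<in> borel_measurable ?M"
    "a1 t \<in> borel_measurable ?M" "be c t \<in> borel_measurable ?M" "b1 t \<in> borel_measurable ?M" if "\<bar>t\<bar> < \<epsilon>" for t
    using cont that cc[OF that] dom by (auto intro!: cm intro: continuous_on_subset)
  note S = second_derivative_integral[of ?M \<epsilon> M "ee c" e1 e2 "al c" a1 a2 "be c" b1 b2, OF fin pathP \<epsilon>(1) ms ae]
  have S1: "integrable ?M (ee c t)" if "\<bar>t\<bar> < \<epsilon>" for t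
    by (rule S(1)) (assumption | rule that)+
  have S2: "integrable ?M (\<lambda>z. area_dens t c z)" if "\<bar>t\<bar> < \<epsilon>" for t
    unfolding area_dens_def by (rule S(2)) (assumption | rule that)+
  have S3: "integrable ?M (\<lambda>z. ((a1 0 z)\<^sup>2 + (b1 0 z)\<^sup>2) / ee c 0 z)"
    by (rule S(3)) assumption+
  have S4: "\<exists>F'. (\<forall>t. \<bar>t\<bar> < \<epsilon> / 2 \<longrightarrow>
        ((\<lambda>t. \<integral>z. ee c t z - area_dens t c z \<partial>?M) has_real_derivative F' t) (at t)) \<and>
      (F' has_real_derivative (\<integral>z. ((a1 0 z)\<^sup>2 + (b1 0 z)\<^sup>2) / ee c 0 z \<partial>?M)) (at 0)"
    unfolding area_dens_def by (rule S(4)) assumption+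
  have iff: "integrable ?M f \<longleftrightarrow> integrable lborel (\<lambda>z. indicator P z * f z)"
    "(\<integral>z. f z \<partial>?M) = (\<integral>z. indicator P z * f z \<partial>lborel)" for f :: "complex \<Rightarrow> real"
    using integrable_restrict_space[OF PM, of f] integral_restrict_space[OF PM, of f] by simp_all
  show "integrable lborel (\<lambda>z. indicator P z * ee c t z)" if "\<bar>t\<bar> < \<epsilon>" for t
    using S1[OF that] unfolding iff(1) .
  show "integrable lborel (\<lambda>z. indicator P z * area_dens t c z)" if "\<bar>t\<bar> < \<epsilon>" for t
    using S2[OF that] unfolding iff(1) .
  have z0: "\<bar>0 :: real\<bar> < \<epsilon>" using \<epsilon>(1) by simp
  have dd: "deriv (\<lambda>t. al c t z) 0 = a1 0 z" "deriv (\<lambda>t. be c t z) 0 = b1 0 z" "0 \<le> ee c 0 z"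
    "al c 0 z = 0" "be c 0 z = 0" if "z \<in> P" for z
  proof -
    interpret semidefinite_path \<epsilon> M "\<lambda>t. ee c t z" "\<lambda>t. e1 t z" "\<lambda>t. e2 t z"
      "\<lambda>t. al c t z" "\<lambda>t. a1 t z" "\<lambda>t. a2 t z" "\<lambda>t. be c t z" "\<lambda>t. b1 t z" "\<lambda>t. b2 t z"
      using path that P(2) by blast
    show "deriv (\<lambda>t. al c t z) 0 = a1 0 z" "deriv (\<lambda>t. be c t z) 0 = b1 0 z" "0 \<le> ee c 0 z"
      "al c 0 z = 0" "be c 0 z = 0"
      using der(3,5)[OF z0] enn[OF z0] a0 b0 by (auto intro: DERIV_imp_deriv)
  qed
  \<comment> \<open>At time 0 the area density equals \<open>ee\<close>, one power of which cancels
    against \<open>mu_dens\<close>; the factor 4 of the final formula comes from the 4 in its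
    denominator.\<close>
  have ad: "indicator P z * (area_dens 0 c z * mu_dens c z)
      = indicator P z * (((a1 0 z)\<^sup>2 + (b1 0 z)\<^sup>2) / ee c 0 z) / 4" for z
  proof (cases "z \<in> P")
    case True
    have "area_dens 0 c z = ee c 0 z" using dd(3-5)[OF True] by (simp add: area_dens_def)
    then show ?thesis using True by (simp add: mu_dens_def dd(1,2)[OF True] power2_eq_square)
  qed simp
  have "integrable lborel (\<lambda>z. indicator P z * (((a1 0 z)\<^sup>2 + (b1 0 z)\<^sup>2) / ee c 0 z))"
    using S3 unfolding iff(1) .
  then show "integrable lborel (\<lambda>z. indicator P z * (area_dens 0 c z * mu_dens c z))"
    unfolding ad by (rule integrable_divide)
  have "(\<lambda>z. ((a1 0 z)\<^sup>2 + (b1 0 z)\<^sup>2) / (4 * (ee c 0 z)\<^sup>2)) \<in> borel_measurable ?M"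
    using ms[OF z0] by measurable
  then have "(\<lambda>z. indicator P z *\<^sub>R (((a1 0 z)\<^sup>2 + (b1 0 z)\<^sup>2) / (4 * (ee c 0 z)\<^sup>2))) \<in> borel_measurable lborel"
    using PM by (subst (asm) borel_measurable_restrict_space_iff) auto
  moreover have "(\<lambda>z. indicator P z *\<^sub>R (((a1 0 z)\<^sup>2 + (b1 0 z)\<^sup>2) / (4 * (ee c 0 z)\<^sup>2))) = (\<lambda>z. indicator P z * mu_dens c z)"
    using dd(1,2) by (auto simp: fun_eq_iff indicator_def mu_dens_def)
  ultimately show "(\<lambda>z. indicator P z * mu_dens c z) \<in> borel_measurable borel" by simp
  have "4 * (\<integral>z. indicator P z * (area_dens 0 c z * mu_dens c z) \<partial>lborel)
      = (\<integral>z. ((a1 0 z)\<^sup>2 + (b1 0 z)\<^sup>2) / ee c 0 z \<partial>?M)"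
    unfolding ad iff(2) integral_divide_zero by simp
  then show "\<exists>F'. (\<forall>t. \<bar>t\<bar> < \<epsilon> / 2 \<longrightarrow>
        ((\<lambda>t. \<integral>z. indicator P z * (ee c t z - area_dens t c z) \<partial>lborel) has_real_derivative F' t) (at t)) \<and>
      (F' has_real_derivative 4 * (\<integral>z. indicator P z * (area_dens 0 c z * mu_dens c z) \<partial>lborel)) (at 0)"
    using S4 unfolding iff(2)[of "\<lambda>z. ee c _ z - area_dens _ c z"] by simp
qed

text \<open>Every point has a coordinate ball and a time interval with uniform estimates.
  Compactness selects finitely many balls, a Borel partition cuts the surface into pieces inside
  them, and the derivatives of the finitely many integrals add up.\<close>

lemma second_variation:
  shows "integrable (area_measure AS AM g (\<Phi> 0)) (mu_normsq AS AM g (\<Phi> 0) (initial_velocity \<Phi>))"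
    and "has_second_derivative (\<lambda>t. energy AS AM g (\<Phi> t) - area AS AM g (\<Phi> t))
      (4 * (\<integral>p. mu_normsq AS AM g (\<Phi> 0) (initial_velocity \<Phi>) p \<partial>area_measure AS AM g (\<Phi> 0))) 0"
proof -
  let ?A = "area_measure AS AM g (\<Phi> 0)" and ?mu = "mu_normsq AS AM g (\<Phi> 0) (initial_velocity \<Phi>)"
  \<comment> \<open>Bundled as one predicate so that time interval and radius can be chosen as
    functions of the point before the cover is formed.\<close>
  define Qp where "Qp p \<epsilon> r \<longleftrightarrow> (let c = chart_at AS p; z0 = snd c p in
    \<epsilon> > 0 \<and> r > 0 \<and> ball 0 \<epsilon> \<subseteq> I \<and> half_plane \<inter> ball z0 r \<subseteq> snd c ` fst c \<and>
    (\<exists>M e1 e2 a1 a2 b1 b2.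
    (\<forall>z\<in>half_plane \<inter> ball z0 r. semidefinite_path \<epsilon> M (\<lambda>t. ee c t z) (\<lambda>t. e1 t z) (\<lambda>t. e2 t z)
      (\<lambda>t. al c t z) (\<lambda>t. a1 t z) (\<lambda>t. a2 t z) (\<lambda>t. be c t z) (\<lambda>t. b1 t z) (\<lambda>t. b2 t z)) \<and>
    (\<forall>t. \<bar>t\<bar> < \<epsilon> \<longrightarrow> continuous_on (half_plane \<inter> ball z0 r) (e1 t) \<and>
      continuous_on (half_plane \<inter> ball z0 r) (a1 t) \<and> continuous_on (half_plane \<inter> ball z0 r) (b1 t) \<and>
      (AE z in lborel. z \<in> half_plane \<inter> ball z0 r \<longrightarrow> (ee c t z)\<^sup>2 - (al c t z)\<^sup>2 - (be c t z)\<^sup>2 \<noteq> 0))))"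
    for p and \<epsilon> r :: real
  have "\<exists>\<epsilon> r. Qp p \<epsilon> r" for p
  proof -
    have "snd (chart_at AS p) p \<in> snd (chart_at AS p) ` fst (chart_at AS p)" using chart_at(2) by (rule imageI)
    from local_path[OF chart_at(1) this] show ?thesis
      unfolding Qp_def Let_def
      by (elim exE conjE) (intro exI conjI; assumption)
  qed
  then obtain ep rr where Q: "\<And>p. Qp p (ep p) (rr p)" by metis
  define U where "U p = fst (chart_at AS p) \<inter> snd (chart_at AS p) -` ball (snd (chart_at AS p) p) (rr p)" for p
  have Uo: "open (U p)" for p
  proof -
    note C = chart_facts[OF chart[OF chart_at(1)[of p]]]
    show ?thesis unfolding U_def by (rule continuous_open_preimage[OF C(6) C(1) open_ball])
  qed
  have Up: "p \<in> U p" for p using Q[of p] chart_at(2)[of p] by (simp add: U_def Qp_def Let_def)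
  obtain n :: nat and q and B where B: "\<And>i. B i \<in> sets borel" "\<And>i. B i \<subseteq> U (q i)" "disjoint_family B" "(\<Union>i\<in>{0..<n}. B i) = UNIV"
    using borel_partition[OF cpt Uo Up, where thesis = thesis] by blast
  define c where "c i = chart_at AS (q i)" for i
  define P where "P i = snd (c i) ` B i" for i
  have c: "c i \<in> AS" for i by (simp add: c_def chart_at)
  have Bc: "B i \<subseteq> fst (c i)" for i using B(2)[of i] by (auto simp: U_def c_def)
  have Pb: "P i \<in> sets borel" for i unfolding P_def by (rule chart_image_borel_subset[OF chart[OF c] B(1) Bc])
  have Ph: "P i \<subseteq> half_plane \<inter> ball (snd (c i) (q i)) (rr (q i))" for i
    using B(2)[of i] chart_facts(9)[OF chart[OF c[of i]]] by (auto simp: P_def U_def c_def)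
  \<comment> \<open>The element 1 keeps the minimum well defined should the list of pieces be
    empty.\<close>
  define \<epsilon> where "\<epsilon> = Min (insert 1 ((\<lambda>i. ep (q i)) ` {..<n}))"
  have ep: "ep (q i) > 0" for i using Q[of "q i"] by (simp add: Qp_def Let_def)
  have \<epsilon>: "\<epsilon> > 0" "\<And>i. i < n \<Longrightarrow> \<epsilon> \<le> ep (q i)"
    unfolding \<epsilon>_def using ep by (auto intro!: Min_le)
  have piece: "(\<forall>t. \<bar>t\<bar> < \<epsilon> \<longrightarrow> t \<in> I \<and> integrable lborel (\<lambda>z. indicator (P i) z * ee (c i) t z) \<and>
      integrable lborel (\<lambda>z. indicator (P i) z * area_dens t (c i) z)) \<and>
    integrable lborel (\<lambda>z. indicator (P i) z * (area_dens 0 (c i) z * mu_dens (c i) z)) \<and>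
    (\<lambda>z. indicator (P i) z * mu_dens (c i) z) \<in> borel_measurable borel \<and>
    (\<exists>F'. (\<forall>t. \<bar>t\<bar> < \<epsilon> / 2 \<longrightarrow>
        ((\<lambda>t. \<integral>z. indicator (P i) z * (ee (c i) t z - area_dens t (c i) z) \<partial>lborel) has_real_derivative F' t) (at t)) \<and>
      (F' has_real_derivative 4 * (\<integral>z. indicator (P i) z * (area_dens 0 (c i) z * mu_dens (c i) z) \<partial>lborel)) (at 0))"
    if i: "i < n" for i
  proof -
    obtain M e1 e2 a1 a2 b1 b2 where 1: "ball 0 (ep (q i)) \<subseteq> I"
      "half_plane \<inter> ball (snd (c i) (q i)) (rr (q i)) \<subseteq> snd (c i) ` fst (c i)" and
      2: "\<forall>z\<in>half_plane \<inter> ball (snd (c i) (q i)) (rr (q i)). semidefinite_path (ep (q i)) M (\<lambda>t. ee (c i) t z) (\<lambda>t. e1 t z) (\<lambda>t. e2 t z)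
        (\<lambda>t. al (c i) t z) (\<lambda>t. a1 t z) (\<lambda>t. a2 t z) (\<lambda>t. be (c i) t z) (\<lambda>t. b1 t z) (\<lambda>t. b2 t z)" and
      3: "\<forall>t. \<bar>t\<bar> < ep (q i) \<longrightarrow> continuous_on (half_plane \<inter> ball (snd (c i) (q i)) (rr (q i))) (e1 t) \<and>
        continuous_on (half_plane \<inter> ball (snd (c i) (q i)) (rr (q i))) (a1 t) \<and>
        continuous_on (half_plane \<inter> ball (snd (c i) (q i)) (rr (q i))) (b1 t) \<and>
        (AE z in lborel. z \<in> half_plane \<inter> ball (snd (c i) (q i)) (rr (q i)) \<longrightarrow>
          (ee (c i) t z)\<^sup>2 - (al (c i) t z)\<^sup>2 - (be (c i) t z)\<^sup>2 \<noteq> 0)"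
      using Q[of "q i"] unfolding Qp_def Let_def c_def[symmetric] by (elim exE conjE) (rule that)
    have s2: "\<forall>z\<in>half_plane \<inter> ball (snd (c i) (q i)) (rr (q i)). semidefinite_path \<epsilon> M (\<lambda>t. ee (c i) t z) (\<lambda>t. e1 t z) (\<lambda>t. e2 t z)
        (\<lambda>t. al (c i) t z) (\<lambda>t. a1 t z) (\<lambda>t. a2 t z) (\<lambda>t. be (c i) t z) (\<lambda>t. b1 t z) (\<lambda>t. b2 t z)"
      using 2 semidefinite_path_mono[OF _ \<epsilon>(1) \<epsilon>(2)[OF i]] by blast
    have s3: "\<forall>t. \<bar>t\<bar> < \<epsilon> \<longrightarrow> continuous_on (half_plane \<inter> ball (snd (c i) (q i)) (rr (q i))) (e1 t) \<and>
        continuous_on (half_plane \<inter> ball (snd (c i) (q i)) (rr (q i))) (a1 t) \<and>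
        continuous_on (half_plane \<inter> ball (snd (c i) (q i)) (rr (q i))) (b1 t) \<and>
        (AE z in lborel. z \<in> half_plane \<inter> ball (snd (c i) (q i)) (rr (q i)) \<longrightarrow>
          (ee (c i) t z)\<^sup>2 - (al (c i) t z)\<^sup>2 - (be (c i) t z)\<^sup>2 \<noteq> 0)"
      using 3 order.strict_trans2[OF _ \<epsilon>(2)[OF i]] by blast
    have s1: "ball 0 \<epsilon> \<subseteq> I" using 1(1) \<epsilon>(2)[OF i] by (meson order_trans subset_ball)
    note E = piece_estimate[OF c Pb Ph 1(2) \<epsilon>(1) s1 s2 s3]
    have "t \<in> I" if "\<bar>t\<bar> < \<epsilon>" for t using s1 that by auto
    then show ?thesis using E by blast
  qed
  have area: "area AS AM g (\<Phi> t) = (\<Sum>i<n. \<integral>z. indicator (P i) z * area_dens t (c i) z \<partial>lborel)"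
    and energy: "energy AS AM g (\<Phi> t) = (\<Sum>i<n. \<integral>z. indicator (P i) z * ee (c i) t z \<partial>lborel)"
    if t: "\<bar>t\<bar> < \<epsilon>" "t \<in> I" for t
  proof -
    show "area AS AM g (\<Phi> t) = (\<Sum>i<n. \<integral>z. indicator (P i) z * area_dens t (c i) z \<partial>lborel)"
      unfolding area_def area_measure_eq P_def
      by (rule density_measure_UNIV[OF density_area[OF t(2)] c B(1) Bc B(3,4)]) (use piece t(1) P_def in auto)
    have "measure (density_measure AS (energy_dens t)) UNIV = (\<Sum>i<n. \<integral>z. indicator (P i) z * energy_dens t (c i) z \<partial>lborel)"
      unfolding P_def
    proof (rule density_measure_UNIV[OF density_energy[OF t(2)] c B(1) Bc B(3,4)])
      fix i assume "i < n"
      then have "integrable lborel (\<lambda>z. 2 * (indicator (P i) z * ee (c i) t z))" using piece t(1) by simp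
      then show "integrable lborel (\<lambda>z. indicator (snd (c i) ` B i) z * energy_dens t (c i) z)"
        by (simp add: energy_dens_eq P_def mult.left_commute)
    qed
    also have "\<dots> = (\<Sum>i<n. 2 * (\<integral>z. indicator (P i) z * ee (c i) t z \<partial>lborel))"
      by (intro sum.cong refl) (simp add: energy_dens_eq mult.left_commute[of _ 2])
    finally show "energy AS AM g (\<Phi> t) = (\<Sum>i<n. \<integral>z. indicator (P i) z * ee (c i) t z \<partial>lborel)"
      unfolding energy_eq by (simp flip: sum_distrib_left)
  qed
  have diff: "energy AS AM g (\<Phi> t) - area AS AM g (\<Phi> t) =
      (\<Sum>i<n. \<integral>z. indicator (P i) z * (ee (c i) t z - area_dens t (c i) z) \<partial>lborel)" if t: "\<bar>t\<bar> < \<epsilon>" for t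
  \<comment> \<open>Membership of \<open>t\<close> in \<open>I\<close> is obtained from a piece, so
    the empty partition is treated apart; it contradicts the nonemptiness of types.\<close>
  proof (cases "n = 0")
    case True
    then have "(UNIV :: 's set) = {}" using B(4) by simp
    then show ?thesis by simp
  next
    case False
    then have "t \<in> I" using piece[of 0] t by blast
    note A = area[OF t this] and E = energy[OF t this]
    show ?thesis
      unfolding A E sum_subtractf[symmetric]
    proof (intro sum.cong refl)
      fix i assume "i \<in> {..<n}"
      then have "integrable lborel (\<lambda>z. indicator (P i) z * ee (c i) t z)"
        "integrable lborel (\<lambda>z. indicator (P i) z * area_dens t (c i) z)" using piece t by auto
      then show "(\<integral>z. indicator (P i) z * ee (c i) t z \<partial>lborel) - (\<integral>z. indicator (P i) z * area_dens t (c i) z \<partial>lborel)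
        = (\<integral>z. indicator (P i) z * (ee (c i) t z - area_dens t (c i) z) \<partial>lborel)"
        by (simp add: right_diff_distrib)
    qed
  qed
  have mu_eq: "?mu (chart_inv (c i) z) = mu_dens (c i) z" if "z \<in> P i" for i z
  proof -
    have "z \<in> snd (c i) ` fst (c i)" using that Bc[of i] by (auto simp: P_def)
    from chart_facts(4,5)[OF chart[OF c] this] show ?thesis using mu_normsq_eq[OF c] by simp
  qed
  have mu_meas: "?mu \<in> borel_measurable borel"
    by (rule borel_measurable_pieces[of c B n "\<lambda>i. mu_dens (c i)", OF c B(1) Bc B(3,4)])
      (use piece Bc mu_normsq_eq[OF c] in \<open>auto simp: P_def subset_iff\<close>)
  have mi: "indicator (snd (c i) ` B i) z * (area_dens 0 (c i) z * ?mu (chart_inv (c i) z))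
      = indicator (P i) z * (area_dens 0 (c i) z * mu_dens (c i) z)" for i z
    using mu_eq[of z i] by (auto simp: indicator_def P_def)
  have int: "integrable lborel (\<lambda>z. indicator (snd (c i) ` B i) z * (area_dens 0 (c i) z * ?mu (chart_inv (c i) z)))"
    if "i < n" for i unfolding mi using piece[OF that] by blast
  note T = density_measure_total[OF density_area[OF I(2)] c B(1) Bc B(3,4) mu_meas int]
  show "integrable ?A ?mu" unfolding area_measure_eq by (rule T(1))
  have total: "(\<integral>p. ?mu p \<partial>?A) = (\<Sum>i<n. \<integral>z. indicator (P i) z * (area_dens 0 (c i) z * mu_dens (c i) z) \<partial>lborel)"
    unfolding area_measure_eq mi[symmetric] by (rule T(2))
  have "\<forall>i. \<exists>F'. i < n \<longrightarrow> (\<forall>t. \<bar>t\<bar> < \<epsilon> / 2 \<longrightarrow>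
        ((\<lambda>t. \<integral>z. indicator (P i) z * (ee (c i) t z - area_dens t (c i) z) \<partial>lborel) has_real_derivative F' t) (at t)) \<and>
      (F' has_real_derivative 4 * (\<integral>z. indicator (P i) z * (area_dens 0 (c i) z * mu_dens (c i) z) \<partial>lborel)) (at 0)"
    using piece by blast
  from choice[OF this] obtain F' where F0: "\<forall>i. i < n \<longrightarrow> (\<forall>t. \<bar>t\<bar> < \<epsilon> / 2 \<longrightarrow>
        ((\<lambda>t. \<integral>z. indicator (P i) z * (ee (c i) t z - area_dens t (c i) z) \<partial>lborel) has_real_derivative F' i t) (at t)) \<and>
      (F' i has_real_derivative 4 * (\<integral>z. indicator (P i) z * (area_dens 0 (c i) z * mu_dens (c i) z) \<partial>lborel)) (at 0)"
    by (rule exE)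
  have F': "((\<lambda>t. \<integral>z. indicator (P i) z * (ee (c i) t z - area_dens t (c i) z) \<partial>lborel) has_real_derivative F' i t) (at t)"
    if "i < n" "\<bar>t\<bar> < \<epsilon> / 2" for i t
    using F0 that by blast
  have F'': "(F' i has_real_derivative 4 * (\<integral>z. indicator (P i) z * (area_dens 0 (c i) z * mu_dens (c i) z) \<partial>lborel)) (at 0)"
    if "i < n" for i
    using F0 that by blast
  show "has_second_derivative (\<lambda>t. energy AS AM g (\<Phi> t) - area AS AM g (\<Phi> t)) (4 * (\<integral>p. ?mu p \<partial>?A)) 0"
    unfolding has_second_derivative_def
  proof (intro exI[of _ "\<lambda>t. \<Sum>i<n. F' i t"] conjI)
    show "((\<lambda>t. \<Sum>i<n. F' i t) has_real_derivative 4 * (\<integral>p. ?mu p \<partial>?A)) (at 0)"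
      unfolding total sum_distrib_left by (intro DERIV_sum F'') auto
    have "((\<lambda>t. energy AS AM g (\<Phi> t) - area AS AM g (\<Phi> t)) has_real_derivative (\<Sum>i<n. F' i t)) (at t)"
      if t: "t \<in> ball 0 (\<epsilon> / 2)" for t
    proof -
      have "((\<lambda>t. \<Sum>i<n. \<integral>z. indicator (P i) z * (ee (c i) t z - area_dens t (c i) z) \<partial>lborel) has_real_derivative (\<Sum>i<n. F' i t)) (at t)"
        using t by (intro DERIV_sum F') auto
      then show ?thesis
        by (rule has_field_derivative_transform_within_open[OF _ open_ball t]) (use \<epsilon>(1) in \<open>auto simp: diff\<close>)
    qed
    then show "\<forall>\<^sub>F t in nhds 0. ((\<lambda>t. energy AS AM g (\<Phi> t) - area AS AM g (\<Phi> t)) has_real_derivative (\<Sum>i<n. F' i t)) (at t)"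
      using \<epsilon>(1) by (intro eventually_nhds[THEN iffD2] exI[of _ "ball 0 (\<epsilon> / 2)"]) auto
  qed
qed

end

theorem theorem5:
  fixes AM :: "('m::t2_space, real^3) chart set"
    and g :: "'m metric_field"
    and AS :: "('s::t2_space, complex) chart set"
    and u :: "'s \<Rightarrow> 'm"
    and I :: "real set"
    and \<Phi> :: "real \<Rightarrow> 's \<Rightarrow> 'm"
    and v :: "('m, real^3) chart \<Rightarrow> 's \<Rightarrow> real^3"
  assumes "compact (UNIV :: 'm set)"
    and "smooth_atlas half_space AM"
    and "riemannian_metric AM g"
    and "compact (UNIV :: 's set)"
    and "riemann_surface_atlas AS"
    and "branched_conformal_immersion AS AM g u"
    and "u ` manifold_boundary half_plane AS \<subseteq> manifold_boundary half_space AM"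
    and "open I" and "is_interval I" and "0 \<in> I"
    and "smooth_family AS AM I \<Phi>"
    and "\<Phi> 0 = u"
    and "\<forall>t\<in>I. \<Phi> t ` manifold_boundary half_plane AS \<subseteq> manifold_boundary half_space AM"
    and "v = initial_velocity \<Phi>"
  shows "boundary_tangent_section AS AM u v \<and>
    integrable (area_measure AS AM g u) (mu_normsq AS AM g u v) \<and>
    has_second_derivative (\<lambda>t. energy AS AM g (\<Phi> t) - area AS AM g (\<Phi> t))
      (4 * (\<integral>p. mu_normsq AS AM g u v p \<partial>area_measure AS AM g u)) 0"
proof -
  interpret conformal_variation AS AM g I \<Phi>
    using assms by unfold_locales simp_all
  show ?thesis
    using boundary_tangent[OF assms(13)] second_variation assms(12,14) by simp
qed

end
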